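(* Let $X$ be a rearrangement invariant space over $(-1,1)$ satisfying $0<\underline{\alpha}_X\le\overline{\alpha}_X<1$. The following statements hold for the vector measure $m_X\colon\mathscr{B}\to X$, $m_X(A)=T_X(\chi_A)$. (i) The range $\mathscr{R}(m_X)=\{m_X(A):A\in\mathscr{B}\}$ is contained in $X_a$. (ii) For every $g\in X'\subseteq X^*$, the scalar measure $\langle m_X,g\rangle$ is given by $\langle m_X,g\rangle(A)=-\int_A T_{X'}(g)\,d\mu$ for $A\in\mathscr{B}$. (iii) There exists $g_0\in X'$ satisfying $|\langle m_X,g_0\rangle|=\mu$ on $\mathscr{B}$. (iv) A set $A\in\mathscr{B}$ is $\mu$-null if and only if it is $m_X$-null. (v) The vector measure $m_X$ has totally infinite variation, that is, $|m_X|(A)=\infty$ for every non-$m_X$-null set $A\in\mathscr{B}$. (vi) $\mathscr{R}(m_X)$ is not a relatively compact subset of $X$. (vii) $\mathscr{R}(m_X)$ is not an order bounded subset of $X$.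
   Context: Let $\mu$ be Lebesgue measure on the Borel $\sigma$-algebra $\mathscr{B}$ of $(-1,1)$, let $\mathrm{sim}\,\mathscr{B}$ be the space of all $\mathbb{C}$-valued $\mathscr{B}$-simple functions, and let $L^0$ be the complex vector lattice of all $\mathbb{C}$-valued $\mathscr{B}$-measurable functions on $(-1,1)$ (functions equal a.e. are identified). $L^p$ means $L^p(-1,1)$. A Banach function space (B.f.s.) over $(-1,1)$ is an order ideal $X$ of $L^0$ with $\mathrm{sim}\,\mathscr{B}\subseteq X$, equipped with a lattice norm $\|\cdot\|_X$ for which $X$ is complete. It has the Fatou property if, whenever $\{f_n\}$ is a norm-bounded increasing sequence of positive functions in $X$ with $f=\sup_n f_n$ in $L^0$, then $f\in X$ and $\|f_n\|_X\to\|f\|_X$. For $f\in L^0$ the decreasing rearrangement $f^*\colon[0,2]\to[0,\infty]$ is the right continuous inverse of the distribution function $\lambda\mapsto\mu(\{|f|>\lambda\})$. A B.f.s. $X$ over $(-1,1)$ with the Fatou property is rearrangement invariant (r.i.) if $g\in L^0$ and $g^*\le f^*$ for some $f\in X$ imply $g\in X$. Then $L^\infty\subseteq X\subseteq L^1$ continuously. For $t>0$ the dilation operator $E_t\colon X\to X$ is $E_t(f)(x)=f(tx)$ if $-1<tx<1$ and $0$ otherwise. The Boyd indices are $\underline{\alpha}_X=\sup_{0<t<1}\frac{\log\|E_{1/t}\|_{\mathrm{op}}}{\log t}$ and $\overline{\alpha}_X=\inf_{1<t<\infty}\frac{\log\|E_{1/t}\|_{\mathrm{op}}}{\log t}$.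 The finite Hilbert transform of $f\in L^1$ is $T(f)(t)=\lim_{\varepsilon\to0+}\frac1\pi\left(\int_{-1}^{t-\varepsilon}+\int_{t+\varepsilon}^1\right)\frac{f(x)}{x-t}\,dx$, which exists for a.e. $t\in(-1,1)$; $T(f)\in L^0$. If $X$ is r.i. with $0<\underline{\alpha}_X\le\overline{\alpha}_X<1$, then $T$ maps $X$ boundedly into $X$ and $T_X\colon X\to X$ denotes this operator. The order continuous part of $X$ is $X_a=\{f\in X: |f|\ge f_n\downarrow0\text{ with }f_n\in X\text{ implies }\|f_n\|_X\downarrow0\}$. The associate space $X'$ consists of all $g\in L^0$ with $fg\in L^1$ for every $f\in X$, with norm $\|g\|_{X'}=\sup\{|\int_{-1}^1fg\,d\mu|:\|f\|_X\le1\}$; it is a closed subspace of the dual $X^*$ via $\langle f,g\rangle=\int_{-1}^1fg\,d\mu$. $X'$ is also r.i. with non-trivial Boyd indices, so $T_{X'}\colon X'\to X'$ is defined in the same way. The set function $m_X\colon A\mapsto T_X(\chi_A)$ on $\mathscr{B}$ is a $\sigma$-additive $X$-valued vector measure. For $x^*\in X^*$, $\langle m_X,x^*\rangle(A)=\langle m_X(A),x^*\rangle$, and $|\langle m_X,x^*\rangle|$ is the variation measure of this complex measure. $|m_X|(A)\in[0,\infty]$ is the variation: the supremum of $\sum_j\|m_X(A_j)\|_X$ over finite $\mathscr{B}$-partitions $\{A_j\}$ of $A$. A set $A\in\mathscr{B}$ is $m_X$-null if $|\langle m_X,x^*\rangle|(A)=0$ for every $x^*\in X^*$ (equivalently $m_X(B)=0$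 for all $B\in\mathscr{B}$, $B\subseteq A$). A subset $W\subseteq X$ is order bounded if there is $0\le h\in X$ with $|f|\le h$ a.e. for every $f\in W$. *)

theory Defs
  imports "HOL-Analysis.Analysis"
begin

text \<open>
  Elements of \<open>L\<^sup>0\<close> are represented by measurable functions on \<open>(-1,1)\<close> (their values outside
  are irrelevant); the identification of functions that are equal a.e. is built into the
  definitions below, which only refer to a.e. relations. A function space is given by its
  carrier \<open>X\<close> together with its norm \<open>N\<close>, which is meaningful on \<open>X\<close> only.
  Nonnegative elements are given by real functions, embedded via \<open>cfun\<close>.
\<close>

abbreviation mu :: "real measure"
  where "mu \<equiv> restrict_space lborel {-1<..<1}"

abbreviation L0 :: "(real \<Rightarrow> complex) set"
  where "L0 \<equiv> borel_measurable mu"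

abbreviation cfun :: "(real \<Rightarrow> real) \<Rightarrow> real \<Rightarrow> complex"
  where "cfun u \<equiv> (\<lambda>x. complex_of_real (u x))"

locale banach_function_space =
  fixes X :: "(real \<Rightarrow> complex) set" and N :: "(real \<Rightarrow> complex) \<Rightarrow> real"
  assumes measurable: "X \<subseteq> L0"
    and add_mem: "\<And>f g. f \<in> X \<Longrightarrow> g \<in> X \<Longrightarrow> (\<lambda>x. f x + g x) \<in> X"
    and scale_mem: "\<And>c f. f \<in> X \<Longrightarrow> (\<lambda>x. c * f x) \<in> X"
    and ideal: "\<And>f g. f \<in> X \<Longrightarrow> g \<in> L0 \<Longrightarrow> AE x in mu. cmod (g x) \<le> cmod (f x) \<Longrightarrow> g \<in> X"
    and simple_mem: "\<And>f. simple_function mu f \<Longrightarrow> f \<in> X"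
    and norm_nonneg: "\<And>f. f \<in> X \<Longrightarrow> 0 \<le> N f"
    and norm_eq_0: "\<And>f. f \<in> X \<Longrightarrow> N f = 0 \<longleftrightarrow> (AE x in mu. f x = 0)"
    and norm_scale: "\<And>c f. f \<in> X \<Longrightarrow> N (\<lambda>x. c * f x) = cmod c * N f"
    and norm_triangle: "\<And>f g. f \<in> X \<Longrightarrow> g \<in> X \<Longrightarrow> N (\<lambda>x. f x + g x) \<le> N f + N g"
    and norm_mono: "\<And>f g. f \<in> X \<Longrightarrow> g \<in> X \<Longrightarrow> AE x in mu. cmod (g x) \<le> cmod (f x) \<Longrightarrow> N g \<le> N f"
    and complete: "\<And>s. (\<And>n::nat. s n \<in> X) \<Longrightarrow>
        (\<And>e. 0 < e \<Longrightarrow> \<exists>K. \<forall>m\<ge>K. \<forall>n\<ge>K. N (\<lambda>x. s m x - s n x) < e) \<Longrightarrow>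
        \<exists>f\<in>X. (\<lambda>n. N (\<lambda>x. s n x - f x)) \<longlonglongrightarrow> 0"

text \<open>
  For an increasing sequence the supremum in \<open>L\<^sup>0\<close> is the a.e. pointwise limit; that it belongs to
  \<open>L\<^sup>0\<close> (i.e. is finite a.e.) is a hypothesis here.
\<close>

definition fatou_property :: "(real \<Rightarrow> complex) set \<Rightarrow> ((real \<Rightarrow> complex) \<Rightarrow> real) \<Rightarrow> bool"
  where "fatou_property X N \<longleftrightarrow>
    (\<forall>(u :: nat \<Rightarrow> real \<Rightarrow> real) v.
       (\<forall>n. cfun (u n) \<in> X) \<and> (\<exists>C. \<forall>n. N (cfun (u n)) \<le> C) \<and>
       (AE x in mu. (\<forall>n. 0 \<le> u n x) \<and> incseq (\<lambda>n. u n x)) \<and>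
       cfun v \<in> L0 \<and> (AE x in mu. (\<lambda>n. u n x) \<longlonglongrightarrow> v x)
       \<longrightarrow> cfun v \<in> X \<and> (\<lambda>n. N (cfun (u n))) \<longlonglongrightarrow> N (cfun v))"

definition rearrangement :: "(real \<Rightarrow> complex) \<Rightarrow> real \<Rightarrow> ennreal"
  where "rearrangement f t =
    Inf {ennreal l | l. 0 \<le> l \<and> emeasure mu {x \<in> space mu. l < cmod (f x)} \<le> ennreal t}"

locale ri_space = banach_function_space +
  assumes fatou: "fatou_property X N"
    and rearrangement_mem: "\<And>f g. f \<in> X \<Longrightarrow> g \<in> L0 \<Longrightarrow>
        (\<And>t. t \<in> {0..2} \<Longrightarrow> rearrangement g t \<le> rearrangement f t) \<Longrightarrow> g \<in> X"

definition dilation :: "real \<Rightarrow> (real \<Rightarrow> complex) \<Rightarrow> real \<Rightarrow> complex"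
  where "dilation t f x = (if -1 < t * x \<and> t * x < 1 then f (t * x) else 0)"

definition dilation_norm :: "(real \<Rightarrow> complex) set \<Rightarrow> ((real \<Rightarrow> complex) \<Rightarrow> real) \<Rightarrow> real \<Rightarrow> real"
  where "dilation_norm X N t = (SUP f\<in>{f \<in> X. N f \<le> 1}. N (dilation t f))"

definition lower_boyd_index :: "(real \<Rightarrow> complex) set \<Rightarrow> ((real \<Rightarrow> complex) \<Rightarrow> real) \<Rightarrow> ereal"
  where "lower_boyd_index X N = (SUP t\<in>{0<..<1}. ereal (ln (dilation_norm X N (1 / t)) / ln t))"

definition upper_boyd_index :: "(real \<Rightarrow> complex) set \<Rightarrow> ((real \<Rightarrow> complex) \<Rightarrow> real) \<Rightarrow> ereal"
  where "upper_boyd_index X N = (INF t\<in>{1<..}. ereal (ln (dilation_norm X N (1 / t)) / ln t))"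

definition truncated_hilbert :: "(real \<Rightarrow> complex) \<Rightarrow> real \<Rightarrow> real \<Rightarrow> complex"
  where "truncated_hilbert f t e =
    complex_of_real (1 / pi) *
      ((LINT x:{-1<..<t - e}|mu. f x / complex_of_real (x - t)) +
       (LINT x:{t + e<..<1}|mu. f x / complex_of_real (x - t)))"

text \<open>
  For integrable \<open>f\<close> the limit exists for almost all \<open>t\<close>; the value 0 is used on the exceptional
  null set.
\<close>

definition finite_hilbert :: "(real \<Rightarrow> complex) \<Rightarrow> real \<Rightarrow> complex"
  where "finite_hilbert f t =
    (if \<exists>l. (truncated_hilbert f t \<longlongrightarrow> l) (at_right 0)
     then Lim (at_right 0) (truncated_hilbert f t) else 0)"

definition hilbert_measure :: "real set \<Rightarrow> real \<Rightarrow> complex"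
  where "hilbert_measure A = finite_hilbert (indicator A)"

definition oc_part :: "(real \<Rightarrow> complex) set \<Rightarrow> ((real \<Rightarrow> complex) \<Rightarrow> real) \<Rightarrow> (real \<Rightarrow> complex) set"
  where "oc_part X N =
    {f \<in> X. \<forall>u :: nat \<Rightarrow> real \<Rightarrow> real.
       (\<forall>n. cfun (u n) \<in> X) \<and>
       (AE x in mu. (\<forall>n. u n x \<le> cmod (f x)) \<and> decseq (\<lambda>n. u n x) \<and> (\<lambda>n. u n x) \<longlonglongrightarrow> 0)
       \<longrightarrow> (\<lambda>n. N (cfun (u n))) \<longlonglongrightarrow> 0}"

definition associate :: "(real \<Rightarrow> complex) set \<Rightarrow> (real \<Rightarrow> complex) set"
  where "associate X = {g \<in> L0. \<forall>f\<in>X. integrable mu (\<lambda>x. f x * g x)}"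

definition pairing :: "(real \<Rightarrow> complex) \<Rightarrow> (real \<Rightarrow> complex) \<Rightarrow> complex"
  where "pairing f g = (LINT x|mu. f x * g x)"

text \<open>
  Bounded linear functionals on \<open>X\<close>; boundedness makes them invariant under a.e. equality.
\<close>

definition dual :: "(real \<Rightarrow> complex) set \<Rightarrow> ((real \<Rightarrow> complex) \<Rightarrow> real) \<Rightarrow>
    ((real \<Rightarrow> complex) \<Rightarrow> complex) set"
  where "dual X N =
    {\<phi>. (\<forall>f\<in>X. \<forall>g\<in>X. \<phi> (\<lambda>x. f x + g x) = \<phi> f + \<phi> g) \<and>
        (\<forall>c. \<forall>f\<in>X. \<phi> (\<lambda>x. c * f x) = c * \<phi> f) \<and>
        (\<exists>C. \<forall>f\<in>X. cmod (\<phi> f) \<le> C * N f)}"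

definition variation :: "('b \<Rightarrow> real) \<Rightarrow> (real set \<Rightarrow> 'b) \<Rightarrow> real set \<Rightarrow> ennreal"
  where "variation nrm \<nu> A =
    (SUP P\<in>{P. finite P \<and> P \<subseteq> sets mu \<and> partition_on A P}. \<Sum>B\<in>P. ennreal (nrm (\<nu> B)))"

definition measure_null ::
    "(real \<Rightarrow> complex) set \<Rightarrow> ((real \<Rightarrow> complex) \<Rightarrow> real) \<Rightarrow> (real set \<Rightarrow> real \<Rightarrow> complex) \<Rightarrow>
      real set \<Rightarrow> bool"
  where "measure_null X N m A \<longleftrightarrow> (\<forall>\<phi>\<in>dual X N. variation cmod (\<lambda>B. \<phi> (m B)) A = 0)"

text \<open>
  The norm topology of \<open>X\<close>. As the elements are representatives, it is the topology of the seminorm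
  \<open>N\<close>, whose open sets are the preimages of the open sets of the space of a.e.-classes.
\<close>

definition norm_topology ::
    "(real \<Rightarrow> complex) set \<Rightarrow> ((real \<Rightarrow> complex) \<Rightarrow> real) \<Rightarrow> (real \<Rightarrow> complex) topology"
  where "norm_topology X N =
    topology (\<lambda>U. U \<subseteq> X \<and> (\<forall>f\<in>U. \<exists>r>0. \<forall>g\<in>X. N (\<lambda>x. g x - f x) < r \<longrightarrow> g \<in> U))"

lemma openin_norm_topology:
  "openin (norm_topology X N) U \<longleftrightarrow>
     U \<subseteq> X \<and> (\<forall>f\<in>U. \<exists>r>0. \<forall>g\<in>X. N (\<lambda>x. g x - f x) < r \<longrightarrow> g \<in> U)"
proof -
  define P where "P U \<longleftrightarrow>
     U \<subseteq> X \<and> (\<forall>f\<in>U. \<exists>r>0. \<forall>g\<in>X. N (\<lambda>x. g x - f x) < r \<longrightarrow> g \<in> U)" for U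
  have "P (S \<inter> T)" if S: "P S" and T: "P T" for S T
    unfolding P_def
  proof (intro conjI ballI)
    show "S \<inter> T \<subseteq> X" using S unfolding P_def by blast
    fix f assume f: "f \<in> S \<inter> T"
    from S f obtain r where r: "r > 0" "\<forall>g\<in>X. N (\<lambda>x. g x - f x) < r \<longrightarrow> g \<in> S"
      unfolding P_def by blast
    from T f obtain s where s: "s > 0" "\<forall>g\<in>X. N (\<lambda>x. g x - f x) < s \<longrightarrow> g \<in> T"
      unfolding P_def by blast
    show "\<exists>r>0. \<forall>g\<in>X. N (\<lambda>x. g x - f x) < r \<longrightarrow> g \<in> S \<inter> T"
      by (rule exI[of _ "min r s"]) (use r s in simp)
  qed
  moreover have "P (\<Union>K)" if K: "\<forall>S\<in>K. P S" for K
    unfolding P_def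
  proof (intro conjI ballI)
    show "\<Union>K \<subseteq> X" using K unfolding P_def by blast
    fix f assume "f \<in> \<Union>K"
    then obtain S where S: "S \<in> K" "f \<in> S" by blast
    with K obtain r where r: "r > 0" "\<forall>g\<in>X. N (\<lambda>x. g x - f x) < r \<longrightarrow> g \<in> S"
      unfolding P_def by blast
    show "\<exists>r>0. \<forall>g\<in>X. N (\<lambda>x. g x - f x) < r \<longrightarrow> g \<in> \<Union>K"
      by (rule exI[of _ r]) (use r S in simp, blast)
  qed
  ultimately have "istopology P" unfolding istopology_def by simp
  moreover have "norm_topology X N = topology P"
    unfolding norm_topology_def P_def ..
  ultimately show ?thesis
    by (simp add: topology_inverse' P_def)
qed

definition relatively_compact ::
    "(real \<Rightarrow> complex) set \<Rightarrow> ((real \<Rightarrow> complex) \<Rightarrow> real) \<Rightarrow> (real \<Rightarrow> complex) set \<Rightarrow> bool"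
  where "relatively_compact X N W \<longleftrightarrow>
    compactin (norm_topology X N) (norm_topology X N closure_of W)"

definition order_bounded :: "(real \<Rightarrow> complex) set \<Rightarrow> (real \<Rightarrow> complex) set \<Rightarrow> bool"
  where "order_bounded X W \<longleftrightarrow>
    (\<exists>h :: real \<Rightarrow> real. cfun h \<in> X \<and> (AE x in mu. 0 \<le> h x) \<and>
       (\<forall>f\<in>W. AE x in mu. cmod (f x) \<le> h x))"

end

theory Submission
  imports Defs "HOL-Complex_Analysis.Complex_Analysis"
begin

text \<open>
  The transform \<open>T\<close> is approached through its regularisations \<open>conj_poisson y\<close>, \<open>y > 0\<close>, in which the
  singular kernel is replaced by the bounded odd kernel \<open>u / (pi (u\<^sup>2 + y\<^sup>2))\<close>.

  One estimate carries the analysis. For a real \<open>h\<close> with \<open>\<bar>h\<bar> \<le> 1\<close> the regularised transform is the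
  real part, on the line \<open>Im z = y\<close>, of the Cauchy integral \<open>F\<close> of \<open>h\<close>, and \<open>\<bar>Im F\<bar> \<le> 1\<close> there because
  \<open>Im F\<close> is a Poisson integral. So \<open>exp F\<close> has a real part comparable to its modulus, and Cauchy's
  theorem on a triangle with base on that line, whose other sides stay away from the interval, bounds
  the integral of \<open>exp (Re F)\<close> independently of \<open>y\<close>. Hence the regularised transforms of bounded
  functions have bounded moments of every order, uniformly in \<open>y\<close> (\<open>conj_poisson_moment\<close>). As the kernel
  is odd, duality turns this into uniform bounds from \<open>L\<^sup>q\<close> to \<open>L\<^sup>1\<close> for the exponents \<open>q = 1 + 1/p\<close>
  (\<open>conj_poisson_L1\<close>). For intervals everything is explicit, and by density the regularised
  transforms of every \<open>g\<close> in \<open>L\<^sup>q\<close> converge in mean (\<open>mean_cauchy_lq\<close>). At common Lebesgue points of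
  \<open>g\<close> and of the limit, the truncated integrals converge to that limit (\<open>pv_limit\<close>), which is
  therefore \<open>T g\<close>. The moment bounds and the antisymmetry pass to \<open>T\<close> (\<open>finite_hilbert_moment\<close>,
  \<open>finite_hilbert_duality\<close>).

  The Boyd indices enter through the embeddings \<open>L\<^sup>p \<subseteq> X \<subseteq> L\<^sup>1\<close> for some \<open>p\<close>, which are bounded by a
  gliding hump argument. A positive lower index yields a function in \<open>X\<close> with a power singularity,
  whose distribution function dominates those of the functions in the unit ball of \<open>L\<^sup>p\<close> up to a scalar
  (\<open>Lp_embedding\<close>). An upper index below 1 bounds the growth of symmetric rearrangements at the origin
  by an integrable rate (\<open>L1_embedding\<close>). Therefore bounded functions belong to \<open>X'\<close>, and \<open>X' \<subseteq> L\<^sup>q\<close>.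

  The statements about \<open>m\<^sub>X\<close> now follow. The functions \<open>T \<chi>\<^sub>A\<close> have all moments, and \<open>L\<^sup>p\<close> functions are
  order continuous in \<open>X\<close>. The formula for \<open>\<langle>m\<^sub>X, g\<rangle>\<close> is antisymmetry. The bounded function
  \<open>sqrt (1 - x\<^sup>2) / (x + i / sqrt 3)\<close> has the unimodular transform \<open>-(t - i a) / (t + i a)\<close>,
  \<open>a = 1 / sqrt 3\<close>; it serves as \<open>g\<^sub>0\<close>, and shows that sets of positive measure are not null. For the
  variation, cut \<open>A\<close> along a grid of \<open>n\<close> cells: the transform of a set \<open>B\<close> in one cell decays only like
  \<open>\<mu>(B)\<close> divided by the distance, so its norm is at least a multiple of \<open>\<mu>(B) ln n\<close>, and these bounds
  add up. The functions \<open>sin (n arccos x)\<close> are bounded, tend to 0 weakly against \<open>L\<^sup>1\<close>, and have the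
  transforms \<open>- cos (n arccos t)\<close>; so some set \<open>A\<close> makes the pairing with \<open>m\<^sub>X(A)\<close> large, which is
  impossible for all large \<open>n\<close> on a relatively compact range. Finally, the transforms of intervals
  \<open>(a, b)\<close> with rational end points are unbounded at every single point \<open>t\<close>, as \<open>a\<close> approaches \<open>t\<close>.
\<close>

section \<open>Lebesgue measure on the interval\<close>

lemma space_mu: "space mu = {-1<..<1}"
  by (simp add: space_restrict_space)

lemma emeasure_mu: "A \<in> sets borel \<Longrightarrow> A \<subseteq> {-1<..<1} \<Longrightarrow> emeasure mu A = emeasure lborel A"
  by (simp add: emeasure_restrict_space)

lemma sets_mu_iff: "A \<in> sets mu \<longleftrightarrow> A \<in> sets borel \<and> A \<subseteq> {-1<..<1}"
  by (subst sets_restrict_space_iff) auto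

lemma sets_mu_borel: "A \<in> sets mu \<Longrightarrow> A \<in> sets borel"
  by (simp add: sets_mu_iff)

interpretation mu: finite_measure mu
  by (rule finite_measureI) (simp add: space_mu emeasure_restrict_space)

interpretation mu_pair: pair_sigma_finite mu mu ..

lemma measure_mu_UNIV: "measure mu {-1<..<1} = 2"
  by (simp add: measure_restrict_space)

lemma borel_measurable_mu: "f \<in> borel_measurable borel \<Longrightarrow> f \<in> borel_measurable mu"
  by (simp add: measurable_restrict_space1)

lemma id_measurable_mu [measurable]: "(\<lambda>x. x) \<in> borel_measurable mu"
  by (rule borel_measurable_mu) simp

lemma difference_kernel_measurable:
  assumes "k \<in> borel_measurable borel"
  shows "(\<lambda>p. k (snd p - fst p)) \<in> borel_measurable (mu \<Otimes>\<^sub>M mu)"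
  using measurable_compose[OF measurable_snd id_measurable_mu, of mu]
    measurable_compose[OF measurable_fst id_measurable_mu, of mu]
  by (intro measurable_compose[OF _ assms] borel_measurable_diff) auto

lemma nn_integral_mu:
  "(\<integral>\<^sup>+x. f x \<partial>mu) = (\<integral>\<^sup>+x. f x * indicator {-1<..<1} x \<partial>lborel)"
  by (subst nn_integral_restrict_space) auto

lemma integral_mu:
  fixes f :: "real \<Rightarrow> 'a::{banach, second_countable_topology}"
  shows "(LINT x|mu. f x) = (LINT x:{-1<..<1}|lborel. f x)"
  by (subst integral_restrict_space) (auto simp: set_lebesgue_integral_def)

lemma integrable_mu_bounded:
  fixes f :: "real \<Rightarrow> 'a::{banach, second_countable_topology}"
  assumes "f \<in> borel_measurable mu" "\<And>x. x \<in> {-1<..<1} \<Longrightarrow> norm (f x) \<le> B"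
  shows "integrable mu f"
  by (rule mu.integrable_const_bound[where B = B]) (use assms in \<open>auto simp: space_mu\<close>)

lemma integrable_mult_bounded:
  fixes f k :: "real \<Rightarrow> 'a::{banach, second_countable_topology, real_normed_field}"
  assumes f: "integrable mu f" and k: "k \<in> borel_measurable mu"
    and B: "\<And>x. x \<in> {-1<..<1} \<Longrightarrow> norm (k x) \<le> B"
  shows "integrable mu (\<lambda>x. f x * k x)"
proof (rule Bochner_Integration.integrable_bound)
  show "integrable mu (\<lambda>x. B * norm (f x))" using f by auto
  show "(\<lambda>x. f x * k x) \<in> borel_measurable mu" using f k by auto
  show "AE x in mu. norm (f x * k x) \<le> norm (B * norm (f x))"
  proof (rule AE_I2)
    fix x assume "x \<in> space mu"
    then have "norm (f x) * norm (k x) \<le> norm (f x) * \<bar>B\<bar>"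
      using B[of x] by (intro mult_left_mono) (auto simp: space_mu)
    then show "norm (f x * k x) \<le> norm (B * norm (f x))" by (simp add: norm_mult mult.commute)
  qed
qed

lemma integrable_indicator_mu:
  assumes "A \<in> sets borel" shows "integrable mu (indicator A :: real \<Rightarrow> complex)"
  by (rule integrable_mu_bounded[where B = 1])
     (use assms in \<open>auto simp: indicator_def intro!: borel_measurable_mu\<close>)

lemma AE_mu_I: "(\<And>x. x \<in> {-1<..<1} \<Longrightarrow> P x) \<Longrightarrow> AE x in mu. P x"
  by (rule AE_I2) (simp add: space_mu)

lemma AE_mu_neq: "AE x in mu. x \<noteq> a"
  by (subst AE_restrict_space_iff) (auto intro: AE_mp[OF AE_lborel_singleton])

lemma set_integrable_mu:
  fixes f :: "real \<Rightarrow> 'a::{banach, second_countable_topology}"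
  assumes "integrable mu f" "A \<in> sets borel"
  shows "set_integrable mu A f"
proof -
  have "integrable mu (\<lambda>x. indicator (A \<inter> {-1<..<1}) x *\<^sub>R f x)"
    using assms by (intro integrable_mult_indicator) (auto simp: sets_mu_iff)
  then show ?thesis unfolding set_integrable_def
    by (rule Bochner_Integration.integrable_cong[THEN iffD1, rotated -1])
       (auto simp: space_mu indicator_def)
qed

section \<open>An induction principle for measurable functions on the interval\<close>

text \<open>
  Dominated limits lead from half-lines to all Borel sets by a Dynkin system argument, then to simple
  functions and to all measurable functions; the factor 2 is the one in the domination of the
  approximating simple functions. The predicate \<open>Q\<close> is an integrability class: it is known for the
  limit in each step, and through the domination it controls the approximants.
\<close>
lemma interval_dense_induct:
  fixes f :: "real \<Rightarrow> complex"
  assumes f: "f \<in> borel_measurable mu" "Q f"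
    and Q: "\<And>f. f \<in> borel_measurable mu \<Longrightarrow> (\<exists>B. \<forall>x\<in>{-1<..<1}. cmod (f x) \<le> B) \<Longrightarrow> Q f"
    and interval: "\<And>a. P (indicator {..<a})"
    and add: "\<And>f g. P f \<Longrightarrow> P g \<Longrightarrow> P (\<lambda>x. f x + g x)"
    and scale: "\<And>c f. P f \<Longrightarrow> P (\<lambda>x. c * f x)"
    and lim: "\<And>f s. f \<in> borel_measurable mu \<Longrightarrow> Q f \<Longrightarrow> (\<And>i::nat. P (s i)) \<Longrightarrow>
       (\<And>x. x \<in> {-1<..<1} \<Longrightarrow> (\<lambda>i. s i x) \<longlonglongrightarrow> f x) \<Longrightarrow>
       (\<And>i x. x \<in> {-1<..<1} \<Longrightarrow> cmod (s i x) \<le> 2 * cmod (f x)) \<Longrightarrow> P f"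
  shows "P f"
proof -
  have cong: "P g" if "P h" "g \<in> borel_measurable mu" "\<exists>B. \<forall>x\<in>{-1<..<1}. cmod (g x) \<le> B"
    "\<And>x. x \<in> {-1<..<1} \<Longrightarrow> h x = g x" for g h
    by (rule lim[where s = "\<lambda>_. h"]) (use that in \<open>auto intro: Q\<close>)
  have ind_meas: "indicator A \<in> borel_measurable mu" if "A \<in> sets borel" for A :: "real set"
    using that by (intro borel_measurable_mu) simp
  have ind_bd: "\<exists>B. \<forall>x\<in>{-1<..<1}. cmod (indicator A x) \<le> B" for A :: "real set"
    by (intro exI[of _ 1]) (auto simp: indicator_def)
  have zero: "P (\<lambda>x. 0)"
    using scale[OF interval, of 0] by simp
  have sum: "P (\<lambda>x. \<Sum>i\<in>I. g i x)" if "finite I" "\<And>i. i \<in> I \<Longrightarrow> P (g i)" for I :: "'c set" and g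
    using that by (induction I rule: finite_induct) (auto intro: zero add)
  have one: "P (\<lambda>x. 1)"
    by (rule cong[OF interval[of 1]]) (auto intro!: exI[of _ 1])
  have ind: "P (indicator A)" if "A \<in> sets borel" for A
  proof -
    have eq: "sets (borel :: real measure) = sigma_sets UNIV (range lessThan)"
      by (simp add: borel_Iio)
    have A: "A \<in> sigma_sets UNIV (range lessThan)"
      using that unfolding eq .
    have int: "Int_stable (range (lessThan :: real \<Rightarrow> real set))"
      unfolding Int_stable_def
    proof safe
      fix a b :: real
      have "{..<a} \<inter> {..<b} = {..<min a b}" by auto
      then show "{..<a} \<inter> {..<b} \<in> range lessThan" by blast
    qed
    have Pow: "range lessThan \<subseteq> Pow (UNIV::real set)" by simp
    show ?thesis
      using int Pow A
    proof (induction rule: sigma_sets_induct_disjoint)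
      case (basic A) then show ?case using interval by auto
    next
      case empty then show ?case using zero by (simp add: indicator_def[abs_def])
    next
      case (compl A)
      have "P (\<lambda>x. 1 + (-1) * indicator A x)"
        by (intro add scale one compl)
      also have "(\<lambda>x. 1 + (-1) * indicator A x) = (indicator (UNIV - A) :: real \<Rightarrow> complex)"
        by (auto simp: indicator_def fun_eq_iff)
      finally show ?case .
    next
      case (union A)
      have [measurable]: "A i \<in> sets borel" for i
        using union(2) by (auto simp: eq)
      have dis: "disjoint_family A" by fact
      have s: "(\<lambda>x. \<Sum>i<n. indicator (A i) x) = (indicator (\<Union>i<n. A i) :: real \<Rightarrow> complex)" for n
        by (rule ext, rule indicator_UN_disjoint[symmetric])
          (use dis in \<open>auto intro: disjoint_family_on_mono[of _ UNIV]\<close>)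
      show ?case
      proof (rule lim[where s = "\<lambda>n. indicator (\<Union>i<n. A i)"])
        show "indicator (\<Union>i. A i) \<in> borel_measurable mu" by (intro ind_meas) measurable
        then show "Q (indicator (\<Union>i. A i))" using Q ind_bd by blast
        show "P (indicator (\<Union>i<n. A i))" for n
          unfolding s[symmetric] by (intro sum union) auto
        show "(\<lambda>n. indicator (\<Union>i<n. A i) x) \<longlonglongrightarrow> (indicator (\<Union>i. A i) x :: complex)" for x
          by (rule LIMSEQ_indicator_UN)
      qed (auto simp: indicator_def)
    qed
  qed
  obtain s where s: "\<And>i. simple_function mu (s i)"
     "\<And>x. x \<in> space mu \<Longrightarrow> (\<lambda>i. s i x) \<longlonglongrightarrow> f x"
     "\<And>i x. x \<in> space mu \<Longrightarrow> norm (s i x) \<le> 2 * norm (f x)"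
    using borel_measurable_implies_sequence_metric[OF f(1)] unfolding norm_conv_dist by metis
  show "P f"
  proof (rule lim[where s = s])
    fix i
    have "P (\<lambda>x. \<Sum>y\<in>s i ` space mu. y * indicator (s i -` {y} \<inter> space mu) x)"
    proof (intro sum scale ind)
      show "finite (s i ` space mu)" by (rule simple_functionD(1)[OF s(1)])
      show "s i -` {y} \<inter> space mu \<in> sets borel" for y
        by (rule sets_mu_borel[OF simple_functionD(2)[OF s(1)]])
    qed
    then show "P (s i)"
    proof (rule cong)
      show "s i \<in> borel_measurable mu" using s(1) by (rule borel_measurable_simple_function)
      have "finite (s i ` {-1<..<1})" using simple_functionD(1)[OF s(1), of i] by (simp add: space_mu)
      then show "\<exists>B. \<forall>x\<in>{-1<..<1}. cmod (s i x) \<le> B"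
        by (intro exI[of _ "Max (cmod ` s i ` {-1<..<1})"]) (auto intro!: Max_ge)
      show "(\<Sum>y\<in>s i ` space mu. y * indicator (s i -` {y} \<inter> space mu) x) = s i x"
        if "x \<in> {-1<..<1}" for x
      proof -
        have "s i x = (\<Sum>y\<in>s i ` space mu. indicator (s i -` {y} \<inter> space mu) x *\<^sub>R y)"
          by (rule simple_function_indicator_representation_banach[OF s(1)]) (use that in \<open>simp add: space_mu\<close>)
        also have "\<dots> = (\<Sum>y\<in>s i ` space mu. y * indicator (s i -` {y} \<inter> space mu) x)"
          by (intro sum.cong) (auto simp: indicator_def)
        finally show ?thesis by (rule sym)
      qed
    qed
  qed (use f s(2,3) space_mu in simp_all)
qed

section \<open>Lebesgue points\<close>

text \<open>
  The weak type estimate for the maximal function. By Vitali's covering lemma the balls on which \<open>h\<close> has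
  a large mean contain a disjoint family whose fivefold enlargements cover all of them; an enlarged
  ball has length \<open>10 r\<close>, and \<open>r\<close> is less than \<open>1/c\<close> times the mass of \<open>h\<close> on the ball.
\<close>
lemma maximal_cover:
  fixes h :: "real \<Rightarrow> real"
  assumes int: "integrable mu h" and nn: "\<And>x. 0 \<le> h x" and c: "c > 0"
  obtains U where "U \<in> sets borel"
    "\<And>t r. 0 < r \<Longrightarrow> r \<le> 1 \<Longrightarrow> c * r < (LINT x:cball t r|mu. h x) \<Longrightarrow> t \<in> U"
    "emeasure lborel U \<le> ennreal (10 / c * (LINT x|mu. h x))"
proof -
  define K where "K = {(t, r). 0 < r \<and> r \<le> 1 \<and> c * r < (LINT x:cball t r|mu. h x)}"
  obtain C where C: "countable C" "C \<subseteq> K"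
     "pairwise (\<lambda>i j. disjnt (cball (fst i) (snd i)) (cball (fst j) (snd j))) C"
     "(\<Union>i\<in>K. cball (fst i) (snd i)) \<subseteq> (\<Union>i\<in>C. cball (fst i) (5 * snd i))"
  proof (rule Vitali_covering_lemma_cballs[OF order_refl, of K snd 1 fst])
    show "0 < snd i \<and> snd i \<le> 1" if "i \<in> K" for i
      using that by (auto simp: K_def)
  qed
  let ?U = "\<Union>i\<in>C. cball (fst i) (5 * snd i)"
  have [measurable]: "h \<in> borel_measurable mu" using int by simp
  have Usets: "?U \<in> sets borel" using C(1) by (intro sets.countable_UN'') auto
  have ball: "(\<integral>\<^sup>+x. indicator (cball (fst i) (5 * snd i)) x \<partial>lborel)
      \<le> ennreal (10 / c) * (\<integral>\<^sup>+x. ennreal (h x) * indicator (cball (fst i) (snd i)) x \<partial>mu)" if "i \<in> C" for i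
  proof -
    obtain t r where i: "i = (t, r)" by force
    with that C(2) have r: "0 < r" "c * r < (LINT x:cball t r|mu. h x)" by (auto simp: K_def)
    have "(\<integral>\<^sup>+x. indicator (cball t (5 * r)) x \<partial>lborel) = ennreal (10 * r)"
      using r by (simp add: cball_eq_atLeastAtMost)
    also have "\<dots> \<le> ennreal (10 / c * (LINT x:cball t r|mu. h x))"
      using r c by (intro ennreal_leI) (simp add: field_simps)
    also have "\<dots> = ennreal (10 / c) * ennreal (LINT x|mu. h x * indicator (cball t r) x)"
      using c by (subst ennreal_mult') (auto simp: set_lebesgue_integral_def mult.commute)
    also have "ennreal (LINT x|mu. h x * indicator (cball t r) x) =
        (\<integral>\<^sup>+x. ennreal (h x * indicator (cball t r) x) \<partial>mu)"
      using nn set_integrable_mu[OF int, of "cball t r"]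
      by (intro nn_integral_eq_integral[symmetric]) (auto simp: mult.commute set_integrable_def)
    also have "\<dots> = (\<integral>\<^sup>+x. ennreal (h x) * indicator (cball t r) x \<partial>mu)"
      by (intro nn_integral_cong) (auto simp: indicator_def)
    finally show ?thesis by (simp add: i)
  qed
  have "emeasure lborel ?U = (\<integral>\<^sup>+x. indicator ?U x \<partial>lborel)"
    using Usets by simp
  also have "\<dots> \<le> (\<integral>\<^sup>+x. (\<integral>\<^sup>+i. indicator (cball (fst i) (5 * snd i)) x \<partial>count_space C) \<partial>lborel)"
  proof (intro nn_integral_mono)
    fix x :: real
    show "indicator ?U x \<le> (\<integral>\<^sup>+i. indicator (cball (fst i) (5 * snd i)) x \<partial>count_space C)"
    proof (cases "x \<in> ?U")
      case True
      then obtain i where i: "i \<in> C" "x \<in> cball (fst i) (5 * snd i)" by blast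
      have "(1::ennreal) = indicator (cball (fst i) (5 * snd i)) x" using i by simp
      also have "\<dots> \<le> (\<integral>\<^sup>+i. indicator (cball (fst i) (5 * snd i)) x \<partial>count_space C)"
        using i(1) by (rule nn_integral_ge_point)
      finally show ?thesis by (simp add: indicator_def)
    qed simp
  qed
  also have "\<dots> = (\<integral>\<^sup>+i. (\<integral>\<^sup>+x. indicator (cball (fst i) (5 * snd i)) x \<partial>lborel) \<partial>count_space C)"
    by (intro nn_integral_count_space_nn_integral C(1) borel_measurable_indicator) simp
  also have "\<dots> \<le> (\<integral>\<^sup>+i. ennreal (10 / c) * (\<integral>\<^sup>+x. ennreal (h x) * indicator (cball (fst i) (snd i)) x \<partial>mu) \<partial>count_space C)"
    using ball by (intro nn_integral_mono) auto
  also have "\<dots> = ennreal (10 / c) * (\<integral>\<^sup>+i. emeasure (density mu h) (cball (fst i) (snd i) \<inter> {-1<..<1}) \<partial>count_space C)"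
  proof (subst nn_integral_cmult[symmetric], simp, intro nn_integral_cong)
    fix i
    have s: "cball (fst i) (snd i) \<inter> {-1<..<1} \<in> sets mu" by (simp add: sets_mu_iff)
    show "ennreal (10 / c) * (\<integral>\<^sup>+x. ennreal (h x) * indicator (cball (fst i) (snd i)) x \<partial>mu)
       = ennreal (10 / c) * emeasure (density mu h) (cball (fst i) (snd i) \<inter> {-1<..<1})"
      by (subst emeasure_density[OF _ s]) (auto simp: space_mu indicator_def intro!: arg_cong[where f = "\<lambda>x. _ * x"] nn_integral_cong)
  qed
  also have "(\<integral>\<^sup>+i. emeasure (density mu h) (cball (fst i) (snd i) \<inter> {-1<..<1}) \<partial>count_space C) =
      emeasure (density mu h) (\<Union>i\<in>C. cball (fst i) (snd i) \<inter> {-1<..<1})"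
  proof (rule emeasure_UN_countable[symmetric])
    show "disjoint_family_on (\<lambda>i. cball (fst i) (snd i) \<inter> {-1<..<1}) C"
      unfolding disjoint_family_on_def
    proof (intro ballI impI)
      fix i j assume "i \<in> C" "j \<in> C" "i \<noteq> j"
      then have "disjnt (cball (fst i) (snd i)) (cball (fst j) (snd j))"
        using C(3) by (auto simp: pairwise_def)
      then show "cball (fst i) (snd i) \<inter> {-1<..<1} \<inter> (cball (fst j) (snd j) \<inter> {-1<..<1}) = {}"
        unfolding disjnt_def by blast
    qed
  qed (use C(1) in \<open>simp_all add: sets_mu_iff\<close>)
  also have "\<dots> \<le> emeasure (density mu h) (space mu)"
    using emeasure_space[of "density mu h"] by simp
  also have "\<dots> = (\<integral>\<^sup>+x. ennreal (h x) \<partial>mu)"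
    by (subst emeasure_density[OF _ sets.top]) (auto intro!: nn_integral_cong)
  also have "\<dots> = ennreal (LINT x|mu. h x)"
    using int nn by (intro nn_integral_eq_integral) auto
  finally have "emeasure lborel ?U \<le> ennreal (10 / c) * ennreal (LINT x|mu. h x)"
    by (simp add: mult_left_mono)
  also have "\<dots> = ennreal (10 / c * (LINT x|mu. h x))"
    using c by (subst ennreal_mult') auto
  finally have Um: "emeasure lborel ?U \<le> ennreal (10 / c * (LINT x|mu. h x))" .
  have Uin: "t \<in> ?U" if "0 < r" "r \<le> 1" "c * r < (LINT x:cball t r|mu. h x)" for t r
  proof -
    have "(t, r) \<in> K" using that by (simp add: K_def)
    moreover have "t \<in> cball t r" using that by simp
    ultimately have "t \<in> (\<Union>i\<in>K. cball (fst i) (snd i))" by force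
    with C(4) show ?thesis by blast
  qed
  show ?thesis
    by (rule that[OF Usets Uin Um])
qed

text \<open>
  The oscillation is compared with \<open>r\<close> instead of the length \<open>2 r\<close> of the ball; only the part of the
  ball inside the interval counts.
\<close>
definition lebesgue_point :: "(real \<Rightarrow> complex) \<Rightarrow> real \<Rightarrow> bool"
  where "lebesgue_point f t \<longleftrightarrow>
    (\<forall>c>0. \<exists>d>0. \<forall>r. 0 < r \<longrightarrow> r < d \<longrightarrow> (LINT x:cball t r|mu. cmod (f x - f t)) \<le> c * r)"

lemma set_integral_const_cball_mu:
  assumes "0 < r" "0 \<le> (a::real)"
  shows "(LINT x:cball t r|mu. a) \<le> 2 * a * r"
proof -
  have "(LINT x:cball t r|mu. a) = (LINT x|mu. a * indicator (cball t r \<inter> {-1<..<1}) x)"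
    unfolding set_lebesgue_integral_def
    by (intro Bochner_Integration.integral_cong) (auto simp: space_mu indicator_def)
  also have "\<dots> = a * measure mu (cball t r \<inter> {-1<..<1})"
    by (subst integral_mult_right_zero) (simp add: sets_mu_iff space_mu Int_absorb2 measure_def)
  also have "measure mu (cball t r \<inter> {-1<..<1}) = measure lborel (cball t r \<inter> {-1<..<1})"
    by (simp add: measure_restrict_space)
  also have "\<dots> \<le> measure lborel (cball t r)"
    using assms by (intro measure_mono_fmeasurable) (auto simp: cball_eq_atLeastAtMost fmeasurable_def)
  also have "\<dots> = 2 * r" using assms by (simp add: cball_eq_atLeastAtMost)
  finally show ?thesis using assms by (simp add: mult_left_mono mult.assoc mult.left_commute)
qed

lemma L1_lim:
  fixes f :: "real \<Rightarrow> complex" and s :: "nat \<Rightarrow> real \<Rightarrow> complex"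
  assumes "integrable mu f" "\<And>i. integrable mu (s i)"
    "\<And>x. x \<in> {-1<..<1} \<Longrightarrow> (\<lambda>i. s i x) \<longlonglongrightarrow> f x"
    "\<And>i x. x \<in> {-1<..<1} \<Longrightarrow> cmod (s i x) \<le> 2 * cmod (f x)"
  shows "(\<lambda>i. LINT x|mu. cmod (f x - s i x)) \<longlonglongrightarrow> 0"
proof -
  have [measurable]: "f \<in> borel_measurable mu" "\<And>i. s i \<in> borel_measurable mu"
    using assms by auto
  have "(\<lambda>i. LINT x|mu. cmod (f x - s i x)) \<longlonglongrightarrow> (LINT x|mu. 0)"
  proof (rule integral_dominated_convergence[where w = "\<lambda>x. 3 * cmod (f x)"])
    show "AE x in mu. (\<lambda>i. cmod (f x - s i x)) \<longlonglongrightarrow> 0"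
    proof (rule AE_mu_I)
      fix x assume "x \<in> {-1<..<1::real}"
      then have "(\<lambda>i. cmod (f x - s i x)) \<longlonglongrightarrow> cmod (f x - f x)"
        by (intro tendsto_intros assms)
      then show "(\<lambda>i. cmod (f x - s i x)) \<longlonglongrightarrow> 0" by simp
    qed
    show "AE x in mu. norm (cmod (f x - s i x)) \<le> 3 * cmod (f x)" for i
    proof (rule AE_mu_I)
      fix x assume "x \<in> {-1<..<1::real}"
      then show "norm (cmod (f x - s i x)) \<le> 3 * cmod (f x)"
        using assms(4)[of x i] norm_triangle_ineq4[of "f x" "s i x"] by simp
    qed
  qed (use assms(1) in auto)
  then show ?thesis by simp
qed

lemma AE_lborel_mu: "AE x in lborel. P x \<Longrightarrow> AE x in mu. P x"
  by (subst AE_restrict_space_iff) auto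

text \<open>
  For the indicator of a half-line only the end point is exceptional. The property passes to dominated
  limits, since \<open>maximal_cover\<close> makes the oscillation of the error small outside a set of small
  measure.
\<close>
theorem AE_lebesgue_point:
  assumes "integrable mu f"
  shows "AE t in mu. lebesgue_point f t"
proof -
  let ?P = "\<lambda>f. integrable mu f \<and> (AE t in mu. lebesgue_point f t)"
  have meas: "f \<in> borel_measurable mu" using assms by auto
  have "?P f"
  proof (rule interval_dense_induct[where Q = "integrable mu", OF meas assms])
    show "integrable mu f" if "f \<in> borel_measurable mu" "\<exists>B. \<forall>x\<in>{-1<..<1}. cmod (f x) \<le> B" for f
      using that by (auto intro: integrable_mu_bounded)
  next
    fix a :: real
    have "lebesgue_point (indicator {..<a}) t" if "t \<noteq> a" for t
      unfolding lebesgue_point_def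
    proof (intro allI impI exI[of _ "\<bar>t - a\<bar>"] conjI)
      fix c r :: real assume cr: "c > 0" "0 < r" "r < \<bar>t - a\<bar>"
      have "(LINT x:cball t r|mu. cmod (indicator {..<a} x - indicator {..<a} t)) = (LINT x|mu. 0)"
        unfolding set_lebesgue_integral_def using cr
        by (intro Bochner_Integration.integral_cong) (auto simp: indicator_def dist_real_def)
      then show "(LINT x:cball t r|mu. cmod (indicator {..<a} x - indicator {..<a} t)) \<le> c * r"
        using cr by simp
    qed (use that in auto)
    with AE_mu_neq[of a] have "AE t in mu. lebesgue_point (indicator {..<a}) t"
      by (auto elim: eventually_mono)
    moreover have "integrable mu (indicator {..<a} :: real \<Rightarrow> complex)"
      by (rule integrable_indicator_mu) simp
    ultimately show "?P (indicator {..<a})" by simp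
  next
    fix f g assume f: "?P f" and g: "?P g"
    have "lebesgue_point (\<lambda>x. f x + g x) t" if lf: "lebesgue_point f t" and lg: "lebesgue_point g t" for t
      unfolding lebesgue_point_def
    proof (intro allI impI)
      fix c :: real assume c: "c > 0"
      from lf c obtain d1 where d1: "d1 > 0" "\<And>r. 0 < r \<Longrightarrow> r < d1 \<Longrightarrow> (LINT x:cball t r|mu. cmod (f x - f t)) \<le> c / 2 * r"
        unfolding lebesgue_point_def by (meson half_gt_zero)
      from lg c obtain d2 where d2: "d2 > 0" "\<And>r. 0 < r \<Longrightarrow> r < d2 \<Longrightarrow> (LINT x:cball t r|mu. cmod (g x - g t)) \<le> c / 2 * r"
        unfolding lebesgue_point_def by (meson half_gt_zero)
      show "\<exists>d>0. \<forall>r. 0 < r \<longrightarrow> r < d \<longrightarrow> (LINT x:cball t r|mu. cmod (f x + g x - (f t + g t))) \<le> c * r"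
      proof (intro exI[of _ "min d1 d2"] conjI allI impI)
        fix r assume r: "0 < r" "r < min d1 d2"
        have i: "set_integrable mu (cball t r) (\<lambda>x. cmod (f x - f t))"
          "set_integrable mu (cball t r) (\<lambda>x. cmod (g x - g t))"
          "set_integrable mu (cball t r) (\<lambda>x. cmod (f x + g x - (f t + g t)))"
          using f g by (auto intro!: set_integrable_mu)
        have "(LINT x:cball t r|mu. cmod (f x + g x - (f t + g t))) \<le>
          (LINT x:cball t r|mu. cmod (f x - f t) + cmod (g x - g t))"
        proof (intro set_integral_mono set_integral_add i)
          fix x show "cmod (f x + g x - (f t + g t)) \<le> cmod (f x - f t) + cmod (g x - g t)"
            using norm_triangle_ineq[of "f x - f t" "g x - g t"] by (simp add: algebra_simps)
        qed
        also have "\<dots> \<le> c / 2 * r + c / 2 * r"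
          using d1(2)[of r] d2(2)[of r] r i by (simp add: set_integral_add)
        finally show "(LINT x:cball t r|mu. cmod (f x + g x - (f t + g t))) \<le> c * r" by simp
      qed (use d1 d2 in auto)
    qed
    with f g show "?P (\<lambda>x. f x + g x)" by auto
  next
    fix k f assume f: "?P f"
    have "lebesgue_point (\<lambda>x. k * f x) t" if lf: "lebesgue_point f t" for t
      unfolding lebesgue_point_def
    proof (intro allI impI)
      fix c :: real assume c: "c > 0"
      have k: "c / (1 + cmod k) > 0" using c by (simp add: add_pos_nonneg)
      then obtain d where d: "d > 0" "\<And>r. 0 < r \<Longrightarrow> r < d \<Longrightarrow> (LINT x:cball t r|mu. cmod (f x - f t)) \<le> c / (1 + cmod k) * r"
        using lf unfolding lebesgue_point_def by blast
      show "\<exists>d>0. \<forall>r. 0 < r \<longrightarrow> r < d \<longrightarrow> (LINT x:cball t r|mu. cmod (k * f x - k * f t)) \<le> c * r"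
      proof (intro exI[of _ d] conjI allI impI)
        fix r assume r: "0 < r" "r < d"
        have "(LINT x:cball t r|mu. cmod (k * f x - k * f t)) = cmod k * (LINT x:cball t r|mu. cmod (f x - f t))"
          by (simp add: norm_mult flip: right_diff_distrib)
        also have "\<dots> \<le> cmod k * (c / (1 + cmod k) * r)"
          using d(2)[OF r] by (rule mult_left_mono) simp
        also have "\<dots> = c * r * (cmod k / (1 + cmod k))" by simp
        also have "\<dots> \<le> c * r * 1"
          using r c by (intro mult_left_mono) (auto simp: divide_le_eq add_pos_nonneg)
        finally show "(LINT x:cball t r|mu. cmod (k * f x - k * f t)) \<le> c * r" by simp
      qed (use d in auto)
    qed
    with f show "?P (\<lambda>x. k * f x)" by auto
  next
    fix f and s :: "nat \<Rightarrow> real \<Rightarrow> complex"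
    assume f: "integrable mu f" and s: "\<And>i. ?P (s i)"
      and conv: "\<And>x. x \<in> {-1<..<1} \<Longrightarrow> (\<lambda>i. s i x) \<longlonglongrightarrow> f x"
      and dom: "\<And>i x. x \<in> {-1<..<1} \<Longrightarrow> cmod (s i x) \<le> 2 * cmod (f x)"
    define h where "h i x = cmod (f x - s i x)" for i x
    have hint: "integrable mu (h i)" for i
      unfolding h_def using f s by auto
    have h0: "(\<lambda>i. LINT x|mu. h i x) \<longlonglongrightarrow> 0"
      unfolding h_def using f s conv dom by (intro L1_lim) auto
    have good: "AE t in mu. \<exists>d>0. \<forall>r. 0 < r \<longrightarrow> r < d \<longrightarrow> (LINT x:cball t r|mu. cmod (f x - f t)) \<le> c * r"
      if c: "c > 0" for c
    proof -
      have "\<exists>U. U \<in> sets borel \<and> (\<forall>t r. 0 < r \<longrightarrow> r \<le> 1 \<longrightarrow> c / 3 * r < (LINT x:cball t r|mu. h i x) \<longrightarrow> t \<in> U)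
         \<and> emeasure lborel U \<le> ennreal (10 / (c / 3) * (LINT x|mu. h i x))" for i
        by (rule maximal_cover[of "h i" "c / 3"]) (use c hint in \<open>auto simp: h_def\<close>)
      then obtain U where U: "\<And>i. U i \<in> sets borel"
        "\<And>i t r. 0 < r \<Longrightarrow> r \<le> 1 \<Longrightarrow> c / 3 * r < (LINT x:cball t r|mu. h i x) \<Longrightarrow> t \<in> U i"
        "\<And>i. emeasure lborel (U i) \<le> ennreal (10 / (c / 3) * (LINT x|mu. h i x))"
        by metis
      have U0: "(\<lambda>i. ennreal (10 / (c / 3) * (LINT x|mu. h i x))) \<longlonglongrightarrow> 0"
        using tendsto_ennrealI[OF tendsto_mult[OF tendsto_const h0, of "10 / (c / 3)"]] by simp
      have out: "AE t in mu. \<exists>i\<ge>k. t \<notin> U i" for k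
      proof (rule AE_lborel_mu, rule AE_I')
        show "(\<Inter>i\<in>{k..}. U i) \<in> null_sets lborel"
        proof (rule null_setsI)
          show s: "(\<Inter>i\<in>{k..}. U i) \<in> sets lborel"
            using U(1) by (intro sets.countable_INT') auto
          have "emeasure lborel (\<Inter>i\<in>{k..}. U i) \<le> 0"
          proof (rule tendsto_lowerbound[OF U0 _ sequentially_bot])
            show "\<forall>\<^sub>F i in sequentially. emeasure lborel (\<Inter>i\<in>{k..}. U i) \<le> ennreal (10 / (c / 3) * (LINT x|mu. h i x))"
              using eventually_ge_at_top[of k]
            proof eventually_elim
              case (elim i)
              have "emeasure lborel (\<Inter>i\<in>{k..}. U i) \<le> emeasure lborel (U i)"
                using elim U(1) by (intro emeasure_mono) auto
              also note U(3)
              finally show ?case .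
            qed
          qed
          then show "emeasure lborel (\<Inter>i\<in>{k..}. U i) = 0" by simp
        qed
      qed auto
      have "AE t in mu. (\<forall>k. \<exists>i\<ge>k. t \<notin> U i) \<and> (\<forall>i. lebesgue_point (s i) t)"
        using out s by (simp add: AE_all_countable AE_conj_iff)
      moreover have "AE t in mu. t \<in> {-1<..<1}" by (rule AE_mu_I)
      ultimately show ?thesis
      proof eventually_elim
        case (elim t)
        have "(\<lambda>i. h i t) \<longlonglongrightarrow> cmod (f t - f t)"
          unfolding h_def by (intro tendsto_intros conv elim)
        then have "\<forall>\<^sub>F i in sequentially. h i t < c / 6"
          using c by (intro order_tendstoD(2)[where y = "cmod (f t - f t)"]) auto
        then obtain k where k: "\<And>i. i \<ge> k \<Longrightarrow> h i t < c / 6"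
          by (auto simp: eventually_sequentially)
        from elim obtain i where i: "i \<ge> k" "t \<notin> U i" by blast
        from elim have "lebesgue_point (s i) t" by blast
        moreover have c3: "c / 3 > 0" using c by simp
        ultimately obtain d where d: "d > 0" "\<And>r. 0 < r \<Longrightarrow> r < d \<Longrightarrow> (LINT x:cball t r|mu. cmod (s i x - s i t)) \<le> c / 3 * r"
          unfolding lebesgue_point_def by blast
        show ?case
        proof (intro exI[of _ "min d 1"] conjI allI impI)
          fix r assume r: "0 < r" "r < min d 1"
          have I: "set_integrable mu (cball t r) (\<lambda>x. cmod (s i x - s i t))"
            "set_integrable mu (cball t r) (h i)"
            "set_integrable mu (cball t r) (\<lambda>x. h i t)"
            "set_integrable mu (cball t r) (\<lambda>x. cmod (f x - f t))"
            using f s hint by (auto intro!: set_integrable_mu)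
          have "(LINT x:cball t r|mu. cmod (f x - f t)) \<le>
             (LINT x:cball t r|mu. cmod (s i x - s i t) + (h i x + h i t))"
          proof (intro set_integral_mono set_integral_add I)
            fix x
            have "f x - f t = (s i x - s i t) + ((f x - s i x) - (f t - s i t))" by simp
            also have "cmod \<dots> \<le> cmod (s i x - s i t) + (h i x + h i t)"
              unfolding h_def by (rule norm_triangle_mono[OF order_refl norm_triangle_ineq4])
            finally show "cmod (f x - f t) \<le> cmod (s i x - s i t) + (h i x + h i t)" .
          qed
          also have "\<dots> = (LINT x:cball t r|mu. cmod (s i x - s i t)) + ((LINT x:cball t r|mu. h i x) + (LINT x:cball t r|mu. h i t))"
            using I by (simp add: set_integral_add)
          also have "\<dots> \<le> c / 3 * r + (c / 3 * r + c / 3 * r)"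
          proof (intro add_mono)
            show "(LINT x:cball t r|mu. cmod (s i x - s i t)) \<le> c / 3 * r" using d(2) r by simp
            show "(LINT x:cball t r|mu. h i x) \<le> c / 3 * r"
            proof (rule ccontr)
              assume "\<not> (LINT x:cball t r|mu. h i x) \<le> c / 3 * r"
              then have "c / 3 * r < (LINT x:cball t r|mu. h i x)" by simp
              from U(2)[OF _ _ this] r i(2) show False by simp
            qed
            have "(LINT x:cball t r|mu. h i t) \<le> 2 * h i t * r"
              using r by (intro set_integral_const_cball_mu) (auto simp: h_def)
            also have "\<dots> \<le> c / 3 * r" using k[OF i(1)] r by simp
            finally show "(LINT x:cball t r|mu. h i t) \<le> c / 3 * r" .
          qed
          finally show "(LINT x:cball t r|mu. cmod (f x - f t)) \<le> c * r" by simp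
        qed (use d in auto)
      qed
    qed
    have "AE t in mu. \<forall>n. \<exists>d>0. \<forall>r. 0 < r \<longrightarrow> r < d \<longrightarrow>
        (LINT x:cball t r|mu. cmod (f x - f t)) \<le> 1 / real (Suc n) * r"
      unfolding AE_all_countable by (intro allI good) simp
    then have "AE t in mu. lebesgue_point f t"
    proof eventually_elim
      case (elim t)
      show ?case unfolding lebesgue_point_def
      proof (intro allI impI)
        fix c :: real assume "c > 0"
        then obtain n where n: "1 / real (Suc n) < c" using nat_approx_posE by blast
        from elim obtain d where d: "d > 0" "\<And>r. 0 < r \<Longrightarrow> r < d \<Longrightarrow>
          (LINT x:cball t r|mu. cmod (f x - f t)) \<le> 1 / real (Suc n) * r" by blast
        show "\<exists>d>0. \<forall>r. 0 < r \<longrightarrow> r < d \<longrightarrow> (LINT x:cball t r|mu. cmod (f x - f t)) \<le> c * r"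
        proof (intro exI[of _ d] conjI allI impI d(1))
          fix r assume r: "0 < r" "r < d"
          from d(2)[OF r] show "(LINT x:cball t r|mu. cmod (f x - f t)) \<le> c * r"
            by (rule order_trans) (use n r in \<open>intro mult_right_mono; simp\<close>)
        qed
      qed
    qed
    with f show "?P f" by simp
  qed
  then show ?thesis by simp
qed

section \<open>The conjugate Poisson kernel on the interval\<close>

lemma set_integral_mu_space:
  fixes f :: "real \<Rightarrow> 'a::{banach, second_countable_topology}"
  shows "(LINT x:{-1<..<1}|mu. f x) = (LINT x|mu. f x)"
  unfolding set_lebesgue_integral_def
  by (intro Bochner_Integration.integral_cong) (auto simp: space_mu)

lemma set_integral_mu:
  fixes f :: "real \<Rightarrow> 'a::{banach, second_countable_topology}"
  assumes "A \<subseteq> {-1<..<1}"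
  shows "(LINT x:A|mu. f x) = (LINT x:A|lborel. f x)"
  unfolding set_lebesgue_integral_def integral_mu
  by (intro Bochner_Integration.integral_cong) (use assms in \<open>auto simp: indicator_def\<close>)

lemma mu_FTC:
  fixes f F :: "real \<Rightarrow> 'a::euclidean_space"
  assumes ab: "-1 \<le> a" "a \<le> b" "b \<le> 1" and f: "continuous_on {a..b} f"
    and F: "\<And>x. a \<le> x \<Longrightarrow> x \<le> b \<Longrightarrow> (F has_vector_derivative f x) (at x within {a..b})"
  shows "(LINT x:{a<..<b}|mu. f x) = F b - F a"
proof -
  have "(LINT x:{a<..<b}|mu. f x) = (LINT x:{a<..<b}|lborel. f x)"
    using ab by (intro set_integral_mu) auto
  also have "\<dots> = (LBINT x=a..b. f x)" using ab by (simp add: interval_integral_Ioo)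
  also have "\<dots> = F b - F a"
    using assms by (intro interval_integral_FTC_finite) (auto simp: min_def max_def)
  finally show ?thesis .
qed

text \<open>
  The real part of \<open>1 / (pi (u - i y))\<close>, the conjugate Poisson kernel.
\<close>
definition conj_kernel :: "real \<Rightarrow> real \<Rightarrow> real"
  where "conj_kernel y u = u / (u\<^sup>2 + y\<^sup>2) / pi"

definition conj_poisson :: "real \<Rightarrow> (real \<Rightarrow> complex) \<Rightarrow> real \<Rightarrow> complex"
  where "conj_poisson y g t = (LINT x|mu. g x * complex_of_real (conj_kernel y (x - t)))"

lemma conj_kernel_minus: "conj_kernel y (- u) = - conj_kernel y u"
  by (simp add: conj_kernel_def)

lemma conj_kernel_measurable [measurable]: "conj_kernel y \<in> borel_measurable borel"
  unfolding conj_kernel_def[abs_def] by measurable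

lemma abs_conj_kernel_le_y:
  assumes "y > 0" shows "\<bar>conj_kernel y u\<bar> \<le> 1 / y"
proof -
  have "\<bar>u\<bar> * y \<le> u\<^sup>2 + y\<^sup>2"
  proof -
    have "0 \<le> (\<bar>u\<bar> - y)\<^sup>2 + u\<^sup>2 + y\<^sup>2" by (intro add_nonneg_nonneg) auto
    then show ?thesis by (simp add: power2_diff)
  qed
  moreover have p: "u\<^sup>2 + y\<^sup>2 > 0" using assms by (intro add_nonneg_pos) auto
  ultimately have "\<bar>u\<bar> / (u\<^sup>2 + y\<^sup>2) \<le> 1 / y" using assms by (simp add: divide_simps)
  moreover have "\<bar>conj_kernel y u\<bar> = \<bar>u\<bar> / (u\<^sup>2 + y\<^sup>2) / pi"
    using p pi_gt_zero by (simp add: conj_kernel_def abs_divide)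
  moreover have "\<bar>u\<bar> / (u\<^sup>2 + y\<^sup>2) / pi \<le> \<bar>u\<bar> / (u\<^sup>2 + y\<^sup>2) / 1"
    using p pi_ge_two by (intro divide_left_mono) auto
  ultimately show ?thesis by simp
qed

lemma abs_conj_kernel_le: "\<bar>u\<bar> * \<bar>conj_kernel y u\<bar> \<le> 1"
proof -
  have "\<bar>u\<bar> * \<bar>conj_kernel y u\<bar> = u\<^sup>2 / (u\<^sup>2 + y\<^sup>2) / pi"
    using pi_gt_zero by (simp add: conj_kernel_def abs_divide abs_mult power2_eq_square)
  also have "\<dots> \<le> u\<^sup>2 / (u\<^sup>2 + y\<^sup>2) / 1"
    using pi_ge_two by (intro divide_left_mono) auto
  also have "\<dots> \<le> 1" by (simp add: divide_le_eq_1 sum_power2_gt_zero_iff)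
  finally show ?thesis .
qed

lemma conj_poisson_integrand:
  assumes "integrable mu g" "y > 0"
  shows "integrable mu (\<lambda>x. g x * complex_of_real (conj_kernel y (x - t)))"
proof (rule integrable_mult_bounded[OF assms(1)])
  have [measurable]: "(\<lambda>x. conj_kernel y (x - t)) \<in> borel_measurable mu"
    by (rule borel_measurable_mu) measurable
  show "(\<lambda>x. complex_of_real (conj_kernel y (x - t))) \<in> borel_measurable mu" by measurable
  show "norm (complex_of_real (conj_kernel y (x - t))) \<le> 1 / y" for x
    using abs_conj_kernel_le_y[OF assms(2)] by simp
qed

lemma conj_poisson_bound:
  assumes "integrable mu g" "y > 0"
  shows "cmod (conj_poisson y g t) \<le> (1 / y) * (LINT x|mu. cmod (g x))"
proof -
  have "cmod (conj_poisson y g t) \<le> (LINT x|mu. cmod (g x * complex_of_real (conj_kernel y (x - t))))"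
    unfolding conj_poisson_def by (rule integral_norm_bound)
  also have "\<dots> \<le> (LINT x|mu. (1 / y) * cmod (g x))"
  proof (rule integral_mono)
    fix x
    have "cmod (g x) * \<bar>conj_kernel y (x - t)\<bar> \<le> cmod (g x) * (1 / y)"
      by (intro mult_left_mono abs_conj_kernel_le_y assms) simp
    then show "cmod (g x * complex_of_real (conj_kernel y (x - t))) \<le> (1 / y) * cmod (g x)"
      by (simp add: norm_mult mult.commute)
  qed (use assms in \<open>auto intro: conj_poisson_integrand\<close>)
  finally show ?thesis by simp
qed

lemma conj_poisson_measurable [measurable]:
  assumes [measurable]: "g \<in> borel_measurable mu"
  shows "conj_poisson y g \<in> borel_measurable mu"
proof -
  have [measurable]: "(\<lambda>p. conj_kernel y (snd p - fst p)) \<in> borel_measurable (mu \<Otimes>\<^sub>M mu)"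
    by (rule difference_kernel_measurable) measurable
  have "(\<lambda>p. g (snd p) * complex_of_real (conj_kernel y (snd p - fst p))) \<in> borel_measurable (mu \<Otimes>\<^sub>M mu)"
    by measurable
  then have "(\<lambda>t. LINT x|mu. g x * complex_of_real (conj_kernel y (x - t))) \<in> borel_measurable mu"
    by (intro mu.borel_measurable_lebesgue_integral) (simp add: case_prod_beta')
  then show ?thesis by (simp add: conj_poisson_def[abs_def])
qed

lemma conj_poisson_integrable:
  assumes "integrable mu g" "y > 0"
  shows "integrable mu (conj_poisson y g)"
  by (rule integrable_mu_bounded[OF conj_poisson_measurable conj_poisson_bound[OF assms]])
     (use assms in auto)

lemma conj_poisson_add:
  assumes "integrable mu f" "integrable mu g" "y > 0"
  shows "conj_poisson y (\<lambda>x. f x + g x) t = conj_poisson y f t + conj_poisson y g t"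
  unfolding conj_poisson_def distrib_right
  by (intro Bochner_Integration.integral_add conj_poisson_integrand assms)

lemma conj_poisson_diff:
  assumes "integrable mu f" "integrable mu g" "y > 0"
  shows "conj_poisson y (\<lambda>x. f x - g x) t = conj_poisson y f t - conj_poisson y g t"
  unfolding conj_poisson_def left_diff_distrib
  by (intro Bochner_Integration.integral_diff conj_poisson_integrand assms)

lemma conj_poisson_scale: "conj_poisson y (\<lambda>x. c * f x) t = c * conj_poisson y f t"
  unfolding conj_poisson_def mult.assoc by simp

text \<open>
  Fubini's theorem; the sign comes from the oddness of the kernel.
\<close>
lemma conj_poisson_duality:
  assumes g: "integrable mu g" and h: "integrable mu h" and y: "y > 0"
  shows "(LINT t|mu. conj_poisson y g t * h t) = - (LINT x|mu. g x * conj_poisson y h x)"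
proof -
  let ?k = "\<lambda>t x. g x * h t * complex_of_real (conj_kernel y (x - t))"
  have [measurable]: "g \<in> borel_measurable mu" "h \<in> borel_measurable mu" using g h by auto
  have [measurable]: "(\<lambda>p. conj_kernel y (snd p - fst p)) \<in> borel_measurable (mu \<Otimes>\<^sub>M mu)"
    by (rule difference_kernel_measurable) measurable
  have "integrable (mu \<Otimes>\<^sub>M mu) (case_prod ?k)"
  proof (rule Bochner_Integration.integrable_bound)
    show "integrable (mu \<Otimes>\<^sub>M mu) (\<lambda>p. complex_of_real (1 / y) * (h (fst p) * g (snd p)))"
    proof (rule mu_pair.Fubini_integrable)
      show "(\<lambda>p. complex_of_real (1 / y) * (h (fst p) * g (snd p))) \<in> borel_measurable (mu \<Otimes>\<^sub>M mu)"
        by measurable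
      have "integrable mu (\<lambda>t. (1 / y * (LINT x|mu. cmod (g x))) * cmod (h t))" using h by auto
      then show "integrable mu (\<lambda>t. LINT x|mu. cmod (complex_of_real (1 / y) * (h (fst (t, x)) * g (snd (t, x)))))"
        using y by (simp add: norm_mult norm_divide mult_ac)
      show "AE t in mu. integrable mu (\<lambda>x. complex_of_real (1 / y) * (h (fst (t, x)) * g (snd (t, x))))"
        using g by auto
    qed
    show "case_prod ?k \<in> borel_measurable (mu \<Otimes>\<^sub>M mu)"
      by (simp add: case_prod_beta')
    show "AE p in mu \<Otimes>\<^sub>M mu. norm (case_prod ?k p) \<le> norm (complex_of_real (1 / y) * (h (fst p) * g (snd p)))"
    proof (rule AE_I2)
      fix p :: "real \<times> real"
      obtain t x where p: "p = (t, x)" by force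
      have "cmod (g x * h t) * \<bar>conj_kernel y (x - t)\<bar> \<le> cmod (g x * h t) * (1 / y)"
        by (intro mult_left_mono abs_conj_kernel_le_y y) simp
      then show "norm (case_prod ?k p) \<le> norm (complex_of_real (1 / y) * (h (fst p) * g (snd p)))"
        using y by (simp add: p norm_mult norm_divide mult_ac)
    qed
  qed
  then have "(LINT x|mu. LINT t|mu. ?k t x) = (LINT t|mu. LINT x|mu. ?k t x)"
    by (rule mu_pair.Fubini_integral)
  moreover have "(LINT t|mu. ?k t x) = - (g x * conj_poisson y h x)" for x
  proof -
    have "(LINT t|mu. ?k t x) = (LINT t|mu. - g x * (h t * complex_of_real (conj_kernel y (t - x))))"
      by (intro Bochner_Integration.integral_cong refl)
         (use conj_kernel_minus[of y "x - _"] in simp)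
    then show ?thesis by (simp add: conj_poisson_def)
  qed
  moreover have "(LINT x|mu. ?k t x) = conj_poisson y g t * h t" for t
  proof -
    have "(LINT x|mu. ?k t x) = (LINT x|mu. h t * (g x * complex_of_real (conj_kernel y (x - t))))"
      by (intro Bochner_Integration.integral_cong refl) (simp add: mult_ac)
    then show ?thesis by (simp add: conj_poisson_def)
  qed
  ultimately show ?thesis by simp
qed

section \<open>Exponential integrability for bounded functions\<close>

lemma poisson_integral_le_pi:
  assumes y: "y > 0"
  shows "(LINT x|mu. y / ((x - t)\<^sup>2 + y\<^sup>2)) \<le> pi"
proof -
  have "(LINT x|mu. y / ((x - t)\<^sup>2 + y\<^sup>2)) = (LINT x:{-1<..<1}|mu. y / ((x - t)\<^sup>2 + y\<^sup>2))"
    by (rule set_integral_mu_space[symmetric])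
  also have "\<dots> = arctan ((1 - t) / y) - arctan ((-1 - t) / y)"
  proof (rule mu_FTC)
    have p: "(x - t)\<^sup>2 + y\<^sup>2 \<noteq> 0" for x
      using y by (metis add_nonneg_pos less_irrefl zero_le_power2 zero_less_power)
    show "continuous_on {-1..1} (\<lambda>x. y / ((x - t)\<^sup>2 + y\<^sup>2))"
      using p by (intro continuous_intros) auto
    show "((\<lambda>x. arctan ((x - t) / y)) has_vector_derivative y / ((x - t)\<^sup>2 + y\<^sup>2)) (at x within {-1..1})" for x
    proof -
      have e: "inverse (1 + ((x - t) / y)\<^sup>2) * (1 / y) = y / ((x - t)\<^sup>2 + y\<^sup>2)"
      proof -
        have "1 + ((x - t) / y)\<^sup>2 = ((x - t)\<^sup>2 + y\<^sup>2) / y\<^sup>2"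
          using y by (simp add: field_simps)
        then show ?thesis using y by (simp add: power2_eq_square)
      qed
      have "((\<lambda>x. arctan ((x - t) / y)) has_real_derivative inverse (1 + ((x - t) / y)\<^sup>2) * (1 / y)) (at x within {-1..1})"
        using y by (auto intro!: derivative_eq_intros)
      then show ?thesis unfolding e
        by (simp add: has_real_derivative_iff_has_vector_derivative)
    qed
  qed auto
  also have "\<dots> \<le> pi"
    using arctan_ubound[of "(1 - t) / y"] arctan_lbound[of "(-1 - t) / y"] by simp
  finally show ?thesis .
qed

text \<open>
  With the normalisation \<open>1 / pi\<close> the real part on the line \<open>Im z = y\<close> is the regularised transform of
  \<open>h\<close>, and the imaginary part is its Poisson integral.
\<close>
definition cauchy_integral :: "(real \<Rightarrow> real) \<Rightarrow> complex \<Rightarrow> complex"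
  where "cauchy_integral h z = (LINT x|mu. complex_of_real (h x) / (complex_of_real x - z)) / complex_of_real pi"

context
  fixes h :: "real \<Rightarrow> real"
  assumes hm: "h \<in> borel_measurable mu" and h1: "\<And>x. x \<in> {-1<..<1} \<Longrightarrow> \<bar>h x\<bar> \<le> 1"
begin

lemma Im_diff_le: "\<bar>Im z\<bar> \<le> cmod (complex_of_real x - z)"
  using abs_Im_le_cmod[of "complex_of_real x - z"] by simp

lemma cauchy_integrand:
  assumes "Im z > 0"
  shows "integrable mu (\<lambda>x. complex_of_real (h x) / (complex_of_real x - z))"
proof (rule integrable_mu_bounded[where B = "1 / Im z"])
  show "(\<lambda>x. complex_of_real (h x) / (complex_of_real x - z)) \<in> borel_measurable mu"
    using hm by measurable
  fix x assume "x \<in> {-1<..<1::real}"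
  then have "\<bar>h x\<bar> \<le> 1" by (rule h1)
  moreover have "Im z \<le> cmod (complex_of_real x - z)" using Im_diff_le[of z x] assms by linarith
  ultimately have "\<bar>h x\<bar> / cmod (complex_of_real x - z) \<le> 1 / Im z"
    using assms by (intro frac_le) auto
  then show "norm (complex_of_real (h x) / (complex_of_real x - z)) \<le> 1 / Im z"
    by (simp add: norm_divide)
qed

text \<open>
  Differentiation under the integral sign. With \<open>e = Im z\<close> and \<open>\<bar>w - z\<bar> < e / 2\<close>, the difference quotient
  of \<open>1 / (x - z)\<close> deviates from the derivative by \<open>(w - z) / ((x - w) (x - z)\<^sup>2)\<close>, which is at most
  \<open>2 \<bar>w - z\<bar> / e\<^sup>3\<close>.
\<close>
lemma cauchy_integral_holomorphic: "cauchy_integral h holomorphic_on {z. Im z > 0}"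
proof -
  have "(\<lambda>z. LINT x|mu. complex_of_real (h x) / (complex_of_real x - z)) field_differentiable at z"
    if z: "Im z > 0" for z
  proof -
    let ?G = "\<lambda>z. LINT x|mu. complex_of_real (h x) / (complex_of_real x - z)"
    let ?D = "LINT x|mu. complex_of_real (h x) / (complex_of_real x - z)\<^sup>2"
    define e where "e = Im z"
    have e: "e > 0" using z by (simp add: e_def)
    note hm[measurable]
    have bd: "cmod ((?G w - ?G z) / (w - z) - ?D) \<le> 4 / e ^ 3 * cmod (w - z)"
      if w: "cmod (w - z) < e / 2" "w \<noteq> z" for w
    proof -
      have "\<bar>Im w - Im z\<bar> \<le> cmod (w - z)" using abs_Im_le_cmod[of "w - z"] by simp
      then have Iw: "Im w \<ge> e / 2" using w by (simp add: e_def)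
      then have w0: "Im w > 0" using e by linarith
      have i2: "integrable mu (\<lambda>x. complex_of_real (h x) / (complex_of_real x - z)\<^sup>2)"
      proof (rule integrable_mu_bounded[where B = "1 / e\<^sup>2"])
        fix x assume "x \<in> {-1<..<1::real}"
        then have "\<bar>h x\<bar> \<le> 1" by (rule h1)
        moreover have "e \<le> cmod (complex_of_real x - z)" using Im_diff_le[of z x] e e_def by linarith
        ultimately have "\<bar>h x\<bar> / (cmod (complex_of_real x - z))\<^sup>2 \<le> 1 / e\<^sup>2"
          using e by (intro frac_le power_mono) auto
        then show "norm (complex_of_real (h x) / (complex_of_real x - z)\<^sup>2) \<le> 1 / e\<^sup>2"
          by (simp add: norm_divide norm_power)
      qed measurable
      have "(?G w - ?G z) / (w - z) - ?D = (LINT x|mu. (complex_of_real (h x) / (complex_of_real x - w) - complex_of_real (h x) / (complex_of_real x - z)) / (w - z) - complex_of_real (h x) / (complex_of_real x - z)\<^sup>2)"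
        using i2 cauchy_integrand[OF w0] cauchy_integrand[OF z] by simp
      also have "cmod \<dots> \<le> (LINT x|mu. 2 / e ^ 3 * cmod (w - z))"
      proof (rule Bochner_Integration.integral_norm_bound_integral)
        show "integrable mu (\<lambda>x. (complex_of_real (h x) / (complex_of_real x - w) - complex_of_real (h x) / (complex_of_real x - z)) / (w - z) - complex_of_real (h x) / (complex_of_real x - z)\<^sup>2)"
          using i2 cauchy_integrand[OF w0] cauchy_integrand[OF z] by auto
        fix x assume "x \<in> space mu"
        then have hx: "\<bar>h x\<bar> \<le> 1" using h1 by (simp add: space_mu)
        have dz: "e \<le> cmod (complex_of_real x - z)" using Im_diff_le[of z x] e e_def by linarith
        have dw: "e / 2 \<le> cmod (complex_of_real x - w)" using Im_diff_le[of w x] Iw e by linarith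
        have nz: "complex_of_real x - z \<noteq> 0" "complex_of_real x - w \<noteq> 0" using dz dw e by auto
        let ?X = "complex_of_real x"
        have "(complex_of_real (h x) / (?X - w) - complex_of_real (h x) / (?X - z)) / (w - z) - complex_of_real (h x) / (?X - z)\<^sup>2
          = complex_of_real (h x) * ((w - z) / ((?X - w) * (?X - z)\<^sup>2))"
        proof -
          have "(1 / (?X - w) - 1 / (?X - z)) / (w - z) = 1 / ((?X - w) * (?X - z))"
            using nz w(2) by (simp add: diff_frac_eq)
          moreover have "1 / ((?X - w) * (?X - z)) - 1 / (?X - z)\<^sup>2 = (w - z) / ((?X - w) * (?X - z)\<^sup>2)"
            using nz by (simp add: divide_simps power2_eq_square)
          ultimately have "complex_of_real (h x) * ((1 / (?X - w) - 1 / (?X - z)) / (w - z) - 1 / (?X - z)\<^sup>2) = complex_of_real (h x) * ((w - z) / ((?X - w) * (?X - z)\<^sup>2))"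
            by simp
          then show ?thesis by (simp add: right_diff_distrib diff_divide_distrib)
        qed
        also have "cmod \<dots> = \<bar>h x\<bar> * (cmod (w - z) / (cmod (?X - w) * (cmod (?X - z))\<^sup>2))"
          by (simp add: norm_mult norm_divide norm_power)
        also have "\<dots> \<le> 1 * (cmod (w - z) / (e / 2 * e\<^sup>2))"
          using hx dz dw e by (intro mult_mono divide_left_mono power_mono mult_pos_pos) auto
        also have "\<dots> = 2 / e ^ 3 * cmod (w - z)"
          by (simp add: power3_eq_cube power2_eq_square mult_ac)
        finally show "norm ((complex_of_real (h x) / (?X - w) - complex_of_real (h x) / (?X - z)) / (w - z) - complex_of_real (h x) / (?X - z)\<^sup>2) \<le> 2 / e ^ 3 * cmod (w - z)" .
      qed auto
      also have "\<dots> = 4 / e ^ 3 * cmod (w - z)" by (simp add: measure_mu_UNIV space_mu)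
      finally show ?thesis .
    qed
    have "((\<lambda>w. (?G w - ?G z) / (w - z) - ?D) \<longlongrightarrow> 0) (at z)"
    proof (rule Lim_null_comparison)
      show "\<forall>\<^sub>F w in at z. cmod ((?G w - ?G z) / (w - z) - ?D) \<le> 4 / e ^ 3 * cmod (w - z)"
        unfolding eventually_at using bd e by (intro exI[of _ "e / 2"]) (auto simp: dist_norm)
      have "((\<lambda>w. 4 / e ^ 3 * cmod (w - z)) \<longlongrightarrow> 4 / e ^ 3 * cmod (z - z)) (at z)"
        by (intro tendsto_intros)
      then show "((\<lambda>w. 4 / e ^ 3 * cmod (w - z)) \<longlongrightarrow> 0) (at z)" by simp
    qed
    then have "((\<lambda>w. (?G w - ?G z) / (w - z)) \<longlongrightarrow> ?D) (at z)"
      by (subst (asm) Lim_null[symmetric])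
    then have "(?G has_field_derivative ?D) (at z)"
      by (simp add: has_field_derivative_iff)
    then show ?thesis unfolding field_differentiable_def by blast
  qed
  then have "(\<lambda>z. LINT x|mu. complex_of_real (h x) / (complex_of_real x - z)) holomorphic_on {z. Im z > 0}"
    by (auto simp: holomorphic_on_def intro: field_differentiable_at_within)
  then show ?thesis
    unfolding cauchy_integral_def[abs_def] by (intro holomorphic_intros) auto
qed

lemma cauchy_integral_bound:
  assumes "Im z > 0" "\<And>x. x \<in> {-1<..<1} \<Longrightarrow> 1 \<le> cmod (complex_of_real x - z)"
  shows "cmod (cauchy_integral h z) \<le> 1"
proof -
  have "cmod (LINT x|mu. complex_of_real (h x) / (complex_of_real x - z)) \<le> (LINT x|mu. 1)"
  proof (rule Bochner_Integration.integral_norm_bound_integral[OF cauchy_integrand[OF assms(1)]])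
    fix x assume "x \<in> space mu"
    then have "\<bar>h x\<bar> / cmod (complex_of_real x - z) \<le> 1 / 1"
      using h1[of x] assms(2)[of x] by (intro frac_le) (auto simp: space_mu)
    then show "norm (complex_of_real (h x) / (complex_of_real x - z)) \<le> 1"
      by (simp add: norm_divide)
  qed simp
  also have "\<dots> = 2" by (simp add: measure_mu_UNIV space_mu)
  finally show ?thesis using pi_ge_two by (simp add: cauchy_integral_def norm_divide divide_simps)
qed

text \<open>
  The bound on the imaginary part, being smaller than \<open>pi / 3\<close>, keeps the values of the exponential of
  the Cauchy integral in a sector around the positive axis.
\<close>
lemma Re_cauchy_integral:
  assumes "y > 0"
  shows "complex_of_real (Re (cauchy_integral h (Complex t y))) = conj_poisson y (\<lambda>x. complex_of_real (h x)) t"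
    and "\<bar>Im (cauchy_integral h (Complex t y))\<bar> \<le> 1"
proof -
  let ?z = "Complex t y"
  have i: "integrable mu (\<lambda>x. complex_of_real (h x) / (complex_of_real x - ?z))"
    using assms by (intro cauchy_integrand) simp
  have e: "complex_of_real (h x) / (complex_of_real x - ?z) =
     Complex (pi * (h x * conj_kernel y (x - t))) (h x * (y / ((x - t)\<^sup>2 + y\<^sup>2)))" for x
    by (simp add: complex_eq_iff Re_divide Im_divide conj_kernel_def)
  have "Re (cauchy_integral h ?z) = (LINT x|mu. pi * (h x * conj_kernel y (x - t))) / pi"
    using i unfolding cauchy_integral_def by (simp flip: integral_Re add: e Re_divide_of_real)
  then have R: "Re (cauchy_integral h ?z) = (LINT x|mu. h x * conj_kernel y (x - t))" by simp
  show "complex_of_real (Re (cauchy_integral h ?z)) = conj_poisson y (\<lambda>x. complex_of_real (h x)) t"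
    unfolding R conj_poisson_def by (simp flip: of_real_mult)
  have I: "Im (cauchy_integral h ?z) = (LINT x|mu. h x * (y / ((x - t)\<^sup>2 + y\<^sup>2))) / pi"
    using i unfolding cauchy_integral_def by (simp flip: integral_Im add: e Im_divide_of_real)
  have i2: "integrable mu (\<lambda>x. y / ((x - t)\<^sup>2 + y\<^sup>2))"
  proof (rule integrable_mu_bounded[where B = "1 / y"])
    fix x :: real
    have "y / ((x - t)\<^sup>2 + y\<^sup>2) \<le> y / y\<^sup>2"
      using assms by (intro divide_left_mono) (auto intro!: mult_pos_pos add_nonneg_pos)
    then show "norm (y / ((x - t)\<^sup>2 + y\<^sup>2)) \<le> 1 / y" using assms by (simp add: power2_eq_square)
  qed measurable
  have i3: "integrable mu (\<lambda>x. h x * (y / ((x - t)\<^sup>2 + y\<^sup>2)))"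
    using integrable_Im[OF i] by (simp add: e)
  have "\<bar>LINT x|mu. h x * (y / ((x - t)\<^sup>2 + y\<^sup>2))\<bar> \<le> (LINT x|mu. y / ((x - t)\<^sup>2 + y\<^sup>2))"
    unfolding real_norm_def[symmetric]
  proof (rule Bochner_Integration.integral_norm_bound_integral[OF i3 i2])
    fix x assume "x \<in> space mu"
    then have "\<bar>h x\<bar> \<le> 1" using h1 by (simp add: space_mu)
    then have "\<bar>h x\<bar> * (y / ((x - t)\<^sup>2 + y\<^sup>2)) \<le> 1 * (y / ((x - t)\<^sup>2 + y\<^sup>2))"
      using assms by (intro mult_right_mono) auto
    then show "norm (h x * (y / ((x - t)\<^sup>2 + y\<^sup>2))) \<le> y / ((x - t)\<^sup>2 + y\<^sup>2)"
      using assms by (simp add: abs_mult abs_divide)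
  qed
  also have "\<dots> \<le> pi" by (rule poisson_integral_le_pi[OF assms])
  finally show "\<bar>Im (cauchy_integral h ?z)\<bar> \<le> 1"
    unfolding I by (simp add: abs_divide)
qed

text \<open>
  The vertices \<open>-3 + i y\<close>, \<open>3 + i y\<close> and \<open>(3 + y) i\<close> are chosen so that the two upper sides have height at
  least 1 where \<open>\<bar>Re z\<bar> < 2\<close>.
\<close>
lemma segment_far:
  assumes y: "y > 0" and x: "x \<in> {-1<..<1::real}"
    and z: "z \<in> closed_segment (Complex 3 y) (Complex 0 (3 + y)) \<or> z \<in> closed_segment (Complex 0 (3 + y)) (Complex (-3) y)"
  shows "1 \<le> cmod (complex_of_real x - z) \<and> Im z > 0"
proof -
  obtain u s where u: "0 \<le> u" "u \<le> 1" and s: "s = 1 \<or> s = -1" and zz: "Re z = s * (3 * (1 - u))" "Im z = y + 3 * u"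
  proof -
    from z consider "z \<in> closed_segment (Complex 3 y) (Complex 0 (3 + y))" | "z \<in> closed_segment (Complex 0 (3 + y)) (Complex (-3) y)" by blast
    then show ?thesis
    proof cases
      case 1
      then obtain u where "0 \<le> u" "u \<le> 1" "z = (1 - u) *\<^sub>R Complex 3 y + u *\<^sub>R Complex 0 (3 + y)"
        by (auto simp: closed_segment_def)
      then have "0 \<le> u" "u \<le> 1" "Re z = (1 - u) * 3" "Im z = (1 - u) * y + u * (3 + y)"
        by simp_all
      then show ?thesis by (intro that[of u 1]) (auto simp: algebra_simps)
    next
      case 2
      then obtain u where "0 \<le> u" "u \<le> 1" "z = (1 - u) *\<^sub>R Complex 0 (3 + y) + u *\<^sub>R Complex (-3) y"
        by (auto simp: closed_segment_def)
      then have "0 \<le> u" "u \<le> 1" "Re z = u * (-3)" "Im z = (1 - u) * (3 + y) + u * y"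
        by simp_all
      then show ?thesis by (intro that[of "1 - u" "-1"]) (auto simp: algebra_simps)
    qed
  qed
  have "1 \<le> cmod (complex_of_real x - z)"
  proof (cases "u \<le> 1/3")
    case True
    then have "2 \<le> \<bar>Re z\<bar>" using s zz by (auto simp: abs_mult)
    then have "1 \<le> \<bar>x - Re z\<bar>" using x by auto
    then show ?thesis using abs_Re_le_cmod[of "complex_of_real x - z"] by simp
  next
    case False
    then have "1 \<le> \<bar>Im z\<bar>" using zz y by auto
    then show ?thesis using Im_diff_le[of z x] by simp
  qed
  then show ?thesis using zz y u by auto
qed

text \<open>
  The integral of \<open>G = exp (s F)\<close> around the triangle vanishes. On the two upper sides \<open>\<bar>F\<bar> \<le> 1\<close>, so
  \<open>\<bar>G\<bar> \<le> 3\<close>; their lengths are at most 5, so the integral along the base is at most 30. On the base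
  \<open>Re G\<close> is at least half of \<open>\<bar>G\<bar> = exp (s Re F)\<close>, in particular positive, which allows the restriction
  to \<open>(-1, 1)\<close>.
\<close>
lemma exp_cauchy_integral_bound:
  assumes y: "y > 0" and s: "s = 1 \<or> s = (-1::real)"
  shows "(\<integral>\<^sup>+t. ennreal (exp (s * Re (cauchy_integral h (Complex t y)))) \<partial>mu) \<le> ennreal 60"
proof -
  let ?F = "cauchy_integral h"
  define G where "G z = exp (complex_of_real s * ?F z)" for z
  have GH: "G holomorphic_on {z. Im z > 0}"
    unfolding G_def by (intro holomorphic_intros cauchy_integral_holomorphic)
  let ?a = "Complex (-3) y" and ?b = "Complex 3 y" and ?c = "Complex 0 (3 + y)"
  have hull: "convex hull {?a, ?b, ?c} \<subseteq> {z. Im z > 0}"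
    by (rule hull_minimal) (use y convex_halfspace_Im_gt[of 0] in auto)
  have GT: "G holomorphic_on convex hull {?a, ?b, ?c}"
    by (rule holomorphic_on_subset[OF GH hull])
  have seg: "closed_segment p q \<subseteq> {z. Im z > 0}" if "Im p > 0" "Im q > 0" for p q
    by (rule closed_segment_subset) (use that convex_halfspace_Im_gt[of 0] in auto)
  have cint: "G contour_integrable_on linepath p q" if "Im p > 0" "Im q > 0" for p q
    by (intro contour_integrable_continuous_linepath holomorphic_on_imp_continuous_on
        holomorphic_on_subset[OF GH] seg that)
  have "(G has_contour_integral 0) (linepath ?a ?b +++ linepath ?b ?c +++ linepath ?c ?a)"
    by (rule Cauchy_theorem_triangle[OF GT])
  then have "0 = contour_integral (linepath ?a ?b +++ linepath ?b ?c +++ linepath ?c ?a) G"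
    by (simp add: contour_integral_unique)
  also have "\<dots> = contour_integral (linepath ?a ?b) G + (contour_integral (linepath ?b ?c) G + contour_integral (linepath ?c ?a) G)"
    using y by (simp add: contour_integral_join cint contour_integrable_joinI)
  finally have eq: "contour_integral (linepath ?a ?b) G = - (contour_integral (linepath ?b ?c) G + contour_integral (linepath ?c ?a) G)"
    by (simp only: eq_neg_iff_add_eq_0 eq_commute[of "_ + _"])
  have G3: "cmod (G z) \<le> 3" if z: "z \<in> closed_segment ?b ?c \<or> z \<in> closed_segment ?c ?a" for z
  proof -
    have F1: "cmod (?F z) \<le> 1"
      by (rule cauchy_integral_bound) (use segment_far[OF y _ z] segment_far[OF y _ z, of 0] in auto)
    have "cmod (G z) = exp (s * Re (?F z))" by (simp add: G_def)
    also have "s * Re (?F z) \<le> 1" using F1 abs_Re_le_cmod[of "?F z"] s by auto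
    then have "exp (s * Re (?F z)) \<le> exp 1" by simp
    also have "\<dots> \<le> 3" by (rule exp_le)
    finally show ?thesis .
  qed
  have len: "cmod (?c - ?b) \<le> 5" "cmod (?a - ?c) \<le> 5"
    by (auto simp: cmod_def intro!: real_le_lsqrt)
  have "cmod (contour_integral (linepath ?b ?c) G) \<le> 3 * cmod (?c - ?b)"
    using y G3 by (intro contour_integral_bound_linepath cint) auto
  then have c1: "cmod (contour_integral (linepath ?b ?c) G) \<le> 15" using len by linarith
  have "cmod (contour_integral (linepath ?c ?a) G) \<le> 3 * cmod (?a - ?c)"
    using y G3 by (intro contour_integral_bound_linepath cint) auto
  then have c2: "cmod (contour_integral (linepath ?c ?a) G) \<le> 15" using len by linarith
  have "cmod (contour_integral (linepath ?a ?b) G) \<le> 30"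
    unfolding eq norm_minus_cancel by (rule order_trans[OF norm_triangle_ineq]) (use c1 c2 in linarith)
  moreover have "contour_integral (linepath ?a ?b) G = integral {-3..3} (\<lambda>x. G (Complex x y))"
  proof -
    have a: "?a = -3 + Complex 0 y" "?b = 3 + Complex 0 y" by (simp_all add: complex_eq_iff)
    have "linepath ?a ?b u = linepath (-3) 3 u + Complex 0 y" for u
      unfolding a linepath_def by (simp add: algebra_simps)
    then have "contour_integral (linepath ?a ?b) G = contour_integral (linepath (-3) 3) (\<lambda>w. G (w + Complex 0 y))"
      unfolding contour_integral_integral
      by (intro Henstock_Kurzweil_Integration.integral_cong) (simp add: vector_derivative_linepath_within a)
    also have "\<dots> = integral {-3..3} (\<lambda>x. G (complex_of_real x + Complex 0 y))"
      by (subst contour_integral_linepath_Reals_eq) auto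
    also have "(\<lambda>x. G (complex_of_real x + Complex 0 y)) = (\<lambda>x. G (Complex x y))"
      by (intro ext arg_cong[where f = G]) (simp add: complex_eq_iff)
    finally show ?thesis .
  qed
  ultimately have I30: "cmod (integral {-3..3} (\<lambda>x. G (Complex x y))) \<le> 30" by simp
  have cont: "continuous_on A (\<lambda>x. G (Complex x y))" for A
  proof (rule continuous_on_compose2[OF holomorphic_on_imp_continuous_on[OF GH]])
    show "continuous_on A (\<lambda>x. Complex x y)" by (intro continuous_intros)
  qed (use y in auto)
  have iG: "(\<lambda>x. G (Complex x y)) integrable_on {-3..3}"
    by (intro integrable_continuous_real cont)
  have ReG: "Re (G (Complex x y)) \<ge> exp (s * Re (?F (Complex x y))) / 2" for x
  proof -
    let ?w = "s * Im (?F (Complex x y))"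
    have "\<bar>?w\<bar> \<le> 1" using Re_cauchy_integral(2)[OF y, of x] s by auto
    then have "cos (pi / 3) \<le> cos \<bar>?w\<bar>"
      using pi_gt3 by (intro cos_monotone_0_pi_le) auto
    then have "1 / 2 \<le> cos ?w" by (simp add: cos_60)
    then have "exp (s * Re (?F (Complex x y))) * (1 / 2) \<le> exp (s * Re (?F (Complex x y))) * cos ?w"
      by (intro mult_left_mono) auto
    then show ?thesis by (simp add: G_def Re_exp)
  qed
  then have Re0: "0 \<le> Re (G (Complex x y))" for x
    by (rule order_trans[rotated]) simp
  have "integral {-1..1} (\<lambda>x. Re (G (Complex x y))) \<le> integral {-3..3} (\<lambda>x. Re (G (Complex x y)))"
    using Re0 by (intro integral_subset_le integrable_continuous_real continuous_on_Re cont) auto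
  also have "\<dots> = Re (integral {-3..3} (\<lambda>x. G (Complex x y)))"
    by (rule integral_linear[OF iG bounded_linear_Re, unfolded o_def])
  also have "\<dots> \<le> 30" using I30 complex_Re_le_cmod order_trans by blast
  finally have b30: "integral {-1..1} (\<lambda>x. Re (G (Complex x y))) \<le> 30" .
  have "(\<integral>\<^sup>+t. ennreal (exp (s * Re (?F (Complex t y)))) \<partial>mu) \<le> (\<integral>\<^sup>+t. ennreal (2 * Re (G (Complex t y))) \<partial>mu)"
    using ReG by (intro nn_integral_mono ennreal_leI) (simp add: field_simps)
  also have "\<dots> \<le> (\<integral>\<^sup>+t. ennreal (2 * Re (G (Complex t y))) * indicator {-1..1} t \<partial>lborel)"
    unfolding nn_integral_mu by (intro nn_integral_mono) (auto simp: indicator_def)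
  also have "\<dots> = ennreal (integral {-1..1} (\<lambda>x. 2 * Re (G (Complex x y))))"
  proof (rule nn_integral_has_integral_lebesgue'[rotated, rotated])
    show "((\<lambda>x. 2 * Re (G (Complex x y))) has_integral integral {-1..1} (\<lambda>x. 2 * Re (G (Complex x y)))) {-1..1}"
      by (intro integrable_integral integrable_continuous_real continuous_intros cont)
    show "0 \<le> 2 * Re (G (Complex x y))" for x using Re0 by simp
  qed
  also have "\<dots> \<le> ennreal 60"
    using b30 by (intro ennreal_leI) simp
  finally show ?thesis .
qed

end

lemma conj_poisson_real:
  "conj_poisson y (\<lambda>x. complex_of_real (h x)) t = complex_of_real (LINT x|mu. h x * conj_kernel y (x - t))"
  unfolding conj_poisson_def by (simp flip: of_real_mult)

lemma power_le_fact_exp: "0 \<le> (x::real) \<Longrightarrow> x ^ m \<le> fact m * exp x"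
proof -
  assume x: "0 \<le> x"
  have "x ^ m /\<^sub>R fact m \<le> (\<Sum>n. x ^ n /\<^sub>R fact n)"
    using sum_le_suminf[of "\<lambda>n. x ^ n /\<^sub>R fact n" "{m}"] summable_exp_generic[of x] x by simp
  then show ?thesis by (simp add: exp_def field_simps)
qed

lemma conj_poisson_moment_real:
  fixes h :: "real \<Rightarrow> real"
  assumes hm: "h \<in> borel_measurable mu" and h1: "\<And>x. x \<in> {-1<..<1} \<Longrightarrow> \<bar>h x\<bar> \<le> 1" and y: "y > 0"
  shows "(\<integral>\<^sup>+t. ennreal (cmod (conj_poisson y (\<lambda>x. complex_of_real (h x)) t) ^ m) \<partial>mu) \<le> ennreal (fact m * 120)"
proof -
  define R where "R t = Re (cauchy_integral h (Complex t y))" for t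
  have eq: "conj_poisson y (\<lambda>x. complex_of_real (h x)) t = complex_of_real (R t)" for t
    using Re_cauchy_integral(1)[OF hm h1 y, of t] by (simp add: R_def)
  have [measurable]: "R \<in> borel_measurable mu"
  proof -
    have "(\<lambda>t. Re (conj_poisson y (\<lambda>x. complex_of_real (h x)) t)) \<in> borel_measurable mu"
      using hm by measurable
    then show ?thesis by (simp add: eq)
  qed
  have "(\<integral>\<^sup>+t. ennreal (cmod (conj_poisson y (\<lambda>x. complex_of_real (h x)) t) ^ m) \<partial>mu)
      \<le> (\<integral>\<^sup>+t. ennreal (fact m) * (ennreal (exp (1 * R t)) + ennreal (exp ((-1) * R t))) \<partial>mu)"
  proof (intro nn_integral_mono)
    fix t
    have "\<bar>R t\<bar> ^ m \<le> fact m * exp \<bar>R t\<bar>" by (rule power_le_fact_exp) simp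
    also have "\<dots> \<le> fact m * (exp (1 * R t) + exp ((-1) * R t))"
      by (intro mult_left_mono) (auto simp: abs_if)
    finally show "ennreal (cmod (conj_poisson y (\<lambda>x. complex_of_real (h x)) t) ^ m) \<le>
       ennreal (fact m) * (ennreal (exp (1 * R t)) + ennreal (exp ((-1) * R t)))"
      by (simp add: eq flip: ennreal_plus ennreal_mult)
  qed
  also have "\<dots> = ennreal (fact m) * ((\<integral>\<^sup>+t. ennreal (exp (1 * R t)) \<partial>mu) + (\<integral>\<^sup>+t. ennreal (exp ((-1) * R t)) \<partial>mu))"
    by (subst nn_integral_cmult) (auto simp: nn_integral_add)
  also have "\<dots> \<le> ennreal (fact m) * (ennreal 60 + ennreal 60)"
    unfolding R_def
    by (intro mult_left_mono add_mono exp_cauchy_integral_bound hm h1 y) auto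
  also have "\<dots> = ennreal (fact m * 120)"
    by (simp add: ennreal_mult flip: ennreal_plus)
  finally show ?thesis .
qed

lemma add_power_le: "0 \<le> (a::real) \<Longrightarrow> 0 \<le> b \<Longrightarrow> (a + b) ^ m \<le> 2 ^ m * (a ^ m + b ^ m)"
proof -
  assume ab: "0 \<le> a" "0 \<le> b"
  have "(a + b) ^ m \<le> (2 * max a b) ^ m" using ab by (intro power_mono) auto
  also have "\<dots> = 2 ^ m * max a b ^ m" by (simp add: power_mult_distrib)
  also have "max a b ^ m \<le> a ^ m + b ^ m" using ab by (simp add: max_def)
  finally show ?thesis by simp
qed

definition moment_const :: "nat \<Rightarrow> real"
  where "moment_const m = 2 ^ m * (fact m * 240)"

text \<open>
  The bound does not depend on \<open>y\<close>, so it survives the limit \<open>y \<rightarrow> 0\<close>.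
\<close>
theorem conj_poisson_moment:
  assumes hm: "h \<in> borel_measurable mu" and h1: "\<And>x. x \<in> {-1<..<1} \<Longrightarrow> cmod (h x) \<le> 1" and y: "y > 0"
  shows "(\<integral>\<^sup>+t. ennreal (cmod (conj_poisson y h t) ^ m) \<partial>mu) \<le> ennreal (moment_const m)"
proof -
  let ?R = "\<lambda>x. complex_of_real (Re (h x))" and ?I = "\<lambda>x. complex_of_real (Im (h x))"
  note hm[measurable]
  have R1: "\<bar>Re (h x)\<bar> \<le> 1" "\<bar>Im (h x)\<bar> \<le> 1" if "x \<in> {-1<..<1}" for x
    using h1[OF that] abs_Re_le_cmod[of "h x"] abs_Im_le_cmod[of "h x"] by linarith+
  have iR: "integrable mu ?R" and iI: "integrable mu ?I"
    by (rule integrable_mu_bounded[where B = 1]; use R1 in simp; fail)+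
  have "h = (\<lambda>x. ?R x + \<i> * ?I x)" by (simp add: fun_eq_iff complex_eq)
  then have "conj_poisson y h t = conj_poisson y (\<lambda>x. ?R x + \<i> * ?I x) t" for t by simp
  then have eq: "conj_poisson y h t = conj_poisson y ?R t + \<i> * conj_poisson y ?I t" for t
    using iR iI y by (simp add: conj_poisson_add conj_poisson_scale)
  have "(\<integral>\<^sup>+t. ennreal (cmod (conj_poisson y h t) ^ m) \<partial>mu) \<le>
     (\<integral>\<^sup>+t. ennreal (2 ^ m) * (ennreal (cmod (conj_poisson y ?R t) ^ m) + ennreal (cmod (conj_poisson y ?I t) ^ m)) \<partial>mu)"
  proof (intro nn_integral_mono)
    fix t
    have "cmod (conj_poisson y h t) ^ m \<le> (cmod (conj_poisson y ?R t) + cmod (conj_poisson y ?I t)) ^ m"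
      unfolding eq using norm_triangle_ineq[of "conj_poisson y ?R t" "\<i> * conj_poisson y ?I t"]
      by (intro power_mono) (auto simp: norm_mult)
    also have "\<dots> \<le> 2 ^ m * (cmod (conj_poisson y ?R t) ^ m + cmod (conj_poisson y ?I t) ^ m)"
      by (intro add_power_le) auto
    finally show "ennreal (cmod (conj_poisson y h t) ^ m) \<le> ennreal (2 ^ m) * (ennreal (cmod (conj_poisson y ?R t) ^ m) + ennreal (cmod (conj_poisson y ?I t) ^ m))"
      by (simp flip: ennreal_plus ennreal_mult)
  qed
  also have "\<dots> = ennreal (2 ^ m) * ((\<integral>\<^sup>+t. ennreal (cmod (conj_poisson y ?R t) ^ m) \<partial>mu) + (\<integral>\<^sup>+t. ennreal (cmod (conj_poisson y ?I t) ^ m) \<partial>mu))"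
    by (subst nn_integral_cmult) (auto simp: nn_integral_add)
  also have "\<dots> \<le> ennreal (2 ^ m) * (ennreal (fact m * 120) + ennreal (fact m * 120))"
    using R1 y by (intro mult_left_mono add_mono conj_poisson_moment_real) auto
  also have "\<dots> = ennreal (moment_const m)"
    by (simp add: moment_const_def flip: ennreal_plus ennreal_mult)
  finally show ?thesis .
qed

section \<open>Convergence in mean of the conjugate Poisson transforms\<close>

text \<open>
  The space \<open>L\<^sup>q\<close> for \<open>q = 1 + 1/p\<close>, the exponent conjugate to \<open>p + 1\<close>. It is parametrised by the natural
  number \<open>p\<close> because \<open>g\<close> belongs to it as soon as \<open>g\<close> can be integrated against \<open>\<bar>g\<bar>\<close> to the power \<open>1/p\<close>,
  a function in \<open>L\<^sup>p\<close>.
\<close>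
definition lq_fun :: "nat \<Rightarrow> (real \<Rightarrow> complex) \<Rightarrow> bool"
  where "lq_fun p g \<longleftrightarrow> g \<in> borel_measurable mu \<and> integrable mu (\<lambda>x. cmod (g x) powr (1 + 1 / real p))"

lemma lq_fun_bounded:
  assumes "g \<in> borel_measurable mu" "\<exists>B. \<forall>x\<in>{-1<..<1}. cmod (g x) \<le> B"
  shows "lq_fun p g"
proof -
  obtain B where B: "\<And>x. x \<in> {-1<..<1} \<Longrightarrow> cmod (g x) \<le> B" using assms(2) by blast
  have "integrable mu (\<lambda>x. cmod (g x) powr (1 + 1 / real p))"
    by (rule integrable_mu_bounded[where B = "B powr (1 + 1 / real p)"])
       (use B assms(1) in \<open>auto intro!: powr_mono2\<close>)
  with assms(1) show ?thesis by (simp add: lq_fun_def)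
qed

lemma lq_fun_integrable:
  assumes "lq_fun p g" shows "integrable mu g"
proof (rule Bochner_Integration.integrable_bound)
  show "integrable mu (\<lambda>x. 1 + cmod (g x) powr (1 + 1 / real p))"
    using assms by (simp add: lq_fun_def)
  show "g \<in> borel_measurable mu" using assms by (simp add: lq_fun_def)
  show "AE x in mu. cmod (g x) \<le> norm (1 + cmod (g x) powr (1 + 1 / real p))"
  proof (rule AE_I2)
    fix x
    have "cmod (g x) \<le> 1 + cmod (g x) powr (1 + 1 / real p)"
    proof (cases "cmod (g x) \<le> 1")
      case False
      then have "cmod (g x) powr 1 \<le> cmod (g x) powr (1 + 1 / real p)"
        by (intro powr_mono) auto
      with False show ?thesis by simp
    qed (use powr_ge_zero[of "cmod (g x)" "1 + 1 / real p"] in linarith)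
    also have "\<dots> \<le> norm (1 + cmod (g x) powr (1 + 1 / real p))" by simp
    finally show "cmod (g x) \<le> norm (1 + cmod (g x) powr (1 + 1 / real p))" .
  qed
qed

text \<open>
  Without sharp constants Young's inequality is elementary: if \<open>b\<^sup>p \<le> a\<close> the first term is the larger one,
  otherwise the second.
\<close>
lemma young_ineq:
  assumes "0 \<le> (a::real)" "0 \<le> b" "0 < p"
  shows "a * b \<le> a powr (1 + 1 / real p) + b ^ (p + 1)"
proof (cases "b \<le> a powr (1 / real p)")
  case True
  then have "a * b \<le> a * a powr (1 / real p)" using assms by (intro mult_left_mono) auto
  also have "\<dots> = a powr (1 + 1 / real p)" using assms by (auto simp: powr_add)
  finally show ?thesis using assms by (simp add: add_increasing2)
next
  case False
  have "a = (a powr (1 / real p)) ^ p"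
    using assms by (cases "a = 0") (auto simp: powr_power)
  also have "\<dots> \<le> b ^ p" using False by (intro power_mono) auto
  finally have "a * b \<le> b ^ p * b" using assms by (intro mult_right_mono) auto
  then show ?thesis by (simp add: mult.commute add_increasing)
qed

text \<open>
  A small \<open>c\<close> makes the second term small when only a bound on \<open>b\<close> is known; the price is a large factor
  in front of the first term, in which \<open>a\<close> can then be chosen small.
\<close>
lemma young_ineq_scaled:
  assumes "0 \<le> (a::real)" "0 \<le> b" "0 < p" "0 < c"
  shows "a * b \<le> (1 / c) powr (1 + 1 / real p) * a powr (1 + 1 / real p) + c ^ (p + 1) * b ^ (p + 1)"
proof -
  have "a * b = ((1 / c) * a) * (c * b)" using assms by simp
  also have "\<dots> \<le> ((1 / c) * a) powr (1 + 1 / real p) + (c * b) ^ (p + 1)"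
    using assms by (intro young_ineq) auto
  also have "\<dots> = (1 / c) powr (1 + 1 / real p) * a powr (1 + 1 / real p) + c ^ (p + 1) * b ^ (p + 1)"
    using assms by (simp add: powr_mult power_mult_distrib powr_divide)
  finally show ?thesis .
qed

lemma young_integral:
  assumes g: "lq_fun p g" and v[measurable]: "v \<in> borel_measurable mu"
    and vK: "(\<integral>\<^sup>+x. ennreal (cmod (v x) ^ (p + 1)) \<partial>mu) \<le> ennreal K" and p: "0 < p" and K: "0 \<le> K"
  shows "integrable mu (\<lambda>x. g x * v x)"
    and "0 < c \<Longrightarrow> (LINT x|mu. cmod (g x * v x)) \<le>
      (1 / c) powr (1 + 1 / real p) * (LINT x|mu. cmod (g x) powr (1 + 1 / real p)) + c ^ (p + 1) * K"
proof -
  note gm[measurable] = g[unfolded lq_fun_def, THEN conjunct1]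
  note gi = g[unfolded lq_fun_def, THEN conjunct2]
  have vi: "integrable mu (\<lambda>x. cmod (v x) ^ (p + 1))"
    by (rule integrableI_bounded) (use vK in \<open>auto simp: norm_power intro: le_less_trans\<close>)
  have vl: "(LINT x|mu. cmod (v x) ^ (p + 1)) \<le> K"
    using vK K by (subst (asm) nn_integral_eq_integral[OF vi]) auto
  have gv: "cmod (g x * v x) \<le> (1 / c) powr (1 + 1 / real p) * cmod (g x) powr (1 + 1 / real p) + c ^ (p + 1) * cmod (v x) ^ (p + 1)"
    if "0 < c" for c x
    unfolding norm_mult using p that by (intro young_ineq_scaled) auto
  show i: "integrable mu (\<lambda>x. g x * v x)"
  proof (rule Bochner_Integration.integrable_bound)
    show "integrable mu (\<lambda>x. (1 / 1) powr (1 + 1 / real p) * cmod (g x) powr (1 + 1 / real p) + 1 ^ (p + 1) * cmod (v x) ^ (p + 1))"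
      using gi vi by auto
    show "AE x in mu. cmod (g x * v x) \<le> norm ((1 / 1) powr (1 + 1 / real p) * cmod (g x) powr (1 + 1 / real p) + 1 ^ (p + 1) * cmod (v x) ^ (p + 1))"
      by (rule AE_I2, rule order_trans[OF gv[of 1]]) auto
  qed measurable
  assume c: "0 < c"
  have "(LINT x|mu. cmod (g x * v x)) \<le> (LINT x|mu. (1 / c) powr (1 + 1 / real p) * cmod (g x) powr (1 + 1 / real p) + c ^ (p + 1) * cmod (v x) ^ (p + 1))"
    using gv[OF c] gi vi i by (intro integral_mono) auto
  also have "\<dots> = (1 / c) powr (1 + 1 / real p) * (LINT x|mu. cmod (g x) powr (1 + 1 / real p)) + c ^ (p + 1) * (LINT x|mu. cmod (v x) ^ (p + 1))"
    using gi vi by simp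
  also have "\<dots> \<le> (1 / c) powr (1 + 1 / real p) * (LINT x|mu. cmod (g x) powr (1 + 1 / real p)) + c ^ (p + 1) * K"
    using vl c by (intro add_left_mono mult_left_mono) auto
  finally show "(LINT x|mu. cmod (g x * v x)) \<le> (1 / c) powr (1 + 1 / real p) * (LINT x|mu. cmod (g x) powr (1 + 1 / real p)) + c ^ (p + 1) * K" .
qed

lemma moment_const_nonneg: "0 \<le> moment_const m"
  by (simp add: moment_const_def)

lemma unimodular_multiplier:
  fixes f :: "real \<Rightarrow> complex"
  assumes [measurable]: "f \<in> borel_measurable M"
  obtains h where "h \<in> borel_measurable M" "\<And>x. cmod (h x) \<le> 1" "\<And>x. f x * h x = complex_of_real (cmod (f x))"
proof
  have [measurable]: "cnj \<in> borel_measurable borel"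
    by (intro borel_measurable_continuous_onI continuous_intros)
  \<comment> \<open>Where \<open>f\<close> vanishes, the quotient is 0 by the convention on division by zero.\<close>
  show "(\<lambda>x. cnj (f x) / complex_of_real (cmod (f x))) \<in> borel_measurable M" by measurable
  show "cmod (cnj (f x) / complex_of_real (cmod (f x))) \<le> 1" for x by (simp add: norm_divide)
  show "f x * (cnj (f x) / complex_of_real (cmod (f x))) = complex_of_real (cmod (f x))" for x
    by (cases "f x = 0") (simp_all add: complex_norm_square[symmetric] power2_eq_square)
qed

text \<open>
  The integral of \<open>\<bar>conj_poisson y g\<bar>\<close> is tested with a unimodular function \<open>h\<close>; duality moves the kernel
  to \<open>h\<close>, whose regularised transforms have uniformly bounded moments.
\<close>
lemma conj_poisson_L1:
  assumes g: "lq_fun p g" and p: "0 < p" and y: "0 < y" and c: "0 < c"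
  shows "(LINT x|mu. cmod (conj_poisson y g x)) \<le>
      (1 / c) powr (1 + 1 / real p) * (LINT x|mu. cmod (g x) powr (1 + 1 / real p)) + c ^ (p + 1) * moment_const (p + 1)"
proof -
  have gi: "integrable mu g" by (rule lq_fun_integrable[OF g])
  have m: "conj_poisson y g \<in> borel_measurable mu" using gi by (intro conj_poisson_measurable) auto
  obtain h where h: "h \<in> borel_measurable mu" "\<And>x. cmod (h x) \<le> 1" "\<And>x. conj_poisson y g x * h x = complex_of_real (cmod (conj_poisson y g x))"
    by (rule unimodular_multiplier[OF m]) blast
  have hi: "integrable mu h" by (rule integrable_mu_bounded[OF h(1)]) (use h(2) in auto)
  have "complex_of_real (LINT x|mu. cmod (conj_poisson y g x)) = (LINT x|mu. conj_poisson y g x * h x)"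
    unfolding h(3) by simp
  also have "\<dots> = - (LINT x|mu. g x * conj_poisson y h x)"
    by (rule conj_poisson_duality[OF gi hi y])
  finally have "cmod (complex_of_real (LINT x|mu. cmod (conj_poisson y g x))) = cmod (LINT x|mu. g x * conj_poisson y h x)"
    by simp
  then have "(LINT x|mu. cmod (conj_poisson y g x)) \<le> cmod (LINT x|mu. g x * conj_poisson y h x)"
    by simp
  also have "\<dots> \<le> (LINT x|mu. cmod (g x * conj_poisson y h x))"
    by (rule integral_norm_bound)
  also have "\<dots> \<le> (1 / c) powr (1 + 1 / real p) * (LINT x|mu. cmod (g x) powr (1 + 1 / real p)) + c ^ (p + 1) * moment_const (p + 1)"
    using h by (intro young_integral(2)[OF g _ _ p _ c] conj_poisson_measurable conj_poisson_moment moment_const_nonneg y)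
  finally show ?thesis .
qed

text \<open>
  Convergence in mean as \<open>y \<rightarrow> 0\<close>, as a Cauchy condition: in this form it is stable under the limits of
  \<open>interval_dense_induct\<close> while no limit is known yet.
\<close>
definition mean_cauchy :: "(real \<Rightarrow> complex) \<Rightarrow> bool"
  where "mean_cauchy g \<longleftrightarrow> integrable mu g \<and> (\<forall>e>0. \<exists>d>0. \<forall>y z. 0 < y \<longrightarrow> y < d \<longrightarrow> 0 < z \<longrightarrow> z < d \<longrightarrow>
      (LINT x|mu. cmod (conj_poisson y g x - conj_poisson z g x)) \<le> e)"

lemma log_kernel_integral:
  assumes "y > 0"
  shows "(LINT t|mu. ln ((t - a)\<^sup>2 + y\<^sup>2)) =
    ((1 - a) * ln ((1 - a)\<^sup>2 + y\<^sup>2) + 2 * y * arctan ((1 - a) / y)) -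
    ((-1 - a) * ln ((-1 - a)\<^sup>2 + y\<^sup>2) + 2 * y * arctan ((-1 - a) / y)) - 4"
    and "integrable mu (\<lambda>t. ln ((t - a)\<^sup>2 + y\<^sup>2))"
proof -
  have p: "(x - a)\<^sup>2 + y\<^sup>2 > 0" for x using assms by (simp add: add_nonneg_pos)
  let ?F = "\<lambda>t. (t - a) * ln ((t - a)\<^sup>2 + y\<^sup>2) + 2 * y * arctan ((t - a) / y) - 2 * t"
  have c: "continuous_on A (\<lambda>t. ln ((t - a)\<^sup>2 + y\<^sup>2))" for A
    using assms by (intro continuous_intros) auto
  have "(LINT t|mu. ln ((t - a)\<^sup>2 + y\<^sup>2)) = (LINT t:{-1<..<1}|mu. ln ((t - a)\<^sup>2 + y\<^sup>2))"
    by (rule set_integral_mu_space[symmetric])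
  also have "\<dots> = ?F 1 - ?F (-1)"
  proof (rule mu_FTC[OF _ _ _ c])
    fix x :: real
    have e: "inverse (1 + ((x - a) / y)\<^sup>2) * (1 / y) = y / ((x - a)\<^sup>2 + y\<^sup>2)"
    proof -
      have "1 + ((x - a) / y)\<^sup>2 = ((x - a)\<^sup>2 + y\<^sup>2) / y\<^sup>2"
        using assms by (simp add: field_simps)
      then show ?thesis using assms by (simp add: power2_eq_square)
    qed
    have "(?F has_real_derivative (1 * ln ((x - a)\<^sup>2 + y\<^sup>2) + (2 * (x - a) / ((x - a)\<^sup>2 + y\<^sup>2)) * (x - a)) + 2 * y * (inverse (1 + ((x - a) / y)\<^sup>2) * (1 / y)) - 2) (at x within {-1..1})"
      using p[of x] assms by (auto intro!: derivative_eq_intros simp: divide_simps)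
    also have "(1 * ln ((x - a)\<^sup>2 + y\<^sup>2) + (2 * (x - a) / ((x - a)\<^sup>2 + y\<^sup>2)) * (x - a)) + 2 * y * (inverse (1 + ((x - a) / y)\<^sup>2) * (1 / y)) - 2
      = ln ((x - a)\<^sup>2 + y\<^sup>2) + (2 * ((x - a)\<^sup>2 + y\<^sup>2) / ((x - a)\<^sup>2 + y\<^sup>2)) - 2"
    proof -
      have "(2 * u / D) * u + 2 * y * (y / D) = 2 * (u\<^sup>2 + y\<^sup>2) / D" for u D :: real
        by (simp add: add_divide_distrib power2_eq_square distrib_left)
      from this[of "x - a" "(x - a)\<^sup>2 + y\<^sup>2"] show ?thesis unfolding e by simp
    qed
    also have "2 * ((x - a)\<^sup>2 + y\<^sup>2) / ((x - a)\<^sup>2 + y\<^sup>2) = 2"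
      by (rule nonzero_mult_div_cancel_right) (metis p less_irrefl)
    also have "ln ((x - a)\<^sup>2 + y\<^sup>2) + 2 - 2 = ln ((x - a)\<^sup>2 + y\<^sup>2)" by simp
    finally show "(?F has_vector_derivative ln ((x - a)\<^sup>2 + y\<^sup>2)) (at x within {-1..1})"
      by (simp add: has_real_derivative_iff_has_vector_derivative)
  qed auto
  finally show "(LINT t|mu. ln ((t - a)\<^sup>2 + y\<^sup>2)) =
    ((1 - a) * ln ((1 - a)\<^sup>2 + y\<^sup>2) + 2 * y * arctan ((1 - a) / y)) -
    ((-1 - a) * ln ((-1 - a)\<^sup>2 + y\<^sup>2) + 2 * y * arctan ((-1 - a) / y)) - 4" by simp
  have "compact ((\<lambda>t. ln ((t - a)\<^sup>2 + y\<^sup>2)) ` {-1..1})"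
    by (intro compact_continuous_image c) auto
  then have "bounded ((\<lambda>t. ln ((t - a)\<^sup>2 + y\<^sup>2)) ` {-1..1})" by (rule compact_imp_bounded)
  then obtain B where "\<forall>v\<in>(\<lambda>t. ln ((t - a)\<^sup>2 + y\<^sup>2)) ` {-1..1}. norm v \<le> B"
    unfolding bounded_iff by blast
  then have B: "\<And>t. t \<in> {-1..1} \<Longrightarrow> norm (ln ((t - a)\<^sup>2 + y\<^sup>2)) \<le> B" by blast
  show "integrable mu (\<lambda>t. ln ((t - a)\<^sup>2 + y\<^sup>2))"
    proof (rule integrable_mu_bounded[where B = B])
    show "(\<lambda>t. ln ((t - a)\<^sup>2 + y\<^sup>2)) \<in> borel_measurable mu"
      by (rule borel_measurable_mu) measurable
    show "norm (ln ((t - a)\<^sup>2 + y\<^sup>2)) \<le> B" if "t \<in> {-1<..<1}" for t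
      using that by (intro B) simp
  qed
qed

text \<open>
  The logarithms are monotone in \<open>y\<close>. So their distance in mean is the difference of their integrals,
  which converge by the explicit formula.
\<close>
lemma log_kernel_cauchy:
  assumes e: "e > 0"
  shows "\<exists>d>0. \<forall>y z. 0 < y \<longrightarrow> y < d \<longrightarrow> 0 < z \<longrightarrow> z < d \<longrightarrow>
     (LINT t|mu. \<bar>ln ((t - a)\<^sup>2 + y\<^sup>2) - ln ((t - a)\<^sup>2 + z\<^sup>2)\<bar>) \<le> e"
proof -
  define I where "I y = (LINT t|mu. ln ((t - a)\<^sup>2 + y\<^sup>2))" for y
  have lim: "\<exists>l. ((\<lambda>y. s * ln (s\<^sup>2 + y\<^sup>2) + 2 * y * arctan (s / y)) \<longlongrightarrow> l) (at_right 0)" for s :: real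
  proof -
    have "((\<lambda>y. 2 * y * arctan (s / y)) \<longlongrightarrow> 0) (at_right 0)"
    proof (rule Lim_null_comparison)
      show "\<forall>\<^sub>F y in at_right 0. norm (2 * y * arctan (s / y)) \<le> 2 * \<bar>y\<bar> * (pi / 2)"
      proof (rule always_eventually, rule allI)
        fix y :: real
        have "\<bar>arctan (s / y)\<bar> \<le> pi / 2" using arctan_bounded[of "s / y"] by auto
        then show "norm (2 * y * arctan (s / y)) \<le> 2 * \<bar>y\<bar> * (pi / 2)"
          unfolding real_norm_def abs_mult by (intro mult_mono) auto
      qed
      have "((\<lambda>y. 2 * \<bar>y\<bar> * (pi / 2)) \<longlongrightarrow> 2 * \<bar>0\<bar> * (pi / 2)) (at_right (0::real))"
        by (intro tendsto_intros)
      then show "((\<lambda>y. 2 * \<bar>y\<bar> * (pi / 2)) \<longlongrightarrow> 0) (at_right (0::real))" by simp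
    qed
    moreover have "\<exists>l. ((\<lambda>y. s * ln (s\<^sup>2 + y\<^sup>2)) \<longlongrightarrow> l) (at_right 0)"
    proof (cases "s = 0")
      case False
      have "((\<lambda>y. s * ln (s\<^sup>2 + y\<^sup>2)) \<longlongrightarrow> s * ln (s\<^sup>2 + 0\<^sup>2)) (at_right 0)"
        using False by (intro tendsto_intros) auto
      then show ?thesis by blast
    qed (auto intro: exI[of _ 0])
    ultimately show ?thesis using tendsto_add by blast
  qed
  obtain l1 l2 where l: "((\<lambda>y. (1 - a) * ln ((1 - a)\<^sup>2 + y\<^sup>2) + 2 * y * arctan ((1 - a) / y)) \<longlongrightarrow> l1) (at_right 0)"
    "((\<lambda>y. (-1 - a) * ln ((-1 - a)\<^sup>2 + y\<^sup>2) + 2 * y * arctan ((-1 - a) / y)) \<longlongrightarrow> l2) (at_right 0)"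
    using lim[of "1 - a"] lim[of "-1 - a"] by blast
  have "(I \<longlongrightarrow> l1 - l2 - 4) (at_right 0)"
  proof (rule Lim_transform_eventually)
    show "((\<lambda>y. ((1 - a) * ln ((1 - a)\<^sup>2 + y\<^sup>2) + 2 * y * arctan ((1 - a) / y)) -
    ((-1 - a) * ln ((-1 - a)\<^sup>2 + y\<^sup>2) + 2 * y * arctan ((-1 - a) / y)) - 4) \<longlongrightarrow> l1 - l2 - 4) (at_right 0)"
      by (intro tendsto_intros l)
    show "\<forall>\<^sub>F y in at_right 0. ((1 - a) * ln ((1 - a)\<^sup>2 + y\<^sup>2) + 2 * y * arctan ((1 - a) / y)) -
    ((-1 - a) * ln ((-1 - a)\<^sup>2 + y\<^sup>2) + 2 * y * arctan ((-1 - a) / y)) - 4 = I y"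
      by (rule eventually_mono[OF eventually_at_right_less[of 0]]) (simp add: I_def log_kernel_integral)
  qed
  then have "\<forall>\<^sub>F y in at_right 0. dist (I y) (l1 - l2 - 4) < e / 2"
    using e by (intro tendstoD) auto
  then obtain d where d: "d > 0" "\<And>y. 0 < y \<Longrightarrow> y < d \<Longrightarrow> dist (I y) (l1 - l2 - 4) < e / 2"
    unfolding eventually_at_right_field by auto
  have main: "(LINT t|mu. \<bar>ln ((t - a)\<^sup>2 + y\<^sup>2) - ln ((t - a)\<^sup>2 + z\<^sup>2)\<bar>) = I y - I z"
    if "0 < z" "z \<le> y" for y z
  proof -
    have "(LINT t|mu. \<bar>ln ((t - a)\<^sup>2 + y\<^sup>2) - ln ((t - a)\<^sup>2 + z\<^sup>2)\<bar>) = (LINT t|mu. ln ((t - a)\<^sup>2 + y\<^sup>2) - ln ((t - a)\<^sup>2 + z\<^sup>2))"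
    proof (intro Bochner_Integration.integral_cong refl abs_of_nonneg)
      fix t
      have "(t - a)\<^sup>2 + z\<^sup>2 > 0" "(t - a)\<^sup>2 + z\<^sup>2 \<le> (t - a)\<^sup>2 + y\<^sup>2"
        using that by (auto simp: add_nonneg_pos intro!: power_mono)
      then show "0 \<le> ln ((t - a)\<^sup>2 + y\<^sup>2) - ln ((t - a)\<^sup>2 + z\<^sup>2)" by simp
    qed
    also have "\<dots> = I y - I z" using that log_kernel_integral(2) by (simp add: I_def)
    finally show ?thesis .
  qed
  have "(LINT t|mu. \<bar>ln ((t - a)\<^sup>2 + y\<^sup>2) - ln ((t - a)\<^sup>2 + z\<^sup>2)\<bar>) \<le> e"
    if yz: "0 < y" "y < d" "0 < z" "z < d" for y z
  proof -
    have "dist (I y) (I z) < e" by (rule dist_triangle_half_l[OF d(2) d(2)]) (use yz in auto)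
    moreover have "(LINT t|mu. \<bar>ln ((t - a)\<^sup>2 + y\<^sup>2) - ln ((t - a)\<^sup>2 + z\<^sup>2)\<bar>) = I y - I z \<or>
       (LINT t|mu. \<bar>ln ((t - a)\<^sup>2 + y\<^sup>2) - ln ((t - a)\<^sup>2 + z\<^sup>2)\<bar>) = I z - I y"
    proof (cases "z \<le> y")
      case False
      have "(LINT t|mu. \<bar>ln ((t - a)\<^sup>2 + y\<^sup>2) - ln ((t - a)\<^sup>2 + z\<^sup>2)\<bar>) = (LINT t|mu. \<bar>ln ((t - a)\<^sup>2 + z\<^sup>2) - ln ((t - a)\<^sup>2 + y\<^sup>2)\<bar>)"
        by (intro Bochner_Integration.integral_cong refl abs_minus_commute)
      also have "\<dots> = I z - I y" using False yz by (intro main) auto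
      finally show ?thesis by (rule disjI2)
    qed (use main[of z y] yz in blast)
    ultimately show ?thesis by (auto simp: dist_real_def)
  qed
  with d(1) show ?thesis by blast
qed

lemma conj_poisson_cong: "(\<And>x. x \<in> {-1<..<1} \<Longrightarrow> f x = g x) \<Longrightarrow> conj_poisson y f t = conj_poisson y g t"
  unfolding conj_poisson_def by (intro Bochner_Integration.integral_cong) (auto simp: space_mu)

lemma conj_poisson_interval:
  assumes "-1 \<le> a" "a \<le> 1" "y > 0"
  shows "conj_poisson y (indicator {..<a}) t = complex_of_real ((ln ((t - a)\<^sup>2 + y\<^sup>2) - ln ((t - (-1))\<^sup>2 + y\<^sup>2)) / (2 * pi))"
proof -
  have p: "(x - t)\<^sup>2 + y\<^sup>2 > 0" for x using assms by (simp add: add_nonneg_pos)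
  have "conj_poisson y (indicator {..<a}) t = complex_of_real (LINT x:{-1<..<a}|mu. conj_kernel y (x - t))"
    unfolding conj_poisson_def set_lebesgue_integral_def integral_complex_of_real[symmetric]
    by (intro Bochner_Integration.integral_cong) (auto simp: space_mu indicator_def)
  also have "(LINT x:{-1<..<a}|mu. conj_kernel y (x - t)) = ln ((a - t)\<^sup>2 + y\<^sup>2) / (2 * pi) - ln ((-1 - t)\<^sup>2 + y\<^sup>2) / (2 * pi)"
  proof (rule mu_FTC)
    show "continuous_on {-1..a} (\<lambda>x. conj_kernel y (x - t))"
      unfolding conj_kernel_def using assms by (intro continuous_intros) auto
    fix x
    have "((\<lambda>x. ln ((x - t)\<^sup>2 + y\<^sup>2) / (2 * pi)) has_real_derivative (2 * (x - t) / ((x - t)\<^sup>2 + y\<^sup>2)) / (2 * pi)) (at x within {-1..a})"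
      using p[of x] by (auto intro!: derivative_eq_intros simp: divide_simps)
    also have "(2 * (x - t) / ((x - t)\<^sup>2 + y\<^sup>2)) / (2 * pi) = conj_kernel y (x - t)"
    proof -
      have "2 * u / D / (2 * pi) = u / D / pi" for u D :: real by simp
      then show ?thesis unfolding conj_kernel_def .
    qed
    finally show "((\<lambda>x. ln ((x - t)\<^sup>2 + y\<^sup>2) / (2 * pi)) has_vector_derivative conj_kernel y (x - t)) (at x within {-1..a})"
      by (simp add: has_real_derivative_iff_has_vector_derivative)
  qed (use assms in auto)
  also have "\<dots> = (ln ((t - a)\<^sup>2 + y\<^sup>2) - ln ((t - (-1))\<^sup>2 + y\<^sup>2)) / (2 * pi)"
    by (simp add: diff_divide_distrib power2_commute[of a t] power2_commute[of "-1" t])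
  finally show ?thesis .
qed

lemma mean_cauchy_interval: "mean_cauchy (indicator {..<a})"
proof -
  \<comment> \<open>The end point is clipped to the interval.\<close>
  define b where "b = max (-1) (min 1 a)"
  have b: "-1 \<le> b" "b \<le> 1" by (auto simp: b_def)
  have ab: "conj_poisson y (indicator {..<a}) t = conj_poisson y (indicator {..<b}) t" for y t
    by (rule conj_poisson_cong) (auto simp: b_def indicator_def min_def max_def)
  have int: "integrable mu (indicator {..<a} :: real \<Rightarrow> complex)" by (rule integrable_indicator_mu) simp
  show ?thesis
    unfolding mean_cauchy_def
  proof (intro conjI int allI impI)
    fix e :: real assume e: "e > 0"
    obtain d1 where d1: "d1 > 0" "\<And>y z. 0 < y \<Longrightarrow> y < d1 \<Longrightarrow> 0 < z \<Longrightarrow> z < d1 \<Longrightarrow>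
     (LINT t|mu. \<bar>ln ((t - b)\<^sup>2 + y\<^sup>2) - ln ((t - b)\<^sup>2 + z\<^sup>2)\<bar>) \<le> e"
      using log_kernel_cauchy[OF e, of b] by blast
    obtain d2 where d2: "d2 > 0" "\<And>y z. 0 < y \<Longrightarrow> y < d2 \<Longrightarrow> 0 < z \<Longrightarrow> z < d2 \<Longrightarrow>
     (LINT t|mu. \<bar>ln ((t - (-1))\<^sup>2 + y\<^sup>2) - ln ((t - (-1))\<^sup>2 + z\<^sup>2)\<bar>) \<le> e"
      using log_kernel_cauchy[OF e, of "-1"] by blast
    show "\<exists>d>0. \<forall>y z. 0 < y \<longrightarrow> y < d \<longrightarrow> 0 < z \<longrightarrow> z < d \<longrightarrow>
      (LINT x|mu. cmod (conj_poisson y (indicator {..<a}) x - conj_poisson z (indicator {..<a}) x)) \<le> e"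
    proof (intro exI[of _ "min d1 d2"] conjI allI impI)
      fix y z assume yz: "0 < y" "y < min d1 d2" "0 < z" "z < min d1 d2"
      let ?A = "\<lambda>b t. \<bar>ln ((t - b)\<^sup>2 + y\<^sup>2) - ln ((t - b)\<^sup>2 + z\<^sup>2)\<bar>"
      have ii: "integrable mu (?A b)" for b
        using log_kernel_integral(2) yz by auto
      have "(LINT x|mu. cmod (conj_poisson y (indicator {..<a}) x - conj_poisson z (indicator {..<a}) x)) \<le> (LINT t|mu. 1 / 2 * (?A b t + ?A (-1) t))"
      proof (rule integral_mono)
        show "integrable mu (\<lambda>x. cmod (conj_poisson y (indicator {..<a}) x - conj_poisson z (indicator {..<a}) x))"
          using conj_poisson_integrable[OF int] yz by auto
        show "integrable mu (\<lambda>t. 1 / 2 * (?A b t + ?A (-1) t))" using ii[of b] ii[of "-1"] by (intro Bochner_Integration.integrable_mult_right Bochner_Integration.integrable_add)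
        fix t
        have "cmod (conj_poisson y (indicator {..<a}) t - conj_poisson z (indicator {..<a}) t)
          = \<bar>(ln ((t - b)\<^sup>2 + y\<^sup>2) - ln ((t - b)\<^sup>2 + z\<^sup>2)) - (ln ((t - (-1))\<^sup>2 + y\<^sup>2) - ln ((t - (-1))\<^sup>2 + z\<^sup>2))\<bar> / (2 * pi)"
          unfolding ab conj_poisson_interval[OF b yz(1)] conj_poisson_interval[OF b yz(3)]
          unfolding of_real_diff[symmetric] norm_of_real
          using pi_gt_zero by (simp add: abs_divide diff_divide_distrib[symmetric] algebra_simps)
        also have "\<dots> \<le> \<bar>(ln ((t - b)\<^sup>2 + y\<^sup>2) - ln ((t - b)\<^sup>2 + z\<^sup>2)) - (ln ((t - (-1))\<^sup>2 + y\<^sup>2) - ln ((t - (-1))\<^sup>2 + z\<^sup>2))\<bar> / 2"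
          using pi_ge_two by (intro divide_left_mono) auto
        also have "\<dots> \<le> (?A b t + ?A (-1) t) / 2"
          by (intro divide_right_mono abs_triangle_ineq4) simp
        also have "\<dots> = 1 / 2 * (?A b t + ?A (-1) t)" by simp
        finally show "cmod (conj_poisson y (indicator {..<a}) t - conj_poisson z (indicator {..<a}) t) \<le> 1 / 2 * (?A b t + ?A (-1) t)" .
      qed
      also have "\<dots> = 1 / 2 * ((LINT t|mu. ?A b t) + (LINT t|mu. ?A (-1) t))"
        using ii[of b] ii[of "-1"] by (simp only: integral_mult_right_zero Bochner_Integration.integral_add)
      also have "\<dots> \<le> 1 / 2 * (e + e)"
        using d1(2)[of y z] d2(2)[of y z] yz by (intro mult_left_mono add_mono) auto
      finally show "(LINT x|mu. cmod (conj_poisson y (indicator {..<a}) x - conj_poisson z (indicator {..<a}) x)) \<le> e"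
        by simp
    qed (use d1 d2 in auto)
  qed
qed

lemma mean_cauchy_add:
  assumes f: "mean_cauchy f" and g: "mean_cauchy g"
  shows "mean_cauchy (\<lambda>x. f x + g x)"
  unfolding mean_cauchy_def
proof (intro conjI allI impI)
  have fi: "integrable mu f" and gi: "integrable mu g" using f g by (auto simp: mean_cauchy_def)
  then show "integrable mu (\<lambda>x. f x + g x)" by simp
  fix e :: real assume "e > 0"
  then have e2: "e / 2 > 0" by simp
  from f e2 obtain d1 where d1: "d1 > 0" "\<And>y z. 0 < y \<Longrightarrow> y < d1 \<Longrightarrow> 0 < z \<Longrightarrow> z < d1 \<Longrightarrow>
      (LINT x|mu. cmod (conj_poisson y f x - conj_poisson z f x)) \<le> e / 2"
    unfolding mean_cauchy_def by blast
  from g e2 obtain d2 where d2: "d2 > 0" "\<And>y z. 0 < y \<Longrightarrow> y < d2 \<Longrightarrow> 0 < z \<Longrightarrow> z < d2 \<Longrightarrow>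
      (LINT x|mu. cmod (conj_poisson y g x - conj_poisson z g x)) \<le> e / 2"
    unfolding mean_cauchy_def by blast
  show "\<exists>d>0. \<forall>y z. 0 < y \<longrightarrow> y < d \<longrightarrow> 0 < z \<longrightarrow> z < d \<longrightarrow>
      (LINT x|mu. cmod (conj_poisson y (\<lambda>x. f x + g x) x - conj_poisson z (\<lambda>x. f x + g x) x)) \<le> e"
  proof (intro exI[of _ "min d1 d2"] conjI allI impI)
    fix y z assume yz: "0 < y" "y < min d1 d2" "0 < z" "z < min d1 d2"
    note ints = conj_poisson_integrable[OF fi yz(1)] conj_poisson_integrable[OF fi yz(3)]
      conj_poisson_integrable[OF gi yz(1)] conj_poisson_integrable[OF gi yz(3)]
    have "(LINT x|mu. cmod (conj_poisson y (\<lambda>x. f x + g x) x - conj_poisson z (\<lambda>x. f x + g x) x))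
      \<le> (LINT x|mu. cmod (conj_poisson y f x - conj_poisson z f x) + cmod (conj_poisson y g x - conj_poisson z g x))"
      unfolding conj_poisson_add[OF fi gi yz(1)] conj_poisson_add[OF fi gi yz(3)]
    proof (rule integral_mono)
      fix x
      show "cmod (conj_poisson y f x + conj_poisson y g x - (conj_poisson z f x + conj_poisson z g x))
        \<le> cmod (conj_poisson y f x - conj_poisson z f x) + cmod (conj_poisson y g x - conj_poisson z g x)"
        unfolding add_diff_add by (rule norm_triangle_ineq)
    qed (use ints in auto)
    also have "\<dots> = (LINT x|mu. cmod (conj_poisson y f x - conj_poisson z f x)) + (LINT x|mu. cmod (conj_poisson y g x - conj_poisson z g x))"
      using ints by (intro Bochner_Integration.integral_add) auto
    also have "\<dots> \<le> e / 2 + e / 2"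
      using d1(2)[of y z] d2(2)[of y z] yz by (intro add_mono) auto
    finally show "(LINT x|mu. cmod (conj_poisson y (\<lambda>x. f x + g x) x - conj_poisson z (\<lambda>x. f x + g x) x)) \<le> e" by simp
  qed (use d1 d2 in auto)
qed

lemma mean_cauchy_scale:
  assumes f: "mean_cauchy f"
  shows "mean_cauchy (\<lambda>x. c * f x)"
  unfolding mean_cauchy_def
proof (intro conjI allI impI)
  have fi: "integrable mu f" using f by (auto simp: mean_cauchy_def)
  then show "integrable mu (\<lambda>x. c * f x)" by simp
  fix e :: real assume "e > 0"
  then have e2: "e / (1 + cmod c) > 0" by (simp add: add_pos_nonneg)
  from f e2 obtain d where d: "d > 0" "\<And>y z. 0 < y \<Longrightarrow> y < d \<Longrightarrow> 0 < z \<Longrightarrow> z < d \<Longrightarrow>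
      (LINT x|mu. cmod (conj_poisson y f x - conj_poisson z f x)) \<le> e / (1 + cmod c)"
    unfolding mean_cauchy_def by blast
  show "\<exists>d>0. \<forall>y z. 0 < y \<longrightarrow> y < d \<longrightarrow> 0 < z \<longrightarrow> z < d \<longrightarrow>
      (LINT x|mu. cmod (conj_poisson y (\<lambda>x. c * f x) x - conj_poisson z (\<lambda>x. c * f x) x)) \<le> e"
  proof (intro exI[of _ d] conjI allI impI d(1))
    fix y z assume yz: "0 < y" "y < d" "0 < z" "z < d"
    have "(LINT x|mu. cmod (conj_poisson y (\<lambda>x. c * f x) x - conj_poisson z (\<lambda>x. c * f x) x))
      = cmod c * (LINT x|mu. cmod (conj_poisson y f x - conj_poisson z f x))"
      by (simp add: conj_poisson_scale norm_mult flip: right_diff_distrib)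
    also have "\<dots> \<le> (1 + cmod c) * (e / (1 + cmod c))"
      using d(2)[OF yz] by (intro mult_mono) auto
    also have "\<dots> = e" using add_pos_nonneg[of 1 "cmod c"] by simp
    finally show "(LINT x|mu. cmod (conj_poisson y (\<lambda>x. c * f x) x - conj_poisson z (\<lambda>x. c * f x) x)) \<le> e" .
  qed
qed

text \<open>
  The constant is \<open>3\<^sup>2\<close>, since the exponent is at most 2.
\<close>
lemma powr_triangle:
  assumes "0 < p" "cmod a \<le> 2 * cmod b"
  shows "cmod (b - a) powr (1 + 1 / real p) \<le> 9 * cmod b powr (1 + 1 / real p)"
proof -
  have q: "1 + 1 / real p \<le> 2" using assms by simp
  have "cmod (b - a) \<le> 3 * cmod b" using norm_triangle_ineq4[of b a] assms by simp
  then have "cmod (b - a) powr (1 + 1 / real p) \<le> (3 * cmod b) powr (1 + 1 / real p)"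
    by (intro powr_mono2) auto
  also have "\<dots> = 3 powr (1 + 1 / real p) * cmod b powr (1 + 1 / real p)"
    by (simp add: powr_mult)
  also have "\<dots> \<le> 3 powr 2 * cmod b powr (1 + 1 / real p)"
    using q by (intro mult_right_mono powr_mono) auto
  finally show ?thesis by simp
qed

lemma lq_lim:
  assumes f: "lq_fun p f" and p: "0 < p" and s: "\<And>i. s i \<in> borel_measurable mu"
    and "\<And>x. x \<in> {-1<..<1} \<Longrightarrow> (\<lambda>i. s i x) \<longlonglongrightarrow> f x"
    "\<And>i x. x \<in> {-1<..<1} \<Longrightarrow> cmod (s i x) \<le> 2 * cmod (f x)"
  shows "lq_fun p (\<lambda>x. f x - s i x)"
    and "(\<lambda>i. LINT x|mu. cmod (f x - s i x) powr (1 + 1 / real p)) \<longlonglongrightarrow> 0"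
proof -
  note fm[measurable] = f[unfolded lq_fun_def, THEN conjunct1] and s[measurable]
  note fi = f[unfolded lq_fun_def, THEN conjunct2]
  have dom: "AE x in mu. norm (cmod (f x - s i x) powr (1 + 1 / real p)) \<le> 9 * cmod (f x) powr (1 + 1 / real p)" for i
    by (rule AE_mu_I) (use assms(5) powr_triangle[OF p] in auto)
  have w: "integrable mu (\<lambda>x. 9 * cmod (f x) powr (1 + 1 / real p))" using fi by auto
  have "integrable mu (\<lambda>x. cmod (f x - s i x) powr (1 + 1 / real p))"
    by (rule Bochner_Integration.integrable_bound[OF w]) (use dom[of i] in auto)
  then show "lq_fun p (\<lambda>x. f x - s i x)" by (simp add: lq_fun_def)
  have "(\<lambda>i. LINT x|mu. cmod (f x - s i x) powr (1 + 1 / real p)) \<longlonglongrightarrow> (LINT x|mu. 0)"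
  proof (rule integral_dominated_convergence[OF _ _ w _ dom])
    show "AE x in mu. (\<lambda>i. cmod (f x - s i x) powr (1 + 1 / real p)) \<longlonglongrightarrow> 0"
    proof (rule AE_mu_I)
      fix x assume "x \<in> {-1<..<1::real}"
      then have "(\<lambda>i. cmod (f x - s i x)) \<longlonglongrightarrow> cmod (f x - f x)"
        by (intro tendsto_intros assms)
      then have "(\<lambda>i. cmod (f x - s i x)) \<longlonglongrightarrow> 0" by simp
      from tendsto_powr'[OF this tendsto_const[of "1 + 1 / real p"]]
      show "(\<lambda>i. cmod (f x - s i x) powr (1 + 1 / real p)) \<longlonglongrightarrow> 0"
        by (simp add: add_pos_nonneg)
    qed
  qed auto
  then show "(\<lambda>i. LINT x|mu. cmod (f x - s i x) powr (1 + 1 / real p)) \<longlonglongrightarrow> 0" by simp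
qed

text \<open>
  By density: \<open>conj_poisson_L1\<close> makes the regularised transforms of the error \<open>f - s\<^sub>i\<close> small in mean,
  uniformly in \<open>y\<close>.
\<close>
theorem mean_cauchy_lq:
  assumes g: "lq_fun p g" and p: "0 < p"
  shows "mean_cauchy g"
proof (rule interval_dense_induct[where P = mean_cauchy and Q = "lq_fun p"])
  show "g \<in> borel_measurable mu" "lq_fun p g" using g by (auto simp: lq_fun_def)
next
  show "lq_fun p f" if "f \<in> borel_measurable mu" "\<exists>B. \<forall>x\<in>{-1<..<1}. cmod (f x) \<le> B" for f
    using that by (rule lq_fun_bounded)
next
  fix f and s :: "nat \<Rightarrow> real \<Rightarrow> complex"
  assume f: "lq_fun p f" and s: "\<And>i. mean_cauchy (s i)"
    and conv: "\<And>x. x \<in> {-1<..<1} \<Longrightarrow> (\<lambda>i. s i x) \<longlonglongrightarrow> f x"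
    and dom: "\<And>i x. x \<in> {-1<..<1} \<Longrightarrow> cmod (s i x) \<le> 2 * cmod (f x)"
  have fi: "integrable mu f" by (rule lq_fun_integrable[OF f])
  have si: "integrable mu (s i)" for i using s[of i] by (simp add: mean_cauchy_def)
  have sm: "s i \<in> borel_measurable mu" for i using si[of i] by simp
  note L = lq_lim[OF f p sm conv dom]
  show "mean_cauchy f"
    unfolding mean_cauchy_def
  proof (intro conjI fi allI impI)
    fix e :: real assume e: "e > 0"
    define K where "K = moment_const (p + 1)"
    have K: "K \<ge> 0" by (simp add: K_def moment_const_nonneg)
    \<comment> \<open>First \<open>c\<close> makes the term with the moment constant small, then \<open>i\<close> makes the other term small.\<close>
    define c where "c = min 1 (e / (6 * (K + 1)))"
    have c: "c > 0" "c \<le> 1" using e K by (auto simp: c_def)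
    have "c ^ (p + 1) * K \<le> c * K"
      using c K power_decreasing[of 1 "p + 1" c] by (intro mult_right_mono) auto
    also have "\<dots> \<le> e / (6 * (K + 1)) * (K + 1)"
      using c K by (intro mult_mono) (auto simp: c_def)
    also have "\<dots> = e / 6" using K by (simp add: field_simps)
    finally have cK: "c ^ (p + 1) * K \<le> e / 6" .
    define C where "C = (1 / c) powr (1 + 1 / real p)"
    have "(\<lambda>i. C * (LINT x|mu. cmod (f x - s i x) powr (1 + 1 / real p))) \<longlonglongrightarrow> C * 0"
      by (intro tendsto_mult tendsto_const L(2))
    then have "\<forall>\<^sub>F i in sequentially. C * (LINT x|mu. cmod (f x - s i x) powr (1 + 1 / real p)) < e / 6"
      using e by (intro order_tendstoD(2)[where y = "C * 0"]) auto
    then obtain i where i: "C * (LINT x|mu. cmod (f x - s i x) powr (1 + 1 / real p)) < e / 6"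
      by (auto simp: eventually_sequentially)
    have small: "(LINT x|mu. cmod (conj_poisson y (\<lambda>x. f x - s i x) x)) \<le> e / 3" if "y > 0" for y
      using conj_poisson_L1[OF L(1) p that c(1), of i] i cK unfolding C_def K_def by linarith
    from e have "e / 3 > 0" by simp
    then obtain d where d: "d > 0" "\<And>y z. 0 < y \<Longrightarrow> y < d \<Longrightarrow> 0 < z \<Longrightarrow> z < d \<Longrightarrow>
      (LINT x|mu. cmod (conj_poisson y (s i) x - conj_poisson z (s i) x)) \<le> e / 3"
      using s[of i] unfolding mean_cauchy_def by blast
    show "\<exists>d>0. \<forall>y z. 0 < y \<longrightarrow> y < d \<longrightarrow> 0 < z \<longrightarrow> z < d \<longrightarrow>
      (LINT x|mu. cmod (conj_poisson y f x - conj_poisson z f x)) \<le> e"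
    proof (intro exI[of _ d] conjI allI impI d(1))
      fix y z assume yz: "0 < y" "y < d" "0 < z" "z < d"
      let ?h = "\<lambda>x. f x - s i x"
      have hi: "integrable mu ?h" using fi si by auto
      note ints = conj_poisson_integrable[OF hi yz(1)] conj_poisson_integrable[OF hi yz(3)]
        conj_poisson_integrable[OF si yz(1), of i] conj_poisson_integrable[OF si yz(3), of i]
        conj_poisson_integrable[OF fi yz(1)] conj_poisson_integrable[OF fi yz(3)]
      have "(LINT x|mu. cmod (conj_poisson y f x - conj_poisson z f x)) \<le>
         (LINT x|mu. cmod (conj_poisson y ?h x) + (cmod (conj_poisson z ?h x) + cmod (conj_poisson y (s i) x - conj_poisson z (s i) x)))"
      proof (rule integral_mono)
        fix x
        have "conj_poisson y f x - conj_poisson z f x = conj_poisson y ?h x + ((conj_poisson y (s i) x - conj_poisson z (s i) x) - conj_poisson z ?h x)"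
          using yz by (simp add: conj_poisson_diff[OF fi si])
        also have "cmod \<dots> \<le> cmod (conj_poisson y ?h x) + (cmod (conj_poisson y (s i) x - conj_poisson z (s i) x) + cmod (conj_poisson z ?h x))"
          by (intro norm_triangle_mono order_refl norm_triangle_ineq4)
        finally show "cmod (conj_poisson y f x - conj_poisson z f x) \<le> cmod (conj_poisson y ?h x) + (cmod (conj_poisson z ?h x) + cmod (conj_poisson y (s i) x - conj_poisson z (s i) x))"
          by simp
      qed (use ints in auto)
      also have "\<dots> = (LINT x|mu. cmod (conj_poisson y ?h x)) + ((LINT x|mu. cmod (conj_poisson z ?h x)) + (LINT x|mu. cmod (conj_poisson y (s i) x - conj_poisson z (s i) x)))"
        using ints by simp
      also have "\<dots> \<le> e / 3 + (e / 3 + e / 3)"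
        using small yz d(2)[OF yz] by (intro add_mono) auto
      finally show "(LINT x|mu. cmod (conj_poisson y f x - conj_poisson z f x)) \<le> e" by simp
    qed
  qed
qed (auto intro: mean_cauchy_interval mean_cauchy_add mean_cauchy_scale)

definition mean_limit :: "(real \<Rightarrow> complex) \<Rightarrow> (real \<Rightarrow> complex) \<Rightarrow> bool"
  where "mean_limit g G \<longleftrightarrow> integrable mu G \<and>
    ((\<lambda>y. LINT x|mu. cmod (conj_poisson y g x - G x)) \<longlongrightarrow> 0) (at_right 0)"

text \<open>
  A subsequence of the regularised transforms for \<open>y = 1, 1/2, 1/3, \<dots>\<close> converges almost everywhere; by
  Fatou's lemma the Cauchy estimates hold for its limit.
\<close>
theorem mean_limit_exists:
  assumes "mean_cauchy g"
  obtains G where "mean_limit g G"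
proof -
  have gi: "integrable mu g" using assms by (simp add: mean_cauchy_def)
  define s where "s n = conj_poisson (1 / real (Suc n)) g" for n
  have si: "integrable mu (s n)" for n unfolding s_def by (intro conj_poisson_integrable gi) simp
  then have sm[measurable]: "s n \<in> borel_measurable mu" for n using si[of n] by simp
  have close: "\<exists>N. \<forall>y n. 0 < y \<longrightarrow> y < 1 / real (Suc N) \<longrightarrow> n > N \<longrightarrow> (LINT x|mu. cmod (conj_poisson y g x - s n x)) \<le> e"
    if e: "e > 0" for e
  proof -
    obtain d where d: "d > 0" "\<And>y z. 0 < y \<Longrightarrow> y < d \<Longrightarrow> 0 < z \<Longrightarrow> z < d \<Longrightarrow>
      (LINT x|mu. cmod (conj_poisson y g x - conj_poisson z g x)) \<le> e"
      using assms e unfolding mean_cauchy_def by blast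
    obtain N where N: "1 / real (Suc N) < d" using d(1) nat_approx_posE by blast
    show ?thesis
    proof (intro exI[of _ N] allI impI)
      fix y n assume "0 < y" "y < 1 / real (Suc N)" "N < n"
      moreover from \<open>N < n\<close> have "1 / real (Suc n) < 1 / real (Suc N)" by (simp add: frac_less2)
      ultimately show "(LINT x|mu. cmod (conj_poisson y g x - s n x)) \<le> e"
        unfolding s_def using N by (intro d(2)) auto
    qed
  qed
  have "\<exists>N. \<forall>i\<ge>N. \<forall>j\<ge>N. (LINT x|mu. norm (s i x - s j x)) < e" if e: "e > 0" for e
  proof -
    obtain N where N: "\<And>y n. 0 < y \<Longrightarrow> y < 1 / real (Suc N) \<Longrightarrow> n > N \<Longrightarrow> (LINT x|mu. cmod (conj_poisson y g x - s n x)) \<le> e / 2"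
      using close[of "e / 2"] e by auto
    show ?thesis
    proof (intro exI[of _ "Suc N"] allI impI)
      fix i j assume ij: "i \<ge> Suc N" "j \<ge> Suc N"
      have "1 / real (Suc i) < 1 / real (Suc N)" using ij by (simp add: frac_less2)
      then have "(LINT x|mu. norm (s i x - s j x)) \<le> e / 2"
        using N[of "1 / real (Suc i)" j] ij by (simp add: s_def)
      then show "(LINT x|mu. norm (s i x - s j x)) < e" using e by simp
    qed
  qed
  then obtain r where r: "strict_mono r" "AE x in mu. Cauchy (\<lambda>i. s (r i) x)"
    using cauchy_L1_AE_cauchy_subseq[of mu s] si by blast
  define G where "G x = lim (\<lambda>i. s (r i) x)" for x
  have Gm[measurable]: "G \<in> borel_measurable mu"
    unfolding G_def by (rule borel_measurable_lim_metric) simp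
  have conv: "AE x in mu. (\<lambda>i. s (r i) x) \<longlonglongrightarrow> G x"
    using r(2) by eventually_elim (simp add: G_def Cauchy_convergent convergent_LIMSEQ_iff[symmetric])
  have bound: "(\<integral>\<^sup>+x. ennreal (cmod (conj_poisson y g x - G x)) \<partial>mu) \<le> ennreal e"
    if e: "e > 0" and y: "0 < y" and N: "\<And>n. n > N \<Longrightarrow> (LINT x|mu. cmod (conj_poisson y g x - s n x)) \<le> e" for e y N
  proof -
    have yi: "integrable mu (conj_poisson y g)" by (intro conj_poisson_integrable gi y)
    then have [measurable]: "conj_poisson y g \<in> borel_measurable mu" by simp
    have "(\<integral>\<^sup>+x. ennreal (cmod (conj_poisson y g x - G x)) \<partial>mu)
       = (\<integral>\<^sup>+x. liminf (\<lambda>i. ennreal (cmod (conj_poisson y g x - s (r i) x))) \<partial>mu)"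
    proof (intro nn_integral_cong_AE)
      show "AE x in mu. ennreal (cmod (conj_poisson y g x - G x)) = liminf (\<lambda>i. ennreal (cmod (conj_poisson y g x - s (r i) x)))"
        using conv
      proof eventually_elim
        case (elim x)
        have "(\<lambda>i. ennreal (cmod (conj_poisson y g x - s (r i) x))) \<longlonglongrightarrow> ennreal (cmod (conj_poisson y g x - G x))"
          by (intro tendsto_ennrealI tendsto_intros elim)
        from lim_imp_Liminf[OF sequentially_bot this] show ?case by (rule sym)
      qed
    qed
    also have "\<dots> \<le> liminf (\<lambda>i. \<integral>\<^sup>+x. ennreal (cmod (conj_poisson y g x - s (r i) x)) \<partial>mu)"
      by (intro nn_integral_liminf) measurable
    also have "\<dots> \<le> liminf (\<lambda>i. ennreal e)"
    proof (rule Liminf_mono)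
      show "\<forall>\<^sub>F i in sequentially. (\<integral>\<^sup>+x. ennreal (cmod (conj_poisson y g x - s (r i) x)) \<partial>mu) \<le> ennreal e"
        using eventually_gt_at_top[of N]
      proof eventually_elim
        case (elim i)
        then have "r i > N" using seq_suble[OF r(1), of i] by linarith
        then have "(LINT x|mu. cmod (conj_poisson y g x - s (r i) x)) \<le> e" by (rule N)
        then show ?case
          using si yi by (subst nn_integral_eq_integral) (auto intro!: ennreal_leI)
      qed
    qed
    also have "\<dots> = ennreal e" by (simp add: Liminf_const)
    finally show ?thesis .
  qed
  have diff_i: "integrable mu (\<lambda>x. conj_poisson y g x - G x)"
    "(LINT x|mu. cmod (conj_poisson y g x - G x)) \<le> e"
    if e: "e > 0" and y: "0 < y" and N: "\<And>n. n > N \<Longrightarrow> (LINT x|mu. cmod (conj_poisson y g x - s n x)) \<le> e" for e y N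
  proof -
    have yi: "integrable mu (conj_poisson y g)" by (intro conj_poisson_integrable gi y)
    then have [measurable]: "conj_poisson y g \<in> borel_measurable mu" by simp
    have b: "(\<integral>\<^sup>+x. ennreal (cmod (conj_poisson y g x - G x)) \<partial>mu) \<le> ennreal e"
      by (rule bound[OF e y N])
    show i: "integrable mu (\<lambda>x. conj_poisson y g x - G x)"
      by (rule integrableI_bounded) (use b in \<open>auto intro: le_less_trans\<close>)
    show "(LINT x|mu. cmod (conj_poisson y g x - G x)) \<le> e"
      using b e by (subst (asm) nn_integral_eq_integral) (use i in auto)
  qed
  have Gi: "integrable mu G"
  proof -
    obtain N where N: "\<And>y n. 0 < y \<Longrightarrow> y < 1 / real (Suc N) \<Longrightarrow> n > N \<Longrightarrow> (LINT x|mu. cmod (conj_poisson y g x - s n x)) \<le> 1"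
      using close[of 1] by auto
    define y where "y = 1 / real (Suc N) / 2"
    have y: "0 < y" "y < 1 / real (Suc N)" by (auto simp: y_def field_simps)
    have "integrable mu (\<lambda>x. conj_poisson y g x - G x)"
      by (rule diff_i(1)[of 1]) (use y N in auto)
    from Bochner_Integration.integrable_diff[OF conj_poisson_integrable[OF gi y(1)] this]
    show ?thesis by simp
  qed
  have "mean_limit g G"
    unfolding mean_limit_def
  proof (intro conjI Gi tendstoI)
    fix e :: real assume e: "e > 0"
    then obtain N where N: "\<And>y n. 0 < y \<Longrightarrow> y < 1 / real (Suc N) \<Longrightarrow> n > N \<Longrightarrow> (LINT x|mu. cmod (conj_poisson y g x - s n x)) \<le> e / 2"
      using close[of "e / 2"] by auto
    show "\<forall>\<^sub>F y in at_right 0. dist (LINT x|mu. cmod (conj_poisson y g x - G x)) 0 < e"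
      unfolding eventually_at_right_field
    proof (intro exI[of _ "1 / real (Suc N)"] conjI allI impI)
      fix y assume "0 < y" "y < 1 / real (Suc N)"
      then have "(LINT x|mu. cmod (conj_poisson y g x - G x)) \<le> e / 2"
        using e N by (intro diff_i(2)[of _ _ N]) auto
      then show "dist (LINT x|mu. cmod (conj_poisson y g x - G x)) 0 < e" using e by simp
    qed simp
  qed
  then show ?thesis by (rule that)
qed

section \<open>Principal values at Lebesgue points\<close>

text \<open>
  An approximate identity. Its Lipschitz continuity keeps the regularised transforms bounded by a multiple
  of \<open>1 / e\<close> uniformly in \<open>y\<close>, which fails for the indicator of an interval.
\<close>
definition tent :: "real \<Rightarrow> real \<Rightarrow> real"
  where "tent e r = max 0 (e - \<bar>r\<bar>) / e\<^sup>2"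

lemma tent_measurable [measurable]: "tent e \<in> borel_measurable borel"
  unfolding tent_def[abs_def] by measurable

lemma tent_basic:
  assumes "e > 0"
  shows "0 \<le> tent e r" "tent e r \<le> 1 / e" "e \<le> \<bar>r\<bar> \<Longrightarrow> tent e r = 0" "tent e (- r) = tent e r"
    "\<bar>tent e r - tent e s\<bar> \<le> \<bar>r - s\<bar> / e\<^sup>2"
proof -
  show "0 \<le> tent e r" "e \<le> \<bar>r\<bar> \<Longrightarrow> tent e r = 0" "tent e (- r) = tent e r"
    by (auto simp: tent_def)
  have "max 0 (e - \<bar>r\<bar>) / e\<^sup>2 \<le> e / e\<^sup>2" using assms by (intro divide_right_mono) auto
  then show "tent e r \<le> 1 / e" using assms by (simp add: tent_def power2_eq_square)
  have "\<bar>tent e r - tent e s\<bar> = \<bar>max 0 (e - \<bar>r\<bar>) - max 0 (e - \<bar>s\<bar>)\<bar> / e\<^sup>2"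
    by (simp add: tent_def abs_divide flip: diff_divide_distrib)
  also have "\<dots> \<le> \<bar>r - s\<bar> / e\<^sup>2" by (intro divide_right_mono) auto
  finally show "\<bar>tent e r - tent e s\<bar> \<le> \<bar>r - s\<bar> / e\<^sup>2" .
qed

lemma lborel_integrable_supported:
  fixes f :: "real \<Rightarrow> real"
  assumes [measurable]: "f \<in> borel_measurable borel" and "\<And>x. \<bar>f x\<bar> \<le> B" "\<And>x. \<bar>x\<bar> > R \<Longrightarrow> f x = 0"
  shows "integrable lborel f"
proof (rule Bochner_Integration.integrable_bound)
  show "integrable lborel (\<lambda>x. B * indicator {-R..R} x)"
    by (intro integrable_mult_right integrable_real_indicator)
       (auto simp: emeasure_lborel_Icc_eq)
  show "AE x in lborel. norm (f x) \<le> norm (B * indicator {-R..R} x)"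
  proof (rule AE_I2)
    fix x show "norm (f x) \<le> norm (B * indicator {-R..R} x)"
      using assms(2)[of x] assms(3)[of x] by (cases "\<bar>x\<bar> > R") (auto simp: indicator_def)
  qed
qed simp

lemma lborel_integral_supported_le:
  fixes f :: "real \<Rightarrow> real"
  assumes [measurable]: "f \<in> borel_measurable borel" and "\<And>x. \<bar>f x\<bar> \<le> B" "\<And>x. \<bar>x\<bar> > R \<Longrightarrow> f x = 0" "0 \<le> R"
  shows "\<bar>LBINT x. f x\<bar> \<le> B * (2 * R)"
proof -
  have i: "integrable lborel (\<lambda>x. B * indicator {-R..R} x)"
    by (intro integrable_mult_right integrable_real_indicator)
       (auto simp: emeasure_lborel_Icc_eq)
  have "norm (LBINT x. f x) \<le> (LBINT x. B * indicator {-R..R} x)"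
  proof (rule Bochner_Integration.integral_norm_bound_integral[OF lborel_integrable_supported[OF assms(1-3)] i])
    fix x show "norm (f x) \<le> B * indicator {-R..R} x"
      using assms(2)[of x] assms(3)[of x] by (cases "\<bar>x\<bar> > R") (auto simp: indicator_def)
  qed
  also have "\<dots> = B * (2 * R)" using assms(4) by simp
  finally show ?thesis by simp
qed

lemma tent_integrable: "e > 0 \<Longrightarrow> integrable lborel (tent e)"
  by (rule lborel_integrable_supported[where B = "1 / e" and R = e])
     (auto simp: tent_basic abs_of_nonneg)

lemma tent_integral:
  assumes e: "e > 0"
  shows "(LBINT r. tent e r) = 1"
proof -
  let ?F = "\<lambda>r. (e * r - r * \<bar>r\<bar> / 2) / e\<^sup>2"
  have "(LBINT r. tent e r) = (LBINT r:{-e..e}. tent e r)"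
    unfolding set_lebesgue_integral_def
    by (intro Bochner_Integration.integral_cong refl) (auto simp: indicator_def tent_def)
  also have "\<dots> = integral {-e..e} (tent e)"
    using integrable_mult_indicator[OF _ tent_integrable[OF e], of "{-e..e}"]
    by (intro set_borel_integral_eq_integral) (simp add: set_integrable_def)
  also have "(tent e has_integral (?F e - ?F (-e))) {-e..e}"
  proof (rule fundamental_theorem_of_calculus_interior_strong[where S = "{0}"])
    show "continuous_on {-e..e} ?F" using e by (intro continuous_intros) auto
    fix x assume x: "x \<in> {-e<..<e} - {0}"
    show "(?F has_vector_derivative tent e x) (at x)"
    proof (cases "x > 0")
      case True
      have "((\<lambda>r. e * r - r * r / 2) has_real_derivative (e - x)) (at x)"
        by (auto intro!: derivative_eq_intros)
      then have "((\<lambda>r. (e * r - r * r / 2) / e\<^sup>2) has_real_derivative (e - x) / e\<^sup>2) (at x)"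
        by (rule DERIV_cdivide)
      then have "(?F has_real_derivative (e - x) / e\<^sup>2) (at x)"
        by (rule has_field_derivative_transform_within_open[where S = "{0<..}"]) (use True in auto)
      then show ?thesis using True x
        by (simp add: has_real_derivative_iff_has_vector_derivative tent_def max_def)
    next
      case False
      with x have neg: "x < 0" by auto
      have "((\<lambda>r. e * r + r * r / 2) has_real_derivative (e + x)) (at x)"
        by (auto intro!: derivative_eq_intros)
      then have "((\<lambda>r. (e * r + r * r / 2) / e\<^sup>2) has_real_derivative (e + x) / e\<^sup>2) (at x)"
        by (rule DERIV_cdivide)
      then have "(?F has_real_derivative (e + x) / e\<^sup>2) (at x)"
        by (rule has_field_derivative_transform_within_open[where S = "{..<0}"]) (use neg in auto)
      then show ?thesis using neg x
        by (simp add: has_real_derivative_iff_has_vector_derivative tent_def max_def)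
    qed
  qed (use e in auto)
  then have "integral {-e..e} (tent e) = ?F e - ?F (-e)" by (rule integral_unique)
  also have "\<dots> = 1" using e by (simp add: power2_eq_square field_simps)
  finally show ?thesis .
qed

definition tent_transform :: "real \<Rightarrow> real \<Rightarrow> real \<Rightarrow> real"
  where "tent_transform y e u = (LBINT r. tent e r * conj_kernel y (r - u))"

lemma tent_kernel_integrable:
  assumes "e > 0" "y > 0"
  shows "integrable lborel (\<lambda>r. tent e r * conj_kernel y (r - u))"
proof (rule lborel_integrable_supported[where B = "1 / e * (1 / y)" and R = e])
  fix x
  have "\<bar>tent e x\<bar> * \<bar>conj_kernel y (x - u)\<bar> \<le> 1 / e * (1 / y)"
    using assms by (intro mult_mono abs_conj_kernel_le_y) (auto simp: tent_basic abs_of_nonneg)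
  then show "\<bar>tent e x * conj_kernel y (x - u)\<bar> \<le> 1 / e * (1 / y)" by (simp add: abs_mult)
  show "tent e x * conj_kernel y (x - u) = 0" if "\<bar>x\<bar> > e"
    using tent_basic(3)[of e x] that assms by simp
qed measurable

lemma tent_transform_odd: "e > 0 \<Longrightarrow> tent_transform y e (- u) = - tent_transform y e u"
proof -
  assume e: "e > 0"
  have "tent_transform y e (- u) = (LBINT r. tent e (0 + (-1) * r) * conj_kernel y ((0 + (-1) * r) - (- u)))"
    unfolding tent_transform_def by (subst lborel_integral_real_affine[where c = "-1" and t = 0]) auto
  also have "\<dots> = (LBINT r. - (tent e r * conj_kernel y (r - u)))"
  proof (intro Bochner_Integration.integral_cong refl)
    fix r
    show "tent e (0 + (-1) * r) * conj_kernel y ((0 + (-1) * r) - (- u)) = - (tent e r * conj_kernel y (r - u))"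
      using conj_kernel_minus[of y "r - u"] e by (simp add: tent_basic(4))
  qed
  finally show ?thesis by (simp add: tent_transform_def)
qed

lemma tent_transform_measurable [measurable]: "tent_transform y e \<in> borel_measurable borel"
proof -
  have "(\<lambda>u. LBINT r. tent e r * conj_kernel y (r - u)) \<in> borel_measurable lborel"
    by (rule lborel.borel_measurable_lebesgue_integral) measurable
  then show ?thesis by (simp add: tent_transform_def[abs_def])
qed

text \<open>
  Symmetrisation, by the oddness of the kernel, replaces the tent by the difference of its values at
  \<open>u + v\<close> and \<open>u - v\<close>, which is at most \<open>2 \<bar>v\<bar> / e\<^sup>2\<close>; this cancels the singularity of the kernel at
  \<open>v = 0\<close>.
\<close>
lemma tent_transform_near:
  assumes e: "e > 0" and y: "y > 0" and u: "\<bar>u\<bar> \<le> 2 * e"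
  shows "\<bar>tent_transform y e u\<bar> \<le> 6 / e"
proof -
  let ?q = "conj_kernel y"
  have A: "tent_transform y e u = (LBINT v. tent e (u + v) * ?q v)"
    unfolding tent_transform_def by (subst lborel_integral_real_affine[where c = 1 and t = u]) auto
  have "tent_transform y e u = (LBINT v. tent e (u + (-1) * v) * ?q (u + (-1) * v - u))"
    unfolding tent_transform_def by (subst lborel_integral_real_affine[where c = "-1" and t = u]) auto
  also have "\<dots> = (LBINT v. - (tent e (u - v) * ?q v))"
    by (intro Bochner_Integration.integral_cong refl) (simp add: conj_kernel_minus)
  finally have B: "tent_transform y e u = (LBINT v. - (tent e (u - v) * ?q v))" .
  have zero: "tent e (u + s * v) = 0" if "\<bar>v\<bar> > 3 * e" "\<bar>s\<bar> = 1" for v s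
    using that u e by (intro tent_basic(3)) (auto simp: abs_if split: if_splits)
  have iA: "integrable lborel (\<lambda>v. tent e (u + s * v) * ?q v)" if s: "\<bar>s\<bar> = 1" for s
  proof (rule lborel_integrable_supported[where B = "1 / e * (1 / y)" and R = "3 * e"])
    fix x
    have "\<bar>tent e (u + s * x)\<bar> * \<bar>?q x\<bar> \<le> 1 / e * (1 / y)"
      using e y by (intro mult_mono abs_conj_kernel_le_y) (auto simp: tent_basic abs_of_nonneg)
    then show "\<bar>tent e (u + s * x) * ?q x\<bar> \<le> 1 / e * (1 / y)" by (simp add: abs_mult)
  qed (use zero s in auto)
  have "2 * tent_transform y e u = (LBINT v. tent e (u + v) * ?q v) + (LBINT v. - (tent e (u - v) * ?q v))"
    using A B by linarith
  also have "\<dots> = (LBINT v. tent e (u + v) * ?q v + - (tent e (u - v) * ?q v))"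
    using iA[of 1] iA[of "-1"] by (intro Bochner_Integration.integral_add[symmetric]) auto
  also have "\<dots> = (LBINT v. (tent e (u + v) - tent e (u - v)) * ?q v)"
    by (intro Bochner_Integration.integral_cong refl) (simp add: algebra_simps)
  finally have "\<bar>2 * tent_transform y e u\<bar> = \<bar>LBINT v. (tent e (u + v) - tent e (u - v)) * ?q v\<bar>" by simp
  also have "\<dots> \<le> 2 / e\<^sup>2 * (2 * (3 * e))"
  proof (rule lborel_integral_supported_le)
    fix v
    have "\<bar>tent e (u + v) - tent e (u - v)\<bar> * \<bar>?q v\<bar> \<le> (\<bar>(u + v) - (u - v)\<bar> / e\<^sup>2) * \<bar>?q v\<bar>"
      by (intro mult_right_mono tent_basic e) auto
    also have "\<dots> = 2 / e\<^sup>2 * (\<bar>v\<bar> * \<bar>?q v\<bar>)" by (simp add: abs_mult)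
    also have "\<dots> \<le> 2 / e\<^sup>2 * 1" by (intro mult_left_mono abs_conj_kernel_le) auto
    finally show "\<bar>(tent e (u + v) - tent e (u - v)) * ?q v\<bar> \<le> 2 / e\<^sup>2" by (simp add: abs_mult)
    show "(tent e (u + v) - tent e (u - v)) * ?q v = 0" if "\<bar>v\<bar> > 3 * e"
      using zero[OF that, of 1] zero[OF that, of "-1"] by simp
  qed (use e in auto)
  also have "\<dots> = 12 / e" using e by (simp add: power2_eq_square)
  finally show ?thesis by (simp add: abs_mult)
qed

lemma frac_le_cross: "a * d \<le> c * b \<Longrightarrow> 0 < b \<Longrightarrow> 0 < d \<Longrightarrow> a / b \<le> c / (d::real)"
  by (simp add: pos_divide_le_eq pos_le_divide_eq)

text \<open>
  Seen from a distance larger than \<open>2 e\<close>, a shift by \<open>\<bar>r\<bar> \<le> e\<close> and the parameter \<open>y \<le> e\<close> change the kernel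
  only by a multiple of \<open>e / u\<^sup>2\<close>.
\<close>
lemma conj_kernel_far:
  assumes e: "e > 0" and y: "0 < y" "y \<le> e" and u: "\<bar>u\<bar> > 2 * e" and r: "\<bar>r\<bar> \<le> e"
  shows "\<bar>conj_kernel y (r - u) + 1 / (pi * u)\<bar> \<le> 2 * e / u\<^sup>2"
proof -
  define w where "w = u - r"
  have w: "2 * \<bar>w\<bar> \<ge> \<bar>u\<bar>" unfolding w_def using u r by (smt (verit))
  have u0: "u \<noteq> 0" using u e by auto
  have p: "w\<^sup>2 + y\<^sup>2 > 0" using y by (simp add: add_nonneg_pos)
  have "conj_kernel y (r - u) = - conj_kernel y w"
    using conj_kernel_minus[of y w] by (simp add: w_def)
  then have "conj_kernel y (r - u) + 1 / (pi * u) = (1 / u - w / (w\<^sup>2 + y\<^sup>2)) / pi"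
    by (simp add: conj_kernel_def diff_divide_distrib)
  also have "1 / u - w / (w\<^sup>2 + y\<^sup>2) = (y\<^sup>2 - r * w) / (u * (w\<^sup>2 + y\<^sup>2))"
  proof -
    have "1 / u - w / (w\<^sup>2 + y\<^sup>2) = ((w\<^sup>2 + y\<^sup>2) - w * u) / (u * (w\<^sup>2 + y\<^sup>2))"
      using u0 p by (subst diff_frac_eq) auto
    also have "(w\<^sup>2 + y\<^sup>2) - w * u = y\<^sup>2 - r * w" by (simp add: w_def power2_eq_square algebra_simps)
    finally show ?thesis .
  qed
  also have "\<bar>(y\<^sup>2 - r * w) / (u * (w\<^sup>2 + y\<^sup>2)) / pi\<bar> = \<bar>y\<^sup>2 - r * w\<bar> / (\<bar>u\<bar> * (w\<^sup>2 + y\<^sup>2)) / pi"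
    using p by (simp add: abs_divide abs_mult)
  also have "\<dots> \<le> (4 * e / u\<^sup>2) / pi"
  proof (rule divide_right_mono)
    have "\<bar>y\<^sup>2 - r * w\<bar> \<le> y * y + \<bar>r\<bar> * \<bar>w\<bar>"
      using abs_triangle_ineq4[of "y\<^sup>2" "r * w"] by (simp add: abs_mult power2_eq_square)
    also have "\<dots> \<le> e * y + e * \<bar>w\<bar>" using y r by (intro add_mono mult_right_mono) auto
    finally have 1: "\<bar>y\<^sup>2 - r * w\<bar> \<le> e * (y + \<bar>w\<bar>)" by (simp add: distrib_left)
    have "(y + \<bar>w\<bar>) * \<bar>u\<bar> \<le> (y + \<bar>w\<bar>) * (2 * \<bar>w\<bar>)" using w y by (intro mult_left_mono) auto
    also have "\<dots> = 2 * w\<^sup>2 + 2 * (y * \<bar>w\<bar>)" by (simp add: power2_eq_square algebra_simps)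
    also have "\<dots> \<le> 4 * (w\<^sup>2 + y\<^sup>2)"
    proof -
      have "0 \<le> y\<^sup>2 + w\<^sup>2 - 2 * (y * \<bar>w\<bar>)"
        using zero_le_power2[of "y - \<bar>w\<bar>"] unfolding power2_diff by (simp add: mult.assoc)
      then show ?thesis
        using zero_le_power2[of w] zero_le_power2[of y] unfolding distrib_left by linarith
    qed
    finally have 2: "(y + \<bar>w\<bar>) * \<bar>u\<bar> \<le> 4 * (w\<^sup>2 + y\<^sup>2)" .
    have "\<bar>y\<^sup>2 - r * w\<bar> * u\<^sup>2 \<le> (e * (y + \<bar>w\<bar>)) * u\<^sup>2" using 1 by (rule mult_right_mono) simp
    also have "\<dots> = (e * \<bar>u\<bar>) * ((y + \<bar>w\<bar>) * \<bar>u\<bar>)"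
    proof -
      have "u\<^sup>2 = \<bar>u\<bar> * \<bar>u\<bar>" by (simp add: power2_eq_square)
      then show ?thesis by (simp only: mult_ac)
    qed
    also have "\<dots> \<le> (e * \<bar>u\<bar>) * (4 * (w\<^sup>2 + y\<^sup>2))" using 2 e by (intro mult_left_mono) auto
    also have "\<dots> = 4 * e * (\<bar>u\<bar> * (w\<^sup>2 + y\<^sup>2))" by simp
    finally show "\<bar>y\<^sup>2 - r * w\<bar> / (\<bar>u\<bar> * (w\<^sup>2 + y\<^sup>2)) \<le> 4 * e / u\<^sup>2"
      using u0 p by (intro frac_le_cross) auto
  qed simp
  also have "\<dots> \<le> (4 * e / u\<^sup>2) / 2" using e pi_ge_two by (intro divide_left_mono) auto
  finally show ?thesis by simp
qed

lemma tent_transform_far: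
  assumes e: "e > 0" and y: "0 < y" "y \<le> e" and u: "\<bar>u\<bar> > 2 * e"
  shows "\<bar>tent_transform y e u + 1 / (pi * u)\<bar> \<le> 2 * e / u\<^sup>2"
proof -
  have i: "integrable lborel (\<lambda>r. tent e r * (1 / (pi * u)))" using tent_integrable[OF e] by auto
  note j = tent_kernel_integrable[OF e y(1), of u]
  have "tent_transform y e u + 1 / (pi * u) = (LBINT r. tent e r * conj_kernel y (r - u)) + (LBINT r. tent e r * (1 / (pi * u)))"
    unfolding tent_transform_def by (simp only: integral_mult_left_zero tent_integral[OF e] mult_1)
  also have "\<dots> = (LBINT r. tent e r * (conj_kernel y (r - u) + 1 / (pi * u)))"
    using i j by (simp only: distrib_left Bochner_Integration.integral_add)
  also have "norm \<dots> \<le> (LBINT r. tent e r * (2 * e / u\<^sup>2))"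
  proof (rule Bochner_Integration.integral_norm_bound_integral)
    show "integrable lborel (\<lambda>r. tent e r * (conj_kernel y (r - u) + 1 / (pi * u)))"
      unfolding distrib_left by (intro Bochner_Integration.integrable_add i j)
    show "integrable lborel (\<lambda>r. tent e r * (2 * e / u\<^sup>2))" using tent_integrable[OF e] by auto
    fix r
    show "norm (tent e r * (conj_kernel y (r - u) + 1 / (pi * u))) \<le> tent e r * (2 * e / u\<^sup>2)"
    proof (cases "\<bar>r\<bar> \<le> e")
      case True
      then have "tent e r * \<bar>conj_kernel y (r - u) + 1 / (pi * u)\<bar> \<le> tent e r * (2 * e / u\<^sup>2)"
        by (intro mult_left_mono conj_kernel_far assms tent_basic)
      then show ?thesis using tent_basic(1)[OF e, of r] by (simp only: real_norm_def abs_mult abs_of_nonneg)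
    qed (use e tent_basic(3)[OF e, of r] in auto)
  qed
  also have "\<dots> = 2 * e / u\<^sup>2" using tent_integral[OF e] by simp
  finally show ?thesis by simp
qed

definition pv_kernel :: "real \<Rightarrow> real \<Rightarrow> real"
  where "pv_kernel e u = (if \<bar>u\<bar> > e then 1 / (pi * u) else 0)"

text \<open>
  The regularised transform of a tent is close to \<open>- pv_kernel e\<close>. What matters about the error is that it
  is dominated by a Poisson kernel of height \<open>e\<close> and that it is odd, so that it annihilates constants on
  symmetric intervals.
\<close>
definition pv_error :: "real \<Rightarrow> real \<Rightarrow> real \<Rightarrow> real"
  where "pv_error y e u = tent_transform y e u + pv_kernel e u"

lemma pv_kernel_measurable [measurable]: "pv_kernel e \<in> borel_measurable borel"
  unfolding pv_kernel_def[abs_def] by measurable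

lemma pv_error_measurable [measurable]: "pv_error y e \<in> borel_measurable borel"
  unfolding pv_error_def[abs_def] by measurable

lemma pv_error_odd: "e > 0 \<Longrightarrow> pv_error y e (- u) = - pv_error y e u"
  by (simp add: pv_error_def pv_kernel_def tent_transform_odd)

lemma pv_kernel_bound: "e > 0 \<Longrightarrow> \<bar>pv_kernel e u\<bar> \<le> 1 / e"
proof -
  assume e: "e > 0"
  have "1 / (pi * \<bar>u\<bar>) \<le> 1 / (1 * e)" if "\<bar>u\<bar> > e"
    using that e pi_ge_two by (intro divide_left_mono mult_mono) auto
  then show ?thesis using e by (auto simp: pv_kernel_def abs_divide abs_mult)
qed

text \<open>
  The constant comes from the range \<open>\<bar>u\<bar> \<le> 2 e\<close>, where the error is at most \<open>7 / e\<close> and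
  \<open>u\<^sup>2 + e\<^sup>2 \<le> 5 e\<^sup>2\<close>.
\<close>
lemma pv_error_bound:
  assumes e: "e > 0" and y: "0 < y" "y \<le> e"
  shows "\<bar>pv_error y e u\<bar> \<le> 35 * (e / (u\<^sup>2 + e\<^sup>2))"
proof -
  have p: "u\<^sup>2 + e\<^sup>2 > 0" using e by (simp add: add_nonneg_pos)
  show ?thesis
  proof (cases "\<bar>u\<bar> \<le> 2 * e")
    case True
    have "\<bar>pv_error y e u\<bar> \<le> 6 / e + 1 / e"
      unfolding pv_error_def
      using tent_transform_near[OF e y(1) True] pv_kernel_bound[OF e, of u] by linarith
    also have "\<dots> = 7 / e" by simp
    also have "7 / e \<le> 35 * (e / (u\<^sup>2 + e\<^sup>2))"
    proof -
      have "u\<^sup>2 \<le> (2 * e)\<^sup>2" using True e by (intro abs_le_square_iff[THEN iffD1]) auto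
      then have "u\<^sup>2 + e\<^sup>2 \<le> 5 * e\<^sup>2" by (simp add: power_mult_distrib)
      then show ?thesis using e p by (simp add: divide_simps power2_eq_square)
    qed
    finally show ?thesis .
  next
    case False
    then have u: "\<bar>u\<bar> > 2 * e" by simp
    then have u0: "u \<noteq> 0" using e by auto
    have "pv_kernel e u = 1 / (pi * u)" using u e by (simp add: pv_kernel_def)
    then have "\<bar>pv_error y e u\<bar> \<le> 2 * e / u\<^sup>2"
      unfolding pv_error_def using tent_transform_far[OF e y u] by simp
    also have "\<dots> \<le> 35 * (e / (u\<^sup>2 + e\<^sup>2))"
    proof -
      have "e\<^sup>2 \<le> u\<^sup>2" using u e by (intro abs_le_square_iff[THEN iffD1]) auto
      then have "2 * (u\<^sup>2 + e\<^sup>2) \<le> 2 * (u\<^sup>2 + u\<^sup>2)" by simp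
      also have "\<dots> = 4 * u\<^sup>2" by simp
      also have "\<dots> \<le> 35 * u\<^sup>2" by (intro mult_right_mono) auto
      finally have "2 * (u\<^sup>2 + e\<^sup>2) \<le> 35 * u\<^sup>2" .
      then have "e * (2 * (u\<^sup>2 + e\<^sup>2)) \<le> e * (35 * u\<^sup>2)" using e by (intro mult_left_mono) auto
      then show ?thesis using e p u0 by (simp add: divide_simps mult_ac)
    qed
    finally show ?thesis .
  qed
qed

text \<open>
  A dyadic decomposition: at distance about \<open>2\<^sup>k e\<close> from \<open>t\<close> the kernel is at most \<open>4 / (4\<^sup>k e)\<close>, and the
  mass of \<open>h\<close> there is at most \<open>2\<^sup>k c e\<close>.
\<close>
lemma poisson_lebesgue_estimate:
  fixes h :: "real \<Rightarrow> real"
  assumes h: "integrable mu h" and nn: "\<And>x. 0 \<le> h x" and r: "r > 0" and e: "e > 0" and c: "c \<ge> 0"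
    and N: "\<And>s. 0 < s \<Longrightarrow> s \<le> r \<Longrightarrow> (LINT x:cball t s|mu. h x) \<le> c * s"
  shows "(LINT x:cball t r|mu. h x * (e / ((x - t)\<^sup>2 + e\<^sup>2))) \<le> 8 * c"
proof -
  \<comment> \<open>The largest ball is reached after \<open>K\<close> doublings; the radii are cut off at \<open>r\<close>, where the hypothesis ends.\<close>
  obtain K where K: "r / e < 2 ^ K" using real_arch_pow[of 2 "r / e"] by auto
  let ?m = "\<lambda>k::nat. min (2 ^ k * e) r"
  let ?S = "\<lambda>x. \<Sum>k\<le>K. (4 / e * (1 / 4) ^ k) * (indicator (cball t (?m k)) x *\<^sub>R h x)"
  have [measurable]: "h \<in> borel_measurable mu" using h by simp
  have ii: "integrable mu (\<lambda>x. indicator (cball t s) x *\<^sub>R h x)" for s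
    using set_integrable_mu[OF h, of "cball t s"] by (simp add: set_integrable_def)
  have pb: "e / (u\<^sup>2 + e\<^sup>2) \<le> 1 / e" for u
  proof -
    have "e / (u\<^sup>2 + e\<^sup>2) \<le> e / e\<^sup>2" using e by (intro divide_left_mono) (auto intro!: mult_pos_pos add_nonneg_pos)
    then show ?thesis using e by (simp add: power2_eq_square)
  qed
  have pt: "e / ((x - t)\<^sup>2 + e\<^sup>2) \<le> (\<Sum>k\<le>K. (4 / e * (1 / 4) ^ k) * indicator (cball t (?m k)) x)"
    if x: "x \<in> cball t r" for x
  proof -
    let ?P = "\<lambda>k. \<bar>x - t\<bar> \<le> 2 ^ k * e"
    have xr: "\<bar>x - t\<bar> \<le> r" using x by (simp add: dist_real_def abs_minus_commute)
    have "?P K" using K xr e by (simp add: divide_simps)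
    then have ex: "\<exists>k. ?P k" by blast
    define k where "k = (LEAST k. ?P k)"
    have Pk: "?P k" unfolding k_def using ex by (rule LeastI_ex)
    have kK: "k \<le> K" unfolding k_def using \<open>?P K\<close> by (rule Least_le)
    have "e / ((x - t)\<^sup>2 + e\<^sup>2) \<le> 4 / e * (1 / 4) ^ k"
    proof (cases k)
      case 0
      have "1 / e \<le> 4 / e" using e by (intro divide_right_mono) auto
      with pb[of "x - t"] 0 show ?thesis by simp
    next
      case (Suc j)
      have "\<not> ?P j" using not_less_Least[of j ?P] Suc k_def by simp
      then have gt: "2 ^ j * e < \<bar>x - t\<bar>" by simp
      then have "(2 ^ j * e)\<^sup>2 \<le> (x - t)\<^sup>2" using e by (intro abs_le_square_iff[THEN iffD1]) auto
      then have "(2 ^ j * e)\<^sup>2 \<le> (x - t)\<^sup>2 + e\<^sup>2" by (simp add: add_increasing2)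
      moreover have "(2 ^ j * e)\<^sup>2 > 0" using e by simp
      ultimately have "e / ((x - t)\<^sup>2 + e\<^sup>2) \<le> e / (2 ^ j * e)\<^sup>2"
        using e by (intro divide_left_mono mult_pos_pos) (auto simp: add_nonneg_pos)
      also have "\<dots> = 1 / (e * 4 ^ j)" using e
        by (simp add: power_mult_distrib power2_eq_square flip: power_mult_distrib)
      also have "\<dots> = 4 / e * (1 / 4) ^ k" using e Suc by (simp add: power_one_over field_simps)
      finally show ?thesis .
    qed
    also have "\<dots> = (4 / e * (1 / 4) ^ k) * indicator (cball t (?m k)) x"
      using Pk xr by (simp add: dist_real_def abs_minus_commute)
    also have "\<dots> \<le> (\<Sum>k\<le>K. (4 / e * (1 / 4) ^ k) * indicator (cball t (?m k)) x)"
      using kK e by (intro member_le_sum) auto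
    finally show ?thesis .
  qed
  have i1: "integrable mu (\<lambda>x. indicator (cball t r) x *\<^sub>R (h x * (e / ((x - t)\<^sup>2 + e\<^sup>2))))"
  proof (rule set_integrable_mu[unfolded set_integrable_def])
    show "integrable mu (\<lambda>x. h x * (e / ((x - t)\<^sup>2 + e\<^sup>2)))"
    proof (rule integrable_mult_bounded[OF h, where B = "1 / e"])
      show "norm (e / ((x - t)\<^sup>2 + e\<^sup>2)) \<le> 1 / e" for x
        using pb[of "x - t"] e by simp
    qed measurable
  qed simp
  have "(LINT x:cball t r|mu. h x * (e / ((x - t)\<^sup>2 + e\<^sup>2))) \<le> (LINT x|mu. ?S x)"
    unfolding set_lebesgue_integral_def
  proof (rule integral_mono[OF i1])
    show "integrable mu ?S" using ii by (intro Bochner_Integration.integrable_sum integrable_mult_right)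
    fix x
    show "indicator (cball t r) x *\<^sub>R (h x * (e / ((x - t)\<^sup>2 + e\<^sup>2))) \<le> ?S x"
    proof (cases "x \<in> cball t r")
      case True
      have "h x * (e / ((x - t)\<^sup>2 + e\<^sup>2)) \<le> h x * (\<Sum>k\<le>K. (4 / e * (1 / 4) ^ k) * indicator (cball t (?m k)) x)"
        by (intro mult_left_mono pt True nn)
      also have "\<dots> = ?S x" by (simp add: sum_distrib_left mult_ac)
      finally show ?thesis using True by simp
    next
      case False
      then show ?thesis using nn e by (auto intro!: sum_nonneg)
    qed
  qed
  also have "\<dots> = (\<Sum>k\<le>K. (4 / e * (1 / 4) ^ k) * (LINT x:cball t (?m k)|mu. h x))"
    unfolding set_lebesgue_integral_def using ii by (subst Bochner_Integration.integral_sum) auto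
  also have "\<dots> \<le> (\<Sum>k\<le>K. 4 * c * (1 / 2) ^ k)"
  proof (rule sum_mono)
    fix k
    have "(LINT x:cball t (?m k)|mu. h x) \<le> c * ?m k" using r e by (intro N) auto
    also have "\<dots> \<le> c * (2 ^ k * e)" using c by (intro mult_left_mono) auto
    finally have "(4 / e * (1 / 4) ^ k) * (LINT x:cball t (?m k)|mu. h x) \<le> (4 / e * (1 / 4) ^ k) * (c * (2 ^ k * e))"
      using e by (intro mult_left_mono) auto
    also have "\<dots> = 4 * c * ((1 / 4) ^ k * 2 ^ k)" using e by simp
    also have "(1 / 4) ^ k * 2 ^ k = (1 / 2 :: real) ^ k" by (simp flip: power_mult_distrib)
    finally show "(4 / e * (1 / 4) ^ k) * (LINT x:cball t (?m k)|mu. h x) \<le> 4 * c * (1 / 2) ^ k" .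
  qed
  also have "\<dots> = 4 * c * (\<Sum>k\<le>K. (1 / 2) ^ k)" by (simp add: sum_distrib_left)
  also have "(\<Sum>k\<le>K. (1 / 2 :: real) ^ k) \<le> 2" by (simp add: sum_gp0)
  then have "4 * c * (\<Sum>k\<le>K. (1 / 2) ^ k) \<le> 4 * c * 2" using c by (intro mult_left_mono) auto
  finally show ?thesis by simp
qed

lemma truncated_hilbert_kernel:
  assumes g: "integrable mu g" and e: "0 < e"
  shows "truncated_hilbert g t e = (LINT x|mu. g x * complex_of_real (pv_kernel e (x - t)))"
    and "integrable mu (\<lambda>x. g x * complex_of_real (pv_kernel e (x - t)))"
proof -
  have [measurable]: "g \<in> borel_measurable mu" using g by simp
  have [measurable]: "(\<lambda>x. pv_kernel e (x - t)) \<in> borel_measurable mu"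
    by (rule borel_measurable_mu) measurable
  show i: "integrable mu (\<lambda>x. g x * complex_of_real (pv_kernel e (x - t)))"
    by (rule integrable_mult_bounded[OF g, where B = "1 / e"]) (use pv_kernel_bound[OF e] in auto)
  let ?k = "\<lambda>x. g x * complex_of_real (pv_kernel e (x - t))"
  have A: "(LINT x:{-1<..<t - e}|mu. g x / complex_of_real (x - t)) = complex_of_real pi * (LINT x:{..<t - e}|mu. ?k x)"
    unfolding set_lebesgue_integral_def integral_mult_right_zero[symmetric]
    by (intro Bochner_Integration.integral_cong) (use e in \<open>auto simp: space_mu indicator_def pv_kernel_def\<close>)
  have B: "(LINT x:{t + e<..<1}|mu. g x / complex_of_real (x - t)) = complex_of_real pi * (LINT x:{t + e<..}|mu. ?k x)"
    unfolding set_lebesgue_integral_def integral_mult_right_zero[symmetric]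
    by (intro Bochner_Integration.integral_cong) (use e in \<open>auto simp: space_mu indicator_def pv_kernel_def\<close>)
  have "truncated_hilbert g t e = (LINT x:{..<t - e}|mu. ?k x) + (LINT x:{t + e<..}|mu. ?k x)"
    unfolding truncated_hilbert_def A B by (simp add: field_simps)
  also have "\<dots> = (LINT x|mu. indicator {..<t - e} x *\<^sub>R ?k x + indicator {t + e<..} x *\<^sub>R ?k x)"
    unfolding set_lebesgue_integral_def
    using set_integrable_mu[OF i, of "{..<t - e}"] set_integrable_mu[OF i, of "{t + e<..}"]
    by (intro Bochner_Integration.integral_add[symmetric]) (auto simp: set_integrable_def)
  also have "\<dots> = (LINT x|mu. ?k x)"
    by (intro Bochner_Integration.integral_cong) (use e in \<open>auto simp: indicator_def pv_kernel_def\<close>)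
  finally show "truncated_hilbert g t e = (LINT x|mu. ?k x)" .
qed

lemma conj_poisson_tent:
  assumes t: "e < 1 - \<bar>t\<bar>" and e: "e > 0"
  shows "conj_poisson y (\<lambda>x. complex_of_real (tent e (x - t))) x0 = complex_of_real (tent_transform y e (x0 - t))"
proof -
  have "conj_poisson y (\<lambda>x. complex_of_real (tent e (x - t))) x0 = complex_of_real (LINT x|mu. tent e (x - t) * conj_kernel y (x - x0))"
    by (rule conj_poisson_real)
  also have "(LINT x|mu. tent e (x - t) * conj_kernel y (x - x0)) = (LBINT x. tent e (x - t) * conj_kernel y (x - x0))"
    unfolding integral_mu set_lebesgue_integral_def
  proof (intro Bochner_Integration.integral_cong refl)
    fix x
    show "indicator {-1<..<1} x *\<^sub>R (tent e (x - t) * conj_kernel y (x - x0)) = tent e (x - t) * conj_kernel y (x - x0)"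
    proof (cases "x \<in> {-1<..<1}")
      case False
      then have "e \<le> \<bar>x - t\<bar>" using t by (auto simp: abs_if split: if_splits)
      then show ?thesis using tent_basic(3)[OF e] by simp
    qed simp
  qed
  also have "\<dots> = (LBINT r. tent e (t + 1 * r - t) * conj_kernel y (t + 1 * r - x0))"
    by (subst lborel_integral_real_affine[where c = 1 and t = t]) auto
  also have "\<dots> = tent_transform y e (x0 - t)"
    unfolding tent_transform_def by (simp add: algebra_simps)
  finally show ?thesis .
qed

lemma pv_error_integral_zero:
  assumes t: "r < 1 - \<bar>t\<bar>" and e: "e > 0"
  shows "(LINT x:cball t r|mu. pv_error y e (x - t)) = 0"
proof -
  let ?I = "LBINT u. indicator {-r..r} u * pv_error y e u"
  have "(LINT x:cball t r|mu. pv_error y e (x - t)) = (LBINT x. indicator {t - r..t + r} x * pv_error y e (x - t))"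
    unfolding integral_mu set_lebesgue_integral_def
    by (intro Bochner_Integration.integral_cong refl)
       (use t in \<open>auto simp: indicator_def cball_eq_atLeastAtMost abs_if split: if_splits\<close>)
  also have "\<dots> = (LBINT u. indicator {t - r..t + r} (t + 1 * u) * pv_error y e (t + 1 * u - t))"
    by (subst lborel_integral_real_affine[where c = 1 and t = t]) auto
  also have "\<dots> = ?I"
    by (intro Bochner_Integration.integral_cong refl) (auto simp: indicator_def)
  finally have A: "(LINT x:cball t r|mu. pv_error y e (x - t)) = ?I" .
  have "?I = (LBINT u. indicator {-r..r} (0 + (-1) * u) * pv_error y e (0 + (-1) * u))"
    by (subst lborel_integral_real_affine[where c = "-1" and t = 0]) auto
  also have "\<dots> = (LBINT u. - (indicator {-r..r} u * pv_error y e u))"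
    using pv_error_odd[OF e, of y] by (intro Bochner_Integration.integral_cong refl) (auto simp: indicator_def)
  also have "\<dots> = - ?I" by simp
  finally have "?I = 0" by simp
  with A show ?thesis by simp
qed

text \<open>
  The mean of \<open>G\<close> against the tent of width \<open>e\<close> at \<open>t\<close> is close to \<open>G t\<close>. In it, \<open>G\<close> may be replaced by
  \<open>conj_poisson y g\<close> for a small \<open>y\<close> depending on \<open>e\<close>. Duality then moves the kernel from \<open>g\<close> to the tent,
  whose transform is \<open>- pv_kernel e\<close> up to \<open>pv_error\<close>; this produces the truncated integral of \<open>g\<close>, and
  at a Lebesgue point of \<open>g\<close> the error is small.
\<close>
theorem pv_limit:
  assumes g: "integrable mu g" and G: "mean_limit g G" and t: "t \<in> {-1<..<1}"
    and lg: "lebesgue_point g t" and lG: "lebesgue_point G t"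
  shows "(truncated_hilbert g t \<longlongrightarrow> G t) (at_right 0)"
proof (rule tendstoI)
  fix c0 :: real assume c0: "c0 > 0"
  \<comment> \<open>The errors below add up to \<open>(1 + 1 + 35 * 9) c\<close>, which is at most \<open>350 c\<close>.\<close>
  define c where "c = c0 / 400"
  have c: "c > 0" using c0 by (simp add: c_def)
  have Gi: "integrable mu G" and Gl: "((\<lambda>y. LINT x|mu. cmod (conj_poisson y g x - G x)) \<longlongrightarrow> 0) (at_right 0)"
    using G by (auto simp: mean_limit_def)
  have [measurable]: "g \<in> borel_measurable mu" "G \<in> borel_measurable mu" using g Gi by auto
  obtain d1 where d1: "d1 > 0" "\<And>r. 0 < r \<Longrightarrow> r < d1 \<Longrightarrow> (LINT x:cball t r|mu. cmod (g x - g t)) \<le> c * r"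
    using lg c unfolding lebesgue_point_def by blast
  obtain d2 where d2: "d2 > 0" "\<And>r. 0 < r \<Longrightarrow> r < d2 \<Longrightarrow> (LINT x:cball t r|mu. cmod (G x - G t)) \<le> c * r"
    using lG c unfolding lebesgue_point_def by blast
  define r where "r = min d1 (1 - \<bar>t\<bar>) / 2"
  have r: "r > 0" "r < d1" "r < 1 - \<bar>t\<bar>" using d1 t by (auto simp: r_def min_def abs_if split: if_splits)
  define M where "M = (LINT x|mu. cmod (g x))"
  have M: "M \<ge> 0" by (simp add: M_def)
  \<comment> \<open>Outside the ball of radius \<open>r\<close> the error kernel is at most \<open>35 e / r\<^sup>2\<close>, so for \<open>e < d3\<close> it contributes at most \<open>35 c\<close>.\<close>
  define d3 where "d3 = c * r\<^sup>2 / (M + 1)"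
  have d3: "d3 > 0" using c r M by (simp add: d3_def)
  have main: "cmod (truncated_hilbert g t e - G t) \<le> 350 * c"
    if e: "0 < e" "e < min d2 (min d3 r)" for e
  proof -
    let ?k = "\<lambda>x. complex_of_real (tent e (x - t))"
    have et: "e < 1 - \<bar>t\<bar>" using e r by simp
    obtain y where y: "0 < y" "y \<le> e" "(LINT x|mu. cmod (conj_poisson y g x - G x)) \<le> c * e"
    proof -
      have "\<forall>\<^sub>F y in at_right 0. dist (LINT x|mu. cmod (conj_poisson y g x - G x)) 0 < c * e"
        using Gl c e by (intro tendstoD) auto
      then obtain b where b: "b > 0" "\<And>y. 0 < y \<Longrightarrow> y < b \<Longrightarrow> dist (LINT x|mu. cmod (conj_poisson y g x - G x)) 0 < c * e"
        unfolding eventually_at_right_field by auto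
      show ?thesis
        by (rule that[of "min e (b / 2)"]) (use b(1) b(2)[of "min e (b / 2)"] e in \<open>auto simp: min_def split: if_splits\<close>)
    qed
    have yi: "integrable mu (conj_poisson y g)" by (intro conj_poisson_integrable g y)
    then have [measurable]: "conj_poisson y g \<in> borel_measurable mu" by simp
    have kb: "cmod (?k x) \<le> 1 / e" for x using tent_basic(1,2)[OF e(1), of "x - t"] by simp
    have km[measurable]: "?k \<in> borel_measurable mu" by (rule borel_measurable_mu) measurable
    have ki: "integrable mu ?k" by (rule integrable_mu_bounded[OF km kb])
    have mk: "integrable mu (\<lambda>x. f x * ?k x)" if "integrable mu f" for f
      using that km kb by (rule integrable_mult_bounded)
    have k1: "(LINT x|mu. ?k x) = 1"
    proof -
      have "(LINT x|mu. tent e (x - t)) = (LBINT x. tent e (x - t))"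
        unfolding integral_mu set_lebesgue_integral_def
      proof (intro Bochner_Integration.integral_cong refl)
        fix x
        show "indicator {-1<..<1} x *\<^sub>R (tent e (x - t)) = tent e (x - t)"
        proof (cases "x \<in> {-1<..<1}")
          case False
          then have "e \<le> \<bar>x - t\<bar>" using et by (auto simp: abs_if split: if_splits)
          then show ?thesis using tent_basic(3)[OF e(1)] by simp
        qed simp
      qed
      also have "\<dots> = (LBINT r. tent e (t + 1 * r - t))"
        by (subst lborel_integral_real_affine[where c = 1 and t = t]) auto
      also have "\<dots> = 1" using tent_integral[OF e(1)] by simp
      finally show ?thesis by simp
    qed
    \<comment> \<open>This uses the Lebesgue point of \<open>G\<close>: the tent is at most \<open>1 / e\<close> and lives on the ball of radius \<open>e\<close>.\<close>
    have a: "cmod ((LINT x|mu. G x * ?k x) - G t) \<le> c"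
    proof -
      have "(LINT x|mu. G x * ?k x) - G t = (LINT x|mu. G x * ?k x) - (LINT x|mu. G t * ?k x)"
        using k1 by simp
      also have "\<dots> = (LINT x|mu. G x * ?k x - G t * ?k x)"
        using mk[OF Gi] ki by (intro Bochner_Integration.integral_diff[symmetric]) auto
      also have "cmod \<dots> \<le> (LINT x|mu. 1 / e * (indicator (cball t e) x *\<^sub>R cmod (G x - G t)))"
      proof (rule Bochner_Integration.integral_norm_bound_integral)
        show "integrable mu (\<lambda>x. G x * ?k x - G t * ?k x)" using mk[OF Gi] ki by auto
        have "set_integrable mu (cball t e) (\<lambda>x. cmod (G x - G t))"
          using Gi by (intro set_integrable_mu) auto
        then show "integrable mu (\<lambda>x. 1 / e * (indicator (cball t e) x *\<^sub>R cmod (G x - G t)))"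
          unfolding set_integrable_def by (intro integrable_mult_right)
        fix x
        show "norm (G x * ?k x - G t * ?k x) \<le> 1 / e * (indicator (cball t e) x *\<^sub>R cmod (G x - G t))"
        proof (cases "x \<in> cball t e")
          case True
          have "norm (G x * ?k x - G t * ?k x) = cmod (?k x) * cmod (G x - G t)"
            by (simp only: left_diff_distrib[symmetric] norm_mult mult.commute)
          also have "\<dots> \<le> 1 / e * cmod (G x - G t)" by (intro mult_right_mono kb) auto
          finally show ?thesis using True by simp
        next
          case False
          then have "tent e (x - t) = 0" using tent_basic(3)[OF e(1), of "x - t"] by (auto simp: dist_real_def abs_minus_commute)
          then show ?thesis using False by simp
        qed
      qed
      also have "\<dots> = 1 / e * (LINT x:cball t e|mu. cmod (G x - G t))"
        by (simp add: set_lebesgue_integral_def)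
      also have "\<dots> \<le> 1 / e * (c * e)" using d2(2)[of e] e by (intro mult_left_mono) auto
      finally show ?thesis using e by simp
    qed
    have b: "cmod ((LINT x|mu. conj_poisson y g x * ?k x) - (LINT x|mu. G x * ?k x)) \<le> c"
    proof -
      have "(LINT x|mu. conj_poisson y g x * ?k x) - (LINT x|mu. G x * ?k x) = (LINT x|mu. conj_poisson y g x * ?k x - G x * ?k x)"
        using mk[OF Gi] mk[OF yi] by (intro Bochner_Integration.integral_diff[symmetric]) auto
      also have "cmod \<dots> \<le> (LINT x|mu. 1 / e * cmod (conj_poisson y g x - G x))"
      proof (rule Bochner_Integration.integral_norm_bound_integral)
        show "integrable mu (\<lambda>x. conj_poisson y g x * ?k x - G x * ?k x)" using mk[OF Gi] mk[OF yi] by auto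
        show "integrable mu (\<lambda>x. 1 / e * cmod (conj_poisson y g x - G x))" using yi Gi by auto
        fix x
        have "norm (conj_poisson y g x * ?k x - G x * ?k x) = cmod (?k x) * cmod (conj_poisson y g x - G x)"
          by (simp only: left_diff_distrib[symmetric] norm_mult mult.commute)
        also have "\<dots> \<le> 1 / e * cmod (conj_poisson y g x - G x)" by (intro mult_right_mono kb) auto
        finally show "norm (conj_poisson y g x * ?k x - G x * ?k x) \<le> 1 / e * cmod (conj_poisson y g x - G x)" .
      qed
      also have "\<dots> = 1 / e * (LINT x|mu. cmod (conj_poisson y g x - G x))" by simp
      also have "\<dots> \<le> 1 / e * (c * e)" using y(3) e by (intro mult_left_mono) auto
      finally show ?thesis using e by simp
    qed
    \<comment> \<open>Antisymmetry moves the kernel to the tent. The constant 9 is 8 from the Lebesgue point of \<open>g\<close>, near \<open>t\<close>, and 1 from the rest.\<close>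
    have d: "cmod ((LINT x|mu. conj_poisson y g x * ?k x) - truncated_hilbert g t e) \<le> 35 * (9 * c)"
    proof -
      let ?E = "\<lambda>x. complex_of_real (pv_error y e (x - t))"
      have Em[measurable]: "(\<lambda>x. pv_error y e (x - t)) \<in> borel_measurable mu"
        by (rule borel_measurable_mu) measurable
      have Eb: "cmod (?E x) \<le> 35 * (e / ((x - t)\<^sup>2 + e\<^sup>2))" for x
        using pv_error_bound[OF e(1) y(1,2), of "x - t"] by simp
      have pb: "e / (u\<^sup>2 + e\<^sup>2) \<le> 1 / e" for u
      proof -
        have "e / (u\<^sup>2 + e\<^sup>2) \<le> e / e\<^sup>2" using e by (intro divide_left_mono) (auto intro!: mult_pos_pos add_nonneg_pos)
        then show ?thesis using e by (simp add: power2_eq_square)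
      qed
      have Eb2: "cmod (?E x) \<le> 35 / e" for x
        using Eb[of x] pb[of "x - t"] by simp
      have Ei: "integrable mu ?E"
      proof (rule integrable_mu_bounded[where B = "35 / e"])
        show "?E \<in> borel_measurable mu" by measurable
      qed (rule Eb2)
      have fE: "integrable mu (\<lambda>x. f x * ?E x)" if "integrable mu f" for f
        by (rule integrable_mult_bounded[OF that _ Eb2]) measurable
      have Si: "set_integrable mu (cball t r) (\<lambda>x. cmod (g x - g t) * (e / ((x - t)\<^sup>2 + e\<^sup>2)))"
      proof (rule set_integrable_mu)
        show "integrable mu (\<lambda>x. cmod (g x - g t) * (e / ((x - t)\<^sup>2 + e\<^sup>2)))"
        proof (rule integrable_mult_bounded[where B = "1 / e"])
          show "norm (e / ((x - t)\<^sup>2 + e\<^sup>2)) \<le> 1 / e" for x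
            using pb[of "x - t"] e by simp
        qed (use g in auto)
      qed simp
      have A1: "(LINT x|mu. conj_poisson y g x * ?k x) = - (LINT x|mu. g x * complex_of_real (tent_transform y e (x - t)))"
        by (subst conj_poisson_duality[OF g ki y(1)]) (simp add: conj_poisson_tent[OF et e(1)])
      have A2: "(LINT x|mu. g x * ?E x) = (LINT x|mu. g x * complex_of_real (tent_transform y e (x - t))) + truncated_hilbert g t e"
      proof -
        note i = truncated_hilbert_kernel(2)[OF g e(1), of t]
        have j: "integrable mu (\<lambda>x. g x * complex_of_real (tent_transform y e (x - t)))"
          using Bochner_Integration.integrable_diff[OF fE[OF g] i] by (simp add: pv_error_def algebra_simps)
        show ?thesis
          unfolding truncated_hilbert_kernel(1)[OF g e(1)]
          using Bochner_Integration.integral_add[OF j i] by (simp add: pv_error_def algebra_simps)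
      qed
      have "(LINT x|mu. conj_poisson y g x * ?k x) - truncated_hilbert g t e = - (LINT x|mu. g x * ?E x)"
        unfolding A1 A2 by simp
      then have "cmod ((LINT x|mu. conj_poisson y g x * ?k x) - truncated_hilbert g t e) = cmod (LINT x|mu. g x * ?E x)"
        by (simp only: norm_minus_cancel)
      also have "(LINT x|mu. g x * ?E x) = (LINT x|mu. indicator (cball t r) x *\<^sub>R ((g x - g t) * ?E x) + indicator (- cball t r) x *\<^sub>R (g x * ?E x))"
      proof -
        \<comment> \<open>The constant \<open>g t\<close> may be subtracted near \<open>t\<close> because the error kernel is odd.\<close>
        have z: "(LINT x|mu. g t * (indicator (cball t r) x *\<^sub>R ?E x)) = 0"
        proof -
          have "(LINT x|mu. indicator (cball t r) x *\<^sub>R ?E x) = complex_of_real (LINT x:cball t r|mu. pv_error y e (x - t))"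
            unfolding set_lebesgue_integral_def integral_complex_of_real[symmetric]
            by (intro Bochner_Integration.integral_cong) (auto simp: scaleR_conv_of_real)
          also have "\<dots> = 0" using pv_error_integral_zero[OF r(3) e(1)] by simp
          finally show ?thesis by (simp only: integral_mult_right_zero mult_zero_right)
        qed
        have i2: "integrable mu (\<lambda>x. g t * (indicator (cball t r) x *\<^sub>R ?E x))"
          using set_integrable_mu[OF Ei, of "cball t r"] by (intro integrable_mult_right) (simp add: set_integrable_def)
        have "(LINT x|mu. g x * ?E x) = (LINT x|mu. g x * ?E x) - (LINT x|mu. g t * (indicator (cball t r) x *\<^sub>R ?E x))"
          by (simp only: z diff_zero)
        also have "\<dots> = (LINT x|mu. g x * ?E x - g t * (indicator (cball t r) x *\<^sub>R ?E x))"
          by (rule Bochner_Integration.integral_diff[symmetric, OF fE[OF g] i2])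
        also have "\<dots> = (LINT x|mu. indicator (cball t r) x *\<^sub>R ((g x - g t) * ?E x) + indicator (- cball t r) x *\<^sub>R (g x * ?E x))"
          by (intro Bochner_Integration.integral_cong refl) (auto simp: indicator_def algebra_simps)
        finally show ?thesis .
      qed
      also have "cmod \<dots> \<le> (LINT x|mu. 35 * (indicator (cball t r) x *\<^sub>R (cmod (g x - g t) * (e / ((x - t)\<^sup>2 + e\<^sup>2)))) + 35 * (e / r\<^sup>2 * cmod (g x)))"
      proof (rule Bochner_Integration.integral_norm_bound_integral)
        have "integrable mu (\<lambda>x. g x - g t)" using g by simp
        then have "set_integrable mu (cball t r) (\<lambda>x. (g x - g t) * ?E x)"
          by (rule set_integrable_mu[OF fE]) simp
        moreover have "set_integrable mu (- cball t r) (\<lambda>x. g x * ?E x)"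
          by (rule set_integrable_mu[OF fE[OF g]]) simp
        ultimately show "integrable mu (\<lambda>x. indicator (cball t r) x *\<^sub>R ((g x - g t) * ?E x) + indicator (- cball t r) x *\<^sub>R (g x * ?E x))"
          unfolding set_integrable_def by (rule Bochner_Integration.integrable_add)
        from Si show "integrable mu (\<lambda>x. 35 * (indicator (cball t r) x *\<^sub>R (cmod (g x - g t) * (e / ((x - t)\<^sup>2 + e\<^sup>2)))) + 35 * (e / r\<^sup>2 * cmod (g x)))"
          unfolding set_integrable_def using g by (intro Bochner_Integration.integrable_add integrable_mult_right integrable_norm)
        fix x
        show "norm (indicator (cball t r) x *\<^sub>R ((g x - g t) * ?E x) + indicator (- cball t r) x *\<^sub>R (g x * ?E x))
          \<le> 35 * (indicator (cball t r) x *\<^sub>R (cmod (g x - g t) * (e / ((x - t)\<^sup>2 + e\<^sup>2)))) + 35 * (e / r\<^sup>2 * cmod (g x))"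
        proof (cases "x \<in> cball t r")
          case True
          have "cmod (g x - g t) * cmod (?E x) \<le> cmod (g x - g t) * (35 * (e / ((x - t)\<^sup>2 + e\<^sup>2)))"
            by (intro mult_left_mono Eb) auto
          then have "cmod (g x - g t) * cmod (?E x) \<le> 35 * (cmod (g x - g t) * (e / ((x - t)\<^sup>2 + e\<^sup>2)))"
            by (simp only: mult.left_commute)
          moreover have "0 \<le> 35 * (e / r\<^sup>2 * cmod (g x))" using e by simp
          ultimately have "cmod (g x - g t) * cmod (?E x) \<le> 35 * (cmod (g x - g t) * (e / ((x - t)\<^sup>2 + e\<^sup>2))) + 35 * (e / r\<^sup>2 * cmod (g x))"
            by (rule add_increasing2[rotated])
          then show ?thesis using True by (simp add: norm_mult)
        next
          case False
          then have "r < \<bar>x - t\<bar>" by (simp add: dist_real_def abs_minus_commute)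
          then have "r\<^sup>2 \<le> (x - t)\<^sup>2" using r by (intro abs_le_square_iff[THEN iffD1]) auto
          then have "r\<^sup>2 \<le> (x - t)\<^sup>2 + e\<^sup>2" by (simp add: add_increasing2)
          then have "e / ((x - t)\<^sup>2 + e\<^sup>2) \<le> e / r\<^sup>2"
            using e r by (intro divide_left_mono mult_pos_pos) (auto simp: add_nonneg_pos)
          then have "35 * (e / ((x - t)\<^sup>2 + e\<^sup>2)) \<le> 35 * (e / r\<^sup>2)" by simp
          with Eb[of x] have "cmod (?E x) \<le> 35 * (e / r\<^sup>2)" by (rule order_trans)
          then have "cmod (g x) * cmod (?E x) \<le> cmod (g x) * (35 * (e / r\<^sup>2))"
            by (intro mult_left_mono) auto
          then show ?thesis using False by (simp add: norm_mult mult_ac)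
        qed
      qed
      also have "\<dots> = 35 * (LINT x:cball t r|mu. cmod (g x - g t) * (e / ((x - t)\<^sup>2 + e\<^sup>2))) + 35 * (e / r\<^sup>2 * M)"
      proof -
        from Si have I: "integrable mu (\<lambda>x. 35 * (indicator (cball t r) x *\<^sub>R (cmod (g x - g t) * (e / ((x - t)\<^sup>2 + e\<^sup>2)))))"
          unfolding set_integrable_def by (rule integrable_mult_right)
        have J: "integrable mu (\<lambda>x. 35 * (e / r\<^sup>2 * cmod (g x)))" using g by auto
        show ?thesis
          unfolding Bochner_Integration.integral_add[OF I J] integral_mult_right_zero set_lebesgue_integral_def M_def by simp
      qed
      also have "\<dots> \<le> 35 * (8 * c) + 35 * c"
      proof (intro add_mono mult_left_mono)
        show "(LINT x:cball t r|mu. cmod (g x - g t) * (e / ((x - t)\<^sup>2 + e\<^sup>2))) \<le> 8 * c"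
          using g d1(2) r c e by (intro poisson_lebesgue_estimate) auto
        have "e * M \<le> d3 * (M + 1)" using e M by (intro mult_mono) auto
        also have "\<dots> = c * r\<^sup>2" using M by (simp add: d3_def)
        finally show "e / r\<^sup>2 * M \<le> c" using r by (simp add: divide_simps)
      qed auto
      finally show ?thesis by simp
    qed
    have "truncated_hilbert g t e - G t = ((LINT x|mu. G x * ?k x) - G t)
       + (((LINT x|mu. conj_poisson y g x * ?k x) - (LINT x|mu. G x * ?k x))
       - ((LINT x|mu. conj_poisson y g x * ?k x) - truncated_hilbert g t e))" by simp
    also have "cmod \<dots> \<le> c + (c + 35 * (9 * c))"
      by (intro norm_triangle_mono order_trans[OF norm_triangle_ineq4] add_mono a b d)
    finally show ?thesis using c by simp
  qed
  show "\<forall>\<^sub>F e in at_right 0. dist (truncated_hilbert g t e) (G t) < c0"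
    unfolding eventually_at_right_field
  proof (intro exI[of _ "min d2 (min d3 r)"] conjI allI impI)
    fix e assume "0 < e" "e < min d2 (min d3 r)"
    from main[OF this] show "dist (truncated_hilbert g t e) (G t) < c0"
      using c0 by (simp add: dist_norm c_def)
  qed (use d2 d3 r in auto)
qed

section \<open>The finite Hilbert transform as a limit in mean\<close>

lemma inverse_Suc_at_right_0: "filterlim (\<lambda>n. 1 / real (Suc n)) (at_right 0) sequentially"
  unfolding filterlim_at using LIMSEQ_Suc[OF lim_const_over_n[of 1]] by auto

lemma finite_hilbert_eqI:
  assumes "(truncated_hilbert g t \<longlongrightarrow> l) (at_right 0)"
  shows "finite_hilbert g t = l"
proof -
  have "Lim (at_right 0) (truncated_hilbert g t) = l"
    using assms by (intro tendsto_Lim) auto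
  then show ?thesis using assms by (auto simp: finite_hilbert_def)
qed

lemma truncated_hilbert_measurable:
  assumes g: "integrable mu g" and e: "0 < e"
  shows "(\<lambda>t. truncated_hilbert g t e) \<in> borel_measurable mu"
proof -
  have [measurable]: "g \<in> borel_measurable mu" using g by simp
  have [measurable]: "(\<lambda>p. pv_kernel e (snd p - fst p)) \<in> borel_measurable (mu \<Otimes>\<^sub>M mu)"
    by (rule difference_kernel_measurable) measurable
  have "(\<lambda>p. g (snd p) * complex_of_real (pv_kernel e (snd p - fst p))) \<in> borel_measurable (mu \<Otimes>\<^sub>M mu)"
    by measurable
  then have "(\<lambda>t. LINT x|mu. g x * complex_of_real (pv_kernel e (x - t))) \<in> borel_measurable mu"
    by (intro mu.borel_measurable_lebesgue_integral) (simp add: case_prod_beta')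
  then show ?thesis unfolding truncated_hilbert_kernel(1)[OF g e] .
qed

text \<open>
  The set where the limit exists is measurable because the Cauchy condition can be tested on countably many
  radii.
\<close>
lemma finite_hilbert_measurable:
  assumes g: "integrable mu g"
  shows "finite_hilbert g \<in> borel_measurable mu"
proof -
  let ?F = "truncated_hilbert g"
  \<comment> \<open>Truncations are right continuous in the radius, so the Cauchy condition \<open>C\<close> on rational radii decides convergence.\<close>
  define Q where "Q = {q::real. q \<in> \<rat> \<and> 0 < q}"
  have Qc: "countable Q" unfolding Q_def by (rule countable_subset[OF _ countable_rat]) auto
  define C where "C t \<longleftrightarrow> (\<forall>k::nat. \<exists>n::nat. \<forall>p\<in>Q. \<forall>q\<in>Q. p < 1 / real (Suc n) \<longrightarrow> q < 1 / real (Suc n) \<longrightarrow>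
     dist (?F t p) (?F t q) \<le> 1 / real (Suc k))" for t
  have approx: "\<exists>q\<in>Q. q < b \<and> dist (?F t e) (?F t q) \<le> d" if e: "0 < e" "e < b" and d: "d > 0" for t e b d
  proof -
    have ex: "\<exists>h>0. \<forall>q. e < q \<longrightarrow> q < e + h \<longrightarrow> dist (?F t e) (?F t q) \<le> d"
    proof -
      have A: "(?F t \<longlongrightarrow> ?F t e) (at_right e)"
      proof (rule tendsto_at_right_sequentially[where b = "e + 1"])
        fix S :: "nat \<Rightarrow> real"
        assume S: "\<And>n. e < S n" "\<And>n. S n < e + 1" "decseq S" "S \<longlonglongrightarrow> e"
        have [measurable]: "g \<in> borel_measurable mu" using g by simp
        have km[measurable]: "(\<lambda>x. pv_kernel d (x - t)) \<in> borel_measurable mu" for d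
          by (rule borel_measurable_mu) measurable
        have pos: "0 < S n" for n using S(1)[of n] e by linarith
        have "(\<lambda>n. LINT x|mu. g x * complex_of_real (pv_kernel (S n) (x - t))) \<longlonglongrightarrow>
            (LINT x|mu. g x * complex_of_real (pv_kernel e (x - t)))"
        proof (rule integral_dominated_convergence[where w = "\<lambda>x. cmod (g x) * (1 / e)"])
          show "integrable mu (\<lambda>x. cmod (g x) * (1 / e))" using g by auto
          show "AE x in mu. (\<lambda>n. g x * complex_of_real (pv_kernel (S n) (x - t))) \<longlonglongrightarrow> g x * complex_of_real (pv_kernel e (x - t))"
          proof (intro AE_I2 tendsto_intros)
            fix x
            show "(\<lambda>n. pv_kernel (S n) (x - t)) \<longlonglongrightarrow> pv_kernel e (x - t)"
            proof (cases "e < \<bar>x - t\<bar>")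
              case True
              then have "\<forall>\<^sub>F n in sequentially. S n < \<bar>x - t\<bar>"
                using S(4) by (rule order_tendstoD(2)[rotated])
              then have "\<forall>\<^sub>F n in sequentially. pv_kernel (S n) (x - t) = pv_kernel e (x - t)"
                by eventually_elim (use True in \<open>simp add: pv_kernel_def\<close>)
              then show ?thesis by (rule tendsto_eventually)
            next
              case False
              have "pv_kernel (S n) (x - t) = pv_kernel e (x - t)" for n
                using False S(1)[of n] by (simp add: pv_kernel_def)
              then show ?thesis by simp
            qed
          qed
          show "AE x in mu. norm (g x * complex_of_real (pv_kernel (S n) (x - t))) \<le> cmod (g x) * (1 / e)" for n
          proof (rule AE_I2)
            fix x
            have "\<bar>pv_kernel (S n) (x - t)\<bar> \<le> 1 / S n" by (rule pv_kernel_bound[OF pos])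
            also have "\<dots> \<le> 1 / e" using e S(1)[of n] by (intro divide_left_mono) auto
            finally show "norm (g x * complex_of_real (pv_kernel (S n) (x - t))) \<le> cmod (g x) * (1 / e)"
              unfolding norm_mult norm_of_real by (intro mult_left_mono) auto
          qed
        qed measurable
        then show "(\<lambda>n. ?F t (S n)) \<longlonglongrightarrow> ?F t e"
          unfolding truncated_hilbert_kernel(1)[OF g e(1)] truncated_hilbert_kernel(1)[OF g pos] .
      qed simp
      then have "\<forall>\<^sub>F q in at_right e. dist (?F t q) (?F t e) < d" using d by (rule tendstoD)
      then obtain b' where "b' > e" "\<And>q. e < q \<Longrightarrow> q < b' \<Longrightarrow> dist (?F t q) (?F t e) < d"
        unfolding eventually_at_right_field by auto
      then show ?thesis by (intro exI[of _ "b' - e"]) (auto simp: dist_commute less_imp_le)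
    qed
    then obtain h where h: "h > 0" "\<And>q. e < q \<Longrightarrow> q < e + h \<Longrightarrow> dist (?F t e) (?F t q) \<le> d" by blast
    obtain q where q: "q \<in> \<rat>" "e < q" "q < min b (e + h)"
      using Rats_dense_in_real[of e "min b (e + h)"] e h by auto
    then show ?thesis using h(2)[of q] e by (intro bexI[of _ q]) (auto simp: Q_def)
  qed
  have C: "(\<exists>l. (?F t \<longlongrightarrow> l) (at_right 0)) \<longleftrightarrow> C t" for t
  proof
    assume "\<exists>l. (?F t \<longlongrightarrow> l) (at_right 0)"
    then obtain l where l: "(?F t \<longlongrightarrow> l) (at_right 0)" by blast
    show "C t" unfolding C_def
    proof
      fix k
      have "\<forall>\<^sub>F q in at_right 0. dist (?F t q) l < 1 / real (Suc k) / 2" using l by (rule tendstoD) simp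
      then obtain b where b: "b > 0" "\<And>q. 0 < q \<Longrightarrow> q < b \<Longrightarrow> dist (?F t q) l < 1 / real (Suc k) / 2"
        unfolding eventually_at_right_field by auto
      obtain n where n: "1 / real (Suc n) < b" using b(1) nat_approx_posE by blast
      show "\<exists>n. \<forall>p\<in>Q. \<forall>q\<in>Q. p < 1 / real (Suc n) \<longrightarrow> q < 1 / real (Suc n) \<longrightarrow> dist (?F t p) (?F t q) \<le> 1 / real (Suc k)"
      proof (intro exI[of _ n] ballI impI less_imp_le)
        fix p q assume "p \<in> Q" "q \<in> Q" "p < 1 / real (Suc n)" "q < 1 / real (Suc n)"
        then show "dist (?F t p) (?F t q) < 1 / real (Suc k)"
          using n by (intro dist_triangle_half_l[OF b(2) b(2)]) (auto simp: Q_def)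
      qed
    qed
  next
    assume Ct: "C t"
    have cau: "\<exists>b>0. \<forall>p q. 0 < p \<longrightarrow> p < b \<longrightarrow> 0 < q \<longrightarrow> q < b \<longrightarrow> dist (?F t p) (?F t q) < d" if d: "d > 0" for d
    proof -
      obtain k where k: "1 / real (Suc k) < d / 4" using d nat_approx_posE[of "d / 4"] by auto
      obtain n where n: "\<And>p q. p \<in> Q \<Longrightarrow> q \<in> Q \<Longrightarrow> p < 1 / real (Suc n) \<Longrightarrow> q < 1 / real (Suc n) \<Longrightarrow> dist (?F t p) (?F t q) \<le> 1 / real (Suc k)"
        using Ct unfolding C_def by blast
      have "dist (?F t p) (?F t q) < d" if pq: "0 < p" "p < 1 / real (Suc n)" "0 < q" "q < 1 / real (Suc n)" for p q
      proof -
        obtain p' where p': "p' \<in> Q" "p' < 1 / real (Suc n)" "dist (?F t p) (?F t p') \<le> d / 4"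
          using approx[OF pq(1,2), of "d / 4" t] d by auto
        obtain q' where q': "q' \<in> Q" "q' < 1 / real (Suc n)" "dist (?F t q) (?F t q') \<le> d / 4"
          using approx[OF pq(3,4), of "d / 4" t] d by auto
        have "dist (?F t p) (?F t q) \<le> dist (?F t p) (?F t p') + (dist (?F t p') (?F t q') + dist (?F t q') (?F t q))"
          using dist_triangle[of "?F t p" "?F t q" "?F t p'"] dist_triangle[of "?F t p'" "?F t q" "?F t q'"] by linarith
        also have "\<dots> \<le> d / 4 + (1 / real (Suc k) + d / 4)"
          using p' q' n[OF p'(1) q'(1) p'(2) q'(2)] by (intro add_mono) (auto simp: dist_commute)
        also have "\<dots> < d" using k d by linarith
        finally show ?thesis .
      qed
      then show ?thesis by (intro exI[of _ "1 / real (Suc n)"]) auto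
    qed
    have "cauchy_filter (filtermap (?F t) (at_right 0))"
      unfolding cauchy_filter_metric_filtermap
    proof (intro allI impI)
      fix d :: real assume "d > 0"
      then obtain b where b: "b > 0" "\<And>p q. 0 < p \<Longrightarrow> p < b \<Longrightarrow> 0 < q \<Longrightarrow> q < b \<Longrightarrow> dist (?F t p) (?F t q) < d"
        using cau by blast
      show "\<exists>P. eventually P (at_right 0) \<and> (\<forall>x y. P x \<and> P y \<longrightarrow> dist (?F t x) (?F t y) < d)"
        by (intro exI[of _ "\<lambda>p. 0 < p \<and> p < b"]) (use b in \<open>auto simp: eventually_at_right_field\<close>)
    qed
    then have "\<exists>l\<in>UNIV. filtermap (?F t) (at_right 0) \<le> nhds l"
      by (intro complete_uniform[THEN iffD1, rule_format, OF complete_UNIV])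
        (auto simp: filtermap_bot_iff trivial_limit_at_right_real)
    then show "\<exists>l. (?F t \<longlongrightarrow> l) (at_right 0)" by (auto simp: filterlim_def)
  qed
  have Cm: "{t \<in> space mu. C t} \<in> sets mu"
    unfolding C_def
  proof (intro sets.sets_Collect_countable_All sets.sets_Collect_countable_Ex sets.sets_Collect_countable_All'[OF _ Qc])
    fix k n p q assume pq: "p \<in> Q" "q \<in> Q"
    have [measurable]: "(\<lambda>t. ?F t p) \<in> borel_measurable mu" "(\<lambda>t. ?F t q) \<in> borel_measurable mu"
      using pq by (auto simp: Q_def intro: truncated_hilbert_measurable[OF g])
    show "{t \<in> space mu. p < 1 / real (Suc n) \<longrightarrow> q < 1 / real (Suc n) \<longrightarrow> dist (?F t p) (?F t q) \<le> 1 / real (Suc k)} \<in> sets mu"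
      by measurable
  qed
  have Lm: "(\<lambda>t. lim (\<lambda>n. ?F t (1 / real (Suc n)))) \<in> borel_measurable mu"
    by (intro borel_measurable_lim_metric truncated_hilbert_measurable g) simp
  have "(\<lambda>t. if C t then lim (\<lambda>n. ?F t (1 / real (Suc n))) else 0) \<in> borel_measurable mu"
    by (rule measurable_If[OF Lm _ Cm]) simp
  moreover have "finite_hilbert g t = (if C t then lim (\<lambda>n. ?F t (1 / real (Suc n))) else 0)" for t
  proof (cases "C t")
    case True
    then obtain l where l: "(?F t \<longlongrightarrow> l) (at_right 0)" using C by blast
    have "(\<lambda>n. ?F t (1 / real (Suc n))) \<longlonglongrightarrow> l" using filterlim_compose[OF l inverse_Suc_at_right_0] .
    then have "lim (\<lambda>n. ?F t (1 / real (Suc n))) = l" by (rule limI)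
    then show ?thesis using True finite_hilbert_eqI[OF l] by simp
  next
    case False
    then show ?thesis using C by (simp add: finite_hilbert_def)
  qed
  ultimately show ?thesis by (simp cong: measurable_cong)
qed

text \<open>
  Almost every point is a Lebesgue point of both \<open>g\<close> and its limit in mean, so that limit is the principal
  value.
\<close>
theorem finite_hilbert_mean_limit:
  assumes g: "lq_fun p g" and p: "0 < p"
  shows "mean_limit g (finite_hilbert g)"
    and "AE t in mu. (truncated_hilbert g t \<longlongrightarrow> finite_hilbert g t) (at_right 0)"
proof -
  have gi: "integrable mu g" by (rule lq_fun_integrable[OF g])
  obtain G where G: "mean_limit g G" using mean_limit_exists[OF mean_cauchy_lq[OF g p]] .
  have Gi: "integrable mu G" using G by (simp add: mean_limit_def)
  have inside: "AE t in mu. t \<in> {-1<..<1}" by (rule AE_mu_I)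
  have lim: "AE t in mu. (truncated_hilbert g t \<longlongrightarrow> G t) (at_right 0)"
    using AE_lebesgue_point[OF gi] AE_lebesgue_point[OF Gi] inside
  proof eventually_elim
    case (elim t)
    then show ?case by (intro pv_limit[OF gi G]) auto
  qed
  then show "AE t in mu. (truncated_hilbert g t \<longlongrightarrow> finite_hilbert g t) (at_right 0)"
    by eventually_elim (simp add: finite_hilbert_eqI)
  have eq: "AE t in mu. G t = finite_hilbert g t"
    using lim by eventually_elim (simp add: finite_hilbert_eqI)
  have m: "finite_hilbert g \<in> borel_measurable mu" by (rule finite_hilbert_measurable[OF gi])
  have Gm: "G \<in> borel_measurable mu" using Gi by simp
  have "integrable mu (finite_hilbert g)"
    using Gi by (subst (asm) integrable_cong_AE[OF Gm m eq])
  moreover have "(LINT x|mu. cmod (conj_poisson y g x - G x)) = (LINT x|mu. cmod (conj_poisson y g x - finite_hilbert g x))" for y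
  proof (rule integral_cong_AE)
    have "conj_poisson y g \<in> borel_measurable mu" using gi by (intro conj_poisson_measurable) simp
    then show "(\<lambda>x. cmod (conj_poisson y g x - G x)) \<in> borel_measurable mu"
      "(\<lambda>x. cmod (conj_poisson y g x - finite_hilbert g x)) \<in> borel_measurable mu"
      using m Gm by measurable
    show "AE x in mu. cmod (conj_poisson y g x - G x) = cmod (conj_poisson y g x - finite_hilbert g x)"
      using eq by eventually_elim simp
  qed
  ultimately show "mean_limit g (finite_hilbert g)" using G by (simp add: mean_limit_def)
qed

lemma mean_limit_subseq:
  assumes g: "integrable mu g" and G: "mean_limit g G"
  obtains y where "\<And>n::nat. 0 < y n" "y \<longlonglongrightarrow> 0" "AE x in mu. (\<lambda>n. conj_poisson (y n) g x) \<longlonglongrightarrow> G x"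
proof -
  have Gi: "integrable mu G" and Gl: "((\<lambda>y. LINT x|mu. cmod (conj_poisson y g x - G x)) \<longlongrightarrow> 0) (at_right 0)"
    using G by (auto simp: mean_limit_def)
  have "(\<lambda>n. LINT x|mu. cmod (conj_poisson (1 / real (Suc n)) g x - G x)) \<longlonglongrightarrow> 0"
    by (rule filterlim_compose[OF Gl inverse_Suc_at_right_0])
  moreover have "integrable mu (\<lambda>x. conj_poisson (1 / real (Suc n)) g x - G x)" for n
    using Gi g by (intro Bochner_Integration.integrable_diff conj_poisson_integrable) auto
  ultimately obtain r where r: "strict_mono r" "AE x in mu. (\<lambda>n. conj_poisson (1 / real (Suc (r n))) g x - G x) \<longlonglongrightarrow> 0"
    using tendsto_L1_AE_subseq[of mu "\<lambda>n x. conj_poisson (1 / real (Suc n)) g x - G x"] by auto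
  show ?thesis
  proof (rule that[of "\<lambda>n. 1 / real (Suc (r n))"])
    show "(\<lambda>n. 1 / real (Suc (r n))) \<longlonglongrightarrow> 0"
      using LIMSEQ_subseq_LIMSEQ[OF LIMSEQ_Suc[OF lim_const_over_n[of 1]] r(1)] by (simp add: o_def)
    show "AE x in mu. (\<lambda>n. conj_poisson (1 / real (Suc (r n))) g x) \<longlonglongrightarrow> G x"
      using r(2) by eventually_elim (simp add: LIM_zero_iff)
  qed simp
qed

text \<open>
  Fatou's lemma along regularised transforms that converge almost everywhere.
\<close>
theorem finite_hilbert_moment:
  assumes hm: "h \<in> borel_measurable mu" and h1: "\<And>x. x \<in> {-1<..<1} \<Longrightarrow> cmod (h x) \<le> 1"
  shows "(\<integral>\<^sup>+t. ennreal (cmod (finite_hilbert h t) ^ m) \<partial>mu) \<le> ennreal (moment_const m)"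
proof -
  have lq: "lq_fun 1 h" by (rule lq_fun_bounded[OF hm]) (use h1 in blast)
  have hi: "integrable mu h" by (rule lq_fun_integrable[OF lq])
  obtain y where y: "\<And>n::nat. 0 < y n" "y \<longlonglongrightarrow> 0" "AE x in mu. (\<lambda>n. conj_poisson (y n) h x) \<longlonglongrightarrow> finite_hilbert h x"
    using mean_limit_subseq[OF hi finite_hilbert_mean_limit(1)[OF lq]] by auto
  have [measurable]: "conj_poisson (y n) h \<in> borel_measurable mu" for n using hm by measurable
  have "(\<integral>\<^sup>+t. ennreal (cmod (finite_hilbert h t) ^ m) \<partial>mu) = (\<integral>\<^sup>+t. liminf (\<lambda>n. ennreal (cmod (conj_poisson (y n) h t) ^ m)) \<partial>mu)"
  proof (intro nn_integral_cong_AE)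
    show "AE t in mu. ennreal (cmod (finite_hilbert h t) ^ m) = liminf (\<lambda>n. ennreal (cmod (conj_poisson (y n) h t) ^ m))"
      using y(3)
    proof eventually_elim
      case (elim t)
      have "(\<lambda>n. ennreal (cmod (conj_poisson (y n) h t) ^ m)) \<longlonglongrightarrow> ennreal (cmod (finite_hilbert h t) ^ m)"
        by (intro tendsto_ennrealI tendsto_intros elim)
      from lim_imp_Liminf[OF sequentially_bot this] show ?case by (rule sym)
    qed
  qed
  also have "\<dots> \<le> liminf (\<lambda>n. \<integral>\<^sup>+t. ennreal (cmod (conj_poisson (y n) h t) ^ m) \<partial>mu)"
    by (intro nn_integral_liminf) measurable
  also have "\<dots> \<le> liminf (\<lambda>n::nat. ennreal (moment_const m))"
    by (intro Liminf_mono always_eventually allI conj_poisson_moment hm h1 y)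
  also have "\<dots> = ennreal (moment_const m)" by (simp add: Liminf_const)
  finally show ?thesis .
qed

text \<open>
  The limit of the duality for the regularised transforms. On the right-hand side mean convergence is
  enough, as \<open>h\<close> is bounded. On the left-hand side \<open>g\<close> is unbounded: its bounded part is treated in the
  same way, and the remainder is uniformly small by Young's inequality and the moments of the transforms
  of \<open>h\<close>.
\<close>
theorem finite_hilbert_duality:
  assumes g: "lq_fun p g" and p: "0 < p"
    and hm: "h \<in> borel_measurable mu" and h1: "\<And>x. x \<in> {-1<..<1} \<Longrightarrow> cmod (h x) \<le> 1"
  shows "integrable mu (\<lambda>x. g x * finite_hilbert h x)"
    and "(LINT x|mu. g x * finite_hilbert h x) = - (LINT x|mu. finite_hilbert g x * h x)"
proof -
  have lqh: "lq_fun 1 h" by (rule lq_fun_bounded[OF hm]) (use h1 in blast)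
  have hi: "integrable mu h" by (rule lq_fun_integrable[OF lqh])
  have gi: "integrable mu g" by (rule lq_fun_integrable[OF g])
  note gm[measurable] = g[unfolded lq_fun_def, THEN conjunct1] and hm[measurable]
  have [measurable]: "finite_hilbert h \<in> borel_measurable mu" "finite_hilbert g \<in> borel_measurable mu"
    by (intro finite_hilbert_measurable hi gi)+
  define K where "K = moment_const (p + 1)"
  have K: "0 \<le> K" by (simp add: K_def moment_const_nonneg)
  show ghi: "integrable mu (\<lambda>x. g x * finite_hilbert h x)"
    by (rule young_integral(1)[OF g _ finite_hilbert_moment[OF hm h1] p moment_const_nonneg]) auto
  obtain y where y: "\<And>n::nat. 0 < y n" "y \<longlonglongrightarrow> 0" "AE x in mu. (\<lambda>n. conj_poisson (y n) h x) \<longlonglongrightarrow> finite_hilbert h x"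
    using mean_limit_subseq[OF hi finite_hilbert_mean_limit(1)[OF lqh]] by auto
  have ym: "conj_poisson (y n) h \<in> borel_measurable mu" for n using hm by (rule conj_poisson_measurable)
  have seq: "filterlim y (at_right 0) sequentially"
  proof -
    have "\<forall>\<^sub>F n in sequentially. y n \<in> {0<..} \<and> y n \<noteq> 0"
    proof (intro always_eventually allI)
      show "y n \<in> {0<..} \<and> y n \<noteq> 0" for n using y(1)[of n] by simp
    qed
    then show ?thesis unfolding filterlim_at using y(2) by auto
  qed
  \<comment> \<open>The truncations \<open>s N\<close> of \<open>g\<close> leave remainders that are small against all the transforms at once.\<close>
  have lim1: "(\<lambda>n. LINT x|mu. g x * conj_poisson (y n) h x) \<longlonglongrightarrow> (LINT x|mu. g x * finite_hilbert h x)"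
  proof (rule LIMSEQ_I)
    fix e :: real assume e: "e > 0"
    define c where "c = min 1 (e / (12 * (K + 1)))"
    have c: "c > 0" "c \<le> 1" using e K by (auto simp: c_def)
    have "c ^ (p + 1) * K \<le> c * K"
      using c K power_decreasing[of 1 "p + 1" c] by (intro mult_right_mono) auto
    also have "\<dots> \<le> e / (12 * (K + 1)) * (K + 1)"
      using c K by (intro mult_mono) (auto simp: c_def)
    also have "\<dots> = e / 12" using K by (simp add: field_simps)
    finally have cK: "c ^ (p + 1) * K \<le> e / 12" .
    define A where "A = (1 / c) powr (1 + 1 / real p)"
    define s where "s N x = (if cmod (g x) \<le> real N then g x else 0)" for N :: nat and x
    have sm: "s N \<in> borel_measurable mu" for N unfolding s_def by measurable
    have sb: "cmod (s N x) \<le> real N" for N x by (simp add: s_def)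
    have slim: "(\<lambda>N. s N x) \<longlonglongrightarrow> g x" for x
    proof (rule tendsto_eventually)
      obtain M where "cmod (g x) \<le> real M" using real_arch_simple by blast
      then show "\<forall>\<^sub>F N in sequentially. s N x = g x"
        by (intro eventually_sequentiallyI[of M]) (auto simp: s_def)
    qed
    have sd: "cmod (s N x) \<le> 2 * cmod (g x)" for N x by (simp add: s_def)
    note L = lq_lim[OF g p sm slim sd]
    have "(\<lambda>N. A * (LINT x|mu. cmod (g x - s N x) powr (1 + 1 / real p))) \<longlonglongrightarrow> A * 0"
      by (intro tendsto_mult tendsto_const L(2))
    then have "\<forall>\<^sub>F N in sequentially. A * (LINT x|mu. cmod (g x - s N x) powr (1 + 1 / real p)) < e / 12"
      using e by (intro order_tendstoD(2)[where y = "A * 0"]) auto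
    then obtain N where N: "A * (LINT x|mu. cmod (g x - s N x) powr (1 + 1 / real p)) < e / 12"
      by (auto simp: eventually_sequentially)
    have tail: "(LINT x|mu. cmod ((g x - s N x) * v x)) \<le> e / 6"
      if "v \<in> borel_measurable mu" "(\<integral>\<^sup>+x. ennreal (cmod (v x) ^ (p + 1)) \<partial>mu) \<le> ennreal K" for v
      using young_integral(2)[OF L(1) that p K c(1), of N] N cK unfolding A_def by linarith
    have tint: "integrable mu (\<lambda>x. (g x - s N x) * v x)"
      if "v \<in> borel_measurable mu" "(\<integral>\<^sup>+x. ennreal (cmod (v x) ^ (p + 1)) \<partial>mu) \<le> ennreal K" for v
      by (rule young_integral(1)[OF L(1) that p K])
    have sint: "integrable mu (\<lambda>x. s N x * v x)" if "integrable mu v" for v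
      using integrable_mult_bounded[OF that sm sb] by (simp add: mult.commute)
    have Hi: "integrable mu (finite_hilbert h)" and
      Hl: "((\<lambda>y. LINT x|mu. cmod (conj_poisson y h x - finite_hilbert h x)) \<longlongrightarrow> 0) (at_right 0)"
      using finite_hilbert_mean_limit(1)[OF lqh] by (auto simp: mean_limit_def)
    have "(\<lambda>n. real N * (LINT x|mu. cmod (conj_poisson (y n) h x - finite_hilbert h x))) \<longlonglongrightarrow> real N * 0"
      by (intro tendsto_mult tendsto_const filterlim_compose[OF Hl seq])
    then have "\<forall>\<^sub>F n in sequentially. real N * (LINT x|mu. cmod (conj_poisson (y n) h x - finite_hilbert h x)) < e / 2"
      using e by (intro order_tendstoD(2)[where y = "real N * 0"]) auto
    then obtain M where M: "\<And>n. n \<ge> M \<Longrightarrow> real N * (LINT x|mu. cmod (conj_poisson (y n) h x - finite_hilbert h x)) < e / 2"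
      by (auto simp: eventually_sequentially)
    have Hmom: "(\<integral>\<^sup>+x. ennreal (cmod (finite_hilbert h x) ^ (p + 1)) \<partial>mu) \<le> ennreal K"
      unfolding K_def by (rule finite_hilbert_moment[OF hm h1])
    show "\<exists>no. \<forall>n\<ge>no. norm ((LINT x|mu. g x * conj_poisson (y n) h x) - (LINT x|mu. g x * finite_hilbert h x)) < e"
    proof (intro exI[of _ M] allI impI)
      fix n assume n: "n \<ge> M"
      let ?P = "conj_poisson (y n) h" and ?H = "finite_hilbert h"
      have Pm: "(\<integral>\<^sup>+x. ennreal (cmod (?P x) ^ (p + 1)) \<partial>mu) \<le> ennreal K"
        unfolding K_def by (rule conj_poisson_moment[OF hm h1 y(1)])
      have Pi: "integrable mu ?P" by (rule conj_poisson_integrable[OF hi y(1)])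
      have i1: "integrable mu (\<lambda>x. (g x - s N x) * ?P x)" by (rule tint[OF ym Pm])
      have i2: "integrable mu (\<lambda>x. (g x - s N x) * ?H x)" by (rule tint[OF _ Hmom]) measurable
      have i3: "integrable mu (\<lambda>x. s N x * (?P x - ?H x))" by (rule sint) (use Pi Hi in auto)
      have i4: "integrable mu (\<lambda>x. g x * ?P x)"
        by (rule young_integral(1)[OF g ym Pm p K])
      have "(LINT x|mu. g x * ?P x) - (LINT x|mu. g x * ?H x) = (LINT x|mu. g x * ?P x - g x * ?H x)"
        by (rule Bochner_Integration.integral_diff[symmetric, OF i4 ghi])
      also have "\<dots> = (LINT x|mu. ((g x - s N x) * ?P x - (g x - s N x) * ?H x) + s N x * (?P x - ?H x))"
        by (intro Bochner_Integration.integral_cong refl) (simp add: algebra_simps)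
      also have "\<dots> = ((LINT x|mu. (g x - s N x) * ?P x) - (LINT x|mu. (g x - s N x) * ?H x)) + (LINT x|mu. s N x * (?P x - ?H x))"
        using i1 i2 i3 by (simp only: Bochner_Integration.integral_add Bochner_Integration.integral_diff Bochner_Integration.integrable_diff)
      also have "cmod \<dots> \<le> (e / 6 + e / 6) + e / 2"
      proof (intro norm_triangle_mono order_trans[OF norm_triangle_ineq4] add_mono)
        show "cmod (LINT x|mu. (g x - s N x) * ?P x) \<le> e / 6"
          by (rule order_trans[OF integral_norm_bound tail[OF ym Pm]])
        show "cmod (LINT x|mu. (g x - s N x) * ?H x) \<le> e / 6"
          by (rule order_trans[OF integral_norm_bound tail[OF _ Hmom]]) measurable
        have "cmod (LINT x|mu. s N x * (?P x - ?H x)) \<le> (LINT x|mu. real N * cmod (?P x - ?H x))"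
        proof (rule Bochner_Integration.integral_norm_bound_integral[OF i3])
          show "integrable mu (\<lambda>x. real N * cmod (?P x - ?H x))" using Pi Hi by auto
          show "norm (s N x * (?P x - ?H x)) \<le> real N * cmod (?P x - ?H x)" for x
            unfolding norm_mult by (intro mult_right_mono sb) auto
        qed
        also have "\<dots> < e / 2" using M[OF n] by simp
        finally show "cmod (LINT x|mu. s N x * (?P x - ?H x)) \<le> e / 2" by simp
      qed
      also have "\<dots> < e" using e by simp
      finally show "norm ((LINT x|mu. g x * ?P x) - (LINT x|mu. g x * ?H x)) < e" .
    qed
  qed
  have Gi: "integrable mu (finite_hilbert g)" and
    Gl: "((\<lambda>y. LINT x|mu. cmod (conj_poisson y g x - finite_hilbert g x)) \<longlongrightarrow> 0) (at_right 0)"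
    using finite_hilbert_mean_limit(1)[OF g p] by (auto simp: mean_limit_def)
  have mi: "integrable mu (\<lambda>x. v x * h x)" if "integrable mu v" for v
    using that hm h1 by (rule integrable_mult_bounded)
  have lim2: "(\<lambda>n. LINT x|mu. conj_poisson (y n) g x * h x) \<longlonglongrightarrow> (LINT x|mu. finite_hilbert g x * h x)"
  proof (rule LIM_zero_cancel, rule Lim_null_comparison)
    show "(\<lambda>n. LINT x|mu. cmod (conj_poisson (y n) g x - finite_hilbert g x)) \<longlonglongrightarrow> 0"
      by (rule filterlim_compose[OF Gl seq])
    show "\<forall>\<^sub>F n in sequentially. norm ((LINT x|mu. conj_poisson (y n) g x * h x) - (LINT x|mu. finite_hilbert g x * h x))
       \<le> (LINT x|mu. cmod (conj_poisson (y n) g x - finite_hilbert g x))"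
    proof (intro always_eventually allI)
      fix n
      have Pi: "integrable mu (conj_poisson (y n) g)" by (rule conj_poisson_integrable[OF gi y(1)])
      have "(LINT x|mu. conj_poisson (y n) g x * h x) - (LINT x|mu. finite_hilbert g x * h x) = (LINT x|mu. (conj_poisson (y n) g x - finite_hilbert g x) * h x)"
        unfolding left_diff_distrib by (rule Bochner_Integration.integral_diff[symmetric, OF mi[OF Pi] mi[OF Gi]])
      also have "norm \<dots> \<le> (LINT x|mu. cmod (conj_poisson (y n) g x - finite_hilbert g x))"
      proof (rule Bochner_Integration.integral_norm_bound_integral)
        show "integrable mu (\<lambda>x. (conj_poisson (y n) g x - finite_hilbert g x) * h x)" by (rule mi) (use Pi Gi in auto)
        show "integrable mu (\<lambda>x. cmod (conj_poisson (y n) g x - finite_hilbert g x))" using Pi Gi by auto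
        show "norm ((conj_poisson (y n) g x - finite_hilbert g x) * h x) \<le> cmod (conj_poisson (y n) g x - finite_hilbert g x)" if "x \<in> space mu" for x
          using h1[of x] that by (simp add: norm_mult mult_left_le space_mu)
      qed
      finally show "norm ((LINT x|mu. conj_poisson (y n) g x * h x) - (LINT x|mu. finite_hilbert g x * h x))
       \<le> (LINT x|mu. cmod (conj_poisson (y n) g x - finite_hilbert g x))" .
    qed
  qed
  have "(LINT x|mu. conj_poisson (y n) g x * h x) = - (LINT x|mu. g x * conj_poisson (y n) h x)" for n
    by (rule conj_poisson_duality[OF gi hi y(1)])
  with lim2 have "(\<lambda>n. - (LINT x|mu. g x * conj_poisson (y n) h x)) \<longlonglongrightarrow> (LINT x|mu. finite_hilbert g x * h x)"
    by simp
  from LIMSEQ_unique[OF this tendsto_minus[OF lim1]]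
  show "(LINT x|mu. g x * finite_hilbert h x) = - (LINT x|mu. finite_hilbert g x * h x)" by simp
qed

section \<open>Explicit transforms\<close>

lemma borel_measurable_mu_continuous:
  fixes f :: "real \<Rightarrow> 'a::{second_countable_topology, real_normed_vector}"
  assumes "continuous_on {-1<..<1} f"
  shows "f \<in> borel_measurable mu"
proof -
  have "f \<in> borel_measurable (restrict_space borel {-1<..<1})"
    by (rule borel_measurable_continuous_on_restrict[OF assms])
  moreover have "sets (restrict_space borel {-1<..<1}) = sets mu"
    by (intro sets_restrict_space_cong) simp
  ultimately show ?thesis using measurable_cong_sets by blast
qed

text \<open>
  Unlike in \<open>mu_FTC\<close>, the primitive may fail to be differentiable at the end points, as happens for \<open>arcsin\<close>
  at 1 and -1.
\<close>
lemma set_integral_mu_FTC_interior: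
  fixes f F :: "real \<Rightarrow> real"
  assumes ab: "-1 \<le> a" "a \<le> b" "b \<le> 1" and f: "continuous_on {a..b} f" and F: "continuous_on {a..b} F"
    and D: "\<And>x. a < x \<Longrightarrow> x < b \<Longrightarrow> (F has_real_derivative f x) (at x)"
  shows "(LINT x:{a<..<b}|mu. f x) = F b - F a"
proof -
  have "(LINT x:{a<..<b}|mu. f x) = (LINT x:{a<..<b}|lborel. f x)"
    using ab by (intro set_integral_mu) auto
  also have "\<dots> = (LBINT x=a..b. f x)" using ab by (simp add: interval_integral_Ioo)
  also have "\<dots> = (LINT x:{a..b}|lborel. f x)" using ab by (simp add: interval_integral_Icc)
  also have "\<dots> = integral {a..b} f"
    by (intro set_borel_integral_eq_integral borel_integrable_compact[unfolded set_integrable_def[symmetric]] f) auto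
  also have "\<dots> = F b - F a"
  proof (rule integral_unique, rule fundamental_theorem_of_calculus_interior[OF ab(2) F])
    show "(F has_vector_derivative f x) (at x)" if "x \<in> {a<..<b}" for x
      using D that by (simp flip: has_real_derivative_iff_has_vector_derivative)
  qed
  finally show ?thesis .
qed

lemma integral_mu_reflect:
  fixes f :: "real \<Rightarrow> 'a::{banach, second_countable_topology}"
  shows "(LINT x|mu. f (- x)) = (LINT x|mu. f x)"
proof -
  have "(LINT x|mu. f x) = (LBINT x. indicator {-1<..<1} (0 + (-1) * x) *\<^sub>R f (0 + (-1) * x))"
    unfolding integral_mu set_lebesgue_integral_def
    by (subst lborel_integral_real_affine[where c = "-1" and t = 0]) auto
  also have "\<dots> = (LINT x|mu. f (- x))"
    unfolding integral_mu set_lebesgue_integral_def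
    by (intro Bochner_Integration.integral_cong refl) (auto simp: indicator_def)
  finally show ?thesis by simp
qed

subsection \<open>Points away from the support\<close>

lemma hilbert_measure_outside:
  assumes B: "B \<in> sets mu" and d: "d > 0" "\<And>x. x \<in> B \<Longrightarrow> d \<le> \<bar>x - t\<bar>"
  shows "hilbert_measure B t = complex_of_real (LINT x:B|mu. 1 / (pi * (x - t)))"
proof -
  have i: "integrable mu (indicator B :: real \<Rightarrow> complex)"
    by (rule integrable_indicator_mu[OF sets_mu_borel[OF B]])
  have "truncated_hilbert (indicator B) t e = complex_of_real (LINT x:B|mu. 1 / (pi * (x - t)))"
    if e: "0 < e" "e < d" for e
  proof -
    have "truncated_hilbert (indicator B) t e = (LINT x|mu. complex_of_real (indicator B x *\<^sub>R (1 / (pi * (x - t)))))"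
      unfolding truncated_hilbert_kernel(1)[OF i e(1)]
    proof (intro Bochner_Integration.integral_cong refl)
      fix x
      show "indicator B x * complex_of_real (pv_kernel e (x - t)) = complex_of_real (indicator B x *\<^sub>R (1 / (pi * (x - t))))"
        using d(2)[of x] e by (auto simp: indicator_def pv_kernel_def)
    qed
    then show ?thesis unfolding set_lebesgue_integral_def by (simp only: integral_complex_of_real)
  qed
  then have "\<forall>\<^sub>F e in at_right 0. truncated_hilbert (indicator B) t e = complex_of_real (LINT x:B|mu. 1 / (pi * (x - t)))"
    unfolding eventually_at_right_field using d(1) by blast
  then have "(truncated_hilbert (indicator B) t \<longlongrightarrow> complex_of_real (LINT x:B|mu. 1 / (pi * (x - t)))) (at_right 0)"
    by (rule tendsto_eventually)
  then show ?thesis unfolding hilbert_measure_def by (rule finite_hilbert_eqI)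
qed

text \<open>
  The kernel has constant sign on \<open>B\<close>, so there is no cancellation; \<open>s\<close> tells on which side of \<open>t\<close> the set
  lies.
\<close>
lemma hilbert_measure_lower_bound:
  assumes B: "B \<in> sets mu" and d: "d > 0" and s: "s = 1 \<or> s = -1"
    and side: "\<And>x. x \<in> B \<Longrightarrow> d \<le> s * (x - t)" "\<And>x. x \<in> B \<Longrightarrow> s * (x - t) \<le> D"
  shows "measure mu B / (pi * D) \<le> cmod (hilbert_measure B t)"
proof (cases "B = {}")
  case False
  then obtain x0 where "x0 \<in> B" by blast
  then have D: "D > 0" using side[of x0] d by linarith
  have Bb: "B \<in> sets borel" by (rule sets_mu_borel[OF B])
  have ab: "d \<le> \<bar>x - t\<bar>" if "x \<in> B" for x using side[OF that] s by auto
  note B[measurable]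
  have I: "integrable mu (\<lambda>x. indicator B x *\<^sub>R (1 / (pi * (s * (x - t)))))"
  proof (rule integrable_mu_bounded[where B = "1 / (1 * d)"])
    show "(\<lambda>x. indicator B x *\<^sub>R (1 / (pi * (s * (x - t))))) \<in> borel_measurable mu" by measurable
    fix x
    have "1 / (pi * (s * (x - t))) \<le> 1 / (1 * d)" "0 \<le> s * (x - t)" if "x \<in> B"
    proof -
      have "1 * d \<le> pi * (s * (x - t))" using side(1)[OF that] d pi_ge_two by (intro mult_mono) auto
      then show "1 / (pi * (s * (x - t))) \<le> 1 / (1 * d)" using d by (intro frac_le) auto
      show "0 \<le> s * (x - t)" using side(1)[OF that] d by linarith
    qed
    then show "norm (indicator B x *\<^sub>R (1 / (pi * (s * (x - t))))) \<le> 1 / (1 * d)"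
      using d by (auto simp: indicator_def abs_of_nonneg)
  qed
  have "measure mu B / (pi * D) = (LINT x|mu. indicator B x * (1 / (pi * D)))"
  proof -
    have "B \<inter> {-1<..<1} = B" using B sets_mu_iff by blast
    then show ?thesis using B by (simp add: measure_def space_mu)
  qed
  also have "\<dots> \<le> (LINT x|mu. indicator B x *\<^sub>R (1 / (pi * (s * (x - t)))))"
  proof (rule integral_mono[OF _ I])
    show "integrable mu (\<lambda>x. indicator B x * (1 / (pi * D)))"
      by (rule integrable_mu_bounded[where B = "\<bar>1 / (pi * D)\<bar>"]) (simp, auto simp: indicator_def)
    fix x
    have "1 / (pi * D) \<le> 1 / (pi * (s * (x - t)))" if "x \<in> B"
    proof -
      have "0 < s * (x - t)" using side(1)[OF that] d by linarith
      then have "0 < pi * (s * (x - t))" by (rule mult_pos_pos[OF pi_gt_zero])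
      then show ?thesis using side(2)[OF that] by (intro frac_le mult_left_mono) auto
    qed
    then show "indicator B x * (1 / (pi * D)) \<le> indicator B x *\<^sub>R (1 / (pi * (s * (x - t))))"
      by (auto simp: indicator_def)
  qed
  also have "\<dots> = s * (LINT x:B|mu. 1 / (pi * (x - t)))"
  proof -
    have "1 / (s * z) = s * (1 / z)" for z using s by auto
    then have "1 / (pi * (s * (x - t))) = s * (1 / (pi * (x - t)))" for x
      by (simp only: mult.left_commute[of pi s])
    then have "(\<lambda>x. indicator B x *\<^sub>R (1 / (pi * (s * (x - t))))) = (\<lambda>x. s * (indicator B x *\<^sub>R (1 / (pi * (x - t)))))"
      by (simp only: real_scaleR_def mult.left_commute)
    then show ?thesis unfolding set_lebesgue_integral_def by (simp only: integral_mult_right_zero)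
  qed
  also have "\<dots> \<le> \<bar>LINT x:B|mu. 1 / (pi * (x - t))\<bar>" using s by auto
  also have "\<dots> = cmod (hilbert_measure B t)"
    using hilbert_measure_outside[OF B d ab] by simp
  finally show ?thesis .
qed simp

lemma hilbert_measure_interval:
  assumes "-1 < t" "t < a" "a < b" "b < 1"
  shows "hilbert_measure {a<..<b} t = complex_of_real ((ln (b - t) - ln (a - t)) / pi)"
proof -
  have B: "{a<..<b} \<in> sets mu" using assms by (auto simp: sets_mu_iff)
  have "hilbert_measure {a<..<b} t = complex_of_real (LINT x:{a<..<b}|mu. 1 / (pi * (x - t)))"
    by (rule hilbert_measure_outside[OF B, of "a - t"]) (use assms in auto)
  also have "(LINT x:{a<..<b}|mu. 1 / (pi * (x - t))) = ln (b - t) / pi - ln (a - t) / pi"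
  proof (rule set_integral_mu_FTC_interior)
    show "continuous_on {a..b} (\<lambda>x. 1 / (pi * (x - t)))"
      using assms by (intro continuous_intros) auto
    show "continuous_on {a..b} (\<lambda>x. ln (x - t) / pi)"
      using assms by (intro continuous_intros) auto
    show "((\<lambda>x. ln (x - t) / pi) has_real_derivative 1 / (pi * (x - t))) (at x)" if "a < x" "x < b" for x
      using assms that by (auto intro!: derivative_eq_intros)
  qed (use assms in auto)
  finally show ?thesis by (simp add: diff_divide_distrib)
qed

subsection \<open>The semicircle density and its Chebyshev relatives\<close>

text \<open>
  With \<open>s = sqrt (1 - x\<^sup>2)\<close>, \<open>c = sqrt (1 - t\<^sup>2)\<close> and the argument \<open>W = 1 - x t + s c\<close> of the second
  logarithm, the claim reduces to the identity \<open>s W + (x - t) (t s + x c) = c W\<close>.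
\<close>
lemma semicircle_primitive_derivative:
  assumes t: "-1 < t" "t < 1" and x: "-1 < x" "x < 1" "x \<noteq> t"
  shows "((\<lambda>x. sqrt (1 - x\<^sup>2) - t * arcsin x + sqrt (1 - t\<^sup>2) *
      (ln \<bar>x - t\<bar> - ln (1 - x * t + sqrt (1 - x\<^sup>2) * sqrt (1 - t\<^sup>2))))
    has_real_derivative sqrt (1 - x\<^sup>2) / (x - t)) (at x)"
proof -
  define s c W where "s = sqrt (1 - x\<^sup>2)" and "c = sqrt (1 - t\<^sup>2)" and "W = 1 - x * t + s * c"
  have x2: "x\<^sup>2 < 1" and t2: "t\<^sup>2 < 1" using t x by (auto simp: abs_square_less_1)
  have s: "s > 0" "s\<^sup>2 = 1 - x\<^sup>2" and c: "c > 0" "c\<^sup>2 = 1 - t\<^sup>2"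
    using x2 t2 by (auto simp: s_def c_def)
  have "x * t < 1"
  proof -
    have "\<bar>x\<bar> * \<bar>t\<bar> < 1 * 1" using t x by (intro mult_strict_mono) auto
    then show ?thesis by (simp add: abs_mult[symmetric] abs_less_iff)
  qed
  then have W: "W > 0" using s c by (simp add: W_def add_pos_nonneg)
  have dl: "((\<lambda>x. ln \<bar>x - t\<bar>) has_real_derivative 1 / (x - t)) (at x)"
  proof (cases "x > t")
    case True
    have "((\<lambda>x. ln (x - t)) has_real_derivative 1 / (x - t)) (at x)"
      using True by (auto intro!: derivative_eq_intros)
    then show ?thesis
      by (rule has_field_derivative_transform_within_open[where S = "{t<..}"]) (use True in auto)
  next
    case False
    with x have lt: "x < t" by simp
    have "((\<lambda>x. ln (t - x)) has_real_derivative - (1 / (t - x))) (at x)"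
      using lt by (auto intro!: derivative_eq_intros)
    also have "- (1 / (t - x)) = 1 / (x - t)" by (metis minus_diff_eq minus_divide_right)
    finally show ?thesis
      by (rule has_field_derivative_transform_within_open[where S = "{..<t}"]) (use lt in auto)
  qed
  have ds: "((\<lambda>x. sqrt (1 - x\<^sup>2)) has_real_derivative - (x / s)) (at x)"
    using x2 by (auto intro!: derivative_eq_intros simp: s_def field_simps)
  have da: "(arcsin has_real_derivative 1 / s) (at x)"
    using DERIV_arcsin[of x] x by (simp add: s_def inverse_eq_divide)
  have dW: "((\<lambda>x. 1 - x * t + sqrt (1 - x\<^sup>2) * c) has_real_derivative - t - (x / s) * c) (at x)"
    by (rule DERIV_cong[OF DERIV_add[OF DERIV_diff[OF DERIV_const DERIV_cmult_right[OF DERIV_ident]] DERIV_cmult_right[OF ds]]]) simp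
  have Ws: "1 - x * t + sqrt (1 - x\<^sup>2) * c = W" by (simp add: W_def s_def)
  have dlW: "((\<lambda>x. ln (1 - x * t + sqrt (1 - x\<^sup>2) * c)) has_real_derivative (- t - (x / s) * c) / W) (at x)"
    by (rule DERIV_cong[OF DERIV_chain2[OF DERIV_ln_divide dW]]) (simp_all only: Ws W, simp)
  have "((\<lambda>x. sqrt (1 - x\<^sup>2) - t * arcsin x + c * (ln \<bar>x - t\<bar> - ln (1 - x * t + sqrt (1 - x\<^sup>2) * c)))
    has_real_derivative - (x / s) - t * (1 / s) + c * (1 / (x - t) - (- t - (x / s) * c) / W)) (at x)"
    by (rule DERIV_add[OF DERIV_diff[OF ds DERIV_cmult[OF da]] DERIV_cmult[OF DERIV_diff[OF dl dlW]]])
  also have "- (x / s) - t * (1 / s) + c * (1 / (x - t) - (- t - (x / s) * c) / W) = s / (x - t)"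
  proof -
    have xt: "x - t \<noteq> 0" using x by simp
    have "s * (W + (x - t) * (t + (x / s) * c)) = s * W + (x - t) * (t * s + x * c)"
      using s by (simp add: field_simps)
    also have "\<dots> = c * W"
    proof -
      have "s * W = s - s * x * t + s\<^sup>2 * c" by (simp add: W_def algebra_simps power2_eq_square)
      moreover have "c * W = c - c * x * t + s * c\<^sup>2" by (simp add: W_def algebra_simps power2_eq_square)
      ultimately show ?thesis unfolding s(2) c(2) by (simp add: algebra_simps power2_eq_square)
    qed
    finally have "(W + (x - t) * (t + (x / s) * c)) * s = c * W" by (simp only: mult.commute)
    then have "W + (x - t) * (t + (x / s) * c) = c * W / s"
      using s by (intro eq_divide_imp) auto
    moreover have "1 / (x - t) - (- t - (x / s) * c) / W = (W + (x - t) * (t + (x / s) * c)) / ((x - t) * W)"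
      using W xt by (simp add: field_simps)
    ultimately have E: "1 / (x - t) - (- t - (x / s) * c) / W = c / (s * (x - t))"
      using W s xt by (simp add: field_simps)
    have "- (x / s) - t * (1 / s) + c * (1 / (x - t) - (- t - (x / s) * c) / W) = (c\<^sup>2 - (x + t) * (x - t)) / (s * (x - t))"
      unfolding E using s(1) xt by (simp add: field_simps power2_eq_square)
    also have "c\<^sup>2 - (x + t) * (x - t) = s\<^sup>2" unfolding c s by (simp add: algebra_simps power2_eq_square)
    also have "s\<^sup>2 / (s * (x - t)) = s / (x - t)" using s(1) by (simp add: power2_eq_square)
    finally show ?thesis .
  qed
  finally show ?thesis unfolding s_def c_def .
qed

definition semicircle :: "real \<Rightarrow> complex"
  where "semicircle x = complex_of_real (sqrt (1 - x\<^sup>2))"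

lemma semicircle_measurable [measurable]: "semicircle \<in> borel_measurable mu"
  unfolding semicircle_def[abs_def] by (rule borel_measurable_mu) measurable

lemma semicircle_bound: "x \<in> {-1<..<1} \<Longrightarrow> cmod (semicircle x) \<le> 1"
proof -
  assume "x \<in> {-1<..<1}"
  then have "0 \<le> 1 - x\<^sup>2" by (auto simp: abs_square_le_1)
  then show ?thesis by (simp add: semicircle_def)
qed

text \<open>
  The primitive is a continuous function plus a multiple of \<open>ln \<bar>x - t\<bar>\<close>, and the logarithms cancel at the
  points \<open>t - e\<close> and \<open>t + e\<close>. What remains is the contribution of the end points of the interval.
\<close>
theorem semicircle_pv:
  assumes t: "-1 < t" "t < 1"
  shows "(truncated_hilbert semicircle t \<longlongrightarrow> - complex_of_real t) (at_right 0)"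
proof -
  define c where "c = sqrt (1 - t\<^sup>2)"
  define B where "B x = sqrt (1 - x\<^sup>2) - t * arcsin x - c * ln (1 - x * t + sqrt (1 - x\<^sup>2) * c)" for x
  define A where "A x = sqrt (1 - x\<^sup>2) - t * arcsin x + c * (ln \<bar>x - t\<bar> - ln (1 - x * t + sqrt (1 - x\<^sup>2) * c))" for x
  have AB: "A x = B x + c * ln \<bar>x - t\<bar>" for x by (simp add: A_def B_def algebra_simps)
  have c0: "c > 0" using t by (auto simp: c_def abs_square_less_1)
  have W: "1 - x * t + sqrt (1 - x\<^sup>2) * c > 0" if "x \<in> {-1..1}" for x
  proof -
    have "\<bar>x\<bar> * \<bar>t\<bar> \<le> 1 * \<bar>t\<bar>" using that by (intro mult_right_mono) auto
    also have "\<dots> < 1" using t by auto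
    finally have "x * t < 1" by (simp add: abs_mult[symmetric] abs_less_iff)
    moreover have "0 \<le> sqrt (1 - x\<^sup>2) * c" using that c0 by (auto intro!: mult_nonneg_nonneg simp: abs_square_le_1)
    ultimately show ?thesis by linarith
  qed
  have Bc: "continuous_on {-1..1} B"
    unfolding B_def using W by (intro continuous_intros) (auto simp: less_imp_neq[symmetric])
  have Ac: "continuous_on S A" if "S \<subseteq> {-1..1}" "t \<notin> S" for S
    unfolding AB using that by (intro continuous_intros continuous_on_subset[OF Bc]) auto
  have fc: "continuous_on S (\<lambda>x. sqrt (1 - x\<^sup>2) / (x - t))" if "t \<notin> S" for S
    using that by (intro continuous_intros) auto
  have A1: "A 1 - A (-1) = - pi * t"
  proof -
    have a1: "A 1 = - t * (pi / 2)" using t by (simp add: A_def)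
    have a2: "A (-1) = t * (pi / 2)" using t by (simp add: A_def add.commute)
    have "A 1 - A (-1) = - t * (pi / 2) - t * (pi / 2)" unfolding a1 a2 ..
    also have "\<dots> = - pi * t" by (simp add: field_simps)
    finally show ?thesis .
  qed
  have tr: "truncated_hilbert semicircle t e = complex_of_real (1 / pi * ((A (t - e) - A (t + e)) - pi * t))"
    if e: "0 < e" "e < 1 - \<bar>t\<bar>" for e
  proof -
    have L: "(LINT x:{-1<..<t - e}|mu. semicircle x / complex_of_real (x - t)) = complex_of_real (LINT x:{-1<..<t - e}|mu. sqrt (1 - x\<^sup>2) / (x - t))"
      unfolding set_lebesgue_integral_def integral_complex_of_real[symmetric]
      by (intro Bochner_Integration.integral_cong refl) (simp add: semicircle_def scaleR_conv_of_real)
    have R: "(LINT x:{t + e<..<1}|mu. semicircle x / complex_of_real (x - t)) = complex_of_real (LINT x:{t + e<..<1}|mu. sqrt (1 - x\<^sup>2) / (x - t))"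
      unfolding set_lebesgue_integral_def integral_complex_of_real[symmetric]
      by (intro Bochner_Integration.integral_cong refl) (simp add: semicircle_def scaleR_conv_of_real)
    have L2: "(LINT x:{-1<..<t - e}|mu. sqrt (1 - x\<^sup>2) / (x - t)) = A (t - e) - A (-1)"
    proof (rule set_integral_mu_FTC_interior)
      show "continuous_on {-1..t - e} (\<lambda>x. sqrt (1 - x\<^sup>2) / (x - t))" using e by (intro fc) auto
      show "continuous_on {-1..t - e} A" using e t by (intro Ac) auto
      show "(A has_real_derivative sqrt (1 - x\<^sup>2) / (x - t)) (at x)" if "-1 < x" "x < t - e" for x
        using semicircle_primitive_derivative[of t x] t e that by (simp add: A_def[abs_def] c_def)
    qed (use e t in \<open>auto simp: abs_if split: if_splits\<close>)
    have R2: "(LINT x:{t + e<..<1}|mu. sqrt (1 - x\<^sup>2) / (x - t)) = A 1 - A (t + e)"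
    proof (rule set_integral_mu_FTC_interior)
      show "continuous_on {t + e..1} (\<lambda>x. sqrt (1 - x\<^sup>2) / (x - t))" using e by (intro fc) auto
      show "continuous_on {t + e..1} A" using e t by (intro Ac) auto
      show "(A has_real_derivative sqrt (1 - x\<^sup>2) / (x - t)) (at x)" if "t + e < x" "x < 1" for x
        using semicircle_primitive_derivative[of t x] t e that by (simp add: A_def[abs_def] c_def)
    qed (use e t in \<open>auto simp: abs_if split: if_splits\<close>)
    have "truncated_hilbert semicircle t e = complex_of_real (1 / pi * ((A (t - e) - A (-1)) + (A 1 - A (t + e))))"
      unfolding truncated_hilbert_def L R L2 R2 by simp
    also have "(A (t - e) - A (-1)) + (A 1 - A (t + e)) = (A (t - e) - A (t + e)) - pi * t"
      using A1 by linarith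
    finally show ?thesis .
  qed
  have Bt: "isCont B t"
    using continuous_on_interior[OF Bc, of t] t by simp
  have "((\<lambda>e. 1 / pi * ((B (t - e) - B (t + e)) - pi * t)) \<longlongrightarrow> 1 / pi * ((B (t - 0) - B (t + 0)) - pi * t)) (at_right 0)"
    using Bt by (intro tendsto_intros isCont_tendsto_compose[of _ B]) auto
  then have lim: "((\<lambda>e. 1 / pi * ((B (t - e) - B (t + e)) - pi * t)) \<longlongrightarrow> - t) (at_right 0)" by simp
  have "\<forall>\<^sub>F e in at_right 0. complex_of_real (1 / pi * ((B (t - e) - B (t + e)) - pi * t)) = truncated_hilbert semicircle t e"
    unfolding eventually_at_right_field
  proof (intro exI[of _ "1 - \<bar>t\<bar>"] conjI allI impI)
    fix e assume e: "0 < e" "e < 1 - \<bar>t\<bar>"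
    show "complex_of_real (1 / pi * ((B (t - e) - B (t + e)) - pi * t)) = truncated_hilbert semicircle t e"
      unfolding tr[OF e] AB by simp
  qed (use t in auto)
  from Lim_transform_eventually[OF tendsto_of_real[OF lim] this] show ?thesis by simp
qed

text \<open>
  Since \<open>x / (x - t) = 1 + t / (x - t)\<close>, multiplication by the variable commutes with the transform up to a
  constant.
\<close>
lemma truncated_hilbert_mult_id:
  assumes g: "g \<in> borel_measurable mu" and b: "\<And>x. x \<in> {-1<..<1} \<Longrightarrow> cmod (g x) \<le> B"
  shows "((\<lambda>e. truncated_hilbert (\<lambda>x. complex_of_real x * g x) t e - complex_of_real t * truncated_hilbert g t e)
     \<longlongrightarrow> (LINT x|mu. g x) / complex_of_real pi) (at_right 0)"
proof (rule LIM_zero_cancel, rule Lim_null_comparison)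
  have gi: "integrable mu g" by (rule integrable_mu_bounded[OF g b])
  note g[measurable]
  have xgi: "integrable mu (\<lambda>x. complex_of_real x * g x)"
  proof (rule integrable_mu_bounded[where B = "1 * B"])
    show "norm (complex_of_real x * g x) \<le> 1 * B" if "x \<in> {-1<..<1}" for x
      unfolding norm_mult by (intro mult_mono) (use b[OF that] that in auto)
  qed measurable
  have B0: "0 \<le> B" by (rule order_trans[OF norm_ge_zero b[of 0]]) simp
  show "((\<lambda>e. B * (2 * e)) \<longlongrightarrow> 0) (at_right (0::real))"
  proof -
    have "((\<lambda>e. B * (2 * e)) \<longlongrightarrow> B * (2 * 0)) (at_right (0::real))" by (intro tendsto_intros)
    then show ?thesis by simp
  qed
  show "\<forall>\<^sub>F e in at_right 0. norm (truncated_hilbert (\<lambda>x. complex_of_real x * g x) t e - complex_of_real t * truncated_hilbert g t e - (LINT x|mu. g x) / complex_of_real pi) \<le> B * (2 * e)"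
    using eventually_at_right_less[of 0]
  proof eventually_elim
    case (elim e)
    note k1 = truncated_hilbert_kernel[OF xgi elim, of t] and k2 = truncated_hilbert_kernel[OF gi elim, of t]
    have "truncated_hilbert (\<lambda>x. complex_of_real x * g x) t e - complex_of_real t * truncated_hilbert g t e - (LINT x|mu. g x) / complex_of_real pi
      = (LINT x|mu. (complex_of_real x * g x * complex_of_real (pv_kernel e (x - t)) - complex_of_real t * (g x * complex_of_real (pv_kernel e (x - t)))) - g x / complex_of_real pi)"
      unfolding k1 k2 using k1(2) k2(2) gi by simp
    also have "\<dots> = (LINT x|mu. - (indicator (cball t e) x *\<^sub>R (g x / complex_of_real pi)))"
    proof (intro Bochner_Integration.integral_cong refl)
      fix x
      have "complex_of_real x * g x * complex_of_real (pv_kernel e (x - t)) - complex_of_real t * (g x * complex_of_real (pv_kernel e (x - t)))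
        = g x * complex_of_real ((x - t) * pv_kernel e (x - t))" by (simp add: algebra_simps)
      also have "(x - t) * pv_kernel e (x - t) = (if x \<in> cball t e then 0 else 1 / pi)"
        using elim by (auto simp: pv_kernel_def dist_real_def abs_minus_commute)
      finally show "complex_of_real x * g x * complex_of_real (pv_kernel e (x - t)) - complex_of_real t * (g x * complex_of_real (pv_kernel e (x - t))) - g x / complex_of_real pi
         = - (indicator (cball t e) x *\<^sub>R (g x / complex_of_real pi))"
        by (auto simp: indicator_def)
    qed
    also have "norm \<dots> \<le> (LINT x:cball t e|mu. B)"
      unfolding set_lebesgue_integral_def
    proof (rule Bochner_Integration.integral_norm_bound_integral)
      show "integrable mu (\<lambda>x. - (indicator (cball t e) x *\<^sub>R (g x / complex_of_real pi)))"
        using set_integrable_mu[of "\<lambda>x. g x / complex_of_real pi" "cball t e"] gi by (simp add: set_integrable_def)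
      show "integrable mu (\<lambda>x. indicator (cball t e) x *\<^sub>R B)"
        using set_integrable_mu[of "\<lambda>x. B" "cball t e"] by (simp add: set_integrable_def)
      fix x assume "x \<in> space mu"
      then have "cmod (g x) \<le> B" using b by (simp add: space_mu)
      moreover have "cmod (g x) / pi \<le> cmod (g x) / 1" using pi_ge_two by (intro divide_left_mono) auto
      ultimately show "norm (- (indicator (cball t e) x *\<^sub>R (g x / complex_of_real pi))) \<le> indicator (cball t e) x *\<^sub>R B"
        by (auto simp: indicator_def norm_divide)
    qed
    also have "\<dots> \<le> 2 * B * e" by (rule set_integral_const_cball_mu[OF elim B0])
    finally show ?case by (simp add: mult_ac)
  qed
qed

subsection \<open>A function whose transform is unimodular\<close>

lemma mu_integral_odd:
  fixes f :: "real \<Rightarrow> real"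
  assumes "\<And>x. f (- x) = - f x"
  shows "(LINT x|mu. f x) = 0"
  using integral_mu_reflect[of f] assms by simp

text \<open>
  For general \<open>a\<close> the integral is \<open>pi (sqrt (1 + a\<^sup>2) / a - 1)\<close>. The primitive used below is
  \<open>- arcsin x + (sqrt (1 + a\<^sup>2) / a) arcsin (q x)\<close>, and the factor is 2 for this \<open>a\<close>.
\<close>
lemma semicircle_poisson_integral:
  fixes a :: real
  assumes a: "a = sqrt (1 / 3)"
  shows "(LINT x|mu. sqrt (1 - x\<^sup>2) / (x\<^sup>2 + a\<^sup>2)) = pi"
proof -
  have a0: "a > 0" and a2: "a\<^sup>2 = 1 / 3" using a by auto
  \<comment> \<open>At the end points \<open>q\<close> takes the values 1 and -1, since \<open>sqrt (1 + a\<^sup>2) = 2 a\<close>.\<close>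
  define q where "q x = 2 * a * x / sqrt (x\<^sup>2 + a\<^sup>2)" for x
  have p: "x\<^sup>2 + a\<^sup>2 > 0" for x using a0 by (simp add: add_nonneg_pos)
  have q1: "1 - (q x)\<^sup>2 = a\<^sup>2 * (1 - x\<^sup>2) / (x\<^sup>2 + a\<^sup>2)" for x
  proof -
    have "(q x)\<^sup>2 = 4 * a\<^sup>2 * x\<^sup>2 / (x\<^sup>2 + a\<^sup>2)"
      using p[of x] by (simp add: q_def power_divide power_mult_distrib)
    then show ?thesis using p[of x] by (simp add: a2 field_simps)
  qed
  have qle: "\<bar>q x\<bar> \<le> 1" if "x \<in> {-1..1}" for x
  proof -
    have "x\<^sup>2 \<le> 1" using that by (auto simp: abs_square_le_1)
    then have "0 \<le> 1 - (q x)\<^sup>2" unfolding q1 using p[of x] by (intro divide_nonneg_pos mult_nonneg_nonneg) auto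
    then show ?thesis by (simp add: abs_square_le_1)
  qed
  have e1: "sqrt (1 + a\<^sup>2) = 2 * a"
  proof (rule real_sqrt_unique)
    show "(2 * a)\<^sup>2 = 1 + a\<^sup>2" by (simp add: power_mult_distrib a2)
  qed (use a0 in simp)
  have "(LINT x:{-1<..<1}|mu. sqrt (1 - x\<^sup>2) / (x\<^sup>2 + a\<^sup>2)) = (- arcsin 1 + 2 * arcsin (q 1)) - (- arcsin (-1) + 2 * arcsin (q (-1)))"
  proof (rule set_integral_mu_FTC_interior)
    show "continuous_on {-1..1} (\<lambda>x. sqrt (1 - x\<^sup>2) / (x\<^sup>2 + a\<^sup>2))"
      using a0 by (intro continuous_intros) (auto simp: add_nonneg_pos less_imp_neq[symmetric])
    have "continuous_on {-1..1} q"
      unfolding q_def using a0 by (intro continuous_intros) (auto simp: add_nonneg_pos less_imp_neq[symmetric])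
    moreover have "\<forall>x\<in>{-1..1}. -1 \<le> q x \<and> q x \<le> 1" using qle by (force simp: abs_le_iff)
    ultimately show "continuous_on {-1..1} (\<lambda>x. - arcsin x + 2 * arcsin (q x))"
      by (intro continuous_intros) auto
    fix x :: real assume x: "-1 < x" "x < 1"
    define s where "s = sqrt (1 - x\<^sup>2)"
    define r where "r = sqrt (x\<^sup>2 + a\<^sup>2)"
    have s: "s > 0" "s\<^sup>2 = 1 - x\<^sup>2" using x by (auto simp: s_def abs_square_less_1 abs_square_le_1)
    have r: "r > 0" "r\<^sup>2 = x\<^sup>2 + a\<^sup>2" using p[of x] by (auto simp: r_def)
    have da: "(arcsin has_real_derivative 1 / s) (at x)"
      using DERIV_arcsin[of x] x by (simp add: s_def inverse_eq_divide)
    have dr: "((\<lambda>x. sqrt (x\<^sup>2 + a\<^sup>2)) has_real_derivative x / r) (at x)"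
      using p[of x] by (auto intro!: derivative_eq_intros simp: r_def field_simps)
    have dq: "(q has_real_derivative 2 * a * a\<^sup>2 / r ^ 3) (at x)"
    proof -
      have "(q has_real_derivative ((2 * a) * r - (2 * a * x) * (x / r)) / (r * r)) (at x)"
        unfolding q_def[abs_def] using DERIV_divide[OF DERIV_cmult[OF DERIV_ident, of "2 * a"] dr] r a0 by (simp add: r_def)
      also have "((2 * a) * r - (2 * a * x) * (x / r)) / (r * r) = 2 * a * (r\<^sup>2 - x\<^sup>2) / r ^ 3"
        using r(1) by (simp add: field_simps power2_eq_square power3_eq_cube)
      also have "r\<^sup>2 - x\<^sup>2 = a\<^sup>2" using r by simp
      finally show ?thesis .
    qed
    have q1x: "1 - (q x)\<^sup>2 = (a * s / r)\<^sup>2"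
      unfolding q1 by (simp add: power_divide power_mult_distrib s r)
    have asr: "a * s / r > 0" using a0 s r by simp
    then have "(q x)\<^sup>2 < 1" using q1x by (smt (verit) zero_less_power)
    then have "\<bar>q x\<bar> < 1" by (simp add: abs_square_less_1)
    then have dA: "((\<lambda>x. arcsin (q x)) has_real_derivative inverse (sqrt (1 - (q x)\<^sup>2)) * (2 * a * a\<^sup>2 / r ^ 3)) (at x)"
      by (intro DERIV_chain2[OF DERIV_arcsin dq]) auto
    have "sqrt (1 - (q x)\<^sup>2) = a * s / r" unfolding q1x using asr by (simp only: real_sqrt_abs abs_of_pos)
    then have "inverse (sqrt (1 - (q x)\<^sup>2)) * (2 * a * a\<^sup>2 / r ^ 3) = 2 * a\<^sup>2 / (s * r\<^sup>2)"
      using a0 s(1) r(1) by (simp add: field_simps power2_eq_square power3_eq_cube)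
    with dA have dA': "((\<lambda>x. arcsin (q x)) has_real_derivative 2 * a\<^sup>2 / (s * r\<^sup>2)) (at x)" by simp
    have "((\<lambda>x. - arcsin x + 2 * arcsin (q x)) has_real_derivative - (1 / s) + 2 * (2 * a\<^sup>2 / (s * r\<^sup>2))) (at x)"
      by (intro DERIV_add DERIV_minus da DERIV_cmult dA')
    also have "- (1 / s) + 2 * (2 * a\<^sup>2 / (s * r\<^sup>2)) = (4 * a\<^sup>2 - r\<^sup>2) / (s * r\<^sup>2)"
      using s(1) r(1) by (simp add: field_simps)
    also have "4 * a\<^sup>2 - r\<^sup>2 = s\<^sup>2" unfolding r s a2 by simp
    also have "s\<^sup>2 / (s * r\<^sup>2) = s / r\<^sup>2" using s(1) by (simp add: power2_eq_square)
    also have "s / r\<^sup>2 = sqrt (1 - x\<^sup>2) / (x\<^sup>2 + a\<^sup>2)" unfolding r(2) s_def ..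
    finally show "((\<lambda>x. - arcsin x + 2 * arcsin (q x)) has_real_derivative sqrt (1 - x\<^sup>2) / (x\<^sup>2 + a\<^sup>2)) (at x)" .
  qed auto
  also have "q 1 = 1" using e1 a0 by (simp add: q_def)
  also have "q (-1) = -1" using e1 a0 by (simp add: q_def)
  finally show ?thesis unfolding set_integral_mu_space by simp
qed

text \<open>
  For \<open>a > 0\<close> the function \<open>sqrt (1 - x\<^sup>2) / (x + i a)\<close> has the transform \<open>- (t - i b) / (t + i a)\<close> with
  \<open>b = sqrt (1 + a\<^sup>2) - a\<close>. It is unimodular for \<open>b = a\<close>, that is for \<open>a = 1 / sqrt 3\<close>.
\<close>
definition unimodular_preimage :: "real \<Rightarrow> complex"
  where "unimodular_preimage x = semicircle x / (complex_of_real x + \<i> * complex_of_real (sqrt (1 / 3)))"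

lemma complex_shift_nonzero: "a > 0 \<Longrightarrow> complex_of_real x + \<i> * complex_of_real a \<noteq> 0"
  by (auto simp: complex_eq_iff)

lemma unimodular_preimage_measurable [measurable]: "unimodular_preimage \<in> borel_measurable mu"
proof -
  show ?thesis unfolding unimodular_preimage_def[abs_def] by measurable
qed

lemma unimodular_preimage_bound:
  assumes "x \<in> {-1<..<1}" shows "cmod (unimodular_preimage x) \<le> 2"
proof -
  let ?a = "sqrt (1 / 3)"
  have "1 / 2 \<le> ?a" by (rule real_le_rsqrt) (simp add: power2_eq_square)
  also have "?a \<le> cmod (complex_of_real x + \<i> * complex_of_real ?a)"
    using abs_Im_le_cmod[of "complex_of_real x + \<i> * complex_of_real ?a"] by simp
  finally have "cmod (semicircle x) / cmod (complex_of_real x + \<i> * complex_of_real ?a) \<le> 1 / (1 / 2)"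
    using semicircle_bound[OF assms] by (intro frac_le) auto
  then show ?thesis by (simp add: unimodular_preimage_def norm_divide)
qed

lemma unimodular_preimage_integral:
  "(LINT x|mu. unimodular_preimage x) = - \<i> * complex_of_real (sqrt (1 / 3)) * complex_of_real pi"
proof -
  define a where "a = sqrt (1 / 3)"
  have a0: "a > 0" by (simp add: a_def)
  have p: "x\<^sup>2 + a\<^sup>2 > 0" for x using a0 by (simp add: add_nonneg_pos)
  have e: "unimodular_preimage x = Complex (sqrt (1 - x\<^sup>2) * x / (x\<^sup>2 + a\<^sup>2)) (- a * (sqrt (1 - x\<^sup>2) / (x\<^sup>2 + a\<^sup>2)))" for x
    unfolding unimodular_preimage_def semicircle_def a_def[symmetric]
    by (simp add: complex_eq_iff Re_divide Im_divide)
  have i: "integrable mu unimodular_preimage"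
    by (rule integrable_mu_bounded[OF _ unimodular_preimage_bound]) measurable
  have "Re (LINT x|mu. unimodular_preimage x) = (LINT x|mu. Re (unimodular_preimage x))"
    by (rule integral_Re[symmetric, OF i])
  also have "\<dots> = (LINT x|mu. sqrt (1 - x\<^sup>2) * x / (x\<^sup>2 + a\<^sup>2))" by (simp add: e)
  also have "\<dots> = 0" by (rule mu_integral_odd) simp
  finally have R: "Re (LINT x|mu. unimodular_preimage x) = 0" .
  have "Im (LINT x|mu. unimodular_preimage x) = (LINT x|mu. Im (unimodular_preimage x))"
    by (rule integral_Im[symmetric, OF i])
  also have "\<dots> = (LINT x|mu. - a * (sqrt (1 - x\<^sup>2) / (x\<^sup>2 + a\<^sup>2)))" by (simp add: e)
  also have "\<dots> = - a * pi" using semicircle_poisson_integral[OF a_def] by (simp only: integral_mult_right_zero)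
  finally have I: "Im (LINT x|mu. unimodular_preimage x) = - a * pi" .
  show ?thesis using R I by (simp add: complex_eq_iff a_def)
qed

text \<open>
  Multiplied by \<open>x + i a\<close> the function becomes \<open>semicircle\<close>, whose transform is known. As multiplication by
  \<open>x\<close> is compatible with the transform up to a constant, the result can be divided by \<open>t + i a\<close>.
\<close>
theorem finite_hilbert_unimodular_preimage:
  assumes t: "t \<in> {-1<..<1}"
  shows "finite_hilbert unimodular_preimage t =
    - (complex_of_real t - \<i> * complex_of_real (sqrt (1 / 3))) / (complex_of_real t + \<i> * complex_of_real (sqrt (1 / 3)))"
proof (rule finite_hilbert_eqI)
  define a where "a = complex_of_real (sqrt (1 / 3))"
  define u where "u = unimodular_preimage"
  have nz: "complex_of_real x + \<i> * a \<noteq> 0" for x unfolding a_def by (rule complex_shift_nonzero) simp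
  have um[measurable]: "u \<in> borel_measurable mu" unfolding u_def by measurable
  have ui: "integrable mu u" unfolding u_def
    by (rule integrable_mu_bounded[OF _ unimodular_preimage_bound]) measurable
  have xui: "integrable mu (\<lambda>x. complex_of_real x * u x)"
  proof (rule integrable_mu_bounded[where B = "1 * 2"])
    show "norm (complex_of_real x * u x) \<le> 1 * 2" if "x \<in> {-1<..<1}" for x
      unfolding norm_mult u_def by (intro mult_mono) (use unimodular_preimage_bound[OF that] that in auto)
  qed measurable
  have w: "semicircle x = complex_of_real x * u x + \<i> * a * u x" for x
  proof -
    have "complex_of_real x * u x + \<i> * a * u x = (complex_of_real x + \<i> * a) * u x" by (simp add: distrib_right)
    also have "\<dots> = semicircle x"
      using nz[of x] unfolding u_def unimodular_preimage_def a_def[symmetric] by simp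
    finally show ?thesis ..
  qed
  have tw: "truncated_hilbert semicircle t e = truncated_hilbert (\<lambda>x. complex_of_real x * u x) t e + \<i> * a * truncated_hilbert u t e" if "e > 0" for e
  proof -
    have si: "integrable mu semicircle" by (rule integrable_mu_bounded[OF _ semicircle_bound]) measurable
    have "truncated_hilbert semicircle t e = (LINT x|mu. complex_of_real x * u x * complex_of_real (pv_kernel e (x - t)) + \<i> * a * (u x * complex_of_real (pv_kernel e (x - t))))"
      unfolding truncated_hilbert_kernel(1)[OF si that] by (intro Bochner_Integration.integral_cong refl) (simp add: w algebra_simps)
    also have "\<dots> = truncated_hilbert (\<lambda>x. complex_of_real x * u x) t e + \<i> * a * truncated_hilbert u t e"
      unfolding truncated_hilbert_kernel(1)[OF xui that] truncated_hilbert_kernel(1)[OF ui that]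
      using truncated_hilbert_kernel(2)[OF xui that, of t] truncated_hilbert_kernel(2)[OF ui that, of t]
      by simp
    finally show ?thesis .
  qed
  have l1: "((\<lambda>e. truncated_hilbert (\<lambda>x. complex_of_real x * u x) t e - complex_of_real t * truncated_hilbert u t e) \<longlongrightarrow> - \<i> * a) (at_right 0)"
  proof -
    have "(LINT x|mu. u x) / complex_of_real pi = - \<i> * a"
      unfolding u_def unimodular_preimage_integral a_def by simp
    then show ?thesis
      using truncated_hilbert_mult_id[OF um, of 2 t] unimodular_preimage_bound by (simp add: u_def)
  qed
  have l2: "(truncated_hilbert semicircle t \<longlongrightarrow> - complex_of_real t) (at_right 0)"
    using t by (intro semicircle_pv) auto
  have "((\<lambda>e. (truncated_hilbert semicircle t e - (truncated_hilbert (\<lambda>x. complex_of_real x * u x) t e - complex_of_real t * truncated_hilbert u t e)) / (complex_of_real t + \<i> * a))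
     \<longlongrightarrow> (- complex_of_real t - - \<i> * a) / (complex_of_real t + \<i> * a)) (at_right 0)"
    by (intro tendsto_intros l1 l2 nz)
  moreover have "\<forall>\<^sub>F e in at_right 0. (truncated_hilbert semicircle t e - (truncated_hilbert (\<lambda>x. complex_of_real x * u x) t e - complex_of_real t * truncated_hilbert u t e)) / (complex_of_real t + \<i> * a) = truncated_hilbert u t e"
    using eventually_at_right_less[of 0]
  proof eventually_elim
    case (elim e)
    have "truncated_hilbert semicircle t e - (truncated_hilbert (\<lambda>x. complex_of_real x * u x) t e - complex_of_real t * truncated_hilbert u t e) = truncated_hilbert u t e * (complex_of_real t + \<i> * a)"
      unfolding tw[OF elim] by (simp add: algebra_simps)
    then show ?case using nz[of t] by simp
  qed
  ultimately have "(truncated_hilbert u t \<longlongrightarrow> (- complex_of_real t - - \<i> * a) / (complex_of_real t + \<i> * a)) (at_right 0)"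
    by (rule Lim_transform_eventually)
  then show "(truncated_hilbert unimodular_preimage t \<longlongrightarrow> - (complex_of_real t - \<i> * complex_of_real (sqrt (1 / 3))) / (complex_of_real t + \<i> * complex_of_real (sqrt (1 / 3)))) (at_right 0)"
    by (simp add: u_def a_def)
qed

subsection \<open>Chebyshev functions\<close>

definition cheb_sin :: "nat \<Rightarrow> real \<Rightarrow> real"
  where "cheb_sin n x = sin (real n * arccos x)"

text \<open>
  The Chebyshev polynomial \<open>T\<^sub>n\<close>; correspondingly \<open>cheb_sin n\<close> is \<open>sqrt (1 - x\<^sup>2)\<close> times the Chebyshev polynomial
  of the second kind of degree \<open>n - 1\<close>.
\<close>
definition cheb_cos :: "nat \<Rightarrow> real \<Rightarrow> real"
  where "cheb_cos n x = cos (real n * arccos x)"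

lemma cheb_continuous:
  "continuous_on {-1..1} (cheb_sin n)" "continuous_on {-1..1} (cheb_cos n)"
  unfolding cheb_sin_def cheb_cos_def by (intro continuous_intros; force)+

lemma cheb_measurable [measurable]:
  "cheb_sin n \<in> borel_measurable mu" "cheb_cos n \<in> borel_measurable mu"
  by (intro borel_measurable_mu_continuous continuous_on_subset[OF cheb_continuous(1)] continuous_on_subset[OF cheb_continuous(2)]; force)+

lemma cheb_bound: "\<bar>cheb_sin n x\<bar> \<le> 1" "\<bar>cheb_cos n x\<bar> \<le> 1"
  by (auto simp: cheb_sin_def cheb_cos_def)

lemma cheb_sin_1: "x \<in> {-1..1} \<Longrightarrow> cheb_sin 1 x = sqrt (1 - x\<^sup>2)"
  by (auto simp: cheb_sin_def sin_arccos)

lemma cheb_sin_recurrence: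
  assumes "x \<in> {-1..1}"
  shows "cheb_sin (Suc (Suc n)) x = 2 * (x * cheb_sin (Suc n) x) - cheb_sin n x"
    and "cheb_cos (Suc (Suc n)) x = 2 * (x * cheb_cos (Suc n) x) - cheb_cos n x"
proof -
  let ?th = "arccos x"
  have c: "cos ?th = x" using assms by auto
  have 1: "real (Suc (Suc n)) * ?th = real (Suc n) * ?th + ?th" "real n * ?th = real (Suc n) * ?th - ?th"
    by (simp_all add: algebra_simps)
  show "cheb_sin (Suc (Suc n)) x = 2 * (x * cheb_sin (Suc n) x) - cheb_sin n x"
    unfolding cheb_sin_def 1 sin_add sin_diff c by simp
  show "cheb_cos (Suc (Suc n)) x = 2 * (x * cheb_cos (Suc n) x) - cheb_cos n x"
    unfolding cheb_cos_def 1 cos_add cos_diff c by simp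
qed

text \<open>
  The substitution \<open>x = cos \<theta>\<close> brings in a factor \<open>sin \<theta>\<close>, and the product formulas for \<open>sin (n \<theta>) sin \<theta>\<close> and
  \<open>cos (n \<theta>) sin \<theta>\<close> give the two neighbouring frequencies.
\<close>
lemma cheb_primitive_derivative:
  assumes x: "-1 < x" "x < 1" and n: "n \<ge> 2"
  shows "((\<lambda>x. (cheb_sin (n + 1) x / real (n + 1) - cheb_sin (n - 1) x / real (n - 1)) / 2) has_real_derivative cheb_sin n x) (at x)"
    and "((\<lambda>x. (cheb_cos (n + 1) x / real (n + 1) - cheb_cos (n - 1) x / real (n - 1)) / 2) has_real_derivative cheb_cos n x) (at x)"
proof -
  define s where "s = sqrt (1 - x\<^sup>2)"
  have s: "s > 0" using x by (auto simp: s_def abs_square_less_1)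
  let ?th = "arccos x"
  have sth: "sin ?th = s" using x by (simp add: s_def sin_arccos)
  have dt: "(arccos has_real_derivative - (1 / s)) (at x)"
    using DERIV_arccos[of x] x by (simp add: s_def inverse_eq_divide)
  have ds: "(cheb_sin m has_real_derivative cos (real m * ?th) * (real m * - (1 / s))) (at x)" for m
    unfolding cheb_sin_def[abs_def] by (intro DERIV_chain2[OF DERIV_sin DERIV_cmult] dt)
  have dc: "(cheb_cos m has_real_derivative - sin (real m * ?th) * (real m * - (1 / s))) (at x)" for m
    unfolding cheb_cos_def[abs_def] by (intro DERIV_chain2[OF DERIV_cos DERIV_cmult] dt)
  have n1: "real (n + 1) \<noteq> 0" "real (n - 1) \<noteq> 0" using n by auto
  have q: "(X * (A * - (1 / s)) / A - Y * (B * - (1 / s)) / B) / 2 = (Y - X) / (2 * s)"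
    if "A \<noteq> 0" "B \<noteq> 0" for X Y A B :: real
    using that s by (simp add: field_simps)
  have q': "(- X * (A * - (1 / s)) / A - - Y * (B * - (1 / s)) / B) / 2 = (X - Y) / (2 * s)"
    if "A \<noteq> 0" "B \<noteq> 0" for X Y A B :: real
    using that s by (simp add: field_simps)
  have rn: "real (n + 1) * ?th = real n * ?th + ?th" "real (n - 1) * ?th = real n * ?th - ?th"
    using n by (simp_all add: algebra_simps of_nat_diff)
  have "((\<lambda>x. (cheb_sin (n + 1) x / real (n + 1) - cheb_sin (n - 1) x / real (n - 1)) / 2) has_real_derivative
    (cos (real (n + 1) * ?th) * (real (n + 1) * - (1 / s)) / real (n + 1) - cos (real (n - 1) * ?th) * (real (n - 1) * - (1 / s)) / real (n - 1)) / 2) (at x)"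
    by (intro DERIV_cdivide DERIV_diff ds)
  also have "(cos (real (n + 1) * ?th) * (real (n + 1) * - (1 / s)) / real (n + 1) - cos (real (n - 1) * ?th) * (real (n - 1) * - (1 / s)) / real (n - 1)) / 2
     = (cos (real (n - 1) * ?th) - cos (real (n + 1) * ?th)) / (2 * s)"
    by (rule q[OF n1])
  also have "\<dots> = cheb_sin n x"
    unfolding rn cos_add cos_diff sth cheb_sin_def using s by simp
  finally show "((\<lambda>x. (cheb_sin (n + 1) x / real (n + 1) - cheb_sin (n - 1) x / real (n - 1)) / 2) has_real_derivative cheb_sin n x) (at x)" .
  have "((\<lambda>x. (cheb_cos (n + 1) x / real (n + 1) - cheb_cos (n - 1) x / real (n - 1)) / 2) has_real_derivative
    (- sin (real (n + 1) * ?th) * (real (n + 1) * - (1 / s)) / real (n + 1) - - sin (real (n - 1) * ?th) * (real (n - 1) * - (1 / s)) / real (n - 1)) / 2) (at x)"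
    by (intro DERIV_cdivide DERIV_diff dc)
  also have "(- sin (real (n + 1) * ?th) * (real (n + 1) * - (1 / s)) / real (n + 1) - - sin (real (n - 1) * ?th) * (real (n - 1) * - (1 / s)) / real (n - 1)) / 2
     = (sin (real (n + 1) * ?th) - sin (real (n - 1) * ?th)) / (2 * s)"
    by (rule q'[OF n1])
  also have "\<dots> = cheb_cos n x"
    unfolding rn sin_add sin_diff sth cheb_cos_def using s by simp
  finally show "((\<lambda>x. (cheb_cos (n + 1) x / real (n + 1) - cheb_cos (n - 1) x / real (n - 1)) / 2) has_real_derivative cheb_cos n x) (at x)" .
qed

lemma cheb_interval_integral:
  assumes n: "n \<ge> 2" and b: "-1 \<le> b" "b \<le> 1"
  shows "(LINT x:{-1<..<b}|mu. cheb_sin n x) = (cheb_sin (n + 1) b / real (n + 1) - cheb_sin (n - 1) b / real (n - 1)) / 2"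
    and "\<bar>LINT x:{-1<..<b}|mu. cheb_sin n x\<bar> \<le> 1 / real (n - 1)"
    and "\<bar>LINT x:{-1<..<b}|mu. cheb_cos n x\<bar> \<le> 2 / real (n - 1)"
proof -
  let ?S = "\<lambda>x. (cheb_sin (n + 1) x / real (n + 1) - cheb_sin (n - 1) x / real (n - 1)) / 2"
  let ?C = "\<lambda>x. (cheb_cos (n + 1) x / real (n + 1) - cheb_cos (n - 1) x / real (n - 1)) / 2"
  have cont: "continuous_on {-1..b} (cheb_sin m)" "continuous_on {-1..b} (cheb_cos m)" for m
    using b by (intro continuous_on_subset[OF cheb_continuous(1)] continuous_on_subset[OF cheb_continuous(2)]; force)+
  have n1: "real (n + 1) \<noteq> 0" "real (n - 1) \<noteq> 0" using n by auto
  have S: "(LINT x:{-1<..<b}|mu. cheb_sin n x) = ?S b - ?S (-1)"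
    using b n n1 by (intro set_integral_mu_FTC_interior cheb_primitive_derivative continuous_intros cont) auto
  have C: "(LINT x:{-1<..<b}|mu. cheb_cos n x) = ?C b - ?C (-1)"
    using b n n1 by (intro set_integral_mu_FTC_interior cheb_primitive_derivative continuous_intros cont) auto
  have S0: "?S (-1) = 0" using sin_npi by (simp add: cheb_sin_def del: of_nat_Suc)
  show "(LINT x:{-1<..<b}|mu. cheb_sin n x) = ?S b" using S S0 by simp
  have q: "\<bar>(u / real (n + 1) - v / real (n - 1)) / 2\<bar> \<le> 1 / real (n - 1)" if "\<bar>u\<bar> \<le> 1" "\<bar>v\<bar> \<le> 1" for u v
  proof -
    have "\<bar>u / real (n + 1)\<bar> \<le> 1 / real (n - 1)" using that n by (simp only: abs_divide) (intro frac_le; simp)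
    moreover have "\<bar>v / real (n - 1)\<bar> \<le> 1 / real (n - 1)" using that n by (simp only: abs_divide) (intro frac_le; simp)
    moreover have "\<bar>(u / real (n + 1) - v / real (n - 1)) / 2\<bar> = \<bar>u / real (n + 1) - v / real (n - 1)\<bar> / 2" by simp
    moreover have "\<bar>u / real (n + 1) - v / real (n - 1)\<bar> \<le> \<bar>u / real (n + 1)\<bar> + \<bar>v / real (n - 1)\<bar>"
      by (rule abs_triangle_ineq4)
    ultimately show ?thesis by linarith
  qed
  show "\<bar>LINT x:{-1<..<b}|mu. cheb_sin n x\<bar> \<le> 1 / real (n - 1)"
    unfolding S S0 using q cheb_bound by simp
  have "\<bar>?C b - ?C (-1)\<bar> \<le> \<bar>?C b\<bar> + \<bar>?C (-1)\<bar>" by (rule abs_triangle_ineq4)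
  also have "\<dots> \<le> 1 / real (n - 1) + 1 / real (n - 1)" by (intro add_mono q cheb_bound)
  finally show "\<bar>LINT x:{-1<..<b}|mu. cheb_cos n x\<bar> \<le> 2 / real (n - 1)" unfolding C by simp
qed

lemma cheb_sin_integral:
  "(LINT x|mu. cheb_sin (Suc n) x) = (if n = 0 then pi / 2 else 0)"
proof (cases "n = 0")
  case True
  have "(LINT x:{-1<..<1}|mu. sqrt (1 - x\<^sup>2)) = (1 * sqrt (1 - 1\<^sup>2) + arcsin 1) / 2 - ((-1) * sqrt (1 - (-1)\<^sup>2) + arcsin (-1)) / 2"
  proof (rule set_integral_mu_FTC_interior)
    show "continuous_on {-1..1} (\<lambda>x. (x * sqrt (1 - x\<^sup>2) + arcsin x) / 2)" by (intro continuous_intros) auto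
    show "continuous_on {-1..1} (\<lambda>x. sqrt (1 - x\<^sup>2))" by (intro continuous_intros)
    fix x :: real assume x: "-1 < x" "x < 1"
    define s where "s = sqrt (1 - x\<^sup>2)"
    have s: "s > 0" "s\<^sup>2 = 1 - x\<^sup>2" using x by (auto simp: s_def abs_square_less_1 abs_square_le_1)
    have da: "(arcsin has_real_derivative 1 / s) (at x)"
      using DERIV_arcsin[of x] x by (simp add: s_def inverse_eq_divide)
    have ds: "((\<lambda>x. sqrt (1 - x\<^sup>2)) has_real_derivative - (x / s)) (at x)"
      using s by (auto intro!: derivative_eq_intros simp: s_def field_simps)
    have "((\<lambda>x. (x * sqrt (1 - x\<^sup>2) + arcsin x) / 2) has_real_derivative ((1 * s + - (x / s) * x) + 1 / s) / 2) (at x)"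
      using DERIV_cdivide[OF DERIV_add[OF DERIV_mult[OF DERIV_ident ds] da], of 2] by (simp add: s_def)
    also have "((1 * s + - (x / s) * x) + 1 / s) / 2 = (s\<^sup>2 + (1 - x\<^sup>2)) / (2 * s)"
      using s(1) by (simp add: field_simps power2_eq_square)
    also have "\<dots> = s" unfolding s(2)[symmetric] using s(1) by (simp add: power2_eq_square)
    finally show "((\<lambda>x. (x * sqrt (1 - x\<^sup>2) + arcsin x) / 2) has_real_derivative sqrt (1 - x\<^sup>2)) (at x)"
      by (simp add: s_def)
  qed auto
  also have "\<dots> = pi / 2" by simp
  finally have "(LINT x|mu. sqrt (1 - x\<^sup>2)) = pi / 2" by (simp add: set_integral_mu_space)
  moreover have "(LINT x|mu. cheb_sin 1 x) = (LINT x|mu. sqrt (1 - x\<^sup>2))"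
    by (intro Bochner_Integration.integral_cong refl cheb_sin_1) (auto simp: space_mu)
  ultimately show ?thesis using True by simp
next
  case False
  then have "(LINT x:{-1<..<1}|mu. cheb_sin (Suc n) x) = (cheb_sin (Suc n + 1) 1 / real (Suc n + 1) - cheb_sin (Suc n - 1) 1 / real (Suc n - 1)) / 2"
    by (intro cheb_interval_integral(1)) auto
  also have "\<dots> = 0" by (simp add: cheb_sin_def)
  finally show ?thesis using False by (simp add: set_integral_mu_space)
qed

text \<open>
  Induction along the three-term recurrence, which involves the transform of \<open>x\<close> times the previous function.
  The constant produced by this multiplication vanishes except in the step from 1 to 2, where it supplies
  the value \<open>- cheb_cos 0\<close> that the transform of \<open>cheb_sin 0 = 0\<close> does not have.
\<close>
theorem cheb_sin_pv:
  assumes t: "t \<in> {-1<..<1}"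
  shows "(truncated_hilbert (\<lambda>x. complex_of_real (cheb_sin n x)) t \<longlongrightarrow> (if n = 0 then 0 else - complex_of_real (cheb_cos n t))) (at_right 0)"
proof (induction n rule: induct_nat_012)
  case 0
  have "truncated_hilbert (\<lambda>x. complex_of_real (cheb_sin 0 x)) t e = 0" for e
    by (simp add: truncated_hilbert_def cheb_sin_def set_lebesgue_integral_def)
  then show ?case by simp
next
  case 1
  have "truncated_hilbert (\<lambda>x. complex_of_real (cheb_sin 1 x)) t e = truncated_hilbert semicircle t e" if "0 < e" for e
  proof -
    have i1: "integrable mu (\<lambda>x. complex_of_real (cheb_sin 1 x))"
      by (rule integrable_mu_bounded[where B = 1]) (use cheb_bound in auto)
    have i2: "integrable mu semicircle" by (rule integrable_mu_bounded[OF _ semicircle_bound]) measurable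
    show ?thesis
      unfolding truncated_hilbert_kernel(1)[OF i1 that] truncated_hilbert_kernel(1)[OF i2 that]
      by (intro Bochner_Integration.integral_cong refl) (auto simp: space_mu semicircle_def cheb_sin_1[unfolded One_nat_def])
  qed
  then have "\<forall>\<^sub>F e in at_right 0. truncated_hilbert semicircle t e = truncated_hilbert (\<lambda>x. complex_of_real (cheb_sin 1 x)) t e"
    using eventually_at_right_less[of 0] by (auto elim: eventually_mono)
  from Lim_transform_eventually[OF semicircle_pv this]
  have "(truncated_hilbert (\<lambda>x. complex_of_real (cheb_sin 1 x)) t \<longlongrightarrow> - complex_of_real t) (at_right 0)" using t by auto
  moreover have "cheb_cos 1 t = t" using t by (simp add: cheb_cos_def)
  ultimately show ?case by simp
next
  case (ge2 n)
  let ?g = "\<lambda>n x. complex_of_real (cheb_sin n x)"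
  have gm: "?g m \<in> borel_measurable mu" for m by measurable
  have gb: "cmod (?g m x) \<le> 1" for m x using cheb_bound(1)[of m x] by simp
  have gi: "integrable mu (?g m)" for m by (rule integrable_mu_bounded[OF gm gb])
  have xgi: "integrable mu (\<lambda>x. complex_of_real x * ?g m x)" for m
  proof (rule integrable_mu_bounded[where B = "1 * 1"])
    show "norm (complex_of_real x * ?g m x) \<le> 1 * 1" if "x \<in> {-1<..<1}" for x
      unfolding norm_mult by (intro mult_mono gb) (use that in auto)
  qed measurable
  have rec: "truncated_hilbert (?g (Suc (Suc n))) t e = 2 * truncated_hilbert (\<lambda>x. complex_of_real x * ?g (Suc n) x) t e - truncated_hilbert (?g n) t e" if "0 < e" for e
  proof -
    have "truncated_hilbert (?g (Suc (Suc n))) t e = (LINT x|mu. 2 * (complex_of_real x * ?g (Suc n) x * complex_of_real (pv_kernel e (x - t))) - ?g n x * complex_of_real (pv_kernel e (x - t)))"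
      unfolding truncated_hilbert_kernel(1)[OF gi that]
    proof (intro Bochner_Integration.integral_cong refl)
      fix x assume "x \<in> space mu"
      then have "x \<in> {-1..1}" by (auto simp: space_mu)
      then show "?g (Suc (Suc n)) x * complex_of_real (pv_kernel e (x - t)) = 2 * (complex_of_real x * ?g (Suc n) x * complex_of_real (pv_kernel e (x - t))) - ?g n x * complex_of_real (pv_kernel e (x - t))"
        by (simp add: cheb_sin_recurrence(1) algebra_simps)
    qed
    also have "\<dots> = 2 * truncated_hilbert (\<lambda>x. complex_of_real x * ?g (Suc n) x) t e - truncated_hilbert (?g n) t e"
      unfolding truncated_hilbert_kernel(1)[OF xgi that] truncated_hilbert_kernel(1)[OF gi that]
      using truncated_hilbert_kernel(2)[OF xgi that, of "Suc n" t] truncated_hilbert_kernel(2)[OF gi that, of n t] by simp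
    finally show ?thesis .
  qed
  have "((\<lambda>e. 2 * ((truncated_hilbert (\<lambda>x. complex_of_real x * ?g (Suc n) x) t e - complex_of_real t * truncated_hilbert (?g (Suc n)) t e) + complex_of_real t * truncated_hilbert (?g (Suc n)) t e) - truncated_hilbert (?g n) t e)
     \<longlongrightarrow> 2 * ((LINT x|mu. ?g (Suc n) x) / complex_of_real pi + complex_of_real t * (if Suc n = 0 then 0 else - complex_of_real (cheb_cos (Suc n) t))) - (if n = 0 then 0 else - complex_of_real (cheb_cos n t))) (at_right 0)"
    by (intro tendsto_intros truncated_hilbert_mult_id[OF gm gb] ge2)
  moreover have "2 * ((LINT x|mu. ?g (Suc n) x) / complex_of_real pi + complex_of_real t * (if Suc n = 0 then 0 else - complex_of_real (cheb_cos (Suc n) t))) - (if n = 0 then 0 else - complex_of_real (cheb_cos n t)) = - complex_of_real (cheb_cos (Suc (Suc n)) t)"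
  proof -
    have "cheb_cos (Suc (Suc n)) t = 2 * (t * cheb_cos (Suc n) t) - cheb_cos n t" using t by (intro cheb_sin_recurrence(2)) auto
    moreover have "cheb_cos 0 t = 1" by (simp add: cheb_cos_def)
    ultimately show ?thesis by (cases "n = 0") (simp_all add: cheb_sin_integral)
  qed
  moreover have "\<forall>\<^sub>F e in at_right 0. 2 * ((truncated_hilbert (\<lambda>x. complex_of_real x * ?g (Suc n) x) t e - complex_of_real t * truncated_hilbert (?g (Suc n)) t e) + complex_of_real t * truncated_hilbert (?g (Suc n)) t e) - truncated_hilbert (?g n) t e = truncated_hilbert (?g (Suc (Suc n))) t e"
    using eventually_at_right_less[of 0] by eventually_elim (simp add: rec)
  ultimately show ?case by (simp add: Lim_transform_eventually)
qed

text \<open>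
  On intervals the integrals are explicit and of order \<open>1 / n\<close>; the rest is density in \<open>L\<^sup>1\<close>.
\<close>
lemma riemann_lebesgue_cheb:
  assumes "integrable mu f"
  shows "(\<lambda>n. LINT x|mu. f x * complex_of_real (cheb_sin n x)) \<longlonglongrightarrow> 0"
proof -
  let ?P = "\<lambda>f. integrable mu f \<and> (\<lambda>n. LINT x|mu. f x * complex_of_real (cheb_sin n x)) \<longlonglongrightarrow> 0"
  have fi: "integrable mu (\<lambda>x. f x * complex_of_real (cheb_sin n x))" if "integrable mu f" for f n
    by (rule integrable_mult_bounded[OF that, where B = 1]) (use cheb_bound in auto)
  have fm: "f \<in> borel_measurable mu" using assms by simp
  have "?P f"
  proof (rule interval_dense_induct[where Q = "integrable mu", OF fm assms])
    show "integrable mu f" if "f \<in> borel_measurable mu" "\<exists>B. \<forall>x\<in>{-1<..<1}. cmod (f x) \<le> B" for f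
      using that by (auto intro: integrable_mu_bounded)
  next
    fix a :: real
    define b where "b = max (-1) (min 1 a)"
    have b: "-1 \<le> b" "b \<le> 1" by (auto simp: b_def)
    have int: "integrable mu (indicator {..<a} :: real \<Rightarrow> complex)" by (rule integrable_indicator_mu) simp
    have eq: "(LINT x|mu. indicator {..<a} x * complex_of_real (cheb_sin n x)) = complex_of_real (LINT x:{-1<..<b}|mu. cheb_sin n x)" for n
      unfolding set_lebesgue_integral_def integral_complex_of_real[symmetric]
      by (intro Bochner_Integration.integral_cong refl) (auto simp: indicator_def b_def space_mu min_def max_def)
    have "(\<lambda>n. LINT x:{-1<..<b}|mu. cheb_sin n x) \<longlonglongrightarrow> 0"
    proof (rule Lim_null_comparison)
      show "\<forall>\<^sub>F n in sequentially. norm (LINT x:{-1<..<b}|mu. cheb_sin n x) \<le> 1 / real (n - 1)"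
        using eventually_ge_at_top[of 2] by eventually_elim (use cheb_interval_integral(2) b in simp)
      have "(\<lambda>n. 1 / real (Suc n - 1)) \<longlonglongrightarrow> 0" using lim_const_over_n[of 1] by simp
      then show "(\<lambda>n. 1 / real (n - 1)) \<longlonglongrightarrow> 0" by (rule LIMSEQ_imp_Suc)
    qed
    then have "(\<lambda>n. LINT x|mu. indicator {..<a} x * complex_of_real (cheb_sin n x)) \<longlonglongrightarrow> 0"
      unfolding eq using tendsto_of_real by fastforce
    with int show "?P (indicator {..<a})" by simp
  next
    fix f g assume f: "?P f" and g: "?P g"
    have "(\<lambda>n. (LINT x|mu. f x * complex_of_real (cheb_sin n x)) + (LINT x|mu. g x * complex_of_real (cheb_sin n x))) \<longlonglongrightarrow> 0 + 0"
      using f g by (intro tendsto_add) auto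
    moreover have "(LINT x|mu. f x * complex_of_real (cheb_sin n x)) + (LINT x|mu. g x * complex_of_real (cheb_sin n x)) = (LINT x|mu. (f x + g x) * complex_of_real (cheb_sin n x))" for n
      unfolding distrib_right using f g by (intro Bochner_Integration.integral_add[symmetric] fi) auto
    ultimately show "?P (\<lambda>x. f x + g x)" using f g by simp
  next
    fix c f assume f: "?P f"
    have "(\<lambda>n. c * (LINT x|mu. f x * complex_of_real (cheb_sin n x))) \<longlonglongrightarrow> c * 0"
      using f by (intro tendsto_mult) auto
    then show "?P (\<lambda>x. c * f x)" using f by (simp add: mult.assoc)
  next
    fix f and s :: "nat \<Rightarrow> real \<Rightarrow> complex"
    assume f: "integrable mu f" and s: "\<And>i. ?P (s i)"
      and conv: "\<And>x. x \<in> {-1<..<1} \<Longrightarrow> (\<lambda>i. s i x) \<longlonglongrightarrow> f x"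
      and dom: "\<And>i x. x \<in> {-1<..<1} \<Longrightarrow> cmod (s i x) \<le> 2 * cmod (f x)"
    have L: "(\<lambda>i. LINT x|mu. cmod (f x - s i x)) \<longlonglongrightarrow> 0" using f s conv dom by (intro L1_lim) auto
    have "(\<lambda>n. LINT x|mu. f x * complex_of_real (cheb_sin n x)) \<longlonglongrightarrow> 0"
    proof (rule LIMSEQ_I)
      fix e :: real assume e: "e > 0"
      then have "\<forall>\<^sub>F i in sequentially. (LINT x|mu. cmod (f x - s i x)) < e / 2" using L by (intro order_tendstoD(2)[OF L]) auto
      then obtain i where i: "(LINT x|mu. cmod (f x - s i x)) < e / 2" by (auto simp: eventually_sequentially)
      have si: "integrable mu (s i)" using s by blast
      have "(\<lambda>n. LINT x|mu. s i x * complex_of_real (cheb_sin n x)) \<longlonglongrightarrow> 0" using s by blast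
      then obtain M where M: "\<And>n. n \<ge> M \<Longrightarrow> cmod ((LINT x|mu. s i x * complex_of_real (cheb_sin n x)) - 0) < e / 2"
        using LIMSEQ_D[of _ 0 "e / 2"] e by (meson half_gt_zero)
      show "\<exists>no. \<forall>n\<ge>no. norm ((LINT x|mu. f x * complex_of_real (cheb_sin n x)) - 0) < e"
      proof (intro exI[of _ M] allI impI)
        fix n assume n: "n \<ge> M"
        have di: "integrable mu (\<lambda>x. f x - s i x)" using f si by simp
        have "(LINT x|mu. f x * complex_of_real (cheb_sin n x)) = (LINT x|mu. (f x - s i x) * complex_of_real (cheb_sin n x)) + (LINT x|mu. s i x * complex_of_real (cheb_sin n x))"
          using Bochner_Integration.integral_add[OF fi[OF di, of n] fi[OF si, of n]] by (simp add: algebra_simps)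
        also have "cmod \<dots> \<le> (LINT x|mu. cmod (f x - s i x)) + cmod (LINT x|mu. s i x * complex_of_real (cheb_sin n x))"
        proof (rule norm_triangle_mono[OF _ order_refl])
          show "cmod (LINT x|mu. (f x - s i x) * complex_of_real (cheb_sin n x)) \<le> (LINT x|mu. cmod (f x - s i x))"
          proof (rule Bochner_Integration.integral_norm_bound_integral[OF fi[OF di]])
            show "norm ((f x - s i x) * complex_of_real (cheb_sin n x)) \<le> cmod (f x - s i x)" for x
              using cheb_bound(1)[of n x] by (simp add: norm_mult mult_left_le)
          qed (use di in auto)
        qed
        also have "\<dots> < e" using i M[OF n] by simp
        finally show "norm ((LINT x|mu. f x * complex_of_real (cheb_sin n x)) - 0) < e" by simp
      qed
    qed
    with f show "?P f" by simp
  qed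
  then show ?thesis by simp
qed

text \<open>
  The integral of \<open>\<bar>cheb_cos n\<bar>\<close> is at least that of its square, which is nearly 1 because
  \<open>2 (cheb_cos n x)\<^sup>2 = 1 + cheb_cos (2 n) x\<close>. The set \<open>A\<close> is where the function is nonnegative or where it
  is negative.
\<close>
lemma cheb_cos_large_on_some_set:
  assumes n: "n \<ge> 2"
  obtains A where "A \<in> sets mu" "1 / 3 \<le> \<bar>LINT x:A|mu. cheb_cos n x\<bar>"
proof -
  let ?A = "{x \<in> space mu. 0 \<le> cheb_cos n x}" and ?B = "{x \<in> space mu. cheb_cos n x < 0}"
  have A: "?A \<in> sets mu" "?B \<in> sets mu" by measurable
  have int: "integrable mu (cheb_cos m)" for m
    by (rule integrable_mu_bounded[where B = 1]) (use cheb_bound(2) in auto)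
  define d where "d = 2 / real (2 * n - 1)"
  have "2 - d \<le> (LINT x|mu. 1 + cheb_cos (2 * n) x)"
  proof -
    have "\<bar>LINT x:{-1<..<1}|mu. cheb_cos (2 * n) x\<bar> \<le> d"
      unfolding d_def using n by (intro cheb_interval_integral(3)) auto
    moreover have "(LINT x|mu. 1 + cheb_cos (2 * n) x) = 2 + (LINT x|mu. cheb_cos (2 * n) x)"
      using int[of "2 * n"] by (simp add: measure_mu_UNIV space_mu)
    ultimately show ?thesis unfolding set_integral_mu_space by linarith
  qed
  also have "(LINT x|mu. 1 + cheb_cos (2 * n) x) = (LINT x|mu. 2 * (cheb_cos n x)\<^sup>2)"
  proof (intro Bochner_Integration.integral_cong refl)
    fix x
    have "cos (2 * (real n * arccos x)) = 2 * (cos (real n * arccos x))\<^sup>2 - 1" by (rule cos_double_cos)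
    then show "1 + cheb_cos (2 * n) x = 2 * (cheb_cos n x)\<^sup>2" by (simp add: cheb_cos_def mult.assoc)
  qed
  also have "\<dots> \<le> (LINT x|mu. 2 * \<bar>cheb_cos n x\<bar>)"
  proof (rule integral_mono)
    have "(cheb_cos n x)\<^sup>2 \<le> 1" for x using cheb_bound(2)[of n x] by (simp add: abs_square_le_1)
    then show "integrable mu (\<lambda>x. 2 * (cheb_cos n x)\<^sup>2)"
      by (intro integrable_mult_right integrable_mu_bounded[where B = 1]) auto
    show "integrable mu (\<lambda>x. 2 * \<bar>cheb_cos n x\<bar>)" using int[of n] by auto
    fix x
    have "\<bar>cheb_cos n x\<bar> * \<bar>cheb_cos n x\<bar> \<le> \<bar>cheb_cos n x\<bar> * 1" using cheb_bound(2)[of n x] by (intro mult_left_mono) auto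
    then show "2 * (cheb_cos n x)\<^sup>2 \<le> 2 * \<bar>cheb_cos n x\<bar>" by (simp add: power2_eq_square)
  qed
  also have "\<dots> = 2 * (LINT x|mu. \<bar>cheb_cos n x\<bar>)" by simp
  also have "(LINT x|mu. \<bar>cheb_cos n x\<bar>) = (LINT x:?A|mu. cheb_cos n x) - (LINT x:?B|mu. cheb_cos n x)"
  proof -
    have "(LINT x|mu. \<bar>cheb_cos n x\<bar>) = (LINT x|mu. indicator ?A x *\<^sub>R cheb_cos n x - indicator ?B x *\<^sub>R cheb_cos n x)"
      by (intro Bochner_Integration.integral_cong refl) (auto simp: indicator_def)
    also have "\<dots> = (LINT x:?A|mu. cheb_cos n x) - (LINT x:?B|mu. cheb_cos n x)"
      unfolding set_lebesgue_integral_def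
      by (intro Bochner_Integration.integral_diff integrable_mult_indicator A int)
    finally show ?thesis .
  qed
  finally have "2 - d \<le> 2 * ((LINT x:?A|mu. cheb_cos n x) - (LINT x:?B|mu. cheb_cos n x))" .
  moreover have "d \<le> 2 / 3" unfolding d_def using n by (intro divide_left_mono) auto
  ultimately have "1 / 3 \<le> \<bar>LINT x:?A|mu. cheb_cos n x\<bar> \<or> 1 / 3 \<le> \<bar>LINT x:?B|mu. cheb_cos n x\<bar>"
    unfolding right_diff_distrib by linarith
  then show ?thesis using that A by blast
qed

section \<open>Banach function spaces\<close>

context banach_function_space
begin

lemma mem_L0: "f \<in> X \<Longrightarrow> f \<in> borel_measurable mu"
  using measurable by blast

lemma bounded_mem:
  assumes "f \<in> borel_measurable mu" "\<And>x. x \<in> {-1<..<1} \<Longrightarrow> cmod (f x) \<le> B"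
  shows "f \<in> X"
proof (rule ideal)
  show "(\<lambda>x. complex_of_real B) \<in> X" by (rule simple_mem) simp
  show "AE x in mu. cmod (f x) \<le> cmod (complex_of_real B)"
    by (rule AE_mu_I, rule order_trans[OF assms(2)]) auto
qed (rule assms)

lemma zero_mem: "(\<lambda>x. 0) \<in> X"
  by (rule bounded_mem[where B = 0]) auto

lemma norm_zero: "N (\<lambda>x. 0) = 0"
  using norm_eq_0[OF zero_mem] by simp

lemma cmod_mem:
  assumes "f \<in> X"
  shows "(\<lambda>x. complex_of_real (cmod (f x))) \<in> X" "N (\<lambda>x. complex_of_real (cmod (f x))) = N f"
proof -
  have [measurable]: "f \<in> borel_measurable mu" by (rule mem_L0[OF assms])
  show m: "(\<lambda>x. complex_of_real (cmod (f x))) \<in> X" by (rule ideal[OF assms]) auto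
  show "N (\<lambda>x. complex_of_real (cmod (f x))) = N f"
    by (intro antisym norm_mono assms m) auto
qed

lemma diff_mem:
  assumes "f \<in> X" "g \<in> X" shows "(\<lambda>x. f x - g x) \<in> X"
  using add_mem[OF assms(1) scale_mem[OF assms(2), of "-1"]] by simp

lemma norm_diff_commute:
  assumes "f \<in> X" "g \<in> X" shows "N (\<lambda>x. f x - g x) = N (\<lambda>x. g x - f x)"
  using norm_scale[OF diff_mem[OF assms], of "-1"] by (simp add: algebra_simps)

lemma sum_mem_norm:
  assumes "finite I" "\<And>i. i \<in> I \<Longrightarrow> g i \<in> X"
  shows "(\<lambda>x. \<Sum>i\<in>I. g i x) \<in> X \<and> N (\<lambda>x. \<Sum>i\<in>I. g i x) \<le> (\<Sum>i\<in>I. N (g i))"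
  using assms
proof (induction I rule: finite_induct)
  case (insert i I)
  then have "(\<lambda>x. \<Sum>i\<in>I. g i x) \<in> X" "N (\<lambda>x. \<Sum>i\<in>I. g i x) \<le> (\<Sum>i\<in>I. N (g i))" "g i \<in> X" by auto
  with norm_triangle[of "g i" "\<lambda>x. \<Sum>i\<in>I. g i x"] insert(1,2) show ?case
    by (auto intro!: add_mem)
qed (simp add: zero_mem norm_zero)

text \<open>
  The gliding hump behind the boundedness proofs below: a positively homogeneous
  monotone quantity whose value is finite at \<open>F\<close> cannot exceed \<open>4\<^sup>k\<close> on all the \<open>f\<^sub>k\<close>. The function \<open>F\<close> is the sum of
  the series of \<open>2\<^sup>-\<^sup>k \<bar>f\<^sub>k\<bar>\<close>, which converges in norm; it dominates the partial sums almost everywhere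
  because the positive part of their excess over \<open>F\<close> has norm 0.
\<close>
lemma majorant:
  fixes f :: "nat \<Rightarrow> real \<Rightarrow> complex"
  assumes f: "\<And>k. f k \<in> X" and C: "\<And>k. N (f k) \<le> C"
  obtains F :: "real \<Rightarrow> real" where "cfun F \<in> X" "\<And>k. AE x in mu. cmod (f k x) \<le> 2 ^ k * F x"
proof -
  define g where "g k x = complex_of_real (cmod (f k x)) * complex_of_real ((1 / 2) ^ k)" for k x
  have g: "g k \<in> X" "N (g k) \<le> C * (1 / 2) ^ k" for k
  proof -
    have e: "g k = (\<lambda>x. complex_of_real ((1 / 2) ^ k) * complex_of_real (cmod (f k x)))"
      by (simp add: g_def fun_eq_iff)
    show "g k \<in> X" unfolding e by (rule scale_mem[OF cmod_mem(1)[OF f]])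
    have "N (g k) = (1 / 2) ^ k * N (f k)"
      unfolding e by (subst norm_scale[OF cmod_mem(1)[OF f]]) (simp add: cmod_mem(2)[OF f] norm_power norm_divide)
    also have "\<dots> \<le> (1 / 2) ^ k * C" by (intro mult_left_mono C) auto
    finally show "N (g k) \<le> C * (1 / 2) ^ k" by (simp add: mult.commute)
  qed
  have C0: "0 \<le> C" using norm_nonneg[OF f[of 0]] C[of 0] by linarith
  define s where "s n x = (\<Sum>k<n. g k x)" for n x
  have s: "s n \<in> X" for n
    unfolding s_def using sum_mem_norm[of "{..<n}" g] g by auto
  have diff: "N (\<lambda>x. s m x - s n x) \<le> 2 * C * (1 / 2) ^ n" if "n \<le> m" for m n
  proof -
    have "(\<lambda>x. s m x - s n x) = (\<lambda>x. \<Sum>k\<in>{n..<m}. g k x)"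
    proof
      fix x
      have "s m x = s n x + (\<Sum>k\<in>{n..<m}. g k x)"
        unfolding s_def using that by (metis atLeast0LessThan sum.atLeastLessThan_concat zero_le)
      then show "s m x - s n x = (\<Sum>k\<in>{n..<m}. g k x)" by simp
    qed
    then have "N (\<lambda>x. s m x - s n x) \<le> (\<Sum>k\<in>{n..<m}. N (g k))"
      using sum_mem_norm[of "{n..<m}" g] g by simp
    also have "\<dots> \<le> (\<Sum>k\<in>{n..<m}. C * (1 / 2) ^ k)" by (intro sum_mono g)
    also have "\<dots> = C * (\<Sum>k\<in>{n..<m}. (1 / 2) ^ k)" by (simp add: sum_distrib_left)
    also have "\<dots> \<le> C * (2 * (1 / 2) ^ n)"
    proof (rule mult_left_mono[OF _ C0])
      have "(\<Sum>k\<in>{n..<m}. (1 / 2 :: real) ^ k) = 2 * ((1 / 2) ^ n - (1 / 2) ^ m)"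
        using that by (induction m rule: dec_induct) (auto simp: sum.atLeastLessThan_Suc)
      then show "(\<Sum>k\<in>{n..<m}. (1 / 2 :: real) ^ k) \<le> 2 * (1 / 2) ^ n" by simp
    qed
    finally show ?thesis by (simp add: mult_ac)
  qed
  have cau: "\<exists>K. \<forall>m\<ge>K. \<forall>n\<ge>K. N (\<lambda>x. s m x - s n x) < e" if e: "0 < e" for e
  proof -
    have "(\<lambda>n. 2 * C * (1 / 2) ^ n) \<longlonglongrightarrow> 2 * C * 0"
      by (intro tendsto_intros LIMSEQ_realpow_zero) auto
    then have "\<forall>\<^sub>F n in sequentially. 2 * C * (1 / 2) ^ n < e"
      using e by (intro order_tendstoD(2)[where y = "2 * C * 0"]) auto
    then obtain K where K: "\<And>n. n \<ge> K \<Longrightarrow> 2 * C * (1 / 2) ^ n < e" by (auto simp: eventually_sequentially)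
    have "N (\<lambda>x. s m x - s n x) < e" if "m \<ge> K" "n \<ge> K" for m n
    proof (cases "n \<le> m")
      case True
      show ?thesis using diff[OF True] K[OF that(2)] by linarith
    next
      case False
      then have "N (\<lambda>x. s n x - s m x) \<le> 2 * C * (1 / 2) ^ m" by (intro diff) simp
      then show ?thesis using K[OF that(1)] norm_diff_commute[OF s s, of m n] by simp
    qed
    then show ?thesis by blast
  qed
  obtain F where F: "F \<in> X" "(\<lambda>n. N (\<lambda>x. s n x - F x)) \<longlonglongrightarrow> 0"
    using complete[of s, OF s cau] by blast
  have [measurable]: "F \<in> borel_measurable mu" "\<And>n. s n \<in> borel_measurable mu"
    using F(1) s by (auto intro: mem_L0)
  have FX: "cfun (\<lambda>x. Re (F x)) \<in> X"
    by (rule ideal[OF F(1)]) (auto simp: abs_Re_le_cmod)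
  have Res: "Re (s n x) = (\<Sum>k<n. cmod (f k x) * (1 / 2) ^ k)" for n x
    by (simp add: s_def g_def flip: of_real_mult)
  \<comment> \<open>The part \<open>h\<close> of \<open>s n\<close> above \<open>F\<close> is dominated by \<open>\<bar>s m - F\<bar>\<close> for all \<open>m \<ge> n\<close>, since the partial sums increase.\<close>
  have le: "AE x in mu. Re (s n x) \<le> Re (F x)" for n
  proof -
    define h where "h x = complex_of_real (max 0 (Re (s n x) - Re (F x)))" for x
    have [measurable]: "h \<in> borel_measurable mu" unfolding h_def by measurable
    have hb: "cmod (h x) \<le> cmod (s m x - F x)" if "n \<le> m" for m x
    proof -
      have "Re (s n x) \<le> Re (s m x)" unfolding Res using that by (intro sum_mono2) auto
      then have "max 0 (Re (s n x) - Re (F x)) \<le> \<bar>Re (s m x - F x)\<bar>" by simp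
      also have "\<dots> \<le> cmod (s m x - F x)" by (rule abs_Re_le_cmod)
      finally show ?thesis by (simp add: h_def)
    qed
    have hX: "h \<in> X" by (rule ideal[OF diff_mem[OF s F(1)], of _ n]) (use hb[of n] in auto)
    have "N h \<le> N (\<lambda>x. s m x - F x)" if "n \<le> m" for m
      using hb[OF that] by (intro norm_mono hX diff_mem s F(1)) auto
    then have "\<forall>\<^sub>F m in sequentially. N h \<le> N (\<lambda>x. s m x - F x)" by (auto simp: eventually_sequentially)
    then have "N h \<le> 0" by (rule tendsto_lowerbound[OF F(2)]) simp
    then have "N h = 0" using norm_nonneg[OF hX] by simp
    then have "AE x in mu. h x = 0" using norm_eq_0[OF hX] by simp
    then show ?thesis
    proof eventually_elim
      case (elim x)
      then have "max 0 (Re (s n x) - Re (F x)) = 0" by (simp only: h_def of_real_eq_0_iff)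
      then show ?case by linarith
    qed
  qed
  show ?thesis
  proof (rule that[OF FX])
    fix k
    show "AE x in mu. cmod (f k x) \<le> 2 ^ k * Re (F x)"
      using le[of "Suc k"]
    proof eventually_elim
      case (elim x)
      have "cmod (f k x) * (1 / 2) ^ k \<le> Re (s (Suc k) x)"
        unfolding Res by (intro member_le_sum) auto
      then have "2 ^ k * (cmod (f k x) * (1 / 2) ^ k) \<le> 2 ^ k * Re (F x)" using elim by (intro mult_left_mono) auto
      then show ?case by (simp add: power_one_over)
    qed
  qed
qed

end

section \<open>Distribution functions and rearrangements\<close>

definition dfun :: "(real \<Rightarrow> complex) \<Rightarrow> real \<Rightarrow> ennreal"
  where "dfun f l = emeasure mu {x \<in> space mu. l < cmod (f x)}"

lemma emeasure_mu_space: "emeasure mu (space mu) = 2"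
  by (simp add: space_mu emeasure_mu)

lemma dfun_le_2: "dfun f l \<le> 2"
  unfolding dfun_def emeasure_mu_space[symmetric] by (rule emeasure_space)

lemma dfun_set:
  assumes [measurable]: "f \<in> borel_measurable mu"
  shows "{x \<in> space mu. l < cmod (f x)} \<in> sets mu"
  by measurable

lemma dfun_finite: "dfun f l < top"
  using dfun_le_2[of f l] by (rule order.strict_trans1) simp

lemma dfun_right_continuous:
  assumes [measurable]: "f \<in> borel_measurable mu" and c: "c < dfun f l"
  shows "\<exists>l'>l. c < dfun f l'"
proof -
  let ?A = "\<lambda>n::nat. {x \<in> space mu. l + 1 / real (Suc n) < cmod (f x)}"
  have inc: "incseq ?A"
  proof (intro incseq_SucI subsetI)
    fix n x assume "x \<in> ?A n"
    moreover have "1 / real (Suc (Suc n)) \<le> 1 / real (Suc n)" by (intro divide_left_mono) auto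
    ultimately show "x \<in> ?A (Suc n)" by (auto intro: le_less_trans[rotated])
  qed
  have "(\<Union>n. ?A n) = {x \<in> space mu. l < cmod (f x)}"
  proof safe
    fix x n assume "l + 1 / real (Suc n) < cmod (f x)"
    moreover have "0 < 1 / real (Suc n)" by simp
    ultimately show "l < cmod (f x)" by linarith
  next
    fix x assume x: "x \<in> space mu" "l < cmod (f x)"
    then obtain n where "1 / real (Suc n) < cmod (f x) - l" using nat_approx_posE[of "cmod (f x) - l"] by auto
    then show "x \<in> (\<Union>n. ?A n)" using x by (auto intro!: exI[of _ n])
  qed
  moreover have "(SUP n. emeasure mu (?A n)) = emeasure mu (\<Union>n. ?A n)"
    by (rule SUP_emeasure_incseq[OF _ inc]) (use dfun_set[OF assms(1)] in blast)
  ultimately have "c < (SUP n. emeasure mu (?A n))" using c unfolding dfun_def by (simp only:)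
  then obtain n where "c < emeasure mu (?A n)" unfolding less_SUP_iff by blast
  then show ?thesis by (intro exI[of _ "l + 1 / real (Suc n)"]) (auto simp: dfun_def)
qed

lemma dfun_small:
  assumes [measurable]: "f \<in> borel_measurable mu" and c: "0 < c"
  shows "\<exists>l\<ge>0. dfun f l \<le> c"
proof -
  let ?A = "\<lambda>n::nat. {x \<in> space mu. real n < cmod (f x)}"
  have dec: "decseq ?A" by (auto simp: decseq_def)
  have "(\<Inter>n. ?A n) = {}"
  proof safe
    fix x assume x: "x \<in> (\<Inter>n. ?A n)"
    obtain n where "cmod (f x) \<le> real n" using real_arch_simple by blast
    moreover have "x \<in> ?A n" using x by blast
    ultimately show "x \<in> {}" by simp
  qed
  moreover have "(\<lambda>n. emeasure mu (?A n)) \<longlonglongrightarrow> emeasure mu (\<Inter>n. ?A n)"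
  proof (rule Lim_emeasure_decseq[OF _ dec])
    show "range ?A \<subseteq> sets mu" using dfun_set[OF assms(1)] by blast
    show "emeasure mu (?A i) \<noteq> \<infinity>" for i using mu.emeasure_finite[of "?A i"] unfolding infinity_ennreal_def .
  qed
  ultimately have "(\<lambda>n. emeasure mu (?A n)) \<longlonglongrightarrow> 0" by (simp only: emeasure_empty)
  then have "\<forall>\<^sub>F n in sequentially. emeasure mu (?A n) < c" using c by (rule order_tendstoD(2))
  then obtain n where "emeasure mu (?A n) < c" by (auto simp: eventually_sequentially)
  then show ?thesis by (intro exI[of _ "real n"]) (auto simp: dfun_def)
qed

text \<open>
  The decreasing rearrangement evaluated at \<open>2 \<bar>x\<bar>\<close>. At the origin the set of levels may be empty, so the value is
  fixed to be 0 there.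
\<close>
definition symm_rearr :: "(real \<Rightarrow> complex) \<Rightarrow> real \<Rightarrow> real"
  where "symm_rearr f x = (if x = 0 then 0 else Inf {l. 0 \<le> l \<and> dfun f l \<le> ennreal (2 * \<bar>x\<bar>)})"

text \<open>
  The distribution function is right continuous, so the infimum over the levels can be compared with a given
  level exactly.
\<close>
lemma symm_rearr_gt_iff:
  assumes f: "f \<in> borel_measurable mu" and l: "0 \<le> l"
  shows "l < symm_rearr f x \<longleftrightarrow> x \<noteq> 0 \<and> ennreal (2 * \<bar>x\<bar>) < dfun f l"
proof (cases "x = 0")
  case False
  let ?S = "{l. 0 \<le> l \<and> dfun f l \<le> ennreal (2 * \<bar>x\<bar>)}"
  have ne: "?S \<noteq> {}" using dfun_small[OF f, of "ennreal (2 * \<bar>x\<bar>)"] False by auto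
  have bd: "bdd_below ?S" by (rule bdd_belowI[of _ 0]) auto
  have mono: "dfun f b \<le> dfun f a" if "a \<le> b" for a b
    unfolding dfun_def by (rule emeasure_mono[OF _ dfun_set[OF f]]) (use that in auto)
  have "l < Inf ?S \<longleftrightarrow> ennreal (2 * \<bar>x\<bar>) < dfun f l"
  proof
    assume "l < Inf ?S"
    then have "l \<notin> ?S" using cInf_lower[OF _ bd, of l] by auto
    then show "ennreal (2 * \<bar>x\<bar>) < dfun f l" using l by auto
  next
    assume "ennreal (2 * \<bar>x\<bar>) < dfun f l"
    then obtain l' where l': "l < l'" "ennreal (2 * \<bar>x\<bar>) < dfun f l'" using dfun_right_continuous[OF f] by blast
    have "l' \<le> Inf ?S"
    proof (rule cInf_greatest[OF ne])
      fix k assume "k \<in> ?S"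
      then have k: "dfun f k \<le> ennreal (2 * \<bar>x\<bar>)" by simp
      show "l' \<le> k"
      proof (rule ccontr)
        assume "\<not> l' \<le> k"
        then have "dfun f l' \<le> dfun f k" by (intro mono) simp
        with l'(2) have "ennreal (2 * \<bar>x\<bar>) < dfun f k" by (rule less_le_trans)
        with k show False by (simp add: not_less[symmetric])
      qed
    qed
    with l' show "l < Inf ?S" by simp
  qed
  then show ?thesis using False by (simp add: symm_rearr_def)
qed (use l in \<open>simp add: symm_rearr_def\<close>)

lemma symm_rearr_nonneg:
  assumes f: "f \<in> borel_measurable mu" shows "0 \<le> symm_rearr f x"
proof (cases "x = 0")
  case False
  have "{l. 0 \<le> l \<and> dfun f l \<le> ennreal (2 * \<bar>x\<bar>)} \<noteq> {}" using dfun_small[OF f, of "ennreal (2 * \<bar>x\<bar>)"] False by auto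
  then show ?thesis using False by (auto simp: symm_rearr_def intro: cInf_greatest)
qed (simp add: symm_rearr_def)

lemma dfun_interval:
  obtains d where "0 \<le> d" "d \<le> 2" "dfun f l = ennreal d"
proof (rule that[of "enn2real (dfun f l)"])
  show "dfun f l = ennreal (enn2real (dfun f l))" using dfun_finite by simp
  show "enn2real (dfun f l) \<le> 2" using enn2real_mono[OF dfun_le_2, of f l] by simp
qed simp

lemma symm_rearr_measurable:
  assumes f: "f \<in> borel_measurable mu" shows "symm_rearr f \<in> borel_measurable borel"
proof (rule borel_measurable_iff_greater[THEN iffD2], rule allI)
  fix a :: real
  show "{w \<in> space borel. a < symm_rearr f w} \<in> sets borel"
  proof (cases "0 \<le> a")
    case True
    obtain d where d: "0 \<le> d" "d \<le> 2" "dfun f a = ennreal d" by (rule dfun_interval)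
    have "{w \<in> space borel. a < symm_rearr f w} = {- d / 2<..<d / 2} - {0}"
      unfolding symm_rearr_gt_iff[OF f True] d(3) by (auto simp: ennreal_less_iff abs_if split: if_splits)
    then show ?thesis by simp
  next
    case False
    then have "a < symm_rearr f w" for w using symm_rearr_nonneg[OF f, of w] by linarith
    then show ?thesis by simp
  qed
qed

lemma emeasure_mu_interval_minus_0:
  assumes "0 \<le> d" "d \<le> 2"
  shows "emeasure mu ({- d / 2<..<d / 2} - {0}) = ennreal d"
proof -
  have "emeasure mu ({- d / 2<..<d / 2} - {0}) = emeasure lborel ({- d / 2<..<d / 2} - {0})"
    using assms by (intro emeasure_mu) auto
  also have "\<dots> = emeasure lborel {- d / 2<..<d / 2}"
    by (rule emeasure_Diff_null_set) auto
  also have "\<dots> = ennreal d" using assms by simp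
  finally show ?thesis .
qed

lemma dfun_symm_rearr:
  assumes f: "f \<in> borel_measurable mu" and l: "0 \<le> l"
  shows "dfun (cfun (symm_rearr f)) l = dfun f l"
proof -
  obtain d where d: "0 \<le> d" "d \<le> 2" "dfun f l = ennreal d" by (rule dfun_interval)
  have "{x \<in> space mu. l < cmod (complex_of_real (symm_rearr f x))} = {x \<in> space mu. l < symm_rearr f x}"
    using symm_rearr_nonneg[OF f] by simp
  also have "\<dots> = {- d / 2<..<d / 2} - {0}"
    unfolding symm_rearr_gt_iff[OF f l] d(3) using d by (auto simp: space_mu ennreal_less_iff abs_if split: if_splits)
  finally have "dfun (cfun (symm_rearr f)) l = emeasure mu ({- d / 2<..<d / 2} - {0})"
    by (simp add: dfun_def)
  then show ?thesis using emeasure_mu_interval_minus_0[OF d(1,2)] d(3) by simp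
qed

context ri_space
begin

text \<open>
  The decreasing rearrangement depends monotonically on the distribution function.
\<close>
lemma dfun_mem:
  assumes f: "f \<in> X" and g: "g \<in> borel_measurable mu" and le: "\<And>l. 0 \<le> l \<Longrightarrow> dfun g l \<le> dfun f l"
  shows "g \<in> X"
proof (rule rearrangement_mem[OF f g])
  fix t :: real
  show "rearrangement g t \<le> rearrangement f t"
    unfolding rearrangement_def dfun_def[symmetric]
    by (rule Inf_superset_mono) (use le in \<open>auto intro: order_trans\<close>)
qed

lemma symm_rearr_mem:
  assumes f: "f \<in> X" shows "cfun (symm_rearr f) \<in> X"
proof (rule dfun_mem[OF f])
  have [measurable]: "symm_rearr f \<in> borel_measurable borel" by (rule symm_rearr_measurable[OF mem_L0[OF f]])
  show "cfun (symm_rearr f) \<in> borel_measurable mu" by (rule borel_measurable_mu) measurable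
  show "dfun (cfun (symm_rearr f)) l \<le> dfun f l" if "0 \<le> l" for l
    using dfun_symm_rearr[OF mem_L0[OF f] that] by (rule eq_refl)
qed

text \<open>
  The function \<open>G\<close> is the twofold dilate of the symmetric rearrangement. On either side of the origin its
  distribution function is at most that of \<open>f\<close>, so both halves belong to \<open>X\<close>.
\<close>
lemma double_dfun:
  assumes f: "f \<in> X"
  obtains G where "G \<in> X" "\<And>l. 0 \<le> l \<Longrightarrow> dfun G l = min 2 (2 * dfun f l)"
proof -
  have fm: "f \<in> borel_measurable mu" by (rule mem_L0[OF f])
  define G where "G x = complex_of_real (symm_rearr f (x / 2))" for x
  have [measurable]: "symm_rearr f \<in> borel_measurable borel" by (rule symm_rearr_measurable[OF fm])
  have gt: "l < cmod (G x) \<longleftrightarrow> x \<noteq> 0 \<and> ennreal \<bar>x\<bar> < dfun f l" if "0 \<le> l" for l x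
    using symm_rearr_gt_iff[OF fm that, of "x / 2"] symm_rearr_nonneg[OF fm, of "x / 2"] by (simp add: G_def)
  have [measurable]: "G \<in> borel_measurable mu"
    unfolding G_def by (rule borel_measurable_mu) measurable
  have half: "(\<lambda>x. indicator S x * G x) \<in> X" if S: "S = {0<..} \<or> S = {..<0}" for S
  proof (rule dfun_mem[OF f])
    have "S \<in> sets borel" using S by auto
    then have [measurable]: "(indicator S :: real \<Rightarrow> complex) \<in> borel_measurable mu" by (intro borel_measurable_mu) simp
    show "(\<lambda>x. indicator S x * G x) \<in> borel_measurable mu" by measurable
    fix l :: real assume l: "0 \<le> l"
    obtain d where d: "0 \<le> d" "d \<le> 2" "dfun f l = ennreal d" by (rule dfun_interval)
    let ?I = "S \<inter> {- min d 1<..<min d 1}"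
    have "{x \<in> space mu. l < cmod (indicator S x * G x)} \<subseteq> ?I"
    proof
      fix x assume "x \<in> {x \<in> space mu. l < cmod (indicator S x * G x)}"
      then have x: "x \<in> {-1<..<1}" "l < cmod (indicator S x * G x)" by (auto simp: space_mu)
      have xS: "x \<in> S"
      proof (rule ccontr)
        assume "x \<notin> S" then show False using x(2) l by simp
      qed
      then have "l < cmod (G x)" using x(2) by simp
      then have "\<bar>x\<bar> < d" using gt[OF l] d by (auto simp: ennreal_less_iff)
      then show "x \<in> ?I" using x(1) xS by (auto simp: abs_less_iff)
    qed
    then have "dfun (\<lambda>x. indicator S x * G x) l \<le> emeasure mu ?I"
      unfolding dfun_def using S by (intro emeasure_mono) (auto simp: sets_mu_iff)
    also have "\<dots> = emeasure lborel ?I"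
      using S by (intro emeasure_mu) auto
    also have "\<dots> = ennreal (min d 1)"
      using S
    proof
      assume "S = {0<..}"
      then have "?I = {0<..<min d 1}" using d by auto
      then show ?thesis using d by simp
    next
      assume "S = {..<0}"
      then have "?I = {- min d 1<..<0}" using d by auto
      then show ?thesis using d by simp
    qed
    also have "\<dots> \<le> dfun f l" unfolding d(3) by (intro ennreal_leI) auto
    finally show "dfun (\<lambda>x. indicator S x * G x) l \<le> dfun f l" .
  qed
  have GX: "G \<in> X"
  proof (rule ideal[OF add_mem[OF half half]])
    show "G \<in> borel_measurable mu" by measurable
    show "AE x in mu. cmod (G x) \<le> cmod (indicator {0<..} x * G x + indicator {..<0} x * G x)"
      using AE_mu_neq[of 0] by eventually_elim (auto simp: indicator_def)
  qed auto
  have dG: "dfun G l = min 2 (2 * dfun f l)" if l: "0 \<le> l" for l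
  proof -
    obtain d where d: "0 \<le> d" "d \<le> 2" "dfun f l = ennreal d" by (rule dfun_interval)
    let ?m = "min (2 * d) 2"
    have "{x \<in> space mu. l < cmod (G x)} = {- ?m / 2<..<?m / 2} - {0}"
      unfolding gt[OF l] d(3) using d by (auto simp: space_mu ennreal_less_iff abs_if min_def split: if_splits)
    then have "dfun G l = ennreal ?m"
      unfolding dfun_def using emeasure_mu_interval_minus_0[of ?m] d by simp
    also have "\<dots> = min (ennreal (2 * d)) (ennreal 2)"
      by (rule min_of_mono[symmetric]) (auto simp: mono_def ennreal_leI)
    also have "\<dots> = min 2 (2 * dfun f l)" unfolding d(3) using d by (simp add: ennreal_mult min.commute)
    finally show ?thesis .
  qed
  show ?thesis by (rule that[OF GX dG])
qed

text \<open>
  Powers of 2 are reached by iteration. Applied to dilations, which multiply distribution functions by at most a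
  constant, this shows that \<open>X\<close> is invariant under them.
\<close>
lemma scaled_dfun_mem:
  assumes "f \<in> X" "g \<in> borel_measurable mu" "\<And>l. 0 \<le> l \<Longrightarrow> dfun g l \<le> 2 ^ n * dfun f l"
  shows "g \<in> X"
  using assms
proof (induction n arbitrary: f)
  case 0
  then show ?case using dfun_mem[of f g] by simp
next
  case (Suc n)
  obtain G where G: "G \<in> X" "\<And>l. 0 \<le> l \<Longrightarrow> dfun G l = min 2 (2 * dfun f l)"
    by (rule double_dfun[OF Suc.prems(1)]) blast
  have "dfun g l \<le> 2 ^ n * dfun G l" if l: "0 \<le> l" for l
  proof (cases "2 * dfun f l \<le> 2")
    case True
    then have "dfun G l = 2 * dfun f l" using G(2)[OF l] by (simp add: min_def)
    then show ?thesis using Suc.prems(3)[OF l] by (simp add: mult_ac)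
  next
    case False
    then have "dfun G l = 2" using G(2)[OF l] by (simp add: min_absorb1 not_le less_imp_le)
    moreover have "(1::ennreal) \<le> 2 ^ n" by (rule one_le_power) simp
    then have "1 * 2 \<le> 2 ^ n * (2::ennreal)" by (intro mult_right_mono) auto
    ultimately show ?thesis using dfun_le_2[of g l] by (auto intro: order_trans)
  qed
  with G(1) Suc.prems(2) show ?case by (rule Suc.IH)
qed

end

section \<open>Dilations\<close>

lemma dilation_measurable:
  assumes [measurable]: "f \<in> borel_measurable mu"
  shows "dilation s f \<in> borel_measurable mu"
proof -
  define f' where "f' x = (if x \<in> {-1<..<1} then f x else 0)" for x
  have m: "f' \<in> borel_measurable borel"
  proof -
    have "(\<lambda>x. indicator {-1<..<1} x *\<^sub>R f x) \<in> borel_measurable lborel"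
      using borel_measurable_restrict_space_iff[of "{-1<..<1}" lborel f] assms by simp
    moreover have "f' = (\<lambda>x. indicator {-1<..<1} x *\<^sub>R f x)"
      by (auto simp: f'_def indicator_def fun_eq_iff)
    ultimately show ?thesis by simp
  qed
  have "dilation s f = (\<lambda>x. f' (s * x))" by (auto simp: dilation_def f'_def fun_eq_iff)
  moreover have "(\<lambda>x. f' (s * x)) \<in> borel_measurable borel" using m by measurable
  ultimately show ?thesis by (simp add: borel_measurable_mu)
qed

lemma dfun_dilation:
  assumes f: "f \<in> borel_measurable mu" and s: "0 < s" and l: "0 \<le> l"
  shows "dfun (dilation s f) l \<le> ennreal (1 / s) * dfun f l"
proof -
  let ?A = "{x \<in> space mu. l < cmod (dilation s f x)}" and ?B = "{x \<in> space mu. l < cmod (f x)}"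
  have A: "?A \<in> sets mu" by (rule dfun_set[OF dilation_measurable[OF f]])
  have B: "?B \<in> sets mu" by (rule dfun_set[OF f])
  have "dfun (dilation s f) l = (\<integral>\<^sup>+x. indicator ?A x \<partial>lborel)"
    unfolding dfun_def using A by (subst emeasure_mu) (auto simp: sets_mu_iff)
  also have "\<dots> = ennreal \<bar>1 / s\<bar> * (\<integral>\<^sup>+x. indicator ?A (0 + (1 / s) * x) \<partial>lborel)"
    using s sets_mu_borel[OF A] by (intro nn_integral_real_affine) auto
  also have "(\<integral>\<^sup>+x. indicator ?A (0 + (1 / s) * x) \<partial>lborel) \<le> (\<integral>\<^sup>+x. indicator ?B x \<partial>lborel)"
    using s l by (intro nn_integral_mono) (auto simp: indicator_def dilation_def space_mu split: if_splits)
  also have "\<dots> = dfun f l"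
    unfolding dfun_def using B by (subst emeasure_mu) (auto simp: sets_mu_iff)
  finally show ?thesis using s by (simp add: mult_left_mono)
qed

lemma AE_dilation:
  assumes P: "AE x in mu. P x" and s: "0 < s"
  shows "AE x in mu. -1 < s * x \<and> s * x < 1 \<longrightarrow> P (s * x)"
proof -
  have "AE x in lborel. x \<in> {-1<..<1} \<longrightarrow> P x"
    using P by (subst (asm) AE_restrict_space_iff) auto
  then obtain Z where Z: "{x \<in> space lborel. \<not> (x \<in> {-1<..<1} \<longrightarrow> P x)} \<subseteq> Z" "emeasure lborel Z = 0" "Z \<in> sets lborel"
    by (rule AE_E)
  have Zb[measurable]: "Z \<in> sets borel" using Z(3) by simp
  have "AE x in lborel. x \<notin> Z" by (rule AE_I[of _ _ Z]) (use Z in auto)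
  then have "AE x in lborel. 0 + s * x \<notin> Z" using s by (intro AE_borel_affine) auto
  then have "AE x in lborel. -1 < s * x \<and> s * x < 1 \<longrightarrow> P (s * x)"
    by eventually_elim (use Z(1) in auto)
  then show ?thesis by (rule AE_lborel_mu)
qed

context ri_space
begin

lemma dilation_mem:
  assumes f: "f \<in> X" and s: "0 < s" shows "dilation s f \<in> X"
proof -
  obtain n where n: "1 / s < 2 ^ n" using real_arch_pow[of 2 "1 / s"] by auto
  show ?thesis
  proof (rule scaled_dfun_mem[OF f dilation_measurable[OF mem_L0[OF f]], of _ n])
    fix l :: real assume l: "0 \<le> l"
    have "dfun (dilation s f) l \<le> ennreal (1 / s) * dfun f l" by (rule dfun_dilation[OF mem_L0[OF f] s l])
    also have "\<dots> \<le> ennreal (2 ^ n) * dfun f l" using n by (intro mult_right_mono ennreal_leI) auto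
    finally show "dfun (dilation s f) l \<le> 2 ^ n * dfun f l" by (simp flip: ennreal_power)
  qed
qed

lemma dilation_scale: "dilation s (\<lambda>x. c * f x) = (\<lambda>x. c * dilation s f x)"
  by (auto simp: dilation_def)

lemma power_growth_contradiction:
  fixes K :: real assumes "\<And>k::nat. 4 ^ k < 2 ^ k * K" shows False
proof -
  obtain k where k: "K < 2 ^ k" using real_arch_pow[of 2 K] by auto
  have "(4::real) ^ k = 2 ^ k * 2 ^ k" by (simp flip: power_mult_distrib)
  with assms[of k] k show False by simp
qed

text \<open>
  The supremum in \<open>dilation_norm\<close> is taken in the real numbers, so it is meaningful only on bounded sets. If
  the set were unbounded, the dilate of the function from \<open>majorant\<close> would have infinite norm.
\<close>
lemma dilation_bounded:
  assumes s: "0 < s"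
  shows "bdd_above ((\<lambda>f. N (dilation s f)) ` {f \<in> X. N f \<le> 1})"
proof (rule ccontr)
  assume "\<not> ?thesis"
  then have "\<exists>f. f \<in> X \<and> N f \<le> 1 \<and> 4 ^ k < N (dilation s f)" for k :: nat
    unfolding bdd_above_def by (force simp: not_le)
  then obtain f where f: "\<And>k::nat. f k \<in> X" "\<And>k. N (f k) \<le> 1" "\<And>k. 4 ^ k < N (dilation s (f k))"
    by metis
  obtain F where F: "cfun F \<in> X" "\<And>k. AE x in mu. cmod (f k x) \<le> 2 ^ k * F x"
    by (rule majorant[of f 1, OF f(1,2)]) blast
  show False
  proof (rule power_growth_contradiction)
    fix k
    have "AE x in mu. cmod (dilation s (f k) x) \<le> cmod (dilation s (\<lambda>x. 2 ^ k * cfun F x) x)"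
      using AE_dilation[OF F(2)[of k] s]
    proof eventually_elim
      case (elim x)
      then show ?case
        by (auto simp: dilation_def norm_mult norm_power intro: order_trans[OF _ mult_left_mono[OF abs_ge_self]])
    qed
    then have "N (dilation s (f k)) \<le> N (dilation s (\<lambda>x. 2 ^ k * cfun F x))"
      by (intro norm_mono dilation_mem scale_mem f F s)
    also have "\<dots> = 2 ^ k * N (dilation s (cfun F))"
      unfolding dilation_scale by (subst norm_scale[OF dilation_mem[OF F(1) s]]) (simp add: norm_power)
    finally show "4 ^ k < 2 ^ k * N (dilation s (cfun F))" using f(3)[of k] by linarith
  qed
qed

lemma dilation_norm_bound:
  assumes s: "0 < s" and f: "f \<in> X"
  shows "N (dilation s f) \<le> dilation_norm X N s * N f" and "0 \<le> dilation_norm X N s"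
proof -
  have up: "N (dilation s g) \<le> dilation_norm X N s" if "g \<in> X" "N g \<le> 1" for g
    unfolding dilation_norm_def by (rule cSUP_upper[OF _ dilation_bounded[OF s]]) (use that in auto)
  show nn: "0 \<le> dilation_norm X N s"
    using up[OF zero_mem] norm_zero norm_nonneg[OF dilation_mem[OF zero_mem s]] by simp
  show "N (dilation s f) \<le> dilation_norm X N s * N f"
  proof (cases "N f = 0")
    case True
    then have "AE x in mu. f x = 0" using norm_eq_0[OF f] by simp
    then have "AE x in mu. dilation s f x = 0"
      using AE_dilation[OF _ s, of "\<lambda>x. f x = 0"] by (auto simp: dilation_def elim: eventually_mono)
    then have "N (dilation s f) = 0" using norm_eq_0[OF dilation_mem[OF f s]] by simp
    then show ?thesis using True by simp
  next
    case False
    then have p: "N f > 0" using norm_nonneg[OF f] by simp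
    let ?c = "complex_of_real (1 / N f)"
    have "N (\<lambda>x. ?c * f x) = 1" using norm_scale[OF f, of ?c] p by (simp add: norm_divide)
    then have "N (dilation s (\<lambda>x. ?c * f x)) \<le> dilation_norm X N s" by (intro up scale_mem f) simp
    moreover have "N (dilation s (\<lambda>x. ?c * f x)) = N (dilation s f) / N f"
      unfolding dilation_scale using norm_scale[OF dilation_mem[OF f s], of ?c] p by (simp add: norm_divide)
    ultimately show ?thesis using p by (simp add: pos_divide_le_eq)
  qed
qed

end

section \<open>Embeddings from the Boyd indices\<close>

lemma emeasure_zero_of_geometric_bound:
  assumes A: "A \<in> sets mu" and le: "\<And>k::nat. emeasure mu A \<le> ennreal (C * r ^ k)" and r: "0 \<le> r" "r < 1"
  shows "emeasure mu A = 0"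
proof -
  have "(\<lambda>k. ennreal (C * r ^ k)) \<longlonglongrightarrow> ennreal (C * 0)"
    using r by (intro tendsto_ennrealI tendsto_mult tendsto_const LIMSEQ_realpow_zero)
  then have "emeasure mu A \<le> ennreal (C * 0)"
    by (rule tendsto_lowerbound) (use le in auto)
  then show ?thesis by simp
qed

context ri_space
begin

text \<open>
  Dilations act on the indicators of these neighbourhoods of the origin by changing the radius, so iterating one
  dilation estimate gives their norms up to geometric factors.
\<close>
definition core :: "real \<Rightarrow> real \<Rightarrow> complex"
  where "core r x = indicator {-r<..<r} x"

lemma core_mem: "core r \<in> X"
  unfolding core_def[abs_def]
  by (rule bounded_mem[where B = 1]) (auto simp: indicator_def intro!: borel_measurable_mu)

lemma dilation_core:
  assumes s: "0 < s" and x: "x \<in> {-1<..<1}" and r: "r \<le> 1"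
  shows "dilation s (core r) x = core (r / s) x"
proof -
  have "s * x \<in> {-r<..<r} \<longleftrightarrow> x \<in> {- (r / s)<..<r / s}"
    using s by (auto simp: field_simps)
  then show ?thesis using r s by (auto simp: dilation_def core_def indicator_def)
qed

lemma norm_le_of_pointwise: "(\<And>x. x \<in> {-1<..<1} \<Longrightarrow> cmod (f x) \<le> cmod (g x)) \<Longrightarrow> f \<in> X \<Longrightarrow> g \<in> X \<Longrightarrow> N f \<le> N g"
  by (intro norm_mono AE_mu_I) auto

lemma norm_one_pos: "0 < N (core 1)"
proof -
  have "\<not> (AE x in mu. core 1 x = 0)"
  proof
    assume "AE x in mu. core 1 x = 0"
    moreover have "AE x in mu. x \<in> {-1<..<1}" by (rule AE_mu_I)
    ultimately have "AE x in mu. False" by eventually_elim (simp add: core_def)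
    then have "emeasure mu (space mu) = 0" by (subst (asm) AE_iff_measurable[of "space mu"]) (auto simp: sets_mu_iff)
    then show False unfolding emeasure_mu_space by simp
  qed
  then show ?thesis using norm_eq_0[OF core_mem] norm_nonneg[OF core_mem, of 1] by fastforce
qed

text \<open>
  The quotient of logarithms is positive for some \<open>t < 1\<close>, so the logarithm of the norm is negative; as \<open>ln 0 = 0\<close>,
  this also excludes a vanishing norm.
\<close>
lemma lower_index_dilation:
  assumes "0 < lower_boyd_index X N"
  obtains s D where "1 < s" "0 < D" "D < 1" "\<And>f. f \<in> X \<Longrightarrow> N (dilation s f) \<le> D * N f"
proof -
  obtain t where t: "0 < t" "t < 1" "0 < ereal (ln (dilation_norm X N (1 / t)) / ln t)"
    using assms unfolding lower_boyd_index_def less_SUP_iff by auto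
  let ?D = "dilation_norm X N (1 / t)"
  have D0: "0 \<le> ?D" by (rule dilation_norm_bound(2)[OF _ zero_mem]) (use t in simp)
  have lt: "ln t < 0" using t by simp
  have "0 < ln ?D / ln t" using t(3) by simp
  then have "ln ?D < 0" using lt by (simp add: zero_less_divide_iff)
  then have "?D > 0" "?D < 1" using D0 by (cases "?D = 0"; simp)+
  then show ?thesis
    using t by (intro that[of "1 / t" ?D] dilation_norm_bound(1)) auto
qed

lemma upper_index_dilation:
  assumes "upper_boyd_index X N < 1"
  obtains t D where "1 < t" "0 \<le> D" "D < t" "\<And>f. f \<in> X \<Longrightarrow> N (dilation (1 / t) f) \<le> D * N f"
proof -
  obtain t where t: "1 < t" "ereal (ln (dilation_norm X N (1 / t)) / ln t) < 1"
    using assms unfolding upper_boyd_index_def INF_less_iff by auto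
  let ?D = "dilation_norm X N (1 / t)"
  have D0: "0 \<le> ?D" by (rule dilation_norm_bound(2)[OF _ zero_mem]) (use t in simp)
  have lt: "ln t > 0" using t by simp
  have "ln ?D / ln t < 1" using t(2) by (simp add: one_ereal_def)
  then have "ln ?D < ln t" using lt by (simp add: pos_divide_less_eq)
  then have "?D < t" using D0 t by (cases "?D = 0") auto
  then show ?thesis
    using t D0 by (intro that[of t ?D] dilation_norm_bound(1)) auto
qed

text \<open>
  The norm of \<open>core (s\<^sup>-\<^sup>k)\<close> is at most a multiple of \<open>D\<^sup>k\<close> with \<open>D < 1\<close>. For \<open>1 < c < 1 / D\<close> the sum of the
  functions \<open>c\<^sup>k core (s\<^sup>-\<^sup>k)\<close> therefore has bounded partial sums, and it belongs to \<open>X\<close> by the Fatou property;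
  near the origin it is at least a negative power of \<open>\<bar>x\<bar>\<close>.
\<close>
lemma power_singularity:
  assumes low: "0 < lower_boyd_index X N"
  obtains v :: "real \<Rightarrow> real" and c s :: real
    where "cfun v \<in> X" "1 < c" "1 < s" "\<And>k x. x \<noteq> 0 \<Longrightarrow> \<bar>x\<bar> < 1 / s ^ k \<Longrightarrow> c ^ k \<le> v x"
proof -
  obtain s D where sD: "1 < s" "0 < D" "D < 1" "\<And>f. f \<in> X \<Longrightarrow> N (dilation s f) \<le> D * N f"
    by (rule lower_index_dilation[OF low]) blast
  \<comment> \<open>The midpoint of the interval between 1 and \<open>1 / D\<close>.\<close>
  define c where "c = (1 + 1 / D) / 2"
  have c: "1 < c" "c * D < 1" using sD by (auto simp: c_def field_simps)
  have sk: "0 < s ^ k" "1 / s ^ k \<le> 1" for k using sD by (auto simp: one_le_power)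
  have core_norm: "N (core (1 / s ^ k)) \<le> D ^ k * N (core 1)" for k
  proof (induction k)
    case (Suc k)
    have "N (core (1 / s ^ Suc k)) \<le> N (dilation s (core (1 / s ^ k)))"
      using sD(1) dilation_core[of s _ "1 / s ^ k"] sk(2)[of k]
      by (intro norm_le_of_pointwise core_mem dilation_mem) (auto simp: mult.commute)
    also have "\<dots> \<le> D * N (core (1 / s ^ k))" by (rule sD(4)[OF core_mem])
    also have "\<dots> \<le> D * (D ^ k * N (core 1))" using Suc sD by (intro mult_left_mono) auto
    finally show ?case by simp
  qed simp
  define u where "u n x = (\<Sum>k<n. c ^ k * indicator {- (1 / s ^ k)<..<1 / s ^ k} x)" for n and x :: real
  define v where "v x = (\<Sum>k. c ^ k * indicator {- (1 / s ^ k)<..<1 / s ^ k} x)" for x :: real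
  have uc: "cfun (u n) = (\<lambda>x. \<Sum>k<n. complex_of_real (c ^ k) * core (1 / s ^ k) x)" for n
    by (auto simp: u_def core_def indicator_def fun_eq_iff intro!: sum.cong)
  have uX: "cfun (u n) \<in> X" and uN: "N (cfun (u n)) \<le> (\<Sum>k<n. N (\<lambda>x. complex_of_real (c ^ k) * core (1 / s ^ k) x))" for n
    unfolding uc using sum_mem_norm[of "{..<n}" "\<lambda>k x. complex_of_real (c ^ k) * core (1 / s ^ k) x"]
    by (auto intro: scale_mem core_mem)
  have bound: "N (cfun (u n)) \<le> N (core 1) * (1 / (1 - c * D))" for n
  proof -
    have "N (cfun (u n)) \<le> (\<Sum>k<n. N (\<lambda>x. complex_of_real (c ^ k) * core (1 / s ^ k) x))" by (rule uN)
    also have "\<dots> \<le> (\<Sum>k<n. N (core 1) * (c * D) ^ k)"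
    proof (rule sum_mono)
      fix k
      have "N (\<lambda>x. complex_of_real (c ^ k) * core (1 / s ^ k) x) = c ^ k * N (core (1 / s ^ k))"
        using c by (subst norm_scale[OF core_mem]) (simp add: norm_power)
      also have "\<dots> \<le> c ^ k * (D ^ k * N (core 1))" using c by (intro mult_left_mono core_norm) auto
      finally show "N (\<lambda>x. complex_of_real (c ^ k) * core (1 / s ^ k) x) \<le> N (core 1) * (c * D) ^ k"
        by (simp add: power_mult_distrib mult_ac)
    qed
    also have "\<dots> = N (core 1) * (\<Sum>k<n. (c * D) ^ k)" by (simp add: sum_distrib_left)
    also have "(\<Sum>k<n. (c * D) ^ k) \<le> (\<Sum>k. (c * D) ^ k)"
      using c sD by (intro sum_le_suminf summable_geometric) auto
    also have "(\<Sum>k. (c * D) ^ k) = 1 / (1 - c * D)"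
      using c sD by (intro suminf_geometric) auto
    finally show ?thesis using norm_one_pos by (simp add: mult_left_mono)
  qed
  have summ: "summable (\<lambda>k. c ^ k * indicator {- (1 / s ^ k)<..<1 / s ^ k} x)" if "x \<noteq> 0" for x :: real
  proof -
    obtain K where K: "1 / \<bar>x\<bar> < s ^ K" using real_arch_pow[OF sD(1)] by blast
    show ?thesis
    proof (rule summable_finite[of "{..<K}"])
      fix k assume "k \<notin> {..<K}"
      then have "s ^ K \<le> s ^ k" using sD by (intro power_increasing) auto
      with K have "1 / \<bar>x\<bar> < s ^ k" by linarith
      then have "1 / s ^ k < \<bar>x\<bar>" using that sk(1)[of k] by (simp add: field_simps)
      then show "c ^ k * indicator {- (1 / s ^ k)<..<1 / s ^ k} x = 0" by (auto simp: indicator_def)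
    qed simp
  qed
  have lim: "(\<lambda>n. u n x) \<longlonglongrightarrow> v x" if "x \<noteq> 0" for x
    unfolding u_def v_def using summable_LIMSEQ[OF summ[OF that]] .
  have "cfun v \<in> X \<and> (\<lambda>n. N (cfun (u n))) \<longlonglongrightarrow> N (cfun v)"
  proof (rule fatou[unfolded fatou_property_def, rule_format], intro conjI allI)
    show "cfun (u n) \<in> X" for n by (rule uX)
    show "\<exists>C. \<forall>n. N (cfun (u n)) \<le> C" using bound by blast
    show "AE x in mu. (\<forall>n. 0 \<le> u n x) \<and> incseq (\<lambda>n. u n x)"
    proof (intro AE_I2 conjI allI incseq_SucI)
      show "0 \<le> u n x" for n x unfolding u_def using c by (intro sum_nonneg) auto
      show "u n x \<le> u (Suc n) x" for n x unfolding u_def using c by simp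
    qed
    show "cfun v \<in> borel_measurable mu"
    proof (rule borel_measurable_mu)
      have "v \<in> borel_measurable borel" unfolding v_def by (intro borel_measurable_suminf) measurable
      then show "cfun v \<in> borel_measurable borel" by measurable
    qed
    show "AE x in mu. (\<lambda>n. u n x) \<longlonglongrightarrow> v x"
      using AE_mu_neq[of 0] by eventually_elim (rule lim)
  qed
  moreover have "c ^ k \<le> v x" if "x \<noteq> 0" "\<bar>x\<bar> < 1 / s ^ k" for k x
  proof -
    have "c ^ k = (\<Sum>j\<in>{k}. c ^ j * indicator {- (1 / s ^ j)<..<1 / s ^ j} x)"
      using that by (simp add: indicator_def abs_less_iff minus_less_iff)
    also have "\<dots> \<le> v x" unfolding v_def using c by (intro sum_le_suminf summ that) auto
    finally show ?thesis .
  qed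
  ultimately show ?thesis using c sD by (intro that[of v c s]) auto
qed

lemma markov_dfun:
  assumes [measurable]: "f \<in> borel_measurable mu" and l: "0 < l"
  shows "ennreal (l ^ p) * dfun f l \<le> (\<integral>\<^sup>+x. ennreal (cmod (f x) ^ p) \<partial>mu)"
proof -
  have "ennreal (l ^ p) * dfun f l = (\<integral>\<^sup>+x. ennreal (l ^ p) * indicator {x \<in> space mu. l < cmod (f x)} x \<partial>mu)"
    unfolding dfun_def by (rule nn_integral_cmult_indicator[symmetric]) (rule dfun_set[OF assms(1)])
  also have "\<dots> \<le> (\<integral>\<^sup>+x. ennreal (cmod (f x) ^ p) \<partial>mu)"
    using l by (intro nn_integral_mono) (auto simp: indicator_def intro!: ennreal_leI power_mono)
  finally show ?thesis .
qed

text \<open>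
  Let \<open>v\<close> be the function of \<open>power_singularity\<close>, which is at least \<open>c\<^sup>k\<close> on an interval of length \<open>2 / s\<^sup>k\<close>. If \<open>p\<close>
  is so large that \<open>c\<^sup>p > s\<close>, then by Markov's inequality the distribution function of an \<open>f\<close> with small
  \<open>p\<close>-th moment lies below that of \<open>v\<close>.
\<close>
theorem Lp_embedding:
  assumes low: "0 < lower_boyd_index X N"
  obtains p :: nat where "0 < p"
    "\<And>f. f \<in> borel_measurable mu \<Longrightarrow> (\<integral>\<^sup>+x. ennreal (cmod (f x) ^ p) \<partial>mu) < \<infinity> \<Longrightarrow> f \<in> X"
proof -
  obtain v c s where v: "cfun v \<in> X" "1 < c" "1 < s" "\<And>k x. x \<noteq> 0 \<Longrightarrow> \<bar>x\<bar> < 1 / s ^ k \<Longrightarrow> c ^ k \<le> v x"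
    by (rule power_singularity[OF low]) blast
  obtain p0 where p0: "s < c ^ p0" using real_arch_pow[OF v(2)] by blast
  have pp: "0 < p0" using p0 v(3) by (cases p0) auto
  define kap where "kap = 2 / c ^ p0"
  have kap: "0 < kap" using v(2) by (simp add: kap_def)
  have vm: "cfun v \<in> borel_measurable mu" by (rule mem_L0[OF v(1)])
  have dv: "ennreal (2 / s ^ k) \<le> dfun (cfun v) l" if l: "l < c ^ k" for l k
  proof -
    have sk: "0 < s ^ k" "1 / s ^ k \<le> 1" using v(3) by (auto simp: one_le_power)
    let ?d = "2 / s ^ k"
    have "ennreal ?d = emeasure mu ({- ?d / 2<..<?d / 2} - {0})"
      using sk by (intro emeasure_mu_interval_minus_0[symmetric]) (auto simp: field_simps)
    also have "\<dots> \<le> dfun (cfun v) l"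
      unfolding dfun_def
    proof (rule emeasure_mono[OF _ dfun_set[OF vm]], rule subsetI)
      fix x assume "x \<in> {- ?d / 2<..<?d / 2} - {0}"
      then have x: "x \<noteq> 0" "\<bar>x\<bar> < 1 / s ^ k" by (auto simp: abs_less_iff)
      then have "l < v x" using v(4)[OF x] l by linarith
      moreover have "x \<in> {-1<..<1}" using x(2) sk(2) by (auto simp: abs_less_iff)
      ultimately show "x \<in> {x \<in> space mu. l < cmod (complex_of_real (v x))}" by (auto simp: space_mu)
    qed
    finally show ?thesis .
  qed
  have small: "f \<in> X" if f: "f \<in> borel_measurable mu" "(\<integral>\<^sup>+x. ennreal (cmod (f x) ^ p0) \<partial>mu) \<le> ennreal kap" for f
  proof (rule dfun_mem[OF v(1) f(1)])
    fix l :: real assume l: "0 \<le> l"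
    show "dfun f l \<le> dfun (cfun v) l"
    proof (cases "l < 1")
      case True
      have "dfun f l \<le> 2" by (rule dfun_le_2)
      also have "2 \<le> dfun (cfun v) l" using dv[of l 0] True by simp
      finally show ?thesis .
    next
      case False
      have ex: "\<exists>k. l < c ^ k" using real_arch_pow[OF v(2)] by blast
      define k where "k = (LEAST k. l < c ^ k)"
      have k: "l < c ^ k" unfolding k_def using ex by (rule LeastI_ex)
      have "k \<noteq> 0" using k False by (cases k) auto
      then obtain j where j: "k = Suc j" by (cases k) auto
      have "\<not> l < c ^ j" using not_less_Least[of j "\<lambda>k. l < c ^ k"] j k_def by simp
      then have cj: "c ^ j \<le> l" by simp
      have l0: "0 < l" using False by simp
      have lp: "(c ^ j) ^ p0 \<le> l ^ p0" using cj v(2) by (intro power_mono) auto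
      have cpos: "0 < (c ^ j) ^ p0" using v(2) by simp
      have "ennreal ((c ^ j) ^ p0) * dfun f l \<le> ennreal (l ^ p0) * dfun f l"
        using lp by (intro mult_right_mono ennreal_leI) auto
      also have "\<dots> \<le> ennreal kap" by (rule order_trans[OF markov_dfun[OF f(1) l0] f(2)])
      finally have m: "ennreal ((c ^ j) ^ p0) * dfun f l \<le> ennreal kap" .
      obtain d where d: "0 \<le> d" "d \<le> 2" "dfun f l = ennreal d" by (rule dfun_interval)
      have "(c ^ j) ^ p0 * d \<le> kap"
        using m cpos kap d(1) unfolding d(3) by (simp flip: ennreal_mult'')
      then have "d \<le> kap / (c ^ j) ^ p0" using cpos by (simp add: pos_le_divide_eq mult.commute)
      also have "\<dots> = 2 / (c ^ p0) ^ k" by (simp add: kap_def j power_mult[symmetric] mult.commute power_add[symmetric])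
      also have "\<dots> \<le> 2 / s ^ k" using p0 v(2,3) by (intro divide_left_mono power_mono mult_pos_pos) auto
      finally have "dfun f l \<le> ennreal (2 / s ^ k)" unfolding d(3) by (rule ennreal_leI)
      also have "\<dots> \<le> dfun (cfun v) l" by (rule dv[OF k])
      finally show ?thesis .
    qed
  qed
  show ?thesis
  proof (rule that[OF pp])
    fix f assume f: "f \<in> borel_measurable mu" "(\<integral>\<^sup>+x. ennreal (cmod (f x) ^ p0) \<partial>mu) < \<infinity>"
    note f(1)[measurable]
    define I where "I = enn2real (\<integral>\<^sup>+x. ennreal (cmod (f x) ^ p0) \<partial>mu)"
    have I: "(\<integral>\<^sup>+x. ennreal (cmod (f x) ^ p0) \<partial>mu) = ennreal I" "0 \<le> I" using f(2) by (auto simp: I_def)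
    define e where "e = min 1 (kap / (I + 1))"
    have e: "0 < e" "e \<le> 1" using kap I by (auto simp: e_def)
    have "(\<integral>\<^sup>+x. ennreal (cmod (complex_of_real e * f x) ^ p0) \<partial>mu) = (\<integral>\<^sup>+x. ennreal (e ^ p0) * ennreal (cmod (f x) ^ p0) \<partial>mu)"
      using e by (intro nn_integral_cong) (simp add: norm_mult power_mult_distrib ennreal_mult)
    also have "\<dots> = ennreal (e ^ p0) * ennreal I" unfolding I(1)[symmetric] by (rule nn_integral_cmult) measurable
    also have "\<dots> = ennreal (e ^ p0 * I)" using e I by (simp add: ennreal_mult)
    also have "\<dots> \<le> ennreal kap"
    proof (rule ennreal_leI)
      have "e ^ p0 \<le> e ^ 1" using e pp by (intro power_decreasing) auto
      then have "e ^ p0 * I \<le> e * (I + 1)" using I e by (intro mult_mono) auto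
      also have "\<dots> \<le> kap / (I + 1) * (I + 1)" using I by (intro mult_right_mono) (auto simp: e_def)
      also have "\<dots> = kap" using I by simp
      finally show "e ^ p0 * I \<le> kap" .
    qed
    finally have "(\<lambda>x. complex_of_real e * f x) \<in> X" by (intro small) measurable
    from scale_mem[OF this, of "complex_of_real (1 / e)"] show "f \<in> X"
      using e by (simp add: mult.assoc[symmetric])
  qed
qed

text \<open>
  A gliding hump again: the function \<open>U\<close> below belongs to \<open>L\<^sup>p\<close> because the \<open>p\<close>-th moments are summed with weights
  \<open>2\<^sup>-\<^sup>k\<close>, and it dominates \<open>2\<^sup>-\<^sup>k \<bar>f\<^sub>k\<bar>\<close>.
\<close>
lemma Lp_bounded:
  assumes p: "0 < p"
    and emb: "\<And>f. f \<in> borel_measurable mu \<Longrightarrow> (\<integral>\<^sup>+x. ennreal (cmod (f x) ^ p) \<partial>mu) < \<infinity> \<Longrightarrow> f \<in> X"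
  obtains C where "0 < C" "\<And>f. f \<in> borel_measurable mu \<Longrightarrow> (\<integral>\<^sup>+x. ennreal (cmod (f x) ^ p) \<partial>mu) \<le> 1 \<Longrightarrow> N f \<le> C"
proof (rule ccontr)
  assume contra: "\<not> thesis"
  have "\<exists>f. f \<in> borel_measurable mu \<and> (\<integral>\<^sup>+x. ennreal (cmod (f x) ^ p) \<partial>mu) \<le> 1 \<and> 4 ^ k < N f" for k :: nat
    using contra that[of "4 ^ k"] by (force simp: not_le)
  then obtain f where f: "\<And>k::nat. f k \<in> borel_measurable mu"
    "\<And>k. (\<integral>\<^sup>+x. ennreal (cmod (f k x) ^ p) \<partial>mu) \<le> 1" "\<And>k. 4 ^ k < N (f k)" by metis
  note f(1)[measurable]
  define W where "W x = (\<Sum>k. ennreal ((1 / 2) ^ k) * ennreal (cmod (f k x) ^ p))" for x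
  have [measurable]: "W \<in> borel_measurable mu" unfolding W_def by measurable
  have "(\<integral>\<^sup>+x. W x \<partial>mu) = (\<Sum>k. \<integral>\<^sup>+x. ennreal ((1 / 2) ^ k) * ennreal (cmod (f k x) ^ p) \<partial>mu)"
    unfolding W_def by (rule nn_integral_suminf) measurable
  also have "\<dots> = (\<Sum>k. ennreal ((1 / 2) ^ k) * (\<integral>\<^sup>+x. ennreal (cmod (f k x) ^ p) \<partial>mu))"
    by (intro suminf_cong nn_integral_cmult) measurable
  also have "\<dots> \<le> (\<Sum>k. ennreal ((1 / 2) ^ k) * 1)"
    by (intro suminf_le mult_left_mono f) auto
  also have "\<dots> = ennreal (\<Sum>k. (1 / 2) ^ k)" by (simp add: suminf_ennreal2 summable_geometric)
  also have "\<dots> < \<infinity>" by simp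
  finally have Wi: "(\<integral>\<^sup>+x. W x \<partial>mu) < \<infinity>" .
  define U where "U x = complex_of_real (root p (enn2real (W x)))" for x
  have [measurable]: "U \<in> borel_measurable mu" unfolding U_def by measurable
  have Up: "cmod (U x) ^ p = enn2real (W x)" for x using p by (simp add: U_def)
  have "(\<integral>\<^sup>+x. ennreal (cmod (U x) ^ p) \<partial>mu) \<le> (\<integral>\<^sup>+x. W x \<partial>mu)"
    unfolding Up by (intro nn_integral_mono) (metis enn2real_nonneg ennreal_enn2real ennreal_enn2real_if ennreal_le_iff le_zero_eq linear order_refl top_greatest)
  also note Wi
  finally have UX: "U \<in> X" by (intro emb) measurable
  have Wfin: "AE x in mu. W x < \<infinity>" using Wi by (intro finite_nn_integral_imp_ae_finite) auto
  show False
  proof (rule power_growth_contradiction)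
    fix k
    have fX: "f k \<in> X" by (rule emb[OF f(1)]) (use f(2)[of k] in \<open>auto intro: le_less_trans\<close>)
    have "AE x in mu. cmod (f k x) \<le> cmod (2 ^ k * U x)"
      using Wfin
    proof eventually_elim
      case (elim x)
      have "ennreal ((1 / 2) ^ k * cmod (f k x) ^ p) = ennreal ((1 / 2) ^ k) * ennreal (cmod (f k x) ^ p)"
        by (simp add: ennreal_mult)
      also have "\<dots> = (\<Sum>j\<in>{k}. ennreal ((1 / 2) ^ j) * ennreal (cmod (f j x) ^ p))" by simp
      also have "\<dots> \<le> W x" unfolding W_def by (rule sum_le_suminf) auto
      also have "W x = ennreal (enn2real (W x))" using elim by simp
      finally have "(1 / 2) ^ k * cmod (f k x) ^ p \<le> enn2real (W x)" by (simp add: ennreal_le_iff)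
      then have "cmod (f k x) ^ p \<le> 2 ^ k * enn2real (W x)" by (simp add: power_one_over field_simps)
      also have "\<dots> \<le> (2 ^ k) ^ p * enn2real (W x)"
        using p power_increasing[of 1 p "2 ^ k :: real"] by (intro mult_right_mono) auto
      also have "\<dots> = (cmod (2 ^ k * U x)) ^ p"
        unfolding norm_mult power_mult_distrib Up by (simp add: norm_power)
      finally show ?case using p by (simp add: power_mono_iff)
    qed
    then have "N (f k) \<le> N (\<lambda>x. 2 ^ k * U x)" by (intro norm_mono fX scale_mem UX)
    also have "\<dots> = 2 ^ k * N U" by (subst norm_scale[OF UX]) (simp add: norm_power)
    finally show "4 ^ k < 2 ^ k * N U" using f(3)[of k] by linarith
  qed
qed

text \<open>
  Dominated convergence in \<open>L\<^sup>p\<close>, transported to \<open>X\<close> by the bound for the embedding.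
\<close>
theorem Lp_order_continuous:
  assumes p: "0 < p"
    and emb: "\<And>f. f \<in> borel_measurable mu \<Longrightarrow> (\<integral>\<^sup>+x. ennreal (cmod (f x) ^ p) \<partial>mu) < \<infinity> \<Longrightarrow> f \<in> X"
    and f: "f \<in> borel_measurable mu" "(\<integral>\<^sup>+x. ennreal (cmod (f x) ^ p) \<partial>mu) < \<infinity>"
  shows "f \<in> oc_part X N"
  unfolding oc_part_def
proof (intro CollectI conjI emb f allI impI, elim conjE)
  note f(1)[measurable]
  fix u :: "nat \<Rightarrow> real \<Rightarrow> real"
  assume uX: "\<forall>n. cfun (u n) \<in> X"
    and u: "AE x in mu. (\<forall>n. u n x \<le> cmod (f x)) \<and> decseq (\<lambda>n. u n x) \<and> (\<lambda>n. u n x) \<longlonglongrightarrow> 0"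
  obtain C where C: "0 < C" "\<And>f. f \<in> borel_measurable mu \<Longrightarrow> (\<integral>\<^sup>+x. ennreal (cmod (f x) ^ p) \<partial>mu) \<le> 1 \<Longrightarrow> N f \<le> C"
    by (rule Lp_bounded[OF p emb]) blast+
  have um[measurable]: "cfun (u n) \<in> borel_measurable mu" for n using uX by (auto intro: mem_L0)
  have um'[measurable]: "u n \<in> borel_measurable mu" for n
  proof -
    have "(\<lambda>x. Re (complex_of_real (u n x))) \<in> borel_measurable mu" using um[of n] by measurable
    then show ?thesis by simp
  qed
  have u0: "AE x in mu. \<forall>n. 0 \<le> u n x \<and> u n x \<le> cmod (f x)"
    using u by eventually_elim (auto dest: decseq_ge)
  have "(\<lambda>n. \<integral>\<^sup>+x. ennreal (cmod (complex_of_real (u n x)) ^ p) \<partial>mu) \<longlonglongrightarrow> (\<integral>\<^sup>+x. 0 \<partial>mu)"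
  proof (rule nn_integral_dominated_convergence[where w = "\<lambda>x. ennreal (cmod (f x) ^ p)"])
    show "AE x in mu. ennreal (cmod (complex_of_real (u n x)) ^ p) \<le> ennreal (cmod (f x) ^ p)" for n
      using u0 by eventually_elim (auto intro!: ennreal_leI power_mono)
    show "AE x in mu. (\<lambda>n. ennreal (cmod (complex_of_real (u n x)) ^ p)) \<longlonglongrightarrow> 0"
      using u
    proof eventually_elim
      case (elim x)
      have "(\<lambda>n. ennreal (cmod (complex_of_real (u n x)) ^ p)) \<longlonglongrightarrow> ennreal (cmod (complex_of_real 0) ^ p)"
        using elim by (intro tendsto_ennrealI tendsto_power tendsto_norm tendsto_of_real) auto
      moreover have "ennreal (cmod (complex_of_real 0) ^ p) = 0" using p by simp
      ultimately show ?case by (simp only:)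
    qed
  qed (use f in auto)
  then have lim: "(\<lambda>n. \<integral>\<^sup>+x. ennreal (cmod (complex_of_real (u n x)) ^ p) \<partial>mu) \<longlonglongrightarrow> 0" by simp
  show "(\<lambda>n. N (cfun (u n))) \<longlonglongrightarrow> 0"
  proof (rule LIMSEQ_I)
    fix e :: real assume e: "e > 0"
    define d where "d = e / (2 * C)"
    have d: "d > 0" using e C by (simp add: d_def)
    have "\<forall>\<^sub>F n in sequentially. (\<integral>\<^sup>+x. ennreal (cmod (complex_of_real (u n x)) ^ p) \<partial>mu) < ennreal (d ^ p)"
      using lim d by (intro order_tendstoD(2)) auto
    then obtain M where M: "\<And>n. n \<ge> M \<Longrightarrow> (\<integral>\<^sup>+x. ennreal (cmod (complex_of_real (u n x)) ^ p) \<partial>mu) < ennreal (d ^ p)"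
      by (auto simp: eventually_sequentially)
    show "\<exists>no. \<forall>n\<ge>no. norm (N (cfun (u n)) - 0) < e"
    proof (intro exI[of _ M] allI impI)
      fix n assume n: "n \<ge> M"
      let ?g = "\<lambda>x. complex_of_real (1 / d) * complex_of_real (u n x)"
      have "(\<integral>\<^sup>+x. ennreal (cmod (?g x) ^ p) \<partial>mu) = (\<integral>\<^sup>+x. ennreal ((1 / d) ^ p) * ennreal (cmod (complex_of_real (u n x)) ^ p) \<partial>mu)"
        using d by (intro nn_integral_cong) (simp add: norm_mult norm_divide power_divide flip: ennreal_mult)
      also have "\<dots> = ennreal ((1 / d) ^ p) * (\<integral>\<^sup>+x. ennreal (cmod (complex_of_real (u n x)) ^ p) \<partial>mu)"
        by (rule nn_integral_cmult) (use um[of n] in measurable)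
      also have "\<dots> \<le> ennreal ((1 / d) ^ p) * ennreal (d ^ p)" using M[OF n] by (intro mult_left_mono) auto
      also have "\<dots> = 1" using d by (simp add: power_one_over flip: ennreal_mult)
      finally have "N ?g \<le> C" using um[of n] by (intro C(2)) measurable
      moreover have "N ?g = N (cfun (u n)) / d" using uX d by (subst norm_scale) (auto simp: norm_divide)
      ultimately have "N (cfun (u n)) \<le> C * d" using d by (simp add: pos_divide_le_eq)
      also have "\<dots> < e" using C e by (simp add: d_def)
      finally show "norm (N (cfun (u n)) - 0) < e" using norm_nonneg uX by simp
    qed
  qed
qed

text \<open>
  Let \<open>F\<close> be the symmetric rearrangement and \<open>a\<^sub>k\<close> its value at \<open>t\<^sup>-\<^sup>k\<close>. The dilation estimate shows that the norm of
  \<open>core (t\<^sup>-\<^sup>k)\<close> is at least a multiple of \<open>D\<^sup>-\<^sup>k\<close>, and \<open>F \<ge> a\<^sub>k\<close> there, so \<open>a\<^sub>k\<close> grows at most like \<open>D\<^sup>k\<close>. The set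
  where \<open>\<bar>f\<bar> > a\<^sub>k\<close> has measure at most \<open>2 t\<^sup>-\<^sup>k\<close>. Summing over the layers between \<open>a\<^sub>k\<close> and \<open>a\<^sub>k\<^sub>+\<^sub>1\<close> bounds the
  integral of \<open>\<bar>f\<bar>\<close> by a geometric series of ratio \<open>D / t < 1\<close>.
\<close>
theorem L1_embedding:
  assumes up: "upper_boyd_index X N < 1" and f: "f \<in> X"
  shows "integrable mu f"
proof -
  obtain t D where tD: "1 < t" "0 \<le> D" "D < t" "\<And>f. f \<in> X \<Longrightarrow> N (dilation (1 / t) f) \<le> D * N f"
    by (rule upper_index_dilation[OF up]) blast
  have fm[measurable]: "f \<in> borel_measurable mu" by (rule mem_L0[OF f])
  have tk: "0 < t ^ k" "1 / t ^ k \<le> 1" "1 / t ^ k > 0" for k using tD(1) by (auto simp: one_le_power)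
  have core_norm: "N (core 1) \<le> D ^ k * N (core (1 / t ^ k))" for k
  proof (induction k)
    case (Suc k)
    have "N (core (1 / t ^ k)) \<le> N (dilation (1 / t) (core (1 / t ^ Suc k)))"
      using tD(1) dilation_core[of "1 / t" _ "1 / t ^ Suc k"] tk(2)[of "Suc k"]
      by (intro norm_le_of_pointwise core_mem dilation_mem) (auto simp: field_simps)
    also have "\<dots> \<le> D * N (core (1 / t ^ Suc k))" by (rule tD(4)[OF core_mem])
    finally have "D ^ k * N (core (1 / t ^ k)) \<le> D ^ k * (D * N (core (1 / t ^ Suc k)))"
      using tD by (intro mult_left_mono) auto
    from order_trans[OF Suc this] show ?case by (simp add: mult_ac)
  qed simp
  define F where "F = symm_rearr f"
  define a where "a k = F (1 / t ^ k)" for k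
  have FX: "cfun F \<in> X" unfolding F_def by (rule symm_rearr_mem[OF f])
  have a0: "0 \<le> a k" for k unfolding a_def F_def by (rule symm_rearr_nonneg[OF fm])
  have gt: "l < F x \<longleftrightarrow> x \<noteq> 0 \<and> ennreal (2 * \<bar>x\<bar>) < dfun f l" if "0 \<le> l" for l x
    unfolding F_def by (rule symm_rearr_gt_iff[OF fm that])
  have Fge: "a k \<le> F x" if "x \<noteq> 0" "\<bar>x\<bar> \<le> 1 / t ^ k" for k x
  proof (rule ccontr)
    assume "\<not> a k \<le> F x"
    then have "F x < a k" by simp
    moreover have F0: "0 \<le> F x" unfolding F_def by (rule symm_rearr_nonneg[OF fm])
    ultimately have "ennreal (2 * \<bar>1 / t ^ k\<bar>) < dfun f (F x)" using gt[OF F0, of "1 / t ^ k"] by (simp add: a_def)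
    moreover have "ennreal (2 * \<bar>x\<bar>) \<le> ennreal (2 * \<bar>1 / t ^ k\<bar>)" using that tk(1)[of k] by (intro ennreal_leI) (auto simp: abs_of_pos)
    ultimately have "ennreal (2 * \<bar>x\<bar>) < dfun f (F x)" by (rule le_less_trans[rotated])
    then show False using gt[OF F0, of x] that by simp
  qed
  have aN: "a k * N (core 1) \<le> D ^ k * N (cfun F)" for k
  proof -
    have "AE x in mu. cmod (complex_of_real (a k) * core (1 / t ^ k) x) \<le> cmod (complex_of_real (F x))"
      using AE_mu_neq[of 0]
    proof eventually_elim
      case (elim x)
      show ?case
      proof (cases "\<bar>x\<bar> < 1 / t ^ k")
        case True
        then show ?thesis using Fge[of x k] elim a0[of k] by (simp add: core_def indicator_def norm_mult)
      next
        case False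
        then have "core (1 / t ^ k) x = 0" by (auto simp: core_def indicator_def abs_less_iff)
        then show ?thesis by simp
      qed
    qed
    then have "N (\<lambda>x. complex_of_real (a k) * core (1 / t ^ k) x) \<le> N (cfun F)"
      by (intro norm_mono FX scale_mem core_mem)
    moreover have "N (\<lambda>x. complex_of_real (a k) * core (1 / t ^ k) x) = a k * N (core (1 / t ^ k))"
      using a0[of k] by (subst norm_scale[OF core_mem]) simp
    ultimately have 1: "a k * N (core (1 / t ^ k)) \<le> N (cfun F)" by simp
    have "a k * N (core 1) \<le> a k * (D ^ k * N (core (1 / t ^ k)))" using a0 core_norm by (intro mult_left_mono) auto
    also have "\<dots> = D ^ k * (a k * N (core (1 / t ^ k)))" by simp
    also have "\<dots> \<le> D ^ k * N (cfun F)" using 1 tD by (intro mult_left_mono) auto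
    finally show ?thesis .
  qed
  define c where "c = N (cfun F) / N (core 1)"
  have c0: "0 \<le> c" using norm_nonneg[OF FX] norm_one_pos by (simp add: c_def)
  have ak: "a k \<le> c * D ^ k" for k
  proof -
    have "a k \<le> D ^ k * N (cfun F) / N (core 1)"
      using aN[of k] norm_one_pos by (simp add: pos_le_divide_eq)
    then show ?thesis by (simp add: c_def mult.commute)
  qed
  have da: "dfun f (a k) \<le> ennreal (2 / t ^ k)" for k
  proof -
    have "\<not> a k < F (1 / t ^ k)" by (simp add: a_def)
    then have "\<not> ennreal (2 * \<bar>1 / t ^ k\<bar>) < dfun f (a k)" using gt[OF a0, of k "1 / t ^ k"] tk(3)[of k] by (metis less_irrefl)
    then show ?thesis using tk(1)[of k] by (simp add: not_less abs_of_pos)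
  qed
  let ?S = "\<lambda>k. {x \<in> space mu. a k < cmod (f x)}"
  have Sm[measurable]: "?S k \<in> sets mu" for k by (rule dfun_set[OF fm])
  have null: "AE x in mu. \<exists>k. cmod (f x) \<le> a k"
  proof (rule AE_I)
    let ?Z = "\<Inter>k. ?S k"
    show Z: "?Z \<in> sets mu" using Sm by (intro sets.countable_INT) auto
    show "{x \<in> space mu. \<not> (\<exists>k. cmod (f x) \<le> a k)} \<subseteq> ?Z" by (auto simp: not_le)
    show "emeasure mu ?Z = 0"
    proof (rule emeasure_zero_of_geometric_bound[OF Z])
      fix k
      have "emeasure mu ?Z \<le> dfun f (a k)" unfolding dfun_def by (rule emeasure_mono[OF _ Sm]) blast
      also have "\<dots> \<le> ennreal (2 * (1 / t) ^ k)" using da[of k] by (simp add: power_one_over)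
      finally show "emeasure mu ?Z \<le> ennreal (2 * (1 / t) ^ k)" .
    qed (use tD in auto)
  qed
  have pt: "AE x in mu. ennreal (cmod (f x)) \<le> (\<Sum>k. ennreal (a (Suc k)) * indicator (?S k) x)"
  proof -
    have "AE x in mu. x \<in> space mu" by (rule AE_space)
    with null show ?thesis
    proof eventually_elim
      case (elim x)
      define k where "k = (LEAST k. cmod (f x) \<le> a k)"
      have k: "cmod (f x) \<le> a k" unfolding k_def using elim(1) by (rule LeastI_ex)
      \<comment> \<open>At the end point 1 the rearrangement vanishes, because the distribution function is at most 2.\<close>
      have a00: "a 0 = 0"
      proof (rule antisym[OF _ a0], rule ccontr)
        assume "\<not> a 0 \<le> 0"
        then have "ennreal (2 * \<bar>1 / t ^ 0\<bar>) < dfun f 0" using gt[of 0 "1 / t ^ 0"] by (simp add: a_def)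
        then show False using dfun_le_2[of f 0] by simp
      qed
      show ?case
      proof (cases k)
        case 0
        then show ?thesis using k a00 by simp
      next
        case (Suc j)
        have "\<not> cmod (f x) \<le> a j" using not_less_Least[of j "\<lambda>k. cmod (f x) \<le> a k"] Suc k_def by simp
        then have xj: "x \<in> ?S j" using elim(2) by simp
        have "ennreal (cmod (f x)) \<le> ennreal (a (Suc j))" using k Suc by (intro ennreal_leI) simp
        also have "\<dots> = (\<Sum>i\<in>{j}. ennreal (a (Suc i)) * indicator (?S i) x)" using xj by simp
        also have "\<dots> \<le> (\<Sum>k. ennreal (a (Suc k)) * indicator (?S k) x)" by (rule sum_le_suminf) auto
        finally show ?thesis .
      qed
    qed
  qed
  have "(\<integral>\<^sup>+x. ennreal (cmod (f x)) \<partial>mu) \<le> (\<integral>\<^sup>+x. (\<Sum>k. ennreal (a (Suc k)) * indicator (?S k) x) \<partial>mu)"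
    by (rule nn_integral_mono_AE[OF pt])
  also have "\<dots> = (\<Sum>k. \<integral>\<^sup>+x. ennreal (a (Suc k)) * indicator (?S k) x \<partial>mu)"
    by (rule nn_integral_suminf) (use Sm in measurable)
  also have "\<dots> = (\<Sum>k. ennreal (a (Suc k)) * dfun f (a k))"
    unfolding dfun_def by (intro suminf_cong nn_integral_cmult_indicator Sm)
  also have "\<dots> \<le> (\<Sum>k. ennreal (2 * c * D * (D / t) ^ k))"
  proof (intro suminf_le)
    fix k
    have "ennreal (a (Suc k)) * dfun f (a k) \<le> ennreal (c * D ^ Suc k) * ennreal (2 / t ^ k)"
      by (intro mult_mono ennreal_leI ak da) auto
    also have "\<dots> = ennreal (2 * c * D * (D / t) ^ k)"
      using c0 tD tk(1)[of k] by (simp add: power_divide mult_ac flip: ennreal_mult)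
    finally show "ennreal (a (Suc k)) * dfun f (a k) \<le> ennreal (2 * c * D * (D / t) ^ k)" .
  qed auto
  also have "\<dots> = ennreal (\<Sum>k. 2 * c * D * (D / t) ^ k)"
    using c0 tD by (intro suminf_ennreal2 summable_mult summable_geometric) (auto simp: divide_less_eq)
  also have "\<dots> < \<infinity>" by simp
  finally show ?thesis using fm by (intro integrableI_bounded) auto
qed

text \<open>
  Functions \<open>f\<^sub>k\<close> of norm at most 1 with integrals beyond \<open>4\<^sup>k\<close> would make the function from \<open>majorant\<close>
  non-integrable.
\<close>
theorem L1_bounded:
  assumes up: "upper_boyd_index X N < 1"
  obtains C where "0 < C" "\<And>f. f \<in> X \<Longrightarrow> (LINT x|mu. cmod (f x)) \<le> C * N f"
proof -
  have "\<exists>C>0. \<forall>f\<in>X. N f \<le> 1 \<longrightarrow> (LINT x|mu. cmod (f x)) \<le> C"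
  proof (rule ccontr)
    assume contra: "\<not> ?thesis"
    have "\<exists>f. f \<in> X \<and> N f \<le> 1 \<and> 4 ^ k < (LINT x|mu. cmod (f x))" for k :: nat
      using contra by (force simp: not_le dest: spec[of _ "4 ^ k"])
    then obtain f where f: "\<And>k::nat. f k \<in> X" "\<And>k. N (f k) \<le> 1" "\<And>k. 4 ^ k < (LINT x|mu. cmod (f k x))"
      by metis
    obtain F where F: "cfun F \<in> X" "\<And>k. AE x in mu. cmod (f k x) \<le> 2 ^ k * F x"
      by (rule majorant[of f 1, OF f(1,2)]) blast
    have Fi: "integrable mu F"
      using integrable_Re[OF L1_embedding[OF up F(1)]] by simp
    show False
    proof (rule power_growth_contradiction)
      fix k
      have "(LINT x|mu. cmod (f k x)) \<le> (LINT x|mu. 2 ^ k * F x)"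
        using Fi F(2)[of k] L1_embedding[OF up f(1)] by (intro integral_mono_AE) auto
      also have "\<dots> = 2 ^ k * (LINT x|mu. F x)" by simp
      finally show "4 ^ k < 2 ^ k * (LINT x|mu. F x)" using f(3)[of k] by linarith
    qed
  qed
  then obtain C where C: "0 < C" "\<And>f. f \<in> X \<Longrightarrow> N f \<le> 1 \<Longrightarrow> (LINT x|mu. cmod (f x)) \<le> C" by blast
  show ?thesis
  proof (rule that[OF C(1)])
    fix f assume f: "f \<in> X"
    show "(LINT x|mu. cmod (f x)) \<le> C * N f"
    proof (cases "N f = 0")
      case True
      then have "AE x in mu. f x = 0" using norm_eq_0[OF f] by simp
      then have "(LINT x|mu. cmod (f x)) = 0" by (intro integral_eq_zero_AE) auto
      then show ?thesis using True by simp
    next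
      case False
      then have p: "N f > 0" using norm_nonneg[OF f] by simp
      let ?c = "complex_of_real (1 / N f)"
      have "N (\<lambda>x. ?c * f x) = 1" using norm_scale[OF f, of ?c] p by (simp add: norm_divide)
      then have "(LINT x|mu. cmod (?c * f x)) \<le> C" by (intro C(2) scale_mem f) simp
      moreover have "(LINT x|mu. cmod (?c * f x)) = (LINT x|mu. cmod (f x)) / N f"
        using p by (simp add: norm_mult norm_divide)
      ultimately show ?thesis using p by (simp add: pos_divide_le_eq)
    qed
  qed
qed

lemma bounded_associate:
  assumes up: "upper_boyd_index X N < 1"
    and g: "g \<in> borel_measurable mu" "\<And>x. x \<in> {-1<..<1} \<Longrightarrow> cmod (g x) \<le> B"
  shows "g \<in> associate X"
  unfolding associate_def
proof (intro CollectI conjI ballI g)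
  fix f assume "f \<in> X"
  then have "integrable mu f" by (rule L1_embedding[OF up])
  then show "integrable mu (\<lambda>x. f x * g x)" using g by (rule integrable_mult_bounded)
qed

text \<open>
  The power \<open>1/p\<close> of \<open>\<bar>g\<bar>\<close> belongs to \<open>L\<^sup>p\<close>, since \<open>g\<close> is integrable; so it can be paired with \<open>g\<close>.
\<close>
lemma associate_lq_fun:
  assumes p: "0 < p"
    and emb: "\<And>f. f \<in> borel_measurable mu \<Longrightarrow> (\<integral>\<^sup>+x. ennreal (cmod (f x) ^ p) \<partial>mu) < \<infinity> \<Longrightarrow> f \<in> X"
    and g: "g \<in> associate X"
  shows "lq_fun p g"
proof -
  have gm[measurable]: "g \<in> borel_measurable mu" and gX: "\<And>f. f \<in> X \<Longrightarrow> integrable mu (\<lambda>x. f x * g x)"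
    using g by (auto simp: associate_def)
  have "(\<lambda>x. 1) \<in> X" by (rule bounded_mem[where B = 1]) auto
  from gX[OF this] have gi: "integrable mu g" by simp
  let ?f = "\<lambda>x. complex_of_real (cmod (g x) powr (1 / real p))"
  have "(cmod (g x) powr (1 / real p)) ^ p = cmod (g x)" for x
    using p by (cases "g x = 0") (auto simp: powr_power)
  then have "(\<integral>\<^sup>+x. ennreal (cmod (?f x) ^ p) \<partial>mu) = (\<integral>\<^sup>+x. ennreal (cmod (g x)) \<partial>mu)"
    by simp
  also have "\<dots> < \<infinity>" using gi by (simp add: integrable_iff_bounded)
  finally have "?f \<in> X" by (intro emb) measurable
  from integrable_norm[OF gX[OF this]]
  have "integrable mu (\<lambda>x. cmod (g x) powr (1 + 1 / real p))"
    by (rule Bochner_Integration.integrable_cong[THEN iffD1, rotated -1])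
       (auto simp: norm_mult powr_add mult.commute)
  then show ?thesis using gm by (simp add: lq_fun_def)
qed

end

section \<open>Variation along a grid\<close>

definition grid_cell :: "nat \<Rightarrow> nat \<Rightarrow> real set"
  where "grid_cell n j = {-1 + 2 * real j / real n..<-1 + 2 * real (Suc j) / real n}"

lemma grid_cell_measurable [measurable]: "grid_cell n j \<in> sets borel"
  by (simp add: grid_cell_def)

lemma grid_cell_diam: "x \<in> grid_cell n j \<Longrightarrow> y \<in> grid_cell n j \<Longrightarrow> \<bar>x - y\<bar> < 2 / real n"
  by (auto simp: grid_cell_def add_divide_distrib abs_less_iff)

lemma grid_cell_disjoint:
  assumes n: "n > 0" and "i \<noteq> j" shows "grid_cell n i \<inter> grid_cell n j = {}"
proof -
  have "grid_cell n i \<inter> grid_cell n j = {}" if "i < j" for i j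
  proof -
    have "2 * real (Suc i) / real n \<le> 2 * real j / real n"
      using that n by (intro divide_right_mono) auto
    then show ?thesis by (auto simp: grid_cell_def)
  qed
  with assms(2) show ?thesis by (metis Int_commute linorder_neqE_nat)
qed

lemma grid_cell_cover:
  assumes n: "n > 0" and x: "x \<in> {-1<..<1::real}"
  shows "\<exists>j<n. x \<in> grid_cell n j"
proof -
  define z where "z = (x + 1) * real n / 2"
  define j where "j = nat \<lfloor>z\<rfloor>"
  have z: "0 \<le> z" "z < real n" using x n by (auto simp: z_def)
  have j: "real j \<le> z" "z < real (Suc j)" using z(1) unfolding j_def by linarith+
  have "j < n" using j(1) z(2) by linarith
  moreover have "x \<in> grid_cell n j"
  proof -
    have xz: "x = -1 + 2 * z / real n" using n by (simp add: z_def)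
    have "2 * real j / real n \<le> 2 * z / real n" "2 * z / real n < 2 * real (Suc j) / real n"
      using j n by (auto intro!: divide_right_mono divide_strict_right_mono)
    then show ?thesis unfolding grid_cell_def xz by auto
  qed
  ultimately show ?thesis by blast
qed

lemma variation_ge_grid:
  assumes A: "A \<in> sets mu" and n: "n > 0" and zero: "nrm (\<nu> {}) \<le> 0"
  shows "(\<Sum>j<n. ennreal (nrm (\<nu> (A \<inter> grid_cell n j)))) \<le> variation nrm \<nu> A"
proof -
  let ?B = "\<lambda>j. A \<inter> grid_cell n j"
  \<comment> \<open>The members of a partition are nonempty, so the cells that miss \<open>A\<close> are left out.\<close>
  define J where "J = {j. j < n \<and> ?B j \<noteq> {}}"
  have AS: "A \<subseteq> {-1<..<1}" using A by (simp add: sets_mu_iff)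
  have disj: "?B i \<inter> ?B j = {}" if "i \<noteq> j" for i j using grid_cell_disjoint[OF n that] by blast
  have inj: "inj_on ?B J"
  proof (rule inj_onI, rule ccontr)
    fix i j assume ij: "i \<in> J" "?B i = ?B j" "i \<noteq> j"
    with disj[of i j] have "?B i = {}" by blast
    with ij(1) show False by (simp add: J_def)
  qed
  have part: "partition_on A (?B ` J)"
  proof (rule partition_onI)
    show "\<Union> (?B ` J) = A"
    proof
      show "A \<subseteq> \<Union> (?B ` J)"
      proof
        fix x assume x: "x \<in> A"
        then obtain j where "j < n" "x \<in> grid_cell n j" using grid_cell_cover[OF n, of x] AS by blast
        with x show "x \<in> \<Union> (?B ` J)" by (auto simp: J_def)
      qed
    qed blast
    show "{} \<notin> ?B ` J" by (auto simp: J_def)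
    show "disjnt p q" if pq: "p \<in> ?B ` J" "q \<in> ?B ` J" "p \<noteq> q" for p q
    proof -
      obtain i j where "p = ?B i" "q = ?B j" using pq(1,2) by (auto elim!: imageE)
      with pq(3) disj[of i j] show ?thesis unfolding disjnt_def by blast
    qed
  qed
  have sets: "?B ` J \<subseteq> sets mu" using A by (auto simp: sets_mu_iff)
  have fin: "finite (?B ` J)" by (simp add: J_def)
  have "(\<Sum>j<n. ennreal (nrm (\<nu> (?B j)))) = (\<Sum>j\<in>J. ennreal (nrm (\<nu> (?B j))))"
  proof (rule sum.mono_neutral_right)
    show "\<forall>j\<in>{..<n} - J. ennreal (nrm (\<nu> (?B j))) = 0"
    proof
      fix j assume "j \<in> {..<n} - J"
      then have "?B j = {}" by (auto simp: J_def)
      then show "ennreal (nrm (\<nu> (?B j))) = 0" using zero by (simp only: ennreal_neg)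
    qed
  qed (auto simp: J_def)
  also have "\<dots> = (\<Sum>B\<in>?B ` J. ennreal (nrm (\<nu> B)))"
    by (simp only: sum.reindex[OF inj] o_def)
  also have "\<dots> \<le> variation nrm \<nu> A"
    unfolding variation_def by (rule SUP_upper) (use part sets fin in blast)
  finally show ?thesis .
qed

lemma sum_grid_measure:
  assumes A: "A \<in> sets mu" and n: "n > 0"
  shows "(\<Sum>j<n. emeasure mu (A \<inter> grid_cell n j)) = emeasure mu A"
proof -
  have AS: "A \<subseteq> {-1<..<1}" using A by (simp add: sets_mu_iff)
  have "(\<Sum>j<n. emeasure mu (A \<inter> grid_cell n j)) = emeasure mu (\<Union>j\<in>{..<n}. A \<inter> grid_cell n j)"
  proof (rule sum_emeasure)
    show "disjoint_family_on (\<lambda>j. A \<inter> grid_cell n j) {..<n}"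
      unfolding disjoint_family_on_def using grid_cell_disjoint[OF n] by blast
  qed (use A in \<open>auto simp: sets_mu_iff\<close>)
  also have "(\<Union>j\<in>{..<n}. A \<inter> grid_cell n j) = A"
    using grid_cell_cover[OF n] AS by blast
  finally show ?thesis .
qed

text \<open>
  On a set \<open>B\<close> in a grid cell the density differs from a constant of modulus 1 by at most \<open>2 L / n\<close>, so
  \<open>\<bar>\<nu>(B)\<bar>\<close> is at least \<open>(1 - 2 L / n) \<mu>(B)\<close>.
\<close>
lemma variation_unimodular_density:
  fixes v :: "real \<Rightarrow> complex"
  assumes vm: "v \<in> borel_measurable mu" and v1: "\<And>x. x \<in> {-1<..<1} \<Longrightarrow> cmod (v x) = 1"
    and lip: "\<And>x y. x \<in> {-1<..<1} \<Longrightarrow> y \<in> {-1<..<1} \<Longrightarrow> cmod (v x - v y) \<le> L * \<bar>x - y\<bar>"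
    and nu: "\<And>B. B \<in> sets mu \<Longrightarrow> \<nu> B = - (LINT x:B|mu. v x)" and A: "A \<in> sets mu"
  shows "variation cmod \<nu> A = emeasure mu A"
proof (rule antisym)
  have vi: "integrable mu v" by (rule integrable_mu_bounded[OF vm]) (use v1 in auto)
  have svi: "integrable mu (\<lambda>x. indicator B x *\<^sub>R v x)" if "B \<in> sets mu" for B
    using that vi by (rule integrable_mult_indicator)
  have meas: "(LINT x|mu. indicator B x) = measure mu B" if "B \<in> sets mu" for B
  proof -
    have "B \<inter> space mu = B" using sets.sets_into_space[OF that] by blast
    then show ?thesis by simp
  qed
  have ind_i: "integrable mu (indicator B :: real \<Rightarrow> real)" if "B \<in> sets mu" for B
    by (rule integrable_mu_bounded[where B = 1]) (use that in \<open>auto simp: indicator_def\<close>)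
  have up: "cmod (\<nu> B) \<le> measure mu B" if B: "B \<in> sets mu" for B
  proof -
    have "cmod (\<nu> B) \<le> (LINT x|mu. indicator B x)"
      unfolding nu[OF B] norm_minus_cancel set_lebesgue_integral_def
    proof (rule Bochner_Integration.integral_norm_bound_integral[OF svi[OF B] ind_i[OF B]])
      fix x assume "x \<in> space mu"
      then show "norm (indicator B x *\<^sub>R v x) \<le> indicator B x" using v1[of x] by (simp add: space_mu indicator_def)
    qed
    then show ?thesis using meas[OF B] by simp
  qed
  show "variation cmod \<nu> A \<le> emeasure mu A"
    unfolding variation_def
  proof (rule SUP_least)
    fix P assume "P \<in> {P. finite P \<and> P \<subseteq> sets mu \<and> partition_on A P}"
    then have P: "finite P" "P \<subseteq> sets mu" "partition_on A P" by auto
    have "(\<Sum>B\<in>P. ennreal (cmod (\<nu> B))) \<le> (\<Sum>B\<in>P. emeasure mu B)"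
    proof (rule sum_mono)
      fix B assume "B \<in> P"
      then have "B \<in> sets mu" using P by blast
      then show "ennreal (cmod (\<nu> B)) \<le> emeasure mu B"
        using up by (simp add: mu.emeasure_eq_measure ennreal_leI)
    qed
    also have "\<dots> = emeasure mu (\<Union>B\<in>P. B)"
    proof (rule sum_emeasure)
      show "disjoint_family_on (\<lambda>B. B) P"
        using P(3) by (auto simp: disjoint_family_on_def partition_on_def disjoint_def)
    qed (use P in auto)
    also have "(\<Union>B\<in>P. B) = A" using P(3) by (simp add: partition_on_def)
    finally show "(\<Sum>B\<in>P. ennreal (cmod (\<nu> B))) \<le> emeasure mu A" .
  qed
  have L0: "0 \<le> L"
    using order_trans[OF norm_ge_zero lip[of 0 "1/2"]] by simp
  have low: "(1 - L * (2 / real n)) * measure mu B \<le> cmod (\<nu> B)"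
    if B: "B \<in> sets mu" "B \<subseteq> grid_cell n j" and n: "n > 0" for B n j
  proof (cases "B = {}")
    case False
    then obtain x0 where x0: "x0 \<in> B" by blast
    have BS: "B \<subseteq> {-1<..<1}" using B(1) by (simp add: sets_mu_iff)
    have c: "(LINT x|mu. indicator B x *\<^sub>R v x0) = complex_of_real (measure mu B) * v x0"
    proof -
      have "(LINT x|mu. indicator B x *\<^sub>R v x0) = (LINT x|mu. complex_of_real (indicator B x)) * v x0"
        by (simp add: scaleR_conv_of_real)
      also have "(LINT x|mu. complex_of_real (indicator B x)) = complex_of_real (LINT x|mu. indicator B x)"
        by (rule integral_complex_of_real)
      finally show ?thesis using meas[OF B(1)] by (simp only:)
    qed
    have ci: "integrable mu (\<lambda>x. indicator B x *\<^sub>R v x0)"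
      using integrable_mult_indicator[OF B(1), of "\<lambda>x. v x0"] by simp
    have "cmod ((LINT x|mu. indicator B x *\<^sub>R v x) - (LINT x|mu. indicator B x *\<^sub>R v x0)) = cmod (LINT x|mu. indicator B x *\<^sub>R v x - indicator B x *\<^sub>R v x0)"
      using svi[OF B(1)] ci by (simp only: Bochner_Integration.integral_diff)
    also have "\<dots> \<le> (LINT x|mu. indicator B x * (L * (2 / real n)))"
    proof (rule Bochner_Integration.integral_norm_bound_integral)
      show "integrable mu (\<lambda>x. indicator B x *\<^sub>R v x - indicator B x *\<^sub>R v x0)"
        using svi[OF B(1)] ci by (rule Bochner_Integration.integrable_diff)
      show "integrable mu (\<lambda>x. indicator B x * (L * (2 / real n)))" using ind_i[OF B(1)] by (rule integrable_mult_left)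
      fix x
      show "norm (indicator B x *\<^sub>R v x - indicator B x *\<^sub>R v x0) \<le> indicator B x * (L * (2 / real n))"
      proof (cases "x \<in> B")
        case True
        have "cmod (v x - v x0) \<le> L * \<bar>x - x0\<bar>" using True x0 BS by (intro lip) auto
        also have "\<dots> \<le> L * (2 / real n)"
          using True x0 B(2) by (intro mult_left_mono[OF _ L0] less_imp_le grid_cell_diam[of x n j x0]) blast+
        finally show ?thesis using True by simp
      qed simp
    qed
    also have "\<dots> = measure mu B * (L * (2 / real n))"
      unfolding integral_mult_left_zero meas[OF B(1)] ..
    finally have d: "cmod ((LINT x|mu. indicator B x *\<^sub>R v x) - complex_of_real (measure mu B) * v x0) \<le> measure mu B * (L * (2 / real n))"
      unfolding c .
    have "measure mu B = cmod (complex_of_real (measure mu B) * v x0)"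
      using v1[of x0] x0 BS by (simp add: norm_mult subset_iff)
    also have "\<dots> \<le> cmod (LINT x|mu. indicator B x *\<^sub>R v x) + measure mu B * (L * (2 / real n))"
      using norm_triangle_sub[of "complex_of_real (measure mu B) * v x0" "LINT x|mu. indicator B x *\<^sub>R v x"] d
      unfolding norm_minus_commute[of "complex_of_real (measure mu B) * v x0"] by linarith
    also have "cmod (LINT x|mu. indicator B x *\<^sub>R v x) = cmod (\<nu> B)"
      unfolding nu[OF B(1)] set_lebesgue_integral_def norm_minus_cancel ..
    finally show ?thesis by (simp add: algebra_simps)
  qed simp
  have nu0: "cmod (\<nu> {}) \<le> 0" by (subst nu) (auto simp: set_lebesgue_integral_def)
  have bound: "ennreal ((1 - L * (2 / real n)) * measure mu A) \<le> variation cmod \<nu> A" if n: "n > 0" for n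
  proof (cases "1 - L * (2 / real n) \<le> 0")
    case True
    then have "(1 - L * (2 / real n)) * measure mu A \<le> 0" by (rule mult_nonpos_nonneg) simp
    then show ?thesis by (simp add: ennreal_neg)
  next
    case False
    let ?B = "\<lambda>j. A \<inter> grid_cell n j"
    have Bs: "?B j \<in> sets mu" for j using A by (auto simp: sets_mu_iff)
    have "ennreal ((1 - L * (2 / real n)) * measure mu A) = ennreal (1 - L * (2 / real n)) * emeasure mu A"
      using False by (simp add: ennreal_mult mu.emeasure_eq_measure)
    also have "\<dots> = (\<Sum>j<n. ennreal (1 - L * (2 / real n)) * emeasure mu (?B j))"
      unfolding sum_grid_measure[OF A n, symmetric] by (simp add: sum_distrib_left)
    also have "\<dots> \<le> (\<Sum>j<n. ennreal (cmod (\<nu> (?B j))))"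
    proof (rule sum_mono)
      fix j
      have "ennreal (1 - L * (2 / real n)) * emeasure mu (?B j) = ennreal ((1 - L * (2 / real n)) * measure mu (?B j))"
        using False by (simp add: ennreal_mult mu.emeasure_eq_measure)
      also have "\<dots> \<le> ennreal (cmod (\<nu> (?B j)))" by (intro ennreal_leI low[OF Bs _ n]) auto
      finally show "ennreal (1 - L * (2 / real n)) * emeasure mu (?B j) \<le> ennreal (cmod (\<nu> (?B j)))" .
    qed
    also have "\<dots> \<le> variation cmod \<nu> A" by (rule variation_ge_grid[OF A n]) (rule nu0)
    finally show ?thesis .
  qed
  have "(\<lambda>n. ennreal ((1 - L * (2 / real n)) * measure mu A)) \<longlonglongrightarrow> ennreal ((1 - L * 0) * measure mu A)"
    by (intro tendsto_ennrealI tendsto_intros lim_const_over_n)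
  then have "ennreal ((1 - L * 0) * measure mu A) \<le> variation cmod \<nu> A"
    by (rule tendsto_upperbound) (rule eventually_mono[OF eventually_gt_at_top[of 0] bound], simp_all)
  then show "emeasure mu A \<le> variation cmod \<nu> A" by (simp add: mu.emeasure_eq_measure)
qed

section \<open>The vector measure of the finite Hilbert transform\<close>

lemma indicator_mu:
  assumes "A \<in> sets mu"
  shows "(indicator A :: real \<Rightarrow> complex) \<in> borel_measurable mu" "cmod (indicator A x) \<le> 1"
  using assms by (auto simp: indicator_def)

lemma hilbert_measure_measurable: "A \<in> sets mu \<Longrightarrow> hilbert_measure A \<in> borel_measurable mu"
  unfolding hilbert_measure_def
  by (intro finite_hilbert_measurable integrable_mu_bounded[where B = 1] indicator_mu)

lemma hilbert_measure_null:
  assumes A: "A \<in> sets mu" "emeasure mu A = 0"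
  shows "hilbert_measure A = (\<lambda>x. 0)"
proof
  fix t
  have i: "integrable mu (indicator A :: real \<Rightarrow> complex)"
    by (rule integrable_indicator_mu[OF sets_mu_borel[OF A(1)]])
  have ae: "AE x in mu. x \<notin> A" by (rule AE_I[of _ _ A]) (use A in auto)
  have "truncated_hilbert (indicator A) t e = 0" if "0 < e" for e
    unfolding truncated_hilbert_kernel(1)[OF i that]
    by (rule integral_eq_zero_AE) (use ae in \<open>auto elim!: eventually_mono\<close>)
  then have "\<forall>\<^sub>F e in at_right 0. truncated_hilbert (indicator A) t e = 0"
    using eventually_at_right_less[of 0] by (auto elim: eventually_mono)
  then show "hilbert_measure A t = 0"
    unfolding hilbert_measure_def by (intro finite_hilbert_eqI tendsto_eventually)
qed

lemma pairing_hilbert_measure: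
  assumes g: "lq_fun p g" and p: "0 < p" and A: "A \<in> sets mu"
  shows "set_integrable mu A (finite_hilbert g)"
    and "pairing (hilbert_measure A) g = - (LINT x:A|mu. finite_hilbert g x)"
proof -
  have "integrable mu (finite_hilbert g)"
    using finite_hilbert_mean_limit(1)[OF g p] by (simp add: mean_limit_def)
  then show "set_integrable mu A (finite_hilbert g)"
    using sets_mu_borel[OF A] by (rule set_integrable_mu)
  have "pairing (hilbert_measure A) g = (LINT x|mu. g x * finite_hilbert (indicator A) x)"
    by (simp add: pairing_def hilbert_measure_def mult.commute)
  also have "\<dots> = - (LINT x|mu. finite_hilbert g x * indicator A x)"
    by (rule finite_hilbert_duality(2)[OF g p indicator_mu(1)[OF A] indicator_mu(2)[OF A]])
  also have "(LINT x|mu. finite_hilbert g x * indicator A x) = (LINT x:A|mu. finite_hilbert g x)"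
    unfolding set_lebesgue_integral_def
    by (intro Bochner_Integration.integral_cong refl) (auto simp: indicator_def)
  finally show "pairing (hilbert_measure A) g = - (LINT x:A|mu. finite_hilbert g x)" .
qed

lemma unimodular_quotient:
  fixes a :: real assumes a: "a > 0"
  defines "w \<equiv> \<lambda>t. - (complex_of_real t - \<i> * complex_of_real a) / (complex_of_real t + \<i> * complex_of_real a)"
  shows "cmod (w t) = 1" "cmod (w t - w u) \<le> 2 / a * \<bar>t - u\<bar>"
proof -
  have nz: "complex_of_real t + \<i> * complex_of_real a \<noteq> 0" for t using a by (rule complex_shift_nonzero)
  have "cmod (complex_of_real t - \<i> * complex_of_real a) = cmod (complex_of_real t + \<i> * complex_of_real a)"
    by (simp add: cmod_def)
  then show "cmod (w t) = 1" using nz[of t] by (simp only: w_def norm_divide norm_minus_cancel) simp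
  have e: "w t = 2 * \<i> * complex_of_real a / (complex_of_real t + \<i> * complex_of_real a) - 1" for t
    using nz[of t] by (simp add: w_def divide_simps)
  have ge: "a \<le> cmod (complex_of_real t + \<i> * complex_of_real a)" for t
    using abs_Im_le_cmod[of "complex_of_real t + \<i> * complex_of_real a"] a by simp
  have "w t - w u = 2 * \<i> * complex_of_real a * (complex_of_real u - complex_of_real t) / ((complex_of_real t + \<i> * complex_of_real a) * (complex_of_real u + \<i> * complex_of_real a))"
    unfolding e using nz[of t] nz[of u] by (simp add: field_simps)
  also have "cmod \<dots> = 2 * a * \<bar>u - t\<bar> / (cmod (complex_of_real t + \<i> * complex_of_real a) * cmod (complex_of_real u + \<i> * complex_of_real a))"
    using a by (simp add: norm_mult norm_divide flip: of_real_diff)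
  also have "\<dots> \<le> 2 * a * \<bar>u - t\<bar> / (a * a)"
    using a ge by (intro divide_left_mono mult_mono mult_pos_pos) (auto simp: nz)
  also have "\<dots> = 2 / a * \<bar>t - u\<bar>" using a by (simp add: abs_minus_commute)
  finally show "cmod (w t - w u) \<le> 2 / a * \<bar>t - u\<bar>" .
qed

lemma variation_unimodular_preimage:
  assumes A: "A \<in> sets mu"
  shows "variation cmod (\<lambda>B. pairing (hilbert_measure B) unimodular_preimage) A = emeasure mu A"
proof -
  have lq: "lq_fun 1 unimodular_preimage"
    by (rule lq_fun_bounded[OF unimodular_preimage_measurable]) (use unimodular_preimage_bound in blast)
  have gi: "integrable mu unimodular_preimage" by (rule lq_fun_integrable[OF lq])
  have a: "sqrt (1 / 3) > (0::real)" by simp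
  show ?thesis
  proof (rule variation_unimodular_density[OF _ _ _ _ A])
    show "finite_hilbert unimodular_preimage \<in> borel_measurable mu" by (rule finite_hilbert_measurable[OF gi])
    show "cmod (finite_hilbert unimodular_preimage x) = 1" if "x \<in> {-1<..<1}" for x
      unfolding finite_hilbert_unimodular_preimage[OF that] by (rule unimodular_quotient(1)[OF a])
    show "cmod (finite_hilbert unimodular_preimage x - finite_hilbert unimodular_preimage y) \<le> 2 / sqrt (1 / 3) * \<bar>x - y\<bar>"
      if "x \<in> {-1<..<1}" "y \<in> {-1<..<1}" for x y
      unfolding finite_hilbert_unimodular_preimage[OF that(1)] finite_hilbert_unimodular_preimage[OF that(2)]
      by (rule unimodular_quotient(2)[OF a])
    show "pairing (hilbert_measure B) unimodular_preimage = - (LINT x:B|mu. finite_hilbert unimodular_preimage x)"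
      if "B \<in> sets mu" for B
      using pairing_hilbert_measure(2)[OF lq _ that] by simp
  qed
qed

text \<open>
  At a point \<open>t\<close> outside the cell, on the side of the cell where the interval extends further, the transform is at
  least \<open>\<mu>(B) / pi\<close> divided by the distance from \<open>t\<close> to the far end of the cell. Integrated over that side
  this gives a logarithm; the far end enters because the bound must hold for all points of \<open>B\<close>.
\<close>
lemma hilbert_measure_L1_lower:
  assumes B: "B \<in> sets mu" "B \<subseteq> grid_cell n j" and n: "n > 0" "j < n"
    and int: "integrable mu (hilbert_measure B)"
  shows "measure mu B / pi * ln (real n / 2) \<le> (LINT t|mu. cmod (hilbert_measure B t))"
proof -
  define a b where "a = -1 + 2 * real j / real n" and "b = -1 + 2 * real (Suc j) / real n"
  have cell: "grid_cell n j = {a..<b}" by (simp add: grid_cell_def a_def b_def)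
  have ba: "b - a = 2 / real n" by (simp add: a_def b_def add_divide_distrib)
  have a1: "-1 \<le> a" by (simp add: a_def)
  have "2 * real (Suc j) / real n \<le> 2" using n by (simp add: divide_le_eq)
  then have b1: "b \<le> 1" unfolding b_def by linarith
  have ab: "a < b" using ba n by (smt (verit) divide_pos_pos of_nat_0_less_iff)
  let ?m = "measure mu B / pi"
  have main: "?m * (LINT t:{c<..<d}|mu. 1 / (s * (e - t))) \<le> (LINT t|mu. cmod (hilbert_measure B t))"
    if cd: "-1 \<le> c" "d \<le> 1" "c \<le> d" and s: "s = 1 \<or> s = -1"
      and far: "\<And>t x. t \<in> {c<..<d} \<Longrightarrow> x \<in> {a..<b} \<Longrightarrow> 0 < s * (x - t) \<and> s * (x - t) \<le> s * (e - t)"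
      and sep: "\<And>t. t \<in> {c<..<d} \<Longrightarrow> \<exists>\<delta>>0. \<forall>x\<in>{a..<b}. \<delta> \<le> s * (x - t)"
      and icont: "integrable mu (\<lambda>t. indicator {c<..<d} t *\<^sub>R (1 / (s * (e - t))))" for c d s e
  proof -
    have "?m * (LINT t:{c<..<d}|mu. 1 / (s * (e - t))) = (LINT t|mu. ?m * (indicator {c<..<d} t *\<^sub>R (1 / (s * (e - t)))))"
      unfolding set_lebesgue_integral_def integral_mult_right_zero ..
    also have "\<dots> \<le> (LINT t|mu. cmod (hilbert_measure B t))"
    proof (rule integral_mono)
      show "integrable mu (\<lambda>t. ?m * (indicator {c<..<d} t *\<^sub>R (1 / (s * (e - t)))))" using icont by (rule integrable_mult_right)
      show "integrable mu (\<lambda>t. cmod (hilbert_measure B t))" using int by (rule integrable_norm)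
      fix t
      show "?m * (indicator {c<..<d} t *\<^sub>R (1 / (s * (e - t)))) \<le> cmod (hilbert_measure B t)"
      proof (cases "t \<in> {c<..<d}")
        case True
        obtain \<delta> where \<delta>: "\<delta> > 0" "\<And>x. x \<in> {a..<b} \<Longrightarrow> \<delta> \<le> s * (x - t)" using sep[OF True] by blast
        have "measure mu B / (pi * (s * (e - t))) \<le> cmod (hilbert_measure B t)"
          using B cell far[OF True] \<delta> by (intro hilbert_measure_lower_bound[OF B(1) \<delta>(1) s]) auto
        then show ?thesis using True by simp
      qed simp
    qed
    finally show ?thesis .
  qed
  have m0: "0 \<le> ?m" by simp
  have n2: "ln (real n / 2) = - ln (2 / real n)" using n by (simp add: ln_div)
  show ?thesis
  proof (cases "a \<le> 0")
    case True
    have "(LINT t:{b<..<1}|mu. 1 / (-1 * (a - t))) = ln (1 - a) - ln (b - a)"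
    proof (rule set_integral_mu_FTC_interior)
      show "continuous_on {b..1} (\<lambda>t. 1 / (-1 * (a - t)))" using ab by (intro continuous_intros) auto
      show "continuous_on {b..1} (\<lambda>t. ln (t - a))" using ab by (intro continuous_intros) auto
      show "((\<lambda>t. ln (t - a)) has_real_derivative 1 / (-1 * (a - x))) (at x)" if "b < x" "x < 1" for x
        using that ab by (auto intro!: derivative_eq_intros)
    qed (use a1 ab b1 in auto)
    moreover have "0 \<le> ln (1 - a)" using True by simp
    ultimately have "ln (real n / 2) \<le> (LINT t:{b<..<1}|mu. 1 / (-1 * (a - t)))" unfolding n2 ba by linarith
    then have "?m * ln (real n / 2) \<le> ?m * (LINT t:{b<..<1}|mu. 1 / (-1 * (a - t)))" using m0 by (rule mult_left_mono)
    also have "\<dots> \<le> (LINT t|mu. cmod (hilbert_measure B t))"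
    proof (rule main)
      show "\<exists>\<delta>>0. \<forall>x\<in>{a..<b}. \<delta> \<le> -1 * (x - t)" if "t \<in> {b<..<1}" for t
        using that by (intro exI[of _ "t - b"]) auto
      show "integrable mu (\<lambda>t. indicator {b<..<1} t *\<^sub>R (1 / (-1 * (a - t))))"
      proof (rule integrable_mu_bounded[where B = "1 / (b - a)"])
        show "(\<lambda>t. indicator {b<..<1} t *\<^sub>R (1 / (-1 * (a - t)))) \<in> borel_measurable mu"
          by (rule borel_measurable_mu) measurable
        show "norm (indicator {b<..<1} t *\<^sub>R (1 / (-1 * (a - t)))) \<le> 1 / (b - a)" for t
          using ab by (auto simp: indicator_def intro!: divide_left_mono mult_pos_pos)
      qed
    qed (use a1 ab b1 in auto)
    finally show ?thesis .
  next
    case False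
    have "(LINT t:{-1<..<a}|mu. 1 / (1 * (b - t))) = - ln (b - a) - (- ln (b - (-1)))"
    proof (rule set_integral_mu_FTC_interior)
      show "continuous_on {-1..a} (\<lambda>t. 1 / (1 * (b - t)))" using ab by (intro continuous_intros) auto
      show "continuous_on {-1..a} (\<lambda>t. - ln (b - t))" using ab by (intro continuous_intros) auto
      show "((\<lambda>t. - ln (b - t)) has_real_derivative 1 / (1 * (b - x))) (at x)" if "-1 < x" "x < a" for x
        using that ab by (auto intro!: derivative_eq_intros)
    qed (use a1 ab b1 in auto)
    moreover have "0 \<le> ln (b - (-1))" using False ab by simp
    ultimately have "ln (real n / 2) \<le> (LINT t:{-1<..<a}|mu. 1 / (1 * (b - t)))" unfolding n2 ba by linarith
    then have "?m * ln (real n / 2) \<le> ?m * (LINT t:{-1<..<a}|mu. 1 / (1 * (b - t)))" using m0 by (rule mult_left_mono)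
    also have "\<dots> \<le> (LINT t|mu. cmod (hilbert_measure B t))"
    proof (rule main)
      show "\<exists>\<delta>>0. \<forall>x\<in>{a..<b}. \<delta> \<le> 1 * (x - t)" if "t \<in> {-1<..<a}" for t
        using that by (intro exI[of _ "a - t"]) auto
      show "integrable mu (\<lambda>t. indicator {-1<..<a} t *\<^sub>R (1 / (1 * (b - t))))"
      proof (rule integrable_mu_bounded[where B = "1 / (b - a)"])
        show "(\<lambda>t. indicator {-1<..<a} t *\<^sub>R (1 / (1 * (b - t)))) \<in> borel_measurable mu"
          by (rule borel_measurable_mu) measurable
        show "norm (indicator {-1<..<a} t *\<^sub>R (1 / (1 * (b - t)))) \<le> 1 / (b - a)" for t
          using ab by (auto simp: indicator_def intro!: divide_left_mono mult_pos_pos)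
      qed
    qed (use a1 ab b1 in auto)
    finally show ?thesis .
  qed
qed

context ri_space
begin

lemma pairing_dual:
  assumes up: "upper_boyd_index X N < 1"
    and g: "g \<in> borel_measurable mu" "\<And>x. x \<in> {-1<..<1} \<Longrightarrow> cmod (g x) \<le> B"
  obtains C where "0 < C" "\<And>f. f \<in> X \<Longrightarrow> cmod (pairing f g) \<le> B * C * N f"
    "(\<lambda>f. pairing f g) \<in> dual X N"
proof -
  obtain C where C: "0 < C" "\<And>f. f \<in> X \<Longrightarrow> (LINT x|mu. cmod (f x)) \<le> C * N f"
    by (rule L1_bounded[OF up]) blast
  have B0: "0 \<le> B" using g(2)[of 0] by (auto intro: order_trans[OF norm_ge_zero])
  have i: "integrable mu (\<lambda>x. f x * g x)" if "f \<in> X" for f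
    using bounded_associate[OF up g] that by (auto simp: associate_def)
  have bd: "cmod (pairing f g) \<le> B * C * N f" if f: "f \<in> X" for f
  proof -
    have "cmod (pairing f g) \<le> (LINT x|mu. B * cmod (f x))"
      unfolding pairing_def
    proof (rule Bochner_Integration.integral_norm_bound_integral[OF i[OF f]])
      show "integrable mu (\<lambda>x. B * cmod (f x))" using L1_embedding[OF up f] by auto
      fix x assume "x \<in> space mu"
      then have "cmod (f x) * cmod (g x) \<le> cmod (f x) * B" using g(2) by (intro mult_left_mono) (auto simp: space_mu)
      then show "norm (f x * g x) \<le> B * cmod (f x)" by (simp add: norm_mult mult.commute)
    qed
    also have "\<dots> = B * (LINT x|mu. cmod (f x))" by simp
    also have "\<dots> \<le> B * (C * N f)" using C(2)[OF f] B0 by (rule mult_left_mono)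
    finally show ?thesis by (simp add: mult.assoc)
  qed
  have "(\<lambda>f. pairing f g) \<in> dual X N"
    unfolding dual_def
  proof (intro CollectI conjI ballI allI)
    show "pairing (\<lambda>x. f x + h x) g = pairing f g + pairing h g" if "f \<in> X" "h \<in> X" for f h
      unfolding pairing_def distrib_right using i that by simp
    show "pairing (\<lambda>x. c * f x) g = c * pairing f g" for c f
      unfolding pairing_def mult.assoc by simp
    show "\<exists>C. \<forall>f\<in>X. cmod (pairing f g) \<le> C * N f" using bd by blast
  qed
  with C(1) bd show ?thesis by (rule that)
qed

text \<open>
  A relatively compact set is totally bounded: finitely many open balls of radius \<open>e\<close> cover the closure.
\<close>
lemma compact_finite_net:
  assumes W: "W \<subseteq> X" "relatively_compact X N W" and e: "e > 0"
  obtains F where "finite F" "F \<subseteq> X" "\<And>w. w \<in> W \<Longrightarrow> \<exists>f\<in>F. N (\<lambda>x. w x - f x) < e"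
proof -
  let ?T = "norm_topology X N"
  have top: "topspace ?T = X"
  proof -
    have "openin ?T X" unfolding openin_norm_topology by (auto intro: exI[of _ 1])
    then have "X \<subseteq> topspace ?T" by (rule openin_subset)
    moreover have "openin ?T (topspace ?T)" by simp
    then have "topspace ?T \<subseteq> X" unfolding openin_norm_topology by blast
    ultimately show ?thesis by blast
  qed
  define U where "U f = {g \<in> X. N (\<lambda>x. g x - f x) < e}" for f
  have Uo: "openin ?T (U f)" if f: "f \<in> X" for f
    unfolding openin_norm_topology
  proof (intro conjI ballI)
    show "U f \<subseteq> X" by (auto simp: U_def)
    fix g assume g: "g \<in> U f"
    then have gX: "g \<in> X" and gf: "N (\<lambda>x. g x - f x) < e" by (auto simp: U_def)
    show "\<exists>r>0. \<forall>h\<in>X. N (\<lambda>x. h x - g x) < r \<longrightarrow> h \<in> U f"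
    proof (intro exI[of _ "e - N (\<lambda>x. g x - f x)"] conjI ballI impI)
      fix h assume h: "h \<in> X" "N (\<lambda>x. h x - g x) < e - N (\<lambda>x. g x - f x)"
      have "N (\<lambda>x. h x - f x) \<le> N (\<lambda>x. h x - g x) + N (\<lambda>x. g x - f x)"
        using norm_triangle[OF diff_mem[OF h(1) gX] diff_mem[OF gX f]] by simp
      then show "h \<in> U f" using h by (simp add: U_def)
    qed (use gf in simp)
  qed
  have comp: "compactin ?T (?T closure_of W)" using W(2) by (simp add: relatively_compact_def)
  have sub: "?T closure_of W \<subseteq> \<Union> (U ` X)"
  proof
    fix f assume "f \<in> ?T closure_of W"
    then have fX: "f \<in> X" using closure_of_subset_topspace[of ?T W] top by blast
    moreover have "N (\<lambda>x. f x - f x) < e" using e norm_zero by simp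
    ultimately have "f \<in> U f" by (simp only: U_def mem_Collect_eq)
    with fX show "f \<in> \<Union> (U ` X)" by blast
  qed
  obtain \<F> where F: "finite \<F>" "\<F> \<subseteq> U ` X" "?T closure_of W \<subseteq> \<Union>\<F>"
    using comp sub Uo unfolding compactin_def by (metis (no_types, lifting) imageE)
  obtain F where F': "finite F" "F \<subseteq> X" "\<F> = U ` F" using finite_subset_image[OF F(1,2)] by blast
  show ?thesis
  proof (rule that[OF F'(1,2)])
    fix w assume w: "w \<in> W"
    then have "w \<in> ?T closure_of W" using closure_of_subset[of W ?T] W(1) top by blast
    then obtain f where "f \<in> F" "w \<in> U f" using F(3) F'(3) by blast
    then show "\<exists>f\<in>F. N (\<lambda>x. w x - f x) < e" by (auto simp: U_def)
  qed
qed

end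

theorem proposition3p2:
  fixes X :: "(real \<Rightarrow> complex) set" and N :: "(real \<Rightarrow> complex) \<Rightarrow> real"
  assumes "ri_space X N"
    and "0 < lower_boyd_index X N"
    and "lower_boyd_index X N \<le> upper_boyd_index X N"
    and "upper_boyd_index X N < 1"
  shows "hilbert_measure ` sets mu \<subseteq> oc_part X N \<and>
    (\<forall>g\<in>associate X. \<forall>A\<in>sets mu.
       set_integrable mu A (finite_hilbert g) \<and>
       pairing (hilbert_measure A) g = - (LINT x:A|mu. finite_hilbert g x)) \<and>
    (\<exists>g0\<in>associate X. \<forall>A\<in>sets mu.
       variation cmod (\<lambda>B. pairing (hilbert_measure B) g0) A = emeasure mu A) \<and>
    (\<forall>A\<in>sets mu. emeasure mu A = 0 \<longleftrightarrow> measure_null X N hilbert_measure A) \<and>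
    (\<forall>A\<in>sets mu. \<not> measure_null X N hilbert_measure A \<longrightarrow>
       variation N hilbert_measure A = \<infinity>) \<and>
    \<not> relatively_compact X N (hilbert_measure ` sets mu) \<and>
    \<not> order_bounded X (hilbert_measure ` sets mu)"
proof -
  interpret ri_space X N by fact
  note low = assms(2) and up = assms(4)
  obtain p where p: "0 < p"
    "\<And>f. f \<in> borel_measurable mu \<Longrightarrow> (\<integral>\<^sup>+x. ennreal (cmod (f x) ^ p) \<partial>mu) < \<infinity> \<Longrightarrow> f \<in> X"
    by (rule Lp_embedding[OF low]) blast
  obtain C where C: "0 < C" "\<And>f. f \<in> X \<Longrightarrow> (LINT x|mu. cmod (f x)) \<le> C * N f"
    by (rule L1_bounded[OF up]) blast
  have i: "hilbert_measure A \<in> oc_part X N" if A: "A \<in> sets mu" for A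
  proof (rule Lp_order_continuous[OF p(1,2) hilbert_measure_measurable[OF A]])
    have "(\<integral>\<^sup>+x. ennreal (cmod (hilbert_measure A x) ^ p) \<partial>mu) \<le> ennreal (moment_const p)"
      unfolding hilbert_measure_def by (rule finite_hilbert_moment[OF indicator_mu[OF A]])
    also have "\<dots> < \<infinity>" by simp
    finally show "(\<integral>\<^sup>+x. ennreal (cmod (hilbert_measure A x) ^ p) \<partial>mu) < \<infinity>" .
  qed
  then have mX: "hilbert_measure A \<in> X" if "A \<in> sets mu" for A using that by (auto simp: oc_part_def)
  have ii: "set_integrable mu A (finite_hilbert g) \<and> pairing (hilbert_measure A) g = - (LINT x:A|mu. finite_hilbert g x)"
    if g: "g \<in> associate X" and A: "A \<in> sets mu" for g A
    using pairing_hilbert_measure[OF associate_lq_fun[OF p g] p(1) A] by blast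
  have g0: "unimodular_preimage \<in> associate X"
    by (rule bounded_associate[OF up unimodular_preimage_measurable unimodular_preimage_bound])
  have iii: "\<exists>g0\<in>associate X. \<forall>A\<in>sets mu. variation cmod (\<lambda>B. pairing (hilbert_measure B) g0) A = emeasure mu A"
    using g0 variation_unimodular_preimage by blast
  have iv: "emeasure mu A = 0 \<longleftrightarrow> measure_null X N hilbert_measure A" if A: "A \<in> sets mu" for A
  proof
    assume A0: "emeasure mu A = 0"
    show "measure_null X N hilbert_measure A"
      unfolding measure_null_def variation_def
    proof
      fix \<phi> assume \<phi>: "\<phi> \<in> dual X N"
      have "\<And>c f. f \<in> X \<Longrightarrow> \<phi> (\<lambda>x. c * f x) = c * \<phi> f" using \<phi> unfolding dual_def by blast
      from this[OF zero_mem, of 0] have \<phi>0: "\<phi> (\<lambda>x. 0) = 0" by simp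
      have "(\<Sum>B\<in>P. ennreal (cmod (\<phi> (hilbert_measure B)))) = 0" if "finite P" "P \<subseteq> sets mu" "partition_on A P" for P
      proof (rule sum.neutral, rule ballI)
        fix B assume B: "B \<in> P"
        then have Bs: "B \<in> sets mu" "B \<subseteq> A" using that by (auto simp: partition_on_def)
        have "emeasure mu B \<le> emeasure mu A" using Bs A by (intro emeasure_mono)
        then have "emeasure mu B = 0" using A0 by simp
        then show "ennreal (cmod (\<phi> (hilbert_measure B))) = 0"
          using hilbert_measure_null[OF Bs(1)] \<phi>0 by simp
      qed
      then show "(SUP P\<in>{P. finite P \<and> P \<subseteq> sets mu \<and> partition_on A P}. \<Sum>B\<in>P. ennreal (cmod (\<phi> (hilbert_measure B)))) = 0"
        by (intro antisym SUP_least) auto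
    qed
  next
    assume null: "measure_null X N hilbert_measure A"
    obtain C0 where "(\<lambda>f. pairing f unimodular_preimage) \<in> dual X N"
      using pairing_dual[OF up unimodular_preimage_measurable unimodular_preimage_bound] by blast
    with null have "variation cmod (\<lambda>B. pairing (hilbert_measure B) unimodular_preimage) A = 0"
      unfolding measure_null_def by (rule bspec)
    then show "emeasure mu A = 0" using variation_unimodular_preimage[OF A] by simp
  qed
  have v: "variation N hilbert_measure A = \<infinity>" if A: "A \<in> sets mu" and nn: "\<not> measure_null X N hilbert_measure A" for A
  proof -
    have "emeasure mu A \<noteq> 0" using iv[OF A] nn by simp
    then have A0: "0 < measure mu A" by (simp add: mu.emeasure_eq_measure zero_less_measure_iff)
    have N0: "N (hilbert_measure {}) \<le> 0" using hilbert_measure_null[of "{}"] norm_zero by simp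
    \<comment> \<open>The norm dominates the integral up to \<open>C\<close>, so each cell contributes its share of \<open>A\<close> times the logarithm.\<close>
    have ge: "ennreal (measure mu A * (ln (real n / 2) / (pi * C))) \<le> variation N hilbert_measure A" if n: "n \<ge> 2" for n
    proof -
      have n0: "n > 0" using n by simp
      let ?B = "\<lambda>j. A \<inter> grid_cell n j"
      let ?l = "ln (real n / 2) / (pi * C)"
      have l0: "0 \<le> ?l" using n C by simp
      have Bs: "?B j \<in> sets mu" for j using A by (auto simp: sets_mu_iff)
      have "ennreal (measure mu A * ?l) = emeasure mu A * ennreal ?l"
        using l0 by (simp only: ennreal_mult measure_nonneg mu.emeasure_eq_measure)
      also have "\<dots> = (\<Sum>j<n. emeasure mu (?B j) * ennreal ?l)"
        unfolding sum_grid_measure[OF A n0, symmetric] by (rule sum_distrib_right)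
      also have "\<dots> \<le> (\<Sum>j<n. ennreal (N (hilbert_measure (?B j))))"
      proof (rule sum_mono)
        fix j assume j: "j \<in> {..<n}"
        have "measure mu (?B j) / pi * ln (real n / 2) \<le> (LINT t|mu. cmod (hilbert_measure (?B j) t))"
          using j by (intro hilbert_measure_L1_lower[OF Bs _ n0] L1_embedding[OF up mX] Bs) auto
        also have "\<dots> \<le> C * N (hilbert_measure (?B j))" by (rule C(2)[OF mX[OF Bs]])
        finally have "measure mu (?B j) * ?l \<le> N (hilbert_measure (?B j))"
          using C(1) by (simp add: field_simps)
        then have "ennreal (measure mu (?B j) * ?l) \<le> ennreal (N (hilbert_measure (?B j)))" by (rule ennreal_leI)
        then show "emeasure mu (?B j) * ennreal ?l \<le> ennreal (N (hilbert_measure (?B j)))"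
          using l0 by (simp only: ennreal_mult measure_nonneg mu.emeasure_eq_measure)
      qed
      also have "\<dots> \<le> variation N hilbert_measure A" by (rule variation_ge_grid[OF A n0, of N hilbert_measure, OF N0])
      finally show ?thesis .
    qed
    show ?thesis
    proof (rule ccontr)
      assume "variation N hilbert_measure A \<noteq> \<infinity>"
      then obtain V where V: "variation N hilbert_measure A = ennreal V" "0 \<le> V"
        by (cases "variation N hilbert_measure A") auto
      have inf: "filterlim (\<lambda>n. measure mu A * (ln (real n / 2) / (pi * C))) at_top sequentially"
      proof -
        have "filterlim (\<lambda>n. real n * (1 / 2)) at_top sequentially"
          by (rule filterlim_at_top_mult_tendsto_pos[OF tendsto_const _ filterlim_real_sequentially, of "1/2", simplified mult.commute]) simp
        then have "filterlim (\<lambda>n. ln (real n / 2)) at_top sequentially"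
          using filterlim_compose[OF ln_at_top] by simp
        from filterlim_tendsto_pos_mult_at_top[OF tendsto_const _ this, of "measure mu A / (pi * C)"]
        show ?thesis using A0 C by (simp add: mult.assoc)
      qed
      then have "\<forall>\<^sub>F n in sequentially. V + 1 \<le> measure mu A * (ln (real n / 2) / (pi * C))"
        unfolding filterlim_at_top by blast
      then have "\<forall>\<^sub>F n in sequentially. V + 1 \<le> measure mu A * (ln (real n / 2) / (pi * C)) \<and> n \<ge> 2"
        using eventually_ge_at_top[of 2] by eventually_elim simp
      then obtain n where n: "V + 1 \<le> measure mu A * (ln (real n / 2) / (pi * C))" "n \<ge> 2"
        by (auto simp: eventually_sequentially)
      from n(1) have "ennreal (V + 1) \<le> ennreal V"
        using ge[OF n(2)] unfolding V(1) by (meson ennreal_leI order_trans)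
      then show False using V(2) by (simp add: ennreal_le_iff)
    qed
  qed
  have vi: "\<not> relatively_compact X N (hilbert_measure ` sets mu)"
  proof
    assume rc: "relatively_compact X N (hilbert_measure ` sets mu)"
    let ?g = "\<lambda>n x. complex_of_real (cheb_sin n x)"
    have gm: "?g n \<in> borel_measurable mu" for n by measurable
    have gb: "cmod (?g n x) \<le> 1" for n x using cheb_bound(1)[of n x] by simp
    have fi: "integrable mu (\<lambda>x. f x * ?g n x)" if "f \<in> X" for f n
      using bounded_associate[OF up gm gb] that by (auto simp: associate_def)
    have pb: "cmod (pairing f (?g n)) \<le> C * N f" if f: "f \<in> X" for f n
    proof -
      have "cmod (pairing f (?g n)) \<le> (LINT x|mu. cmod (f x))"
        unfolding pairing_def
      proof (rule Bochner_Integration.integral_norm_bound_integral[OF fi[OF f]])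
        show "norm (f x * ?g n x) \<le> cmod (f x)" for x
          using gb[of n x] by (simp add: norm_mult mult_left_le)
      qed (use L1_embedding[OF up f] in auto)
      also have "\<dots> \<le> C * N f" by (rule C(2)[OF f])
      finally show ?thesis .
    qed
    \<comment> \<open>Approximation within \<open>e\<close> and the weak limit contribute at most 1/12 each, less than the lower bound 1/3.\<close>
    define e where "e = 1 / (12 * C)"
    have e: "e > 0" using C by (simp add: e_def)
    obtain F where F: "finite F" "F \<subseteq> X" "\<And>w. w \<in> hilbert_measure ` sets mu \<Longrightarrow> \<exists>f\<in>F. N (\<lambda>x. w x - f x) < e"
      using compact_finite_net[OF _ rc e] mX by blast
    have "\<forall>f\<in>F. \<forall>\<^sub>F n in sequentially. cmod (pairing f (?g n)) < 1 / 12"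
    proof
      fix f assume "f \<in> F"
      then have "integrable mu f" using F(2) by (intro L1_embedding[OF up]) auto
      then have "(\<lambda>n. pairing f (?g n)) \<longlonglongrightarrow> 0" unfolding pairing_def by (rule riemann_lebesgue_cheb)
      then have "(\<lambda>n. cmod (pairing f (?g n))) \<longlonglongrightarrow> 0" by (rule tendsto_norm_zero)
      then show "\<forall>\<^sub>F n in sequentially. cmod (pairing f (?g n)) < 1 / 12" by (rule order_tendstoD(2)) simp
    qed
    then have "\<forall>\<^sub>F n in sequentially. \<forall>f\<in>F. cmod (pairing f (?g n)) < 1 / 12"
      using F(1) by (simp add: eventually_ball_finite_distrib)
    then have "\<forall>\<^sub>F n in sequentially. (\<forall>f\<in>F. cmod (pairing f (?g n)) < 1 / 12) \<and> n \<ge> 2"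
      using eventually_ge_at_top[of 2] by eventually_elim simp
    then obtain n where n: "\<And>f. f \<in> F \<Longrightarrow> cmod (pairing f (?g n)) < 1 / 12" "n \<ge> 2"
      by (auto simp: eventually_sequentially)
    obtain A where A: "A \<in> sets mu" "1 / 3 \<le> \<bar>LINT x:A|mu. cheb_cos n x\<bar>"
      by (rule cheb_cos_large_on_some_set[OF n(2)])
    have Tg: "finite_hilbert (?g n) t = - complex_of_real (cheb_cos n t)" if "t \<in> {-1<..<1}" for t
      using cheb_sin_pv[OF that, of n] n(2) by (intro finite_hilbert_eqI) simp
    have lq: "lq_fun 1 (?g n)" by (rule lq_fun_bounded[OF gm]) (use gb in blast)
    have "pairing (hilbert_measure A) (?g n) = - (LINT x:A|mu. finite_hilbert (?g n) x)"
      using pairing_hilbert_measure(2)[OF lq _ A(1)] by simp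
    also have "(LINT x:A|mu. finite_hilbert (?g n) x) = - (LINT x:A|mu. complex_of_real (cheb_cos n x))"
    proof -
      have "(LINT x:A|mu. finite_hilbert (?g n) x) = (LINT x|mu. - (indicator A x *\<^sub>R complex_of_real (cheb_cos n x)))"
        unfolding set_lebesgue_integral_def
        by (intro Bochner_Integration.integral_cong refl) (simp add: space_mu Tg)
      then show ?thesis by (simp add: set_lebesgue_integral_def)
    qed
    also have "(LINT x:A|mu. complex_of_real (cheb_cos n x)) = complex_of_real (LINT x:A|mu. cheb_cos n x)"
      unfolding set_lebesgue_integral_def integral_complex_of_real[symmetric]
      by (simp add: scaleR_conv_of_real)
    finally have pA: "cmod (pairing (hilbert_measure A) (?g n)) \<ge> 1 / 3" using A(2) by simp
    obtain f where f: "f \<in> F" "N (\<lambda>x. hilbert_measure A x - f x) < e" using F(3) A(1) by blast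
    have fX: "f \<in> X" using f(1) F(2) by blast
    let ?d = "\<lambda>x. hilbert_measure A x - f x"
    have dX: "?d \<in> X" by (rule diff_mem[OF mX[OF A(1)] fX])
    have "pairing (hilbert_measure A) (?g n) = pairing ?d (?g n) + pairing f (?g n)"
      unfolding pairing_def left_diff_distrib
      using Bochner_Integration.integral_diff[OF fi[OF mX[OF A(1)]] fi[OF fX]] by simp
    then have "cmod (pairing (hilbert_measure A) (?g n)) \<le> cmod (pairing ?d (?g n)) + cmod (pairing f (?g n))"
      by (simp add: norm_triangle_ineq)
    also have "\<dots> \<le> C * N ?d + 1 / 12" using pb[OF dX, of n] n(1)[OF f(1)] by linarith
    also have "C * N ?d \<le> C * e" using f(2) C(1) by (intro mult_left_mono) auto
    also have "C * e = 1 / 12" using C(1) by (simp add: e_def)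
    finally show False using pA by simp
  qed
  have vii: "\<not> order_bounded X (hilbert_measure ` sets mu)"
  proof
    assume "order_bounded X (hilbert_measure ` sets mu)"
    then obtain h :: "real \<Rightarrow> real" where h: "\<And>A. A \<in> sets mu \<Longrightarrow> AE x in mu. cmod (hilbert_measure A x) \<le> h x"
      unfolding order_bounded_def by blast
    define J where "J = {(a, b). a \<in> \<rat> \<and> b \<in> \<rat> \<and> -1 < a \<and> a < b \<and> b < (1::real)}"
    have Jc: "countable J"
      by (rule countable_subset[of _ "\<rat> \<times> \<rat>"]) (auto simp: J_def countable_rat)
    have "AE x in mu. \<forall>q\<in>J. cmod (hilbert_measure {fst q<..<snd q} x) \<le> h x"
      using Jc by (subst AE_ball_countable) (auto simp: J_def sets_mu_iff intro!: h)
    moreover have "AE x in mu. x \<in> {-1<..<1}" by (rule AE_mu_I)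
    ultimately have "AE x in mu. False"
    proof eventually_elim
      case (elim t)
      then have t: "-1 < t" "t < 1" by auto
      obtain b where b: "b \<in> \<rat>" "t < b" "b < 1" using Rats_dense_in_real[OF t(2)] by blast
      \<comment> \<open>The left end point \<open>a\<close> is taken so close to \<open>t\<close> that the logarithm exceeds \<open>h t\<close>.\<close>
      define K where "K = ln (b - t) - pi * (h t + 1)"
      obtain a where a: "a \<in> \<rat>" "t < a" "a < min b (t + exp K)"
        using Rats_dense_in_real[of t "min b (t + exp K)"] b by auto
      have "(a, b) \<in> J" using a b t by (auto simp: J_def)
      then have le: "cmod (hilbert_measure {a<..<b} t) \<le> h t" using elim(1) by force
      have "ln (a - t) < K"
      proof -
        have "a - t < exp K" using a by simp
        then have "ln (a - t) < ln (exp K)" using a(2) by (subst ln_less_cancel_iff) auto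
        then show ?thesis by simp
      qed
      then have "pi * (h t + 1) < ln (b - t) - ln (a - t)" by (simp add: K_def)
      then have "h t + 1 < (ln (b - t) - ln (a - t)) / pi" by (simp add: pos_less_divide_eq mult.commute)
      also have "\<dots> \<le> cmod (hilbert_measure {a<..<b} t)"
        using a b t by (subst hilbert_measure_interval) (auto simp del: of_real_diff of_real_divide)
      finally show False using le by simp
    qed
    then have "emeasure mu (space mu) = 0"
      by (subst (asm) AE_iff_measurable[of "space mu"]) (auto simp: sets_mu_iff)
    then show False unfolding emeasure_mu_space by simp
  qed
  show ?thesis using i ii iii iv v vi vii by blast
qed

end
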